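(* Assume that (1) there exists $\bar{\mathcal H}>0$ such that $\frac1n\sum_{x=0}^n\big(\bar r_x^2(0)+\bar p_x^2(0)\big)\le\bar{\mathcal H}$ for all $n\ge1$; and (2) there exists a continuous function $r_{\rm ini}:[0,1]\to\mathbb R$ such that $\lim_{n\to\infty}\frac1n\sum_{x=1}^n\big(\bar r_x(0)-r_{\rm ini}(\tfrac xn)\big)^2=0$. Let $r(t,u)$ be the solution of $$\partial_t r=\tfrac1{2\gamma}\partial_{uu}r\ \text{ on }(0,\infty)\times(0,1),\qquad r(t,0)=0,\quad r(t,1)=\bar F,\quad r(0,u)=r_{\rm ini}(u).$$ Then for any continuous $\varphi:[0,1]\to\mathbb R$ and any $t>0$, $$\lim_{n\to\infty}\frac1n\sum_{x=1}^n\varphi\big(\tfrac xn\big)\bar r_x(n^2t)=\int_0^1 r(t,u)\varphi(u)\,du$$ and $$\lim_{n\to\infty}\frac1n\sum_{x=0}^n\varphi\big(\tfrac xn\big)\,\mathcal E_x^{\rm mech}(n^2t)=\int_0^1\varphi(u)\,\tfrac12 r^2(t,u)\,du .$$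
   Context: Model. Fix $\gamma>0$, $T_->0$, $\theta>0$, $\omega=2\pi/\theta$, $\bar F\in\mathbb R$, and complex numbers $\hat{\mathcal F}(\ell)$, $\ell\in\mathbb Z\setminus\{0\}$ (not depending on $n$), with $\hat{\mathcal F}(-\ell)=\overline{\hat{\mathcal F}(\ell)}$, decaying fast enough (e.g. exponentially) that the force below is smooth; in particular $\sum_{\ell\ne0}|\hat{\mathcal F}(\ell)|<\infty$. For $n\ge1$ put $\tilde{\mathcal F}_n(t)=n^{-1/2}\sum_{\ell\neq0}\hat{\mathcal F}(\ell)e^{i\ell\omega t}$ and $\mathcal F_n(t)=\bar F+\tilde{\mathcal F}_n(t)$. The configuration $(\mathbf r,\mathbf p)=(r_1,\dots,r_n,p_0,\dots,p_n)\in\Omega_n=\mathbb R^n\times\mathbb R^{n+1}$ evolves by $dr_x=(p_x-p_{x-1})dt$ for $1\le x\le n$; $dp_0=r_1dt-2\gamma p_0dt+\sqrt{4\gamma T_-}\,dw_-(t)$; $dp_x=(r_{x+1}-r_x)dt-2p_x(t^-)dN_x(\gamma t)$ for $1\le x\le n-1$; $dp_n=(\mathcal F_n(t)-r_n)dt-2p_n(t^-)dN_n(\gamma t)$. Here $N_1,\dots,N_n$ are independent Poisson processes of intensity $1$ and $w_-$ is an independent standard Wiener process. The initial configuration has law $\mu_n$ (a probability measure on $\Omega_n$) and is independent of the noises; $\mathbb E_{\mu_n}$ is the corresponding expectation. Set $\bar r_x(t)=\mathbb E_{\mu_n}[r_x(t)]$, $\bar p_x(t)=\mathbb E_{\mu_n}[p_x(t)]$,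 with the convention $r_0\equiv\bar r_0\equiv0$. The microscopic mechanical energy is $\mathcal E_x^{\rm mech}(t)=\frac12(\bar p_x^2(t)+\bar r_x^2(t))$, $x=0,\dots,n$. Solution of the stretch equation: let $\mathcal M_{\rm fin}([0,1])$ be the finite signed measures on $[0,1]$ with the weak topology. A solution is $r\in C([0,\infty);\mathcal M_{\rm fin}([0,1]))$ such that for all $\varphi\in C^2([0,1])$ with $\varphi(0)=\varphi(1)=0$ and all $t\ge 0$, $\int_0^1\varphi(u)\,r(t,du)-\int_0^1\varphi(u)r_{\rm ini}(u)\,du=\frac1{2\gamma}\int_0^t ds\int_0^1\varphi''(u)\,r(s,du)-\frac{\bar F t}{2\gamma}\varphi'(1)$. It is unique, and has a density, smooth on $(0,\infty)\times[0,1]$, denoted $r(t,u)$. *)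

theory Defs
  imports "HOL-Probability.Probability"
begin

subsection \<open>Driving noises\<close>

text \<open>Increments over consecutive, possibly degenerate, time intervals are independent.\<close>

definition indep_increments :: "'a measure \<Rightarrow> (real \<Rightarrow> 'a \<Rightarrow> real) \<Rightarrow> bool" where
  "indep_increments M X \<longleftrightarrow>
     (\<forall>(k::nat) (ts :: nat \<Rightarrow> real). 0 \<le> ts 0 \<and> (\<forall>i<k. ts i \<le> ts (Suc i)) \<longrightarrow>
        prob_space.indep_vars M (\<lambda>_. borel) (\<lambda>i \<omega>. X (ts (Suc i)) \<omega> - X (ts i) \<omega>) {..<k})"

definition wiener_process :: "'a measure \<Rightarrow> (real \<Rightarrow> 'a \<Rightarrow> real) \<Rightarrow> bool" where
  "wiener_process M w \<longleftrightarrow>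
     (\<forall>t\<ge>0. w t \<in> borel_measurable M) \<and>
     (AE \<omega> in M. w 0 \<omega> = 0 \<and> continuous_on {0..} (\<lambda>t. w t \<omega>)) \<and>
     indep_increments M w \<and>
     (\<forall>s t. 0 \<le> s \<and> s < t \<longrightarrow>
        distributed M lborel (\<lambda>\<omega>. w t \<omega> - w s \<omega>) (normal_density 0 (sqrt (t - s))))"

definition unit_poisson_process :: "'a measure \<Rightarrow> (real \<Rightarrow> 'a \<Rightarrow> nat) \<Rightarrow> bool" where
  "unit_poisson_process M N \<longleftrightarrow>
     (\<forall>t\<ge>0. N t \<in> measurable M (count_space UNIV)) \<and>
     (AE \<omega> in M. N 0 \<omega> = 0 \<and> mono_on {0..} (\<lambda>t. N t \<omega>) \<and>
        (\<forall>t\<ge>0. continuous (at_right t) (\<lambda>s. real (N s \<omega>)))) \<and>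
     indep_increments M (\<lambda>t \<omega>. real (N t \<omega>)) \<and>
     (\<forall>s t. 0 \<le> s \<and> s < t \<longrightarrow>
        distr M (count_space UNIV) (\<lambda>\<omega>. N t \<omega> - N s \<omega>) = measure_pmf (poisson_pmf (t - s)))"

definition generated_sigma :: "'a measure \<Rightarrow> ('a \<Rightarrow> real) set \<Rightarrow> 'a set set" where
  "generated_sigma M \<X> = sigma_sets (space M) {X -` A \<inter> space M | X A. X \<in> \<X> \<and> A \<in> sets borel}"

datatype source = Init | Wiener | Poisson nat

subsection \<open>The chain\<close>

text \<open>The Fourier series below is real valued because of the symmetry imposed on the
  coefficients by \<open>force_coeffs\<close>, so taking the real part only adjusts the type.\<close>

definition force :: "real \<Rightarrow> real \<Rightarrow> (int \<Rightarrow> complex) \<Rightarrow> nat \<Rightarrow> real \<Rightarrow> real" where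
  "force \<theta> Fbar Fhat n t = Fbar + 1 / sqrt (real n) *
     Re (\<Sum>\<^sub>\<infinity>l\<in>-{0}. Fhat l * exp (\<i> * of_int l * of_real (2 * pi / \<theta>) * of_real t))"

text \<open>Rapid decay of the coefficients is what smoothness of the force amounts to.\<close>

definition force_coeffs :: "(int \<Rightarrow> complex) \<Rightarrow> bool" where
  "force_coeffs Fhat \<longleftrightarrow>
     (\<forall>l. l \<noteq> 0 \<longrightarrow> Fhat (- l) = cnj (Fhat l)) \<and>
     (\<forall>k::nat. (\<lambda>l. \<bar>real_of_int l\<bar> ^ k * norm (Fhat l)) summable_on -{0})"

definition left_lim :: "(real \<Rightarrow> real) \<Rightarrow> real \<Rightarrow> real" where
  "left_lim f s = Lim (at_left s) f"

definition cadlag :: "(real \<Rightarrow> real) \<Rightarrow> bool" where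
  "cadlag f \<longleftrightarrow> (\<forall>t\<ge>0. continuous (at_right t) f) \<and> (\<forall>t>0. \<exists>l. (f \<longlongrightarrow> l) (at_left t))"

text \<open>The pathwise integral of the left limits of \<open>f\<close> over \<open>{0<..t}\<close> against a counting path \<open>A\<close>.
  The sum is finite since a nondecreasing path with values in the natural numbers has
  finitely many jumps on bounded intervals.\<close>

definition jump_integral :: "(real \<Rightarrow> real) \<Rightarrow> (real \<Rightarrow> real) \<Rightarrow> real \<Rightarrow> real" where
  "jump_integral f A t =
     (\<Sum>s \<in> {s. 0 < s \<and> s \<le> t \<and> A s \<noteq> left_lim A s}. left_lim f s * (A s - left_lim A s))"

definition config_space :: "nat \<Rightarrow> ((nat \<Rightarrow> real) \<times> (nat \<Rightarrow> real)) measure" where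
  "config_space n = (\<Pi>\<^sub>M x\<in>{1..n}. borel) \<Otimes>\<^sub>M (\<Pi>\<^sub>M x\<in>{0..n}. borel)"

text \<open>Pathwise integral form of the evolution equations on a fixed path. Since the Gaussian noise
  is additive, its integral is a multiple of the Wiener path.\<close>

definition chain_path ::
  "real \<Rightarrow> real \<Rightarrow> (real \<Rightarrow> real) \<Rightarrow> nat \<Rightarrow> (real \<Rightarrow> real) \<Rightarrow> (nat \<Rightarrow> real \<Rightarrow> nat) \<Rightarrow>
   (nat \<Rightarrow> real \<Rightarrow> real) \<Rightarrow> (nat \<Rightarrow> real \<Rightarrow> real) \<Rightarrow> bool" where
  "chain_path \<gamma> Tm F n w N r p \<longleftrightarrow>
     (\<forall>x\<in>{1..n}. cadlag (r x)) \<and> (\<forall>x\<in>{0..n}. cadlag (p x)) \<and>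
     (\<forall>t\<ge>0.
       (\<forall>x\<in>{1..n}. r x t = r x 0 + (LBINT s:{0..t}. p x s - p (x - 1) s)) \<and>
       p 0 t = p 0 0 + (LBINT s:{0..t}. r 1 s - 2 * \<gamma> * p 0 s) + sqrt (4 * \<gamma> * Tm) * w t \<and>
       (\<forall>x\<in>{1..<n}. p x t = p x 0 + (LBINT s:{0..t}. r (x + 1) s - r x s)
          - 2 * jump_integral (p x) (\<lambda>s. real (N x (\<gamma> * s))) t) \<and>
       p n t = p n 0 + (LBINT s:{0..t}. F s - r n s)
          - 2 * jump_integral (p n) (\<lambda>s. real (N n (\<gamma> * s))) t)"

text \<open>The processes \<open>r x\<close>, \<open>p x\<close> solve the dynamics with initial law \<open>\<mu>\<close>, where \<open>r 0\<close> is zero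
  by convention. The first moments of \<open>\<mu>\<close> have to exist for the averages to be meaningful.\<close>

definition chain_process ::
  "real \<Rightarrow> real \<Rightarrow> (real \<Rightarrow> real) \<Rightarrow> nat \<Rightarrow> 'a measure \<Rightarrow> ((nat \<Rightarrow> real) \<times> (nat \<Rightarrow> real)) measure \<Rightarrow>
   (real \<Rightarrow> 'a \<Rightarrow> real) \<Rightarrow> (nat \<Rightarrow> real \<Rightarrow> 'a \<Rightarrow> nat) \<Rightarrow>
   (nat \<Rightarrow> real \<Rightarrow> 'a \<Rightarrow> real) \<Rightarrow> (nat \<Rightarrow> real \<Rightarrow> 'a \<Rightarrow> real) \<Rightarrow> bool" where
  "chain_process \<gamma> Tm F n M \<mu> w N r p \<longleftrightarrow>
     prob_space M \<and>
     wiener_process M w \<and>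
     (\<forall>x\<in>{1..n}. unit_poisson_process M (N x)) \<and>
     (\<forall>t\<ge>0. \<forall>x\<in>{1..n}. r x t \<in> borel_measurable M) \<and>
     (\<forall>t\<ge>0. \<forall>x\<in>{0..n}. p x t \<in> borel_measurable M) \<and>
     (\<forall>t \<omega>. r 0 t \<omega> = 0) \<and>
     distr M (config_space n) (\<lambda>\<omega>. (\<lambda>x\<in>{1..n}. r x 0 \<omega>, \<lambda>x\<in>{0..n}. p x 0 \<omega>)) = \<mu> \<and>
     (\<forall>x\<in>{1..n}. integrable \<mu> (\<lambda>c. fst c x)) \<and> (\<forall>x\<in>{0..n}. integrable \<mu> (\<lambda>c. snd c x)) \<and>
     prob_space.indep_sets M
       (\<lambda>i. case i of
          Init \<Rightarrow> generated_sigma M ((\<lambda>x. r x 0) ` {1..n} \<union> (\<lambda>x. p x 0) ` {0..n})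
        | Wiener \<Rightarrow> generated_sigma M (w ` {0..})
        | Poisson x \<Rightarrow> generated_sigma M ((\<lambda>t \<omega>. real (N x t \<omega>)) ` {0..}))
       ({Init, Wiener} \<union> Poisson ` {1..n}) \<and>
     (AE \<omega> in M. chain_path \<gamma> Tm F n (\<lambda>t. w t \<omega>) (\<lambda>x t. N x t \<omega>) (\<lambda>x t. r x t \<omega>) (\<lambda>x t. p x t \<omega>))"

definition mean :: "'a measure \<Rightarrow> (nat \<Rightarrow> real \<Rightarrow> 'a \<Rightarrow> real) \<Rightarrow> nat \<Rightarrow> real \<Rightarrow> real" where
  "mean M X x t = (LINT \<omega>|M. X x t \<omega>)"

definition mech_energy ::
  "'a measure \<Rightarrow> (nat \<Rightarrow> real \<Rightarrow> 'a \<Rightarrow> real) \<Rightarrow> (nat \<Rightarrow> real \<Rightarrow> 'a \<Rightarrow> real) \<Rightarrow> nat \<Rightarrow> real \<Rightarrow> real" where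
  "mech_energy M r p x t = 1 / 2 * ((mean M p x t)\<^sup>2 + (mean M r x t)\<^sup>2)"

subsection \<open>The stretch equation\<close>

text \<open>A finite signed measure on the unit interval is represented by a pair of finite measures
  whose difference it is (Jordan decomposition). The pair is not unique, but everything
  below depends on the difference only.\<close>

type_synonym signed_measure = "real measure \<times> real measure"

definition signed_measure01 :: "signed_measure \<Rightarrow> bool" where
  "signed_measure01 \<nu> \<longleftrightarrow>
     finite_measure (fst \<nu>) \<and> sets (fst \<nu>) = sets (restrict_space borel {0..1}) \<and>
     finite_measure (snd \<nu>) \<and> sets (snd \<nu>) = sets (restrict_space borel {0..1})"

definition signed_integral :: "signed_measure \<Rightarrow> (real \<Rightarrow> real) \<Rightarrow> real" where
  "signed_integral \<nu> f = (LINT u|fst \<nu>. f u) - (LINT u|snd \<nu>. f u)"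

definition signed_density :: "signed_measure \<Rightarrow> (real \<Rightarrow> real) \<Rightarrow> bool" where
  "signed_density \<nu> f \<longleftrightarrow> set_integrable lborel {0..1} f \<and>
     (\<forall>A\<in>sets borel. A \<subseteq> {0..1} \<longrightarrow> measure (fst \<nu>) A - measure (snd \<nu>) A = (LBINT u:A. f u))"

text \<open>Derivatives of test functions are one-sided at the endpoints.\<close>

definition stretch_solution ::
  "real \<Rightarrow> real \<Rightarrow> (real \<Rightarrow> real) \<Rightarrow> (real \<Rightarrow> signed_measure) \<Rightarrow> bool" where
  "stretch_solution \<gamma> Fbar rini R \<longleftrightarrow>
     (\<forall>t\<ge>0. signed_measure01 (R t)) \<and>
     (\<forall>\<phi>. continuous_on {0..1} \<phi> \<longrightarrow> continuous_on {0..} (\<lambda>t. signed_integral (R t) \<phi>)) \<and>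
     (\<forall>\<phi> \<phi>' \<phi>''.
        (\<forall>u\<in>{0..1}. (\<phi> has_real_derivative \<phi>' u) (at u within {0..1})) \<and>
        (\<forall>u\<in>{0..1}. (\<phi>' has_real_derivative \<phi>'' u) (at u within {0..1})) \<and>
        continuous_on {0..1} \<phi>'' \<and> \<phi> 0 = 0 \<and> \<phi> 1 = 0 \<longrightarrow>
        (\<forall>t\<ge>0. signed_integral (R t) \<phi> - (LBINT u:{0..1}. \<phi> u * rini u) =
           1 / (2 * \<gamma>) * (LBINT s:{0..t}. signed_integral (R s) \<phi>'') - Fbar * t / (2 * \<gamma>) * \<phi>' 1))"

end

theory Submission
  imports Defs "HOL-Real_Asymp.Real_Asymp"
begin

text \<open>Multiplying a momentum by the parity of its number of flips turns the dynamics into a linear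
  system without jumps. A Gronwall argument shows that future parities are uncorrelated with the
  present configuration, so the averages solve the damped chain with friction at every site.
  Its displacements give a second Lyapunov function, which bounds the energy at time \<open>T\<close>
  by \<open>1 / T\<close> times the energy and the squared displacements at time zero, up to forcing errors.
  On the time scale \<open>n\<^sup>2\<close> this allows comparison with an explicit approximate solution: a linear profile,
  finitely many slowly decaying sine modes, and finitely many modes driven by the
  oscillating force, which are localised at the boundary. The limit profile is identified with the
  solution of the stretch equation through its sine coefficients.\<close>

subsection \<open>Energy decay for the damped chain\<close>

text \<open>Decay of the energy alone cannot suffice: hypothesis (1) bounds the squared initial
  momenta only by a multiple of \<open>n\<close>, so they need not be small per site. The
  displacement functional separates the two kinds of data. At \<open>T = n^2 t\<close> it weighs
  squared stretches by \<open>n^2 / T = 1 / t\<close> and the whole energy by \<open>1 / T\<close>,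
  so the initial momenta disappear at order \<open>n^-2\<close> and only the L2 distance of the
  initial stretches from the reference profile survives.

  The amplitude \<open>n^(-1/2)\<close> of the oscillating force is critical for the same estimate:
  a force error of squared size \<open>eps^2 / n\<close> acting for a time \<open>n^2 t\<close>
  costs \<open>eps^2\<close> per site, up to a constant. Treating the whole oscillation as an error
  would leave a nonzero remainder. Finitely many Fourier modes are therefore solved for explicitly,
  and only the tail of the series pays this price. Accordingly the mode sets are fixed by
  \<open>eps\<close>, then \<open>n\<close> tends to infinity, and \<open>eps\<close> tends to zero
  last.\<close>

definition chain_ode ::
  "nat \<Rightarrow> real \<Rightarrow> (nat \<Rightarrow> real \<Rightarrow> real) \<Rightarrow> (nat \<Rightarrow> real \<Rightarrow> real) \<Rightarrow> (nat \<Rightarrow> real \<Rightarrow> real) \<Rightarrow> bool" where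
  "chain_ode n \<gamma> r p g \<longleftrightarrow> (\<forall>t\<ge>0.
     (\<forall>x\<in>{1..n}. (r x has_real_derivative p x t - p (x - 1) t) (at t within {0..})) \<and>
     (\<forall>x\<le>n. (p x has_real_derivative
        (if x < n then r (Suc x) t else 0) - (if 0 < x then r x t else 0) - 2 * \<gamma> * p x t + g x t)
        (at t within {0..})))"

lemma chain_odeI:
  assumes "\<And>t x. t \<ge> 0 \<Longrightarrow> 1 \<le> x \<Longrightarrow> x \<le> n \<Longrightarrow>
      (r x has_real_derivative p x t - p (x - 1) t) (at t within {0..})"
    and "\<And>t x. t \<ge> 0 \<Longrightarrow> x \<le> n \<Longrightarrow> (p x has_real_derivative
        (if x < n then r (Suc x) t else 0) - (if 0 < x then r x t else 0) - 2 * \<gamma> * p x t + g x t)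
        (at t within {0..})"
  shows "chain_ode n \<gamma> r p g"
  using assms by (auto simp: chain_ode_def)

lemma chain_odeD:
  assumes "chain_ode n \<gamma> r p g" "t \<ge> 0"
  shows "1 \<le> x \<Longrightarrow> x \<le> n \<Longrightarrow> (r x has_real_derivative p x t - p (x - 1) t) (at t within {0..})"
    and "x \<le> n \<Longrightarrow> (p x has_real_derivative
        (if x < n then r (Suc x) t else 0) - (if 0 < x then r x t else 0) - 2 * \<gamma> * p x t + g x t)
        (at t within {0..})"
  using assms by (auto simp: chain_ode_def)

lemma chain_ode_add:
  assumes "chain_ode n \<gamma> r p g" "chain_ode n \<gamma> r' p' g'"
  shows "chain_ode n \<gamma> (\<lambda>x t. r x t + r' x t) (\<lambda>x t. p x t + p' x t) (\<lambda>x t. g x t + g' x t)"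
proof (rule chain_odeI)
  fix t :: real and x assume "t \<ge> 0" "1 \<le> x" "x \<le> n"
  from DERIV_add[OF chain_odeD(1)[OF assms(1) this] chain_odeD(1)[OF assms(2) this]]
  show "((\<lambda>t. r x t + r' x t) has_real_derivative p x t + p' x t - (p (x - 1) t + p' (x - 1) t)) (at t within {0..})"
    by (simp add: algebra_simps)
next
  fix t :: real and x assume "t \<ge> 0" "x \<le> n"
  from DERIV_add[OF chain_odeD(2)[OF assms(1) this] chain_odeD(2)[OF assms(2) this]]
  show "((\<lambda>t. p x t + p' x t) has_real_derivative
     (if x < n then r (Suc x) t + r' (Suc x) t else 0) - (if 0 < x then r x t + r' x t else 0)
      - 2 * \<gamma> * (p x t + p' x t) + (g x t + g' x t)) (at t within {0..})"
    by (auto elim!: DERIV_cong simp: algebra_simps)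
qed

lemma chain_ode_scale:
  assumes "chain_ode n \<gamma> r p g"
  shows "chain_ode n \<gamma> (\<lambda>x t. c * r x t) (\<lambda>x t. c * p x t) (\<lambda>x t. c * g x t)"
proof (rule chain_odeI)
  fix t :: real and x assume "t \<ge> 0" "1 \<le> x" "x \<le> n"
  from DERIV_cmult[OF chain_odeD(1)[OF assms(1) this], of c]
  show "((\<lambda>t. c * r x t) has_real_derivative c * p x t - (c * p (x - 1) t)) (at t within {0..})"
    by (simp add: algebra_simps)
next
  fix t :: real and x assume "t \<ge> 0" "x \<le> n"
  from DERIV_cmult[OF chain_odeD(2)[OF assms(1) this], of c]
  show "((\<lambda>t. c * p x t) has_real_derivative
     (if x < n then c * r (Suc x) t else 0) - (if 0 < x then c * r x t else 0)
      - 2 * \<gamma> * (c * p x t) + (c * g x t)) (at t within {0..})"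
    by (auto elim!: DERIV_cong simp: algebra_simps)
qed

lemma chain_ode_sum:
  assumes "finite J" "\<And>j. j \<in> J \<Longrightarrow> chain_ode n \<gamma> (r j) (p j) (g j)"
  shows "chain_ode n \<gamma> (\<lambda>x t. \<Sum>j\<in>J. r j x t) (\<lambda>x t. \<Sum>j\<in>J. p j x t) (\<lambda>x t. \<Sum>j\<in>J. g j x t)"
  using assms
proof (induction J rule: finite_induct)
  case empty
  show ?case by (rule chain_odeI) auto
next
  case (insert j J)
  then show ?case
    using chain_ode_add[of n \<gamma> "r j" "p j" "g j"] by simp
qed

text \<open>All time derivatives are taken within \<open>{0..}\<close> so that they exist at time
  zero. At positive times this filter coincides with the two-sided one, which the monotonicity
  criterion needs.\<close>

lemma nonincreasing_of_deriv:
  fixes f f' :: "real \<Rightarrow> real"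
  assumes "a \<le> b" and d: "\<And>t. a \<le> t \<Longrightarrow> t \<le> b \<Longrightarrow> (f has_real_derivative f' t) (at t within {0..})"
    and a: "0 \<le> a" and n: "\<And>t. a \<le> t \<Longrightarrow> t \<le> b \<Longrightarrow> f' t \<le> 0"
  shows "f b \<le> f a"
proof (rule DERIV_nonpos_imp_decreasing_open[OF assms(1)])
  show "continuous_on {a..b} f"
    by (rule DERIV_continuous_on, rule DERIV_subset, rule d) (use a in auto)
  fix x assume x: "a < x" "x < b"
  have "(f has_real_derivative f' x) (at x)"
  proof -
    have "(f has_real_derivative f' x) (at x within {0<..})"
      using d[of x] x by (auto intro: DERIV_subset)
    moreover have "at x within {0<..} = at x"
      using x a by (intro at_within_open) auto
    ultimately show ?thesis by simp
  qed
  with n[of x] x show "\<exists>y. (f has_real_derivative y) (at x) \<and> y \<le> 0" by force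
qed

text \<open>The forward difference of the stretches over the \<open>n + 1\<close> sites and the
  backward difference of the momenta over the \<open>n\<close> bonds are negative adjoints. Setting
  \<open>r 0\<close> and \<open>r (Suc n)\<close> to zero removes the boundary terms at both
  ends.\<close>

lemma sum_by_parts:
  fixes r p :: "nat \<Rightarrow> real"
  shows "(\<Sum>x\<le>n. p x * ((if x < n then r (Suc x) else 0) - (if 0 < x then r x else 0)))
       = - (\<Sum>x=1..n. r x * (p x - p (x - 1)))"
proof -
  have 1: "(\<Sum>x\<le>n. p x * (if x < n then r (Suc x) else 0)) = (\<Sum>x=1..n. r x * p (x - 1))"
  proof -
    have "(\<Sum>x\<le>n. p x * (if x < n then r (Suc x) else 0)) = (\<Sum>x<n. p x * r (Suc x))"
      by (rule sum.mono_neutral_cong_right) auto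
    also have "\<dots> = (\<Sum>x=1..n. r x * p (x - 1))"
      by (rule sum.reindex_bij_witness[of _ "\<lambda>x. x - 1" Suc]) auto
    finally show ?thesis .
  qed
  have 2: "(\<Sum>x\<le>n. p x * (if 0 < x then r x else 0)) = (\<Sum>x=1..n. r x * p x)"
    by (rule sum.mono_neutral_cong_right) auto
  show ?thesis
    using 1 2 by (simp add: algebra_simps sum_subtractf)
qed

text \<open>Twice the mechanical energy of the averaged chain. The bond sum starts at 1 because
  \<open>r 0\<close> is a convention and not a variable.\<close>

definition chain_energy :: "nat \<Rightarrow> (nat \<Rightarrow> real \<Rightarrow> real) \<Rightarrow> (nat \<Rightarrow> real \<Rightarrow> real) \<Rightarrow> real \<Rightarrow> real" where
  "chain_energy n r p t = (\<Sum>x=1..n. (r x t)\<^sup>2) + (\<Sum>x\<le>n. (p x t)\<^sup>2)"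

text \<open>By \<open>sum_by_parts\<close> the exchange between the two sums cancels, leaving only
  the work of \<open>g\<close> and the friction.\<close>

lemma chain_energy_deriv:
  assumes "chain_ode n \<gamma> r p g" "t \<ge> 0"
  shows "(chain_energy n r p has_real_derivative
     2 * (\<Sum>x\<le>n. p x t * g x t) - 4 * \<gamma> * (\<Sum>x\<le>n. (p x t)\<^sup>2)) (at t within {0..})"
proof -
  have "(chain_energy n r p has_real_derivative
     (\<Sum>x=1..n. 2 * (r x t * (p x t - p (x - 1) t))) +
     (\<Sum>x\<le>n. 2 * (p x t * ((if x < n then r (Suc x) t else 0) - (if 0 < x then r x t else 0) - 2 * \<gamma> * p x t + g x t))))
     (at t within {0..})"
    unfolding chain_energy_def[abs_def]
    by (intro DERIV_add DERIV_sum)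
      (auto intro!: derivative_eq_intros chain_odeD[OF assms] simp: power2_eq_square)
  moreover have "(\<Sum>x=1..n. 2 * (r x t * (p x t - p (x - 1) t))) +
     (\<Sum>x\<le>n. 2 * (p x t * ((if x < n then r (Suc x) t else 0) - (if 0 < x then r x t else 0) - 2 * \<gamma> * p x t + g x t)))
    = 2 * ((\<Sum>x=1..n. r x t * (p x t - p (x - 1) t)) +
       (\<Sum>x\<le>n. p x t * ((if x < n then r (Suc x) t else 0) - (if 0 < x then r x t else 0))))
      - 4 * \<gamma> * (\<Sum>x\<le>n. (p x t)\<^sup>2) + 2 * (\<Sum>x\<le>n. p x t * g x t)"
    by (simp add: sum_distrib_left algebra_simps power2_eq_square sum.distrib sum_subtractf)
  ultimately show ?thesis
    using sum_by_parts[of "\<lambda>x. p x t" n "\<lambda>x. r x t"] by simp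
qed

lemma mult_le_weighted_squares:
  fixes a b c :: real
  assumes "c > 0"
  shows "a * b \<le> c * a\<^sup>2 + b\<^sup>2 / (4 * c)"
proof -
  have "0 \<le> (2 * c * a - b)\<^sup>2 / (4 * c)" using assms by simp
  also have "\<dots> = c * a\<^sup>2 + b\<^sup>2 / (4 * c) - a * b"
    using assms by (simp add: field_simps power2_eq_square)
  finally show ?thesis by simp
qed

lemma sum_mult_le_weighted_squares:
  fixes a b :: "'i \<Rightarrow> real"
  assumes "c > 0"
  shows "(\<Sum>x\<in>A. a x * b x) \<le> c * (\<Sum>x\<in>A. (a x)\<^sup>2) + (\<Sum>x\<in>A. (b x)\<^sup>2) / (4 * c)"
proof -
  have "(\<Sum>x\<in>A. a x * b x) \<le> (\<Sum>x\<in>A. c * (a x)\<^sup>2 + (b x)\<^sup>2 / (4 * c))"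
    by (intro sum_mono mult_le_weighted_squares assms)
  then show ?thesis by (simp add: sum.distrib sum_distrib_left sum_divide_distrib)
qed


lemma integral_deriv_within_atLeast:
  fixes f :: "real \<Rightarrow> real"
  assumes "continuous_on {0..} f" "t \<ge> 0"
  shows "((\<lambda>t. integral {0..t} f) has_real_derivative f t) (at t within {0..})"
proof -
  have "((\<lambda>t. integral {0..t} f) has_real_derivative f t) (at t within {0..t+1})"
    by (rule integral_has_real_derivative)
      (use assms in \<open>auto intro: continuous_on_subset\<close>)
  moreover have "at t within {0..t+1} = at t within {0..}"
    by (rule at_within_nhd[of _ "{..<t+1}"]) (use assms in auto)
  ultimately show ?thesis by simp
qed

text \<open>Cauchy-Schwarz on each partial sum. The loss of order \<open>n^2\<close> is what a time
  of order \<open>n^2\<close> makes up for in \<open>chain_energy_decay\<close>.\<close>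

lemma chain_displacement_bound:
  fixes r :: "nat \<Rightarrow> real"
  shows "(\<Sum>x\<le>n. (\<Sum>y=1..x. r y)\<^sup>2) \<le> real n * (real n + 1) * (\<Sum>x=1..n. (r x)\<^sup>2)"
proof -
  have "(\<Sum>y=1..x. r y)\<^sup>2 \<le> real n * (\<Sum>x=1..n. (r x)\<^sup>2)" if "x \<le> n" for x
  proof -
    have "(\<Sum>y=1..x. r y)\<^sup>2 \<le> real (card {1..x}) * (\<Sum>y=1..x. (r y)\<^sup>2)"
      using sum_squared_le_sum_of_squares[of "\<lambda>y. r y" "{1..x}"] by (simp add: mult.commute)
    also have "\<dots> \<le> real n * (\<Sum>x=1..n. (r x)\<^sup>2)"
      using that by (intro mult_mono sum_mono2) (auto intro: sum_nonneg)
    finally show ?thesis .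
  qed
  then have "(\<Sum>x\<le>n. (\<Sum>y=1..x. r y)\<^sup>2) \<le> (\<Sum>x\<le>n. real n * (\<Sum>x=1..n. (r x)\<^sup>2))"
    by (intro sum_mono) auto
  then show ?thesis by (simp add: algebra_simps)
qed

text \<open>Besides the energy \<open>E\<close>, which is almost nonincreasing, a functional
  \<open>\<Psi>\<close> built from the displacements satisfies
  \<open>\<Psi>' <= - E + \<Psi> / T\<close> up to forcing errors. Integrated over
  \<open>[0, T]\<close> with \<open>E t >= E T\<close> this gives
  \<open>T * E T <= 2 * \<Psi> 0\<close>, again up to forcing errors. The value
  \<open>\<Psi> 0\<close> is controlled by \<open>n^2\<close> times the squared stretches and by the
  energy without such a factor, so large initial momenta are damped by the full
  \<open>1 / T\<close>.\<close>

lemma chain_energy_decay: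
  assumes ode: "chain_ode n \<gamma> r p g" and \<gamma>: "\<gamma> > 0" and T: "T > 0" and n: "n \<ge> 1"
    and \<delta>: "\<And>t. 0 \<le> t \<Longrightarrow> t \<le> T \<Longrightarrow> (\<Sum>x\<le>n. (g x t)\<^sup>2) \<le> \<delta>"
  shows "chain_energy n r p T \<le> 2 / T * (4 * \<gamma> * (real n)\<^sup>2 * (\<Sum>x=1..n. (r x 0)\<^sup>2)
      + 5 / (4 * \<gamma>) * chain_energy n r p 0) + \<delta> * (T / \<gamma> + 1 / (2 * \<gamma>\<^sup>2))"
proof -
  let ?E = "chain_energy n r p"
  have \<delta>0: "\<delta> \<ge> 0"
    using \<delta>[of 0] T sum_nonneg[of "{..n}" "\<lambda>x. (g x 0)\<^sup>2"] by simp
  have pE: "(\<Sum>x\<le>n. (p x t)\<^sup>2) \<le> ?E t" for t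
    unfolding chain_energy_def by (simp add: sum_nonneg)
  have p0: "continuous_on {0..} (p 0)"
    by (rule DERIV_continuous_on) (rule chain_odeD(2)[OF ode], auto)
  \<comment> \<open>Displacements with time derivative \<open>p x\<close>. Integrating
    \<open>p 0\<close> from time zero gives \<open>q 0 0 = 0\<close>, so that \<open>q\<close> at
    time zero is a partial sum of the initial stretches alone.\<close>
  define q where "q x t = integral {0..t} (p 0) + (\<Sum>y=1..x. r y t)" for x t
  have q_deriv: "(q x has_real_derivative p x t) (at t within {0..})" if "x \<le> n" "t \<ge> 0" for x t
  proof -
    have "(q x has_real_derivative p 0 t + (\<Sum>y=1..x. p y t - p (y - 1) t)) (at t within {0..})"
      unfolding q_def[abs_def]
      by (intro DERIV_add integral_deriv_within_atLeast DERIV_sum p0 chain_odeD(1)[OF ode])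
        (use that in auto)
    moreover have "p 0 t + (\<Sum>y=1..x. p y t - p (y - 1) t) = p x t"
      by (induction x) auto
    ultimately show ?thesis by simp
  qed
  have q_diff: "q x t - q (x - 1) t = r x t" if "x \<ge> 1" for x t
    using that unfolding q_def by (cases x) auto
  \<comment> \<open>Testing the momentum equation with \<open>q\<close>: the friction term
    \<open>- 2 * \<gamma> * q * p\<close> is minus the derivative of \<open>\<gamma> * q^2\<close>,
    which is added here to cancel it.\<close>
  define \<Phi> where "\<Phi> t = (\<Sum>x\<le>n. q x t * p x t + \<gamma> * (q x t)\<^sup>2)" for t
  have \<Phi>_deriv: "(\<Phi> has_real_derivative (\<Sum>x\<le>n. (p x t)\<^sup>2) - (\<Sum>x=1..n. (r x t)\<^sup>2) + (\<Sum>x\<le>n. q x t * g x t))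
      (at t within {0..})" if t: "t \<ge> 0" for t
  proof -
    let ?d = "\<lambda>x. (if x < n then r (Suc x) t else 0) - (if 0 < x then r x t else 0)"
    have "(\<Phi> has_real_derivative (\<Sum>x\<le>n. p x t * p x t + (?d x - 2 * \<gamma> * p x t + g x t) * q x t
        + \<gamma> * (2 * q x t * p x t))) (at t within {0..})"
      unfolding \<Phi>_def[abs_def]
      by (intro DERIV_sum DERIV_add DERIV_mult DERIV_cmult chain_odeD(2)[OF ode] q_deriv)
        (auto intro!: derivative_eq_intros q_deriv t)
    moreover have "(\<Sum>x\<le>n. p x t * p x t + (?d x - 2 * \<gamma> * p x t + g x t) * q x t + \<gamma> * (2 * q x t * p x t))
       = (\<Sum>x\<le>n. (p x t)\<^sup>2) + (\<Sum>x\<le>n. q x t * ?d x) + (\<Sum>x\<le>n. q x t * g x t)"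
      unfolding sum.distrib[symmetric] by (intro sum.cong refl) (simp add: algebra_simps power2_eq_square)
    moreover have "(\<Sum>x\<le>n. q x t * ?d x) = - (\<Sum>x=1..n. (r x t)\<^sup>2)"
      unfolding sum_by_parts[of "\<lambda>x. q x t" n "\<lambda>x. r x t"]
      using q_diff by (auto simp: power2_eq_square intro!: sum.cong)
    ultimately show ?thesis by simp
  qed
  \<comment> \<open>Adding the energy over \<open>\<gamma>\<close> does two things: its friction
    \<open>- 4 * p^2\<close> outweighs the \<open>+ p^2\<close> in the derivative of
    \<open>\<Phi>\<close>, and it compensates the unknown sign of \<open>q * p\<close>, so that
    \<open>\<Psi>\<close> dominates \<open>q^2\<close>.\<close>
  define \<Psi> where "\<Psi> t = \<Phi> t + ?E t / \<gamma>" for t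
  have \<Phi>_eq: "\<Phi> t = (\<Sum>x\<le>n. q x t * p x t) + \<gamma> * (\<Sum>x\<le>n. (q x t)\<^sup>2)" for t
    unfolding \<Phi>_def by (simp add: sum.distrib sum_distrib_left)
  have \<Psi>_lower: "\<gamma> / 2 * (\<Sum>x\<le>n. (q x t)\<^sup>2) \<le> \<Psi> t" for t
  proof -
    have "(\<Sum>x\<le>n. q x t * (- p x t)) \<le> \<gamma> / 2 * (\<Sum>x\<le>n. (q x t)\<^sup>2) + (\<Sum>x\<le>n. (- p x t)\<^sup>2) / (4 * (\<gamma> / 2))"
      by (rule sum_mult_le_weighted_squares) (use \<gamma> in simp)
    moreover have "(\<Sum>x\<le>n. (- p x t)\<^sup>2) / (4 * (\<gamma> / 2)) \<le> ?E t / (2 * \<gamma>)"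
      using pE[of t] \<gamma> by (simp add: field_simps)
    moreover have "?E t / (2 * \<gamma>) \<le> ?E t / \<gamma>"
    proof -
      have "?E t \<ge> 0" unfolding chain_energy_def by (simp add: sum_nonneg)
      then show ?thesis using \<gamma> by (simp add: field_simps)
    qed
    ultimately show ?thesis unfolding \<Psi>_def \<Phi>_eq by (simp add: sum_negf field_simps)
  qed
  then have \<Psi>_nonneg: "\<Psi> t \<ge> 0" for t
    using \<gamma> by (meson order_trans mult_nonneg_nonneg sum_nonneg zero_le_power2 half_gt_zero less_imp_le)
  \<comment> \<open>The final energy minus all forcing losses, a lower bound for the dissipation
    throughout \<open>[0, T]\<close>. The claim reduces to
    \<open>D <= 2 / T * \<Psi> 0\<close>.\<close>
  define D where "D = ?E T - \<delta> * (T / \<gamma> + 1 / (2 * \<gamma>\<^sup>2))"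
  define \<Psi>' where "\<Psi>' t = (\<Sum>x\<le>n. (p x t)\<^sup>2) - (\<Sum>x=1..n. (r x t)\<^sup>2) + (\<Sum>x\<le>n. q x t * g x t)
     + (2 * (\<Sum>x\<le>n. p x t * g x t) - 4 * \<gamma> * (\<Sum>x\<le>n. (p x t)\<^sup>2)) / \<gamma>" for t
  have \<Psi>_deriv: "(\<Psi> has_real_derivative \<Psi>' t) (at t within {0..})" if "t \<ge> 0" for t
    unfolding \<Psi>_def[abs_def] \<Psi>'_def
    by (intro DERIV_add DERIV_cdivide \<Phi>_deriv chain_energy_deriv[OF ode] that)
  have pg: "(\<Sum>x\<le>n. p x t * g x t) \<le> \<gamma> * (\<Sum>x\<le>n. (p x t)\<^sup>2) + \<delta> / (4 * \<gamma>)" if "0 \<le> t" "t \<le> T" for t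
    using sum_mult_le_weighted_squares[OF \<gamma>, of "\<lambda>x. p x t" "\<lambda>x. g x t" "{..n}"] \<delta>[OF that]
      divide_right_mono[OF \<delta>[OF that], of "4 * \<gamma>"] \<gamma> by simp
  \<comment> \<open>The energy gained from the force is at most
    \<open>\<delta> / (2 * \<gamma>)\<close> per unit time, hence the energy is never much below its
    final value.\<close>
  have E_late: "?E T - \<delta> * T / (2 * \<gamma>) \<le> ?E t" if t: "0 \<le> t" "t \<le> T" for t
  proof -
    have "?E T - \<delta> / (2 * \<gamma>) * T \<le> ?E t - \<delta> / (2 * \<gamma>) * t"
    proof (rule nonincreasing_of_deriv[OF t(2) _ t(1)])
      fix s assume "t \<le> s" "s \<le> T"
      then have s: "0 \<le> s" "s \<le> T" using t by auto
      show "((\<lambda>t. ?E t - \<delta> / (2 * \<gamma>) * t) has_real_derivative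
         (2 * (\<Sum>x\<le>n. p x s * g x s) - 4 * \<gamma> * (\<Sum>x\<le>n. (p x s)\<^sup>2)) - \<delta> / (2 * \<gamma>) * 1) (at s within {0..})"
        by (intro DERIV_diff DERIV_cmult DERIV_ident chain_energy_deriv[OF ode] s)
      have "0 \<le> \<gamma> * (\<Sum>x\<le>n. (p x s)\<^sup>2)" using \<gamma> by (simp add: sum_nonneg)
      moreover have "\<delta> / (2 * \<gamma>) = 2 * (\<delta> / (4 * \<gamma>))" by simp
      ultimately show "(2 * (\<Sum>x\<le>n. p x s * g x s) - 4 * \<gamma> * (\<Sum>x\<le>n. (p x s)\<^sup>2)) - \<delta> / (2 * \<gamma>) * 1 \<le> 0"
        using pg[OF s] by linarith
    qed
    moreover have "\<delta> / (2 * \<gamma>) * t \<ge> 0" using \<delta>0 \<gamma> t by simp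
    ultimately show ?thesis by simp
  qed
  \<comment> \<open>The weight \<open>\<gamma> / (2 * T)\<close> in the quadratic inequality turns
    the term \<open>q * g\<close> into at most \<open>\<Psi> / T\<close>, a growth rate that costs
    only a constant factor over \<open>[0, T]\<close>, plus the force error
    \<open>\<delta> * T / (2 * \<gamma>)\<close>.\<close>
  have \<Psi>'_le: "\<Psi>' t \<le> \<Psi> t / T - D" if t: "0 \<le> t" "t \<le> T" for t
  proof -
    have "(\<Sum>x\<le>n. q x t * g x t) \<le> \<gamma> / (2 * T) * (\<Sum>x\<le>n. (q x t)\<^sup>2) + (\<Sum>x\<le>n. (g x t)\<^sup>2) / (4 * (\<gamma> / (2 * T)))"
      by (rule sum_mult_le_weighted_squares) (use \<gamma> T in simp)
    also have "(\<Sum>x\<le>n. (g x t)\<^sup>2) / (4 * (\<gamma> / (2 * T))) \<le> \<delta> / (4 * (\<gamma> / (2 * T)))"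
      by (intro divide_right_mono \<delta> t) (use \<gamma> T in simp)
    also have "\<delta> / (4 * (\<gamma> / (2 * T))) = \<delta> * T / (2 * \<gamma>)" using \<gamma> T by (simp add: field_simps)
    also have "\<gamma> / (2 * T) * (\<Sum>x\<le>n. (q x t)\<^sup>2) = \<gamma> / 2 * (\<Sum>x\<le>n. (q x t)\<^sup>2) / T" by simp
    also have "\<dots> \<le> \<Psi> t / T" by (intro divide_right_mono \<Psi>_lower) (use T in simp)
    finally have 1: "(\<Sum>x\<le>n. q x t * g x t) \<le> \<Psi> t / T + \<delta> * T / (2 * \<gamma>)" by simp
    have "(2 * (\<Sum>x\<le>n. p x t * g x t) - 4 * \<gamma> * (\<Sum>x\<le>n. (p x t)\<^sup>2)) / \<gamma>
      \<le> (2 * (\<gamma> * (\<Sum>x\<le>n. (p x t)\<^sup>2) + \<delta> / (4 * \<gamma>)) - 4 * \<gamma> * (\<Sum>x\<le>n. (p x t)\<^sup>2)) / \<gamma>"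
      by (intro divide_right_mono diff_right_mono mult_left_mono pg t) (use \<gamma> in auto)
    also have "\<dots> = - 2 * (\<Sum>x\<le>n. (p x t)\<^sup>2) + \<delta> / (2 * \<gamma>\<^sup>2)"
      using \<gamma> by (simp add: field_simps power2_eq_square)
    finally have "\<Psi>' t \<le> - ?E t + \<Psi> t / T + \<delta> * T / (2 * \<gamma>) + \<delta> / (2 * \<gamma>\<^sup>2)"
      using 1 unfolding \<Psi>'_def chain_energy_def by simp
    moreover have "D = ?E T - \<delta> * T / (2 * \<gamma>) - \<delta> * T / (2 * \<gamma>) - \<delta> / (2 * \<gamma>\<^sup>2)"
      unfolding D_def using \<gamma> by (simp add: field_simps)
    ultimately show ?thesis using E_late[OF t] by linarith
  qed
  \<comment> \<open>Integrating factor for \<open>\<Psi>' <= \<Psi> / T - D\<close>; the constant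
    \<open>D * T\<close> is the equilibrium of the comparison equation.\<close>
  define f where "f t = exp (- t / T) * (\<Psi> t - D * T)" for t
  have "f T \<le> f 0"
  proof (rule nonincreasing_of_deriv[where f = f and f' = "\<lambda>s. exp (- s / T) * (\<Psi>' s - (\<Psi> s / T - D))"])
    fix s assume s: "0 \<le> s" "s \<le> T"
    show "(f has_real_derivative exp (- s / T) * (\<Psi>' s - (\<Psi> s / T - D))) (at s within {0..})"
      unfolding f_def[abs_def] using T by (auto intro!: derivative_eq_intros \<Psi>_deriv s simp: field_simps)
    show "exp (- s / T) * (\<Psi>' s - (\<Psi> s / T - D)) \<le> 0"
      using \<Psi>'_le[OF s] by (simp add: mult_le_0_iff)
  qed (use T in auto)
  have "- (exp (-1) * (D * T)) \<le> \<Psi> 0 - D * T"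
  proof -
    have "f T = exp (-1) * \<Psi> T - exp (-1) * (D * T)" "f 0 = \<Psi> 0 - D * T"
      using T by (simp_all add: f_def algebra_simps)
    moreover have "0 \<le> exp (-1) * \<Psi> T" using \<Psi>_nonneg by simp
    ultimately show ?thesis using \<open>f T \<le> f 0\<close> by linarith
  qed
  then have *: "D * T * (1 - exp (-1)) \<le> \<Psi> 0" by (simp add: algebra_simps)
  \<comment> \<open>Makes \<open>1 - exp (-1)\<close> at least \<open>1 / 2\<close>, the source of
    the factor 2 in front of \<open>\<Psi> 0\<close>.\<close>
  have e: "exp (-1) \<le> (1/2 :: real)"
    using exp_ge_add_one_self[of "1::real"] by (simp add: exp_minus field_simps)
  have "D * T \<le> 2 * \<Psi> 0"
  proof (cases "D * T \<le> 0")
    case False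
    then have "D * T * (1 / 2) \<le> D * T * (1 - exp (-1))" using e by (intro mult_left_mono) auto
    with * show ?thesis by simp
  qed (use \<Psi>_nonneg[of 0] in simp)
  then have D: "D \<le> 2 / T * \<Psi> 0" using T by (simp add: field_simps)
  have "\<Psi> 0 \<le> 4 * \<gamma> * (real n)\<^sup>2 * (\<Sum>x=1..n. (r x 0)\<^sup>2) + 5 / (4 * \<gamma>) * ?E 0"
  proof -
    have "(\<Sum>x\<le>n. q x 0 * p x 0) \<le> \<gamma> * (\<Sum>x\<le>n. (q x 0)\<^sup>2) + (\<Sum>x\<le>n. (p x 0)\<^sup>2) / (4 * \<gamma>)"
      by (rule sum_mult_le_weighted_squares[OF \<gamma>])
    moreover have "(\<Sum>x\<le>n. (p x 0)\<^sup>2) / (4 * \<gamma>) \<le> ?E 0 / (4 * \<gamma>)"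
      by (intro divide_right_mono pE) (use \<gamma> in simp)
    moreover have "5 / (4 * \<gamma>) * ?E 0 = ?E 0 / \<gamma> + ?E 0 / (4 * \<gamma>)"
      using \<gamma> by (simp add: field_simps)
    ultimately have "\<Psi> 0 \<le> 2 * \<gamma> * (\<Sum>x\<le>n. (q x 0)\<^sup>2) + 5 / (4 * \<gamma>) * ?E 0"
      unfolding \<Psi>_def \<Phi>_eq by linarith
    moreover have "(\<Sum>x\<le>n. (q x 0)\<^sup>2) \<le> 2 * (real n)\<^sup>2 * (\<Sum>x=1..n. (r x 0)\<^sup>2)"
    proof -
      have "(\<Sum>x\<le>n. (q x 0)\<^sup>2) \<le> real n * (real n + 1) * (\<Sum>x=1..n. (r x 0)\<^sup>2)"
        using chain_displacement_bound[where r="\<lambda>y. r y 0"] by (simp add: q_def)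
      also have "\<dots> \<le> 2 * (real n)\<^sup>2 * (\<Sum>x=1..n. (r x 0)\<^sup>2)"
        using n by (intro mult_right_mono sum_nonneg) (auto simp: power2_eq_square algebra_simps)
      finally show ?thesis .
    qed
    then have "2 * \<gamma> * (\<Sum>x\<le>n. (q x 0)\<^sup>2) \<le> 2 * \<gamma> * (2 * (real n)\<^sup>2 * (\<Sum>x=1..n. (r x 0)\<^sup>2))"
      using \<gamma> by (intro mult_left_mono) auto
    ultimately show ?thesis by simp
  qed
  then have "2 / T * \<Psi> 0 \<le> 2 / T * (4 * \<gamma> * (real n)\<^sup>2 * (\<Sum>x=1..n. (r x 0)\<^sup>2) + 5 / (4 * \<gamma>) * ?E 0)"
    using T by (intro mult_left_mono) auto
  with D show ?thesis unfolding D_def by linarith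
qed

subsection \<open>Explicit approximate solutions\<close>

text \<open>The square is the \<open>k\<close>-th eigenvalue of the negative discrete Laplacian on
  the bonds \<open>1..n\<close> with zero values at the fictitious bonds \<open>0\<close> and
  \<open>n + 1\<close>.\<close>

definition lattice_freq :: "nat \<Rightarrow> nat \<Rightarrow> real" where
  "lattice_freq n k = 2 * sin (pi * real k / (2 * (real n + 1)))"

text \<open>Overdamped ansatz: the momentum is slaved to the stretch gradient by
  \<open>2 * \<gamma> * p x = r (x + 1) - r x\<close>, so that the stretch solves the lattice heat
  equation exactly. The momentum \<open>heat_mode_p\<close> is this gradient in closed form.\<close>

definition heat_mode_r :: "real \<Rightarrow> nat \<Rightarrow> nat \<Rightarrow> nat \<Rightarrow> real \<Rightarrow> real" where
  "heat_mode_r \<gamma> n k x t =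
     exp (- ((lattice_freq n k)\<^sup>2 / (2 * \<gamma>) * t)) * sin (pi * real k * real x / (real n + 1))"

definition heat_mode_p :: "real \<Rightarrow> nat \<Rightarrow> nat \<Rightarrow> nat \<Rightarrow> real \<Rightarrow> real" where
  "heat_mode_p \<gamma> n k x t = lattice_freq n k / (2 * \<gamma>) *
     exp (- ((lattice_freq n k)\<^sup>2 / (2 * \<gamma>) * t)) * cos (pi * real k * (real x + 1 / 2) / (real n + 1))"

text \<open>Only the inertial term \<open>p'\<close>, neglected in the overdamped ansatz, is left
  over as a force. For fixed \<open>k\<close> it has size \<open>n^-3\<close>: one power from the
  gradient and two from the decay rate.\<close>

lemma chain_ode_heat_mode:
  assumes \<gamma>: "\<gamma> > 0"
  shows "chain_ode n \<gamma> (heat_mode_r \<gamma> n k) (heat_mode_p \<gamma> n k)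
     (\<lambda>x t. - ((lattice_freq n k)\<^sup>2 / (2 * \<gamma>)) * heat_mode_p \<gamma> n k x t)"
proof -
  define \<theta> where "\<theta> = pi * real k / (real n + 1)"
  define \<mu> where "\<mu> = lattice_freq n k"
  have \<mu>: "\<mu> = 2 * sin (\<theta> / 2)"
    by (simp add: \<mu>_def lattice_freq_def \<theta>_def algebra_simps)
  define e where "e t = exp (- (\<mu>\<^sup>2 / (2 * \<gamma>) * t))" for t
  have r: "heat_mode_r \<gamma> n k x t = e t * sin (\<theta> * real x)" for x t
    by (simp add: heat_mode_r_def \<theta>_def e_def \<mu>_def)
  have p: "heat_mode_p \<gamma> n k x t = \<mu> / (2 * \<gamma>) * (e t * cos (\<theta> * (real x + 1 / 2)))" for x t
    using \<gamma> by (simp add: heat_mode_p_def \<theta>_def e_def \<mu>_def)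
  have e: "(e has_real_derivative - (\<mu>\<^sup>2 / (2 * \<gamma>)) * e t) (at t within A)" for t A
    unfolding e_def[abs_def] using \<gamma> by (auto intro!: derivative_eq_intros)
  have cos_diff: "cos (\<theta> * (real x + 1 / 2)) - cos (\<theta> * (real (x - 1) + 1 / 2)) = - \<mu> * sin (\<theta> * real x)"
    if "x \<ge> 1" for x
  proof -
    have "real (x - 1) + 1 / 2 = real x - 1 / 2" using that by (simp add: of_nat_diff)
    then show ?thesis
      by (simp add: \<mu> ring_distribs cos_add cos_diff algebra_simps)
  qed
  have sin_diff: "sin (\<theta> * (real x + 1)) - sin (\<theta> * real x) = \<mu> * cos (\<theta> * (real x + 1 / 2))" for x
  proof -
    define a where "a = \<theta> * (real x + 1 / 2)"
    have 1: "\<theta> * (real x + 1) = a + \<theta> / 2" "\<theta> * real x = a - \<theta> / 2"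
      by (simp_all add: a_def field_simps)
    show ?thesis unfolding 1 a_def[symmetric] \<mu> by (simp add: sin_add sin_diff)
  qed
  \<comment> \<open>The sine vanishes at the fictitious bond \<open>n + 1\<close>, so the case
    distinction at \<open>x = n\<close> agrees with the general formula.\<close>
  have last: "sin (\<theta> * (real n + 1)) = 0"
    by (simp add: \<theta>_def mult.commute[of pi])
  show ?thesis
  proof (rule chain_odeI)
    fix t :: real and x assume x: "1 \<le> x" "x \<le> n"
    have "(heat_mode_r \<gamma> n k x has_real_derivative - (\<mu>\<^sup>2 / (2 * \<gamma>)) * e t * sin (\<theta> * real x)) (at t within {0..})"
      unfolding r[abs_def] by (intro DERIV_cmult_right e)
    moreover have "heat_mode_p \<gamma> n k x t - heat_mode_p \<gamma> n k (x - 1) t = - (\<mu>\<^sup>2 / (2 * \<gamma>)) * e t * sin (\<theta> * real x)"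
    proof -
      have "heat_mode_p \<gamma> n k x t - heat_mode_p \<gamma> n k (x - 1) t
        = \<mu> / (2 * \<gamma>) * e t * (cos (\<theta> * (real x + 1 / 2)) - cos (\<theta> * (real (x - 1) + 1 / 2)))"
        unfolding p by (simp only: right_diff_distrib mult.assoc)
      then show ?thesis unfolding cos_diff[OF x(1)] by (simp add: power2_eq_square)
    qed
    ultimately show "(heat_mode_r \<gamma> n k x has_real_derivative
       heat_mode_p \<gamma> n k x t - heat_mode_p \<gamma> n k (x - 1) t) (at t within {0..})" by simp
  next
    fix t :: real and x assume x: "x \<le> n"
    have "(heat_mode_p \<gamma> n k x has_real_derivative
       \<mu> / (2 * \<gamma>) * (- (\<mu>\<^sup>2 / (2 * \<gamma>)) * e t * cos (\<theta> * (real x + 1 / 2)))) (at t within {0..})"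
      unfolding p[abs_def] by (intro DERIV_cmult DERIV_cmult_right e)
    moreover have "(if x < n then heat_mode_r \<gamma> n k (Suc x) t else 0) = e t * sin (\<theta> * (real x + 1))"
      using x last by (auto simp: r ac_simps dest!: le_neq_implies_less)
    moreover have "(if 0 < x then heat_mode_r \<gamma> n k x t else 0) = e t * sin (\<theta> * real x)"
      by (simp add: r)
    moreover have "\<mu> / (2 * \<gamma>) * (- (\<mu>\<^sup>2 / (2 * \<gamma>)) * e t * cos (\<theta> * (real x + 1 / 2)))
      = e t * sin (\<theta> * (real x + 1)) - e t * sin (\<theta> * real x) - 2 * \<gamma> * heat_mode_p \<gamma> n k x t
        + - ((lattice_freq n k)\<^sup>2 / (2 * \<gamma>)) * heat_mode_p \<gamma> n k x t"
      unfolding right_diff_distrib[symmetric] sin_diff p \<mu>_def[symmetric] using \<gamma>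
      by (simp add: field_simps)
    ultimately show "(heat_mode_p \<gamma> n k x has_real_derivative
        (if x < n then heat_mode_r \<gamma> n k (Suc x) t else 0)
        - (if 0 < x then heat_mode_r \<gamma> n k x t else 0) - 2 * \<gamma> * heat_mode_p \<gamma> n k x t
        + - ((lattice_freq n k)\<^sup>2 / (2 * \<gamma>)) * heat_mode_p \<gamma> n k x t) (at t within {0..})"
      by simp
  qed
qed

text \<open>A force at site \<open>n\<close> acts like a stretch \<open>F\<close> on the fictitious
  bond \<open>n + 1\<close>. The linear interpolation between \<open>0\<close> and \<open>F\<close>
  has constant gradient, which a constant momentum balances through friction.\<close>

lemma chain_ode_stationary:
  assumes \<gamma>: "\<gamma> > 0"
  shows "chain_ode n \<gamma> (\<lambda>x t. F * real x / (real n + 1)) (\<lambda>x t. F / (2 * \<gamma> * (real n + 1)))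
    (\<lambda>x t. if x = n then F else 0)"
proof (rule chain_odeI)
  fix t :: real and x assume x: "x \<le> n"
  have "(if x < n then F * real (Suc x) / (real n + 1) else 0) - (if 0 < x then F * real x / (real n + 1) else 0)
    - 2 * \<gamma> * (F / (2 * \<gamma> * (real n + 1))) + (if x = n then F else 0) = 0"
    using x \<gamma> by (auto simp: divide_simps) (auto simp: algebra_simps)
  then show "((\<lambda>t. F / (2 * \<gamma> * (real n + 1))) has_real_derivative
     (if x < n then F * real (Suc x) / (real n + 1) else 0) - (if 0 < x then F * real x / (real n + 1) else 0)
    - 2 * \<gamma> * (F / (2 * \<gamma> * (real n + 1))) + (if x = n then F else 0)) (at t within {0..})"
    by (metis DERIV_const)
qed auto

text \<open>A force oscillating at a nonzero frequency only excites modes decaying exponentially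
  away from the boundary, because the damping keeps the propagation factor off the unit circle.\<close>

lemma evanescent_factor_exists:
  assumes \<gamma>: "\<gamma> > 0" and \<omega>: "\<omega> \<noteq> (0::real)"
  obtains l b :: complex where "norm l < 1" "\<i> * of_real \<omega> * l = b * (1 - l)"
    "(\<i> * of_real \<omega> + 2 * of_real \<gamma>) * b = 1 - l"
proof -
  define z where "z = \<i> * complex_of_real \<omega>"
  \<comment> \<open>Inserting powers of \<open>l\<close> times \<open>exp (z t)\<close> into the
    chain gives \<open>z l = b (1 - l)\<close> and \<open>(z + 2 \<gamma>) b = 1 - l\<close>.
    Eliminating \<open>b\<close> leaves \<open>(1 - l)^2 = l v\<close>, a quadratic whose roots have
    product 1 and sum \<open>2 + v\<close>.\<close>
  define v where "v = z * (z + 2 * of_real \<gamma>)"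
  define s where "s = csqrt ((2 + v)\<^sup>2 - 4)"
  define l1 where "l1 = ((2 + v) + s) / 2"
  define l2 where "l2 = ((2 + v) - s) / 2"
  have s2: "s\<^sup>2 = (2 + v)\<^sup>2 - 4" by (simp add: s_def)
  have prod: "l1 * l2 = 1"
  proof -
    have "l1 * l2 = ((2 + v)\<^sup>2 - s\<^sup>2) / 4" by (simp add: l1_def l2_def field_simps power2_eq_square)
    then show ?thesis by (simp add: s2)
  qed
  have sum: "l1 + l2 = 2 + v" by (simp add: l1_def l2_def field_simps)
  \<comment> \<open>On the unit circle the two roots would be conjugate and their sum real, but
    \<open>v\<close> has imaginary part \<open>2 * \<gamma> * \<omega>\<close>.\<close>
  have "norm l1 \<noteq> 1"
  proof
    assume "norm l1 = 1"
    then have "l1 * cnj l1 = 1" by (simp add: complex_norm_square[symmetric])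
    then have "l2 = cnj l1" using prod by (metis mult.assoc mult.commute mult.left_neutral)
    then have "Im (2 + v) = 0" by (simp flip: sum)
    then show False using \<gamma> \<omega> by (simp add: v_def z_def)
  qed
  moreover have "norm l1 * norm l2 = 1" using prod by (metis norm_mult norm_one)
  ultimately have "norm l1 < 1 \<or> norm l2 < 1"
    using mult_strict_left_mono[of 1 "norm l1" "norm l2"] by (fastforce simp: not_less mult.commute)
  moreover have "l1 * (2 + v - l1) = 1" "l2 * (2 + v - l2) = 1"
    using prod by (simp_all add: mult.commute flip: sum)
  ultimately obtain l where l: "norm l < 1" "l * (2 + v - l) = 1" by blast
  have root: "(1 - l)\<^sup>2 = l * v" using l(2) by (simp add: algebra_simps power2_eq_square)
  have ne: "z + 2 * of_real \<gamma> \<noteq> 0"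
    using \<gamma> by (auto simp: z_def complex_eq_iff)
  define b where "b = (1 - l) / (z + 2 * of_real \<gamma>)"
  have "b * (1 - l) = z * l"
  proof -
    have "b * (1 - l) = (1 - l)\<^sup>2 / (z + 2 * of_real \<gamma>)" by (simp add: b_def power2_eq_square)
    then show ?thesis unfolding root v_def using ne by simp
  qed
  moreover have "(z + 2 * of_real \<gamma>) * b = 1 - l" using ne by (simp add: b_def)
  ultimately show thesis using that[of l b] l(1) by (simp add: z_def)
qed

text \<open>Exponents count the distance to the right end. The fictitious bond \<open>n + 1\<close>
  gets exponent \<open>0\<close> and so carries the force itself.\<close>

definition boundary_mode_r :: "complex \<Rightarrow> real \<Rightarrow> complex \<Rightarrow> nat \<Rightarrow> nat \<Rightarrow> real \<Rightarrow> real" where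
  "boundary_mode_r c \<omega> l n x t = Re (c * l ^ (n + 1 - x) * exp (\<i> * of_real \<omega> * of_real t))"

definition boundary_mode_p :: "complex \<Rightarrow> real \<Rightarrow> complex \<Rightarrow> complex \<Rightarrow> nat \<Rightarrow> nat \<Rightarrow> real \<Rightarrow> real" where
  "boundary_mode_p c \<omega> l b n x t = Re (c * b * l ^ (n - x) * exp (\<i> * of_real \<omega> * of_real t))"

text \<open>On a lattice unbounded to the left the wave is an exact solution driven from bond
  \<open>n + 1\<close>. Cutting the chain at site \<open>0\<close> leaves the value at bond
  \<open>0\<close> as a residual, of order \<open>norm l ^ (n + 1)\<close>.\<close>

lemma chain_ode_boundary_mode:
  assumes l: "\<i> * of_real \<omega> * l = b * (1 - l)" "(\<i> * of_real \<omega> + 2 * of_real \<gamma>) * b = 1 - l"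
  shows "chain_ode n \<gamma> (boundary_mode_r c \<omega> l n) (boundary_mode_p c \<omega> l b n)
     (\<lambda>x t. (if x = n then Re (c * exp (\<i> * of_real \<omega> * of_real t)) else 0)
        - (if x = 0 then boundary_mode_r c \<omega> l n 0 t else 0))"
proof -
  define z where "z = \<i> * complex_of_real \<omega>"
  have zb: "z * b = 1 - l - 2 * of_real \<gamma> * b" using l(2) by (simp add: z_def algebra_simps)
  have zl: "z * l = b * (1 - l)" using l(1) by (simp add: z_def)
  have re_scale: "Re (of_real a * w) = a * Re w" for a w by simp
  have D: "((\<lambda>t. Re (a * exp (z * of_real t))) has_real_derivative Re (a * (z * exp (z * of_real t)))) (at t within A)"
    for a t A
  proof -
    have "((\<lambda>w. a * exp (z * w)) has_field_derivative a * (z * exp (z * of_real t))) (at (of_real t))"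
      by (auto intro!: derivative_eq_intros)
    then have "((\<lambda>t. a * exp (z * of_real t)) has_vector_derivative a * (z * exp (z * of_real t))) (at t within A)"
      by (rule has_vector_derivative_real_field)
    then show ?thesis
      unfolding has_real_derivative_iff_has_vector_derivative
      by (rule bounded_linear.has_vector_derivative[OF bounded_linear_Re])
  qed
  show ?thesis
  proof (rule chain_odeI)
    fix t :: real and x assume x: "1 \<le> x" "x \<le> n"
    have "l ^ (n + 1 - x) = l * l ^ (n - x)" "l ^ (n - (x - 1)) = l * l ^ (n - x)"
      using x by (simp_all add: Suc_diff_le flip: power_Suc)
    moreover have "c * (l * l ^ (n - x)) * (z * exp (z * of_real t))
       = c * l ^ (n - x) * (z * l) * exp (z * of_real t)" by (simp add: algebra_simps)
    moreover have "c * l ^ (n - x) * (z * l) * exp (z * of_real t)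
       = c * b * l ^ (n - x) * exp (z * of_real t) - c * b * (l * l ^ (n - x)) * exp (z * of_real t)"
      unfolding zl by (simp add: algebra_simps)
    ultimately have "c * l ^ (n + 1 - x) * (z * exp (z * of_real t))
       = c * b * l ^ (n - x) * exp (z * of_real t) - c * b * l ^ (n - (x - 1)) * exp (z * of_real t)"
      by simp
    then have "Re (c * l ^ (n + 1 - x) * (z * exp (z * of_real t)))
      = boundary_mode_p c \<omega> l b n x t - boundary_mode_p c \<omega> l b n (x - 1) t"
      by (simp only: boundary_mode_p_def z_def minus_complex.sel)
    then show "(boundary_mode_r c \<omega> l n x has_real_derivative
       boundary_mode_p c \<omega> l b n x t - boundary_mode_p c \<omega> l b n (x - 1) t) (at t within {0..})"
      using D[of "c * l ^ (n + 1 - x)" t "{0..}"] unfolding boundary_mode_r_def[abs_def] z_def by simp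
  next
    fix t :: real and x assume x: "x \<le> n"
    let ?e = "exp (z * complex_of_real t)"
    have 1: "(if x < n then boundary_mode_r c \<omega> l n (Suc x) t else 0) + (if x = n then Re (c * ?e) else 0)
       = Re (c * l ^ (n - x) * ?e)"
      using x by (auto simp: boundary_mode_r_def z_def)
    have 2: "(if 0 < x then boundary_mode_r c \<omega> l n x t else 0) + (if x = 0 then boundary_mode_r c \<omega> l n 0 t else 0)
       = Re (c * (l * l ^ (n - x)) * ?e)"
      using x by (auto simp: boundary_mode_r_def z_def Suc_diff_le)
    have "c * b * l ^ (n - x) * (z * ?e) = c * l ^ (n - x) * (z * b) * ?e" by (simp add: algebra_simps)
    also have "\<dots> = c * l ^ (n - x) * ?e - c * (l * l ^ (n - x)) * ?e - of_real (2 * \<gamma>) * (c * b * l ^ (n - x) * ?e)"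
      unfolding zb by (simp add: algebra_simps)
    finally have "Re (c * b * l ^ (n - x) * (z * ?e))
      = Re (c * l ^ (n - x) * ?e) - Re (c * (l * l ^ (n - x)) * ?e) - 2 * \<gamma> * boundary_mode_p c \<omega> l b n x t"
      unfolding boundary_mode_p_def z_def[symmetric] by (simp only: minus_complex.sel re_scale)
    then have "Re (c * b * l ^ (n - x) * (z * ?e)) =
       (if x < n then boundary_mode_r c \<omega> l n (Suc x) t else 0)
        - (if 0 < x then boundary_mode_r c \<omega> l n x t else 0) - 2 * \<gamma> * boundary_mode_p c \<omega> l b n x t
        + ((if x = n then Re (c * ?e) else 0) - (if x = 0 then boundary_mode_r c \<omega> l n 0 t else 0))"
      using 1 2 by linarith
    then show "(boundary_mode_p c \<omega> l b n x has_real_derivative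
        (if x < n then boundary_mode_r c \<omega> l n (Suc x) t else 0)
        - (if 0 < x then boundary_mode_r c \<omega> l n x t else 0) - 2 * \<gamma> * boundary_mode_p c \<omega> l b n x t
        + ((if x = n then Re (c * exp (\<i> * of_real \<omega> * of_real t)) else 0)
        - (if x = 0 then boundary_mode_r c \<omega> l n 0 t else 0))) (at t within {0..})"
      using D[of "c * b * l ^ (n - x)" t "{0..}"] unfolding boundary_mode_p_def[abs_def] z_def by simp
  qed
qed

section \<open>Size and scaling limits of the explicit modes\<close>

lemma lattice_freq_le: "\<bar>lattice_freq n k\<bar> \<le> pi * real k / (real n + 1)"
proof -
  have "\<bar>sin (pi * real k / (2 * (real n + 1)))\<bar> \<le> \<bar>pi * real k / (2 * (real n + 1))\<bar>"
    by (rule abs_sin_x_le_abs_x)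
  then have "\<bar>lattice_freq n k\<bar> \<le> 2 * \<bar>pi * real k / (2 * (real n + 1))\<bar>"
    unfolding lattice_freq_def abs_mult by simp
  also have "\<dots> = pi * real k / (real n + 1)"
    by (simp add: abs_mult field_simps)
  finally show ?thesis .
qed

lemma lattice_freq_scaled_tendsto: "(\<lambda>n. real n * lattice_freq n k) \<longlonglongrightarrow> pi * real k"
proof (cases "k = 0")
  case False
  have "filterlim (\<lambda>n. pi * real k / (2 * (real n + 1))) (at 0) sequentially"
  proof (rule filterlim_atI)
    show "(\<lambda>n. pi * real k / (2 * (real n + 1))) \<longlonglongrightarrow> 0" by real_asymp
    show "\<forall>\<^sub>F n in sequentially. pi * real k / (2 * (real n + 1)) \<noteq> 0"
      using False by (intro always_eventually) (auto simp: add_eq_0_iff)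
  qed
  moreover have "((\<lambda>x::real. sin x / x) \<longlongrightarrow> 1) (at 0)"
    using DERIV_sin[of "0::real"] by (simp add: DERIV_def)
  ultimately have "(\<lambda>n. sin (pi * real k / (2 * (real n + 1))) / (pi * real k / (2 * (real n + 1)))) \<longlonglongrightarrow> 1"
    by (rule filterlim_compose[rotated])
  moreover have "(\<lambda>n. pi * real k * (real n / (real n + 1))) \<longlonglongrightarrow> pi * real k * 1"
    by (intro tendsto_mult tendsto_const) real_asymp
  ultimately have "(\<lambda>n. sin (pi * real k / (2 * (real n + 1))) / (pi * real k / (2 * (real n + 1)))
      * (pi * real k * (real n / (real n + 1)))) \<longlonglongrightarrow> 1 * (pi * real k * 1)"
    by (rule tendsto_mult)
  moreover have "sin (pi * real k / (2 * (real n + 1))) / (pi * real k / (2 * (real n + 1)))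
      * (pi * real k * (real n / (real n + 1))) = real n * lattice_freq n k" for n
    using False by (simp add: lattice_freq_def divide_simps)
  ultimately show ?thesis by simp
qed (simp add: lattice_freq_def)

lemma norm_exp_i_times_real: "norm (exp (\<i> * of_real \<omega> * of_real t)) = 1"
  by (simp add: norm_exp_eq_Re)

lemma abs_boundary_mode_r_le:
  assumes "norm l < 1"
  shows "\<bar>boundary_mode_r c \<omega> l n x t\<bar> \<le> norm c * norm l ^ (n + 1 - x)"
proof -
  have "\<bar>boundary_mode_r c \<omega> l n x t\<bar> \<le> norm (c * l ^ (n + 1 - x) * exp (\<i> * of_real \<omega> * of_real t))"
    unfolding boundary_mode_r_def by (rule abs_Re_le_cmod)
  then show ?thesis by (simp only: norm_mult norm_power norm_exp_i_times_real)
qed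

lemma abs_boundary_mode_p_le:
  assumes "norm l < 1"
  shows "\<bar>boundary_mode_p c \<omega> l b n x t\<bar> \<le> norm c * norm b"
proof -
  have "\<bar>boundary_mode_p c \<omega> l b n x t\<bar> \<le> norm (c * b * l ^ (n - x) * exp (\<i> * of_real \<omega> * of_real t))"
    unfolding boundary_mode_p_def by (rule abs_Re_le_cmod)
  also have "\<dots> = norm c * norm b * norm l ^ (n - x)"
    by (simp only: norm_mult norm_power norm_exp_i_times_real)
  also have "\<dots> \<le> norm c * norm b"
    using assms by (intro mult_left_le power_le_one mult_nonneg_nonneg) auto
  finally show ?thesis .
qed

text \<open>What the linear profile and the heat modes become at time \<open>n^2 t\<close> as
  \<open>n\<close> grows; at time zero it is the linear profile plus a sine polynomial.\<close>

definition heat_sum :: "real \<Rightarrow> real \<Rightarrow> nat set \<Rightarrow> (nat \<Rightarrow> real) \<Rightarrow> real \<Rightarrow> real \<Rightarrow> real" where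
  "heat_sum \<gamma> F K c t u = F * u +
     (\<Sum>k\<in>K. c k * (exp (- (pi\<^sup>2 * (real k)\<^sup>2 / (2 * \<gamma>) * t)) * sin (pi * real k * u)))"

lemma abs_sin_diff_le: "\<bar>sin a - sin b\<bar> \<le> \<bar>a - b\<bar>" for a b :: real
proof -
  define u v where "u = sin ((a - b) / 2)" and "v = cos ((a + b) / 2)"
  have u: "\<bar>u\<bar> \<le> \<bar>(a - b) / 2\<bar>" unfolding u_def by (rule abs_sin_x_le_abs_x)
  have v: "\<bar>v\<bar> \<le> 1" unfolding v_def by (rule abs_cos_le_one)
  have "\<bar>u * v\<bar> \<le> \<bar>(a - b) / 2\<bar> * 1"
    unfolding abs_mult by (rule mult_mono[OF u v]) auto
  moreover have "sin a - sin b = 2 * (u * v)"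
    unfolding u_def v_def by (simp add: sin_diff_sin)
  ultimately show ?thesis by simp
qed

text \<open>Two errors enter: the lattice decay rate in place of the continuum one, which does not
  depend on \<open>x\<close>, and the grid \<open>x / (n + 1)\<close> in place of
  \<open>x / n\<close>.\<close>

lemma heat_mode_r_uniform:
  assumes "1 \<le> x" "x \<le> n" "t \<ge> 0" "\<gamma> > 0"
  shows "\<bar>heat_mode_r \<gamma> n k x ((real n)\<^sup>2 * t)
     - exp (- (pi\<^sup>2 * (real k)\<^sup>2 / (2 * \<gamma>) * t)) * sin (pi * real k * (real x / real n))\<bar>
     \<le> \<bar>exp (- ((real n * lattice_freq n k)\<^sup>2 / (2 * \<gamma>) * t)) - exp (- (pi\<^sup>2 * (real k)\<^sup>2 / (2 * \<gamma>) * t))\<bar>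
        + pi * real k / real n"
proof -
  let ?a = "exp (- ((real n * lattice_freq n k)\<^sup>2 / (2 * \<gamma>) * t))"
  let ?b = "exp (- (pi\<^sup>2 * (real k)\<^sup>2 / (2 * \<gamma>) * t))"
  let ?s = "sin (pi * real k * real x / (real n + 1))"
  let ?s' = "sin (pi * real k * (real x / real n))"
  have 1: "heat_mode_r \<gamma> n k x ((real n)\<^sup>2 * t) = ?a * ?s"
    by (simp add: heat_mode_r_def power_mult_distrib algebra_simps)
  have "\<bar>?s - ?s'\<bar> \<le> \<bar>pi * real k * real x / (real n + 1) - pi * real k * (real x / real n)\<bar>"
    by (rule abs_sin_diff_le)
  also have "\<bar>pi * real k * real x / (real n + 1) - pi * real k * (real x / real n)\<bar>
     = pi * real k * (real x / (real n * (real n + 1)))"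
  proof -
    have "real x / (real n + 1) - real x / real n = - (real x / (real n * (real n + 1)))"
      using assms by (simp add: divide_simps) (simp add: algebra_simps)
    moreover have "pi * real k * real x / (real n + 1) - pi * real k * (real x / real n)
       = pi * real k * (real x / (real n + 1) - real x / real n)" by (simp add: algebra_simps)
    ultimately show ?thesis by (simp add: abs_mult)
  qed
  also have "\<dots> \<le> pi * real k * (1 / real n)"
    by (intro mult_left_mono) (use assms in \<open>auto simp: divide_simps\<close>)
  finally have s: "\<bar>?s - ?s'\<bar> \<le> pi * real k / real n" by simp
  have *: "\<bar>a * u - b * v\<bar> \<le> \<bar>a - b\<bar> + w" if "\<bar>u\<bar> \<le> 1" "\<bar>b\<bar> \<le> 1" "\<bar>u - v\<bar> \<le> w"
    for a b u v w :: real
  proof -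
    have "a * u - b * v = (a - b) * u + b * (u - v)" by (simp add: algebra_simps)
    then have "\<bar>a * u - b * v\<bar> \<le> \<bar>(a - b) * u\<bar> + \<bar>b * (u - v)\<bar>"
      by (simp only: abs_triangle_ineq)
    also have "\<dots> \<le> \<bar>a - b\<bar> * 1 + 1 * w"
      unfolding abs_mult by (intro add_mono mult_left_mono mult_mono) (use that in auto)
    finally show ?thesis by simp
  qed
  show ?thesis unfolding 1
    by (rule *[OF _ _ s]) (use assms in auto)
qed

lemma abs_heat_mode_p_le:
  assumes "\<gamma> > 0" "t \<ge> 0"
  shows "\<bar>heat_mode_p \<gamma> n k x t\<bar> \<le> pi * real k / (2 * \<gamma> * (real n + 1))"
proof -
  have "\<bar>heat_mode_p \<gamma> n k x t\<bar> = \<bar>lattice_freq n k\<bar> / (2 * \<gamma>) *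
     (exp (- ((lattice_freq n k)\<^sup>2 / (2 * \<gamma>) * t)) * \<bar>cos (pi * real k * (real x + 1 / 2) / (real n + 1))\<bar>)"
    using assms by (simp add: heat_mode_p_def abs_mult)
  also have "\<dots> \<le> (pi * real k / (real n + 1)) / (2 * \<gamma>) * (1 * 1)"
    using assms by (intro mult_mono divide_right_mono lattice_freq_le) auto
  finally show ?thesis by (simp add: mult.commute mult.left_commute)
qed

lemma chain_energy_diff_le:
  "chain_energy n (\<lambda>x t. r x t - r' x t) (\<lambda>x t. p x t - p' x t) t
     \<le> 2 * chain_energy n r p t + 2 * chain_energy n r' p' t"
proof -
  have sq: "(a - b)\<^sup>2 \<le> 2 * a\<^sup>2 + 2 * b\<^sup>2" for a b :: real
    using sum_squares_bound[of a "-b"] by (simp add: power2_diff)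
  have "chain_energy n (\<lambda>x t. r x t - r' x t) (\<lambda>x t. p x t - p' x t) t \<le>
     (\<Sum>x=1..n. 2 * (r x t)\<^sup>2 + 2 * (r' x t)\<^sup>2) + (\<Sum>x\<le>n. 2 * (p x t)\<^sup>2 + 2 * (p' x t)\<^sup>2)"
    unfolding chain_energy_def by (intro add_mono sum_mono sq)
  then show ?thesis by (simp add: chain_energy_def sum.distrib sum_distrib_left)
qed

text \<open>Apply \<open>chain_energy_decay\<close> to the difference from the explicit approximate
  solution and divide by \<open>n\<close>. The initial mismatch \<open>\<epsilon>'\<close> enters
  with \<open>8 * \<gamma> / t\<close> and is doubled twice when squares of sums are split. The
  force error enters with \<open>t / \<gamma>\<close>, tripled by the split of the residual and
  doubled at the end. All other contributions vanish in the limit and go into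
  \<open>\<eta>\<close>.\<close>

lemma chain_hydrodynamic_finite:
  fixes r p :: "nat \<Rightarrow> nat \<Rightarrow> real \<Rightarrow> real" and f :: "int \<Rightarrow> complex" and \<omega> :: "int \<Rightarrow> real"
  assumes \<gamma>: "\<gamma> > 0" and t: "t > 0" and K: "finite K" and L: "finite L" "\<And>l. l \<in> L \<Longrightarrow> \<omega> l \<noteq> 0"
    and ode: "\<And>n. n \<ge> 1 \<Longrightarrow> chain_ode n \<gamma> (r n) (p n) (\<lambda>x t. if x = n then F n t else 0)"
    and F: "\<And>n t. n \<ge> 1 \<Longrightarrow> t \<ge> 0 \<Longrightarrow>
       \<bar>F n t - Fbar - 1 / sqrt (real n) * (\<Sum>l\<in>L. Re (f l * exp (\<i> * of_real (\<omega> l) * of_real t)))\<bar>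
         \<le> \<epsilon> / sqrt (real n)"
    and H: "\<And>n. n \<ge> 1 \<Longrightarrow> chain_energy n (r n) (p n) 0 \<le> H * real n"
    and init: "\<forall>\<^sub>F n in sequentially.
       1 / real n * (\<Sum>x=1..n. (r n x 0 - heat_sum \<gamma> Fbar K c 0 (real x / real n))\<^sup>2) \<le> \<epsilon>'"
    and \<eta>: "\<eta> > 0"
  shows "\<forall>\<^sub>F n in sequentially.
       1 / real n * (\<Sum>x=1..n. (r n x ((real n)\<^sup>2 * t) - heat_sum \<gamma> Fbar K c t (real x / real n))\<^sup>2)
         + 1 / real n * (\<Sum>x\<le>n. (p n x ((real n)\<^sup>2 * t))\<^sup>2)
       \<le> 32 * \<gamma> / t * \<epsilon>' + 6 * t / \<gamma> * \<epsilon>\<^sup>2 + \<eta>"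
proof -
  have "\<forall>l\<in>L. \<exists>a b. norm a < 1 \<and> \<i> * of_real (\<omega> l) * a = b * (1 - a) \<and>
      (\<i> * of_real (\<omega> l) + 2 * of_real \<gamma>) * b = 1 - a"
    using evanescent_factor_exists[OF \<gamma> L(2)] by metis
  then obtain a b where ab: "\<And>l. l \<in> L \<Longrightarrow> norm (a l :: complex) < 1"
      "\<And>l. l \<in> L \<Longrightarrow> \<i> * of_real (\<omega> l) * a l = b l * (1 - a l)"
      "\<And>l. l \<in> L \<Longrightarrow> (\<i> * of_real (\<omega> l) + 2 * of_real \<gamma>) * b l = 1 - a l"
    by metis
  define R where "R n x s = Fbar * real x / (real n + 1) + ((\<Sum>k\<in>K. c k * heat_mode_r \<gamma> n k x s)
     + 1 / sqrt (real n) * (\<Sum>l\<in>L. boundary_mode_r (f l) (\<omega> l) (a l) n x s))" for n x s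
  define P where "P n x s = Fbar / (2 * \<gamma> * (real n + 1)) + ((\<Sum>k\<in>K. c k * heat_mode_p \<gamma> n k x s)
     + 1 / sqrt (real n) * (\<Sum>l\<in>L. boundary_mode_p (f l) (\<omega> l) (a l) (b l) n x s))" for n x s
  define G where "G n x s = (if x = n then Fbar else 0) +
     ((\<Sum>k\<in>K. c k * (- ((lattice_freq n k)\<^sup>2 / (2 * \<gamma>)) * heat_mode_p \<gamma> n k x s))
     + 1 / sqrt (real n) * (\<Sum>l\<in>L. (if x = n then Re (f l * exp (\<i> * of_real (\<omega> l) * of_real s)) else 0)
        - (if x = 0 then boundary_mode_r (f l) (\<omega> l) (a l) n 0 s else 0)))" for n x s
  have approx_ode: "chain_ode n \<gamma> (R n) (P n) (G n)" for n
    unfolding R_def[abs_def] P_def[abs_def] G_def[abs_def]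
    by (intro chain_ode_add chain_ode_scale chain_ode_sum chain_ode_stationary chain_ode_heat_mode
        chain_ode_boundary_mode K L \<gamma> ab)
  \<comment> \<open>Residual force of the difference. It consists of the untreated part of the force
    at site \<open>n\<close>, the inertial terms of the heat modes and the cut of the boundary modes
    at site \<open>0\<close>.\<close>
  define g where "g n x s = (if x = n then F n s else 0) - G n x s" for n x s
  have diff_ode: "chain_ode n \<gamma> (\<lambda>x s. r n x s - R n x s) (\<lambda>x s. p n x s - P n x s) (g n)" if "n \<ge> 1" for n
    using chain_ode_add[OF ode[OF that] chain_ode_scale[OF approx_ode, of n "-1"]]
    by (simp add: g_def[abs_def])
  \<comment> \<open>Uniform distance of the approximate stretches at time \<open>n^2 s\<close> from
    the continuum profile; \<open>\<beta>\<close> below plays the same role for the momenta,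
    compared with zero.\<close>
  define \<alpha> where "\<alpha> s n = \<bar>Fbar\<bar> / real n + (\<Sum>k\<in>K. \<bar>c k\<bar> *
      (\<bar>exp (- ((real n * lattice_freq n k)\<^sup>2 / (2 * \<gamma>) * s)) - exp (- (pi\<^sup>2 * (real k)\<^sup>2 / (2 * \<gamma>) * s))\<bar>
        + pi * real k / real n)) + 1 / sqrt (real n) * (\<Sum>l\<in>L. norm (f l))" for s n
  define \<beta> where "\<beta> n = \<bar>Fbar\<bar> / (2 * \<gamma> * (real n + 1)) + (\<Sum>k\<in>K. \<bar>c k\<bar> * (pi * real k / (2 * \<gamma> * (real n + 1))))
      + 1 / sqrt (real n) * (\<Sum>l\<in>L. norm (f l) * norm (b l))" for n
  have \<alpha>0: "\<alpha> s \<longlonglongrightarrow> 0" for s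
  proof -
    have 1: "(\<lambda>n. (real n * lattice_freq n k)\<^sup>2) \<longlonglongrightarrow> (pi * real k)\<^sup>2" for k
      by (intro tendsto_power lattice_freq_scaled_tendsto)
    have 2: "(\<lambda>n. \<bar>Fbar\<bar> / real n) \<longlonglongrightarrow> 0" and 3: "(\<lambda>n. 1 / sqrt (real n)) \<longlonglongrightarrow> 0"
      and 4: "(\<lambda>n. pi * real k / real n) \<longlonglongrightarrow> 0" for k
      by real_asymp+
    have "\<alpha> s \<longlonglongrightarrow> 0 + (\<Sum>k\<in>K. \<bar>c k\<bar> *
      (\<bar>exp (- ((pi * real k)\<^sup>2 / (2 * \<gamma>) * s)) - exp (- (pi\<^sup>2 * (real k)\<^sup>2 / (2 * \<gamma>) * s))\<bar> + 0)) + 0 * (\<Sum>l\<in>L. norm (f l))"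
      unfolding \<alpha>_def[abs_def]
      by (intro tendsto_add tendsto_sum tendsto_mult tendsto_const tendsto_rabs tendsto_diff tendsto_exp
          tendsto_minus tendsto_divide 1 2 3 4) (use \<gamma> in simp)
    then show ?thesis by (simp add: power_mult_distrib)
  qed
  have \<beta>0: "\<beta> \<longlonglongrightarrow> 0"
  proof -
    have 1: "(\<lambda>n. C / (2 * \<gamma> * (real n + 1))) \<longlonglongrightarrow> 0" for C
      using \<gamma> by real_asymp
    have "\<beta> \<longlonglongrightarrow> 0 + (\<Sum>k\<in>K. \<bar>c k\<bar> * 0) + 0 * (\<Sum>l\<in>L. norm (f l) * norm (b l))"
      unfolding \<beta>_def[abs_def] by (intro tendsto_add tendsto_sum tendsto_mult tendsto_const 1) real_asymp
    then show ?thesis by simp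
  qed
  have R_close: "\<bar>R n x ((real n)\<^sup>2 * s) - heat_sum \<gamma> Fbar K c s (real x / real n)\<bar> \<le> \<alpha> s n"
    if "1 \<le> x" "x \<le> n" "s \<ge> 0" for n x s
  proof -
    let ?h = "\<lambda>k. exp (- (pi\<^sup>2 * (real k)\<^sup>2 / (2 * \<gamma>) * s)) * sin (pi * real k * (real x / real n))"
    have eq: "R n x ((real n)\<^sup>2 * s) - heat_sum \<gamma> Fbar K c s (real x / real n)
       = (Fbar * real x / (real n + 1) - Fbar * (real x / real n))
         + (\<Sum>k\<in>K. c k * (heat_mode_r \<gamma> n k x ((real n)\<^sup>2 * s) - ?h k))
         + 1 / sqrt (real n) * (\<Sum>l\<in>L. boundary_mode_r (f l) (\<omega> l) (a l) n x ((real n)\<^sup>2 * s))"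
      by (simp add: R_def heat_sum_def right_diff_distrib sum_subtractf)
    have 1: "\<bar>Fbar * real x / (real n + 1) - Fbar * (real x / real n)\<bar> \<le> \<bar>Fbar\<bar> / real n"
    proof -
      have "Fbar * real x / (real n + 1) - Fbar * (real x / real n) = - Fbar * (real x / (real n * (real n + 1)))"
        using that by (simp add: divide_simps) (simp add: algebra_simps)
      then have "\<bar>Fbar * real x / (real n + 1) - Fbar * (real x / real n)\<bar> = \<bar>Fbar\<bar> * (real x / (real n * (real n + 1)))"
        by (simp add: abs_mult)
      also have "\<dots> \<le> \<bar>Fbar\<bar> * (1 / real n)"
        by (intro mult_left_mono) (use that in \<open>auto simp: divide_simps\<close>)
      finally show ?thesis by simp
    qed
    have 2: "\<bar>\<Sum>k\<in>K. c k * (heat_mode_r \<gamma> n k x ((real n)\<^sup>2 * s) - ?h k)\<bar> \<le> (\<Sum>k\<in>K. \<bar>c k\<bar> *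
      (\<bar>exp (- ((real n * lattice_freq n k)\<^sup>2 / (2 * \<gamma>) * s)) - exp (- (pi\<^sup>2 * (real k)\<^sup>2 / (2 * \<gamma>) * s))\<bar>
        + pi * real k / real n))"
      by (rule order.trans[OF sum_abs], intro sum_mono, unfold abs_mult)
        (intro mult_left_mono heat_mode_r_uniform that \<gamma> abs_ge_zero)
    have 3: "\<bar>1 / sqrt (real n) * (\<Sum>l\<in>L. boundary_mode_r (f l) (\<omega> l) (a l) n x ((real n)\<^sup>2 * s))\<bar>
       \<le> 1 / sqrt (real n) * (\<Sum>l\<in>L. norm (f l))"
    proof -
      have "\<bar>\<Sum>l\<in>L. boundary_mode_r (f l) (\<omega> l) (a l) n x ((real n)\<^sup>2 * s)\<bar> \<le> (\<Sum>l\<in>L. norm (f l))"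
      proof (rule order.trans[OF sum_abs], rule sum_mono)
        fix l assume l: "l \<in> L"
        have "norm (f l) * norm (a l) ^ (n + 1 - x) \<le> norm (f l) * 1"
          using ab(1)[OF l] by (intro mult_left_mono power_le_one) auto
        then show "\<bar>boundary_mode_r (f l) (\<omega> l) (a l) n x ((real n)\<^sup>2 * s)\<bar> \<le> norm (f l)"
          using abs_boundary_mode_r_le[OF ab(1)[OF l], of "f l" "\<omega> l" n x "(real n)\<^sup>2 * s"] by linarith
      qed
      then show ?thesis unfolding abs_mult by (intro mult_mono) auto
    qed
    show ?thesis unfolding eq \<alpha>_def using 1 2 3 by linarith
  qed
  have P_small: "\<bar>P n x s\<bar> \<le> \<beta> n" if "s \<ge> 0" for n x s
  proof -
    have 1: "\<bar>\<Sum>k\<in>K. c k * heat_mode_p \<gamma> n k x s\<bar> \<le> (\<Sum>k\<in>K. \<bar>c k\<bar> * (pi * real k / (2 * \<gamma> * (real n + 1))))"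
      by (rule order.trans[OF sum_abs], intro sum_mono, unfold abs_mult)
        (intro mult_left_mono abs_heat_mode_p_le that \<gamma> abs_ge_zero)
    have "\<bar>\<Sum>l\<in>L. boundary_mode_p (f l) (\<omega> l) (a l) (b l) n x s\<bar> \<le> (\<Sum>l\<in>L. norm (f l) * norm (b l))"
      by (rule order.trans[OF sum_abs], intro sum_mono abs_boundary_mode_p_le ab)
    then have 2: "\<bar>1 / sqrt (real n) * (\<Sum>l\<in>L. boundary_mode_p (f l) (\<omega> l) (a l) (b l) n x s)\<bar>
       \<le> 1 / sqrt (real n) * (\<Sum>l\<in>L. norm (f l) * norm (b l))"
      unfolding abs_mult by (intro mult_mono) auto
    have "\<bar>Fbar / (2 * \<gamma> * (real n + 1))\<bar> = \<bar>Fbar\<bar> / (2 * \<gamma> * (real n + 1))"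
      using \<gamma> by (simp add: abs_mult)
    then show ?thesis unfolding P_def \<beta>_def using 1 2 by linarith
  qed
  define C3 where "C3 = (\<Sum>k\<in>K. \<bar>c k\<bar> * ((pi * real k) ^ 3 / (4 * \<gamma>\<^sup>2)))"
  define \<kappa> where "\<kappa> n = (\<Sum>l\<in>L. norm (f l) * norm (a l) ^ (n + 1))" for n
  \<comment> \<open>The three summands belong to the three parts of the residual. Multiplied by
    \<open>n\<close>, only the first stays of order one: the heat modes give \<open>n^-4\<close> and
    the boundary modes decay exponentially.\<close>
  define \<delta> where "\<delta> n = 3 * (\<epsilon>\<^sup>2 / real n + (real n + 1) * (C3 / (real n + 1) ^ 3)\<^sup>2 + (\<kappa> n)\<^sup>2 / real n)" for n
  have g_bound: "(\<Sum>x\<le>n. (g n x s)\<^sup>2) \<le> \<delta> n" if n: "n \<ge> 1" and s: "s \<ge> 0" for n s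
  proof -
    define A where "A x = (if x = n then F n s - Fbar - 1 / sqrt (real n) *
       (\<Sum>l\<in>L. Re (f l * exp (\<i> * of_real (\<omega> l) * of_real s))) else 0)" for x
    define B where "B (x::nat) = (\<Sum>k\<in>K. c k * ((lattice_freq n k)\<^sup>2 / (2 * \<gamma>) * heat_mode_p \<gamma> n k x s))" for x
    define D where "D x = (if x = (0::nat) then 1 / sqrt (real n) * (\<Sum>l\<in>L. boundary_mode_r (f l) (\<omega> l) (a l) n 0 s) else 0)" for x
    have g_eq: "g n x s = A x + B x + D x" for x
      by (auto simp: g_def G_def A_def B_def D_def sum_subtractf sum_negf right_diff_distrib diff_divide_distrib)
    have sq: "(u + v + w)\<^sup>2 \<le> 3 * u\<^sup>2 + 3 * v\<^sup>2 + 3 * w\<^sup>2" for u v w :: real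
      using sum_squares_bound[of u v] sum_squares_bound[of u w] sum_squares_bound[of v w]
      by (simp add: power2_eq_square algebra_simps)
    have "(\<Sum>x\<le>n. (g n x s)\<^sup>2) \<le> (\<Sum>x\<le>n. 3 * (A x)\<^sup>2 + 3 * (B x)\<^sup>2 + 3 * (D x)\<^sup>2)"
      unfolding g_eq by (intro sum_mono sq)
    also have "\<dots> = 3 * ((\<Sum>x\<le>n. (A x)\<^sup>2) + (\<Sum>x\<le>n. (B x)\<^sup>2) + (\<Sum>x\<le>n. (D x)\<^sup>2))"
      by (simp add: sum.distrib sum_distrib_left)
    also have "(\<Sum>x\<le>n. (A x)\<^sup>2) = (A n)\<^sup>2"
      by (rule sum.remove[of "{..n}" n, THEN trans]) (auto simp: A_def intro!: sum.neutral)
    also have "(\<Sum>x\<le>n. (D x)\<^sup>2) = (D 0)\<^sup>2"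
      by (rule sum.remove[of "{..n}" 0, THEN trans]) (auto simp: D_def intro!: sum.neutral)
    finally have *: "(\<Sum>x\<le>n. (g n x s)\<^sup>2) \<le> 3 * ((A n)\<^sup>2 + (\<Sum>x\<le>n. (B x)\<^sup>2) + (D 0)\<^sup>2)" .
    have "\<bar>A n\<bar> \<le> \<epsilon> / sqrt (real n)" using F[OF n s] by (simp add: A_def)
    then have "(A n)\<^sup>2 \<le> (\<epsilon> / sqrt (real n))\<^sup>2" 
      by (metis abs_ge_zero abs_le_square_iff abs_of_nonneg order.trans)
    then have 1: "(A n)\<^sup>2 \<le> \<epsilon>\<^sup>2 / real n" by (simp add: power_divide)
    have "\<bar>B x\<bar> \<le> C3 / (real n + 1) ^ 3" for x
    proof -
      have "\<bar>B x\<bar> \<le> (\<Sum>k\<in>K. \<bar>c k\<bar> * ((pi * real k / (real n + 1))\<^sup>2 / (2 * \<gamma>) * (pi * real k / (2 * \<gamma> * (real n + 1)))))"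
        unfolding B_def
      proof (rule order.trans[OF sum_abs], rule sum_mono)
        fix k
        have "(lattice_freq n k)\<^sup>2 \<le> (pi * real k / (real n + 1))\<^sup>2"
          using lattice_freq_le[of n k] by (simp add: abs_le_square_iff[symmetric])
        then have "\<bar>(lattice_freq n k)\<^sup>2 / (2 * \<gamma>) * heat_mode_p \<gamma> n k x s\<bar> \<le>
           (pi * real k / (real n + 1))\<^sup>2 / (2 * \<gamma>) * (pi * real k / (2 * \<gamma> * (real n + 1)))"
          using \<gamma> s unfolding abs_mult by (intro mult_mono abs_heat_mode_p_le) (auto simp: divide_right_mono)
        then show "\<bar>c k * ((lattice_freq n k)\<^sup>2 / (2 * \<gamma>) * heat_mode_p \<gamma> n k x s)\<bar>
          \<le> \<bar>c k\<bar> * ((pi * real k / (real n + 1))\<^sup>2 / (2 * \<gamma>) * (pi * real k / (2 * \<gamma> * (real n + 1))))"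
          unfolding abs_mult[of "c k"] by (rule mult_left_mono) simp
      qed
      also have "\<dots> = C3 / (real n + 1) ^ 3"
        unfolding C3_def sum_divide_distrib
        by (intro sum.cong refl) (simp add: power2_eq_square power3_eq_cube)
      finally show ?thesis .
    qed
    then have "(B x)\<^sup>2 \<le> (C3 / (real n + 1) ^ 3)\<^sup>2" for x
      by (metis abs_ge_zero abs_le_square_iff abs_of_nonneg order.trans)
    then have "(\<Sum>x\<le>n. (B x)\<^sup>2) \<le> (\<Sum>x\<le>n. (C3 / (real n + 1) ^ 3)\<^sup>2)" by (intro sum_mono)
    then have 2: "(\<Sum>x\<le>n. (B x)\<^sup>2) \<le> (real n + 1) * (C3 / (real n + 1) ^ 3)\<^sup>2" by (simp add: add.commute)
    have "\<bar>\<Sum>l\<in>L. boundary_mode_r (f l) (\<omega> l) (a l) n 0 s\<bar> \<le> \<kappa> n"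
      unfolding \<kappa>_def using abs_boundary_mode_r_le[OF ab(1), where x=0]
      by (intro order.trans[OF sum_abs] sum_mono) force
    then have "(\<Sum>l\<in>L. boundary_mode_r (f l) (\<omega> l) (a l) n 0 s)\<^sup>2 \<le> (\<kappa> n)\<^sup>2"
      by (metis abs_ge_zero abs_le_square_iff abs_of_nonneg order.trans)
    then have 3: "(D 0)\<^sup>2 \<le> (\<kappa> n)\<^sup>2 / real n"
      by (simp add: D_def power_divide power_mult_distrib divide_right_mono)
    show ?thesis unfolding \<delta>_def
      by (rule order.trans[OF *], intro mult_left_mono add_mono 1 2 3) simp
  qed
  \<comment> \<open>A bound on the initial profile is enough here: it enters through the initial
    energy per site, which is divided by \<open>n^2\<close> in the end.\<close>
  define V where "V = \<bar>Fbar\<bar> + (\<Sum>k\<in>K. \<bar>c k\<bar>)"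
  have V: "\<bar>heat_sum \<gamma> Fbar K c 0 u\<bar> \<le> V" if "0 \<le> u" "u \<le> 1" for u
  proof -
    have "\<bar>\<Sum>k\<in>K. c k * (exp (- (pi\<^sup>2 * (real k)\<^sup>2 / (2 * \<gamma>) * 0)) * sin (pi * real k * u))\<bar> \<le> (\<Sum>k\<in>K. \<bar>c k\<bar>)"
      by (rule order.trans[OF sum_abs], rule sum_mono) (simp add: abs_mult mult_left_le)
    moreover have "\<bar>Fbar * u\<bar> \<le> \<bar>Fbar\<bar>" using that by (simp add: abs_mult mult_left_le)
    ultimately show ?thesis unfolding heat_sum_def V_def by linarith
  qed
  define \<Xi> where "\<Xi> n = 2 * H + 2 * (\<alpha> 0 n + V)\<^sup>2 + 4 * (\<beta> n)\<^sup>2" for n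
  \<comment> \<open>The complete bound after division by \<open>n\<close> and with
    \<open>T = n^2 t\<close>, collected so that the limit in \<open>n\<close> is computed
    once.\<close>
  define BB where "BB n = 2 * (2 / t * (4 * \<gamma> * (2 * \<epsilon>' + 2 * (\<alpha> 0 n)\<^sup>2) + 5 / (4 * \<gamma>) * \<Xi> n / (real n)\<^sup>2)
      + 3 * (\<epsilon>\<^sup>2 + real n * (real n + 1) * (C3 / (real n + 1) ^ 3)\<^sup>2 + (\<kappa> n)\<^sup>2)
          * (t / \<gamma> + 1 / (2 * \<gamma>\<^sup>2) / (real n)\<^sup>2)) + 2 * (\<alpha> t n)\<^sup>2 + 4 * (\<beta> n)\<^sup>2" for n
  have "BB \<longlonglongrightarrow> 2 * (2 / t * (4 * \<gamma> * (2 * \<epsilon>' + 2 * 0\<^sup>2) + 5 / (4 * \<gamma>) * (2 * H + 2 * (0 + V)\<^sup>2 + 4 * 0\<^sup>2) * 0)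
      + 3 * (\<epsilon>\<^sup>2 + 0 + 0\<^sup>2) * (t / \<gamma> + 1 / (2 * \<gamma>\<^sup>2) * 0)) + 2 * 0\<^sup>2 + 4 * 0\<^sup>2"
  proof -
    have k: "\<kappa> \<longlonglongrightarrow> 0"
    proof -
      have "(\<lambda>n. norm (a l) ^ (n + 1)) \<longlonglongrightarrow> 0" if "l \<in> L" for l
        using ab(1)[OF that] by (intro LIMSEQ_ignore_initial_segment LIMSEQ_power_zero) simp
      then have "\<kappa> \<longlonglongrightarrow> (\<Sum>l\<in>L. norm (f l) * 0)"
        unfolding \<kappa>_def[abs_def] by (intro tendsto_sum tendsto_mult tendsto_const)
      then show ?thesis by simp
    qed
    have i: "(\<lambda>n. 1 / (real n)\<^sup>2) \<longlonglongrightarrow> 0" by real_asymp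
    have j: "(\<lambda>n. real n * (real n + 1) * (C3 / (real n + 1) ^ 3)\<^sup>2) \<longlonglongrightarrow> 0"
    proof -
      have "(\<lambda>n. real n * (real n + 1) * (1 / (real n + 1) ^ 3)\<^sup>2) \<longlonglongrightarrow> 0" by real_asymp
      from tendsto_mult_left[OF this, of "C3\<^sup>2"] show ?thesis
        by (simp add: power_divide ac_simps)
    qed
    have BB_eq: "BB = (\<lambda>n. 2 * (2 / t * (4 * \<gamma> * (2 * \<epsilon>' + 2 * (\<alpha> 0 n)\<^sup>2) + 5 / (4 * \<gamma>) * \<Xi> n * (1 / (real n)\<^sup>2))
      + 3 * (\<epsilon>\<^sup>2 + real n * (real n + 1) * (C3 / (real n + 1) ^ 3)\<^sup>2 + (\<kappa> n)\<^sup>2)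
          * (t / \<gamma> + 1 / (2 * \<gamma>\<^sup>2) * (1 / (real n)\<^sup>2))) + 2 * (\<alpha> t n)\<^sup>2 + 4 * (\<beta> n)\<^sup>2)"
      by (simp add: BB_def fun_eq_iff)
    show ?thesis
      unfolding BB_eq \<Xi>_def
      by (intro tendsto_add tendsto_mult tendsto_const tendsto_power \<alpha>0 \<beta>0 k i j)
  qed
  moreover have "2 * (2 / t * (4 * \<gamma> * (2 * \<epsilon>' + 2 * 0\<^sup>2) + 5 / (4 * \<gamma>) * (2 * H + 2 * (0 + V)\<^sup>2 + 4 * 0\<^sup>2) * 0)
      + 3 * (\<epsilon>\<^sup>2 + 0 + 0\<^sup>2) * (t / \<gamma> + 1 / (2 * \<gamma>\<^sup>2) * 0)) + 2 * 0\<^sup>2 + 4 * 0\<^sup>2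
     < 32 * \<gamma> / t * \<epsilon>' + 6 * t / \<gamma> * \<epsilon>\<^sup>2 + \<eta>"
    using \<eta> by (simp add: ac_simps)
  ultimately have "\<forall>\<^sub>F n in sequentially. BB n < 32 * \<gamma> / t * \<epsilon>' + 6 * t / \<gamma> * \<epsilon>\<^sup>2 + \<eta>"
    by (rule order_tendstoD)
  with init eventually_ge_at_top[of "1::nat"] show ?thesis
  proof eventually_elim
    case (elim n)
    then have n: "n \<ge> 1" by simp
    let ?T = "(real n)\<^sup>2 * t"
    let ?dr = "\<lambda>x s. r n x s - R n x s" and ?dp = "\<lambda>x s. p n x s - P n x s"
    have T: "?T > 0" using n t by simp
    have two: "(a + b)\<^sup>2 \<le> 2 * a\<^sup>2 + 2 * b\<^sup>2" for a b :: real
      using sum_squares_bound[of a b] by (simp add: power2_sum)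
    have sq_mono: "a\<^sup>2 \<le> b\<^sup>2" if "\<bar>a\<bar> \<le> b" for a b :: real
      using that by (metis abs_ge_zero abs_le_square_iff abs_of_nonneg order.trans)
    have decay: "chain_energy n ?dr ?dp ?T \<le> 2 / ?T * (4 * \<gamma> * (real n)\<^sup>2 * (\<Sum>x=1..n. (?dr x 0)\<^sup>2)
      + 5 / (4 * \<gamma>) * chain_energy n ?dr ?dp 0) + \<delta> n * (?T / \<gamma> + 1 / (2 * \<gamma>\<^sup>2))"
      by (rule chain_energy_decay[OF diff_ode[OF n] \<gamma> T n g_bound[OF n]])
    have r0: "1 / real n * (\<Sum>x=1..n. (?dr x 0)\<^sup>2) \<le> 2 * \<epsilon>' + 2 * (\<alpha> 0 n)\<^sup>2"
    proof -
      have "(\<Sum>x=1..n. (?dr x 0)\<^sup>2) \<le> (\<Sum>x=1..n. 2 * (r n x 0 - heat_sum \<gamma> Fbar K c 0 (real x / real n))\<^sup>2 + 2 * (\<alpha> 0 n)\<^sup>2)"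
      proof (rule sum_mono)
        fix x assume x: "x \<in> {1..n}"
        let ?h = "heat_sum \<gamma> Fbar K c 0 (real x / real n)"
        have "(?dr x 0)\<^sup>2 = ((r n x 0 - ?h) + (?h - R n x 0))\<^sup>2" by simp
        also have "\<dots> \<le> 2 * (r n x 0 - ?h)\<^sup>2 + 2 * (?h - R n x 0)\<^sup>2" by (rule two)
        also have "(?h - R n x 0)\<^sup>2 \<le> (\<alpha> 0 n)\<^sup>2"
          using R_close[of x n 0] x by (intro sq_mono) (simp add: abs_minus_commute)
        finally show "(?dr x 0)\<^sup>2 \<le> 2 * (r n x 0 - ?h)\<^sup>2 + 2 * (\<alpha> 0 n)\<^sup>2" by simp
      qed
      then have "1 / real n * (\<Sum>x=1..n. (?dr x 0)\<^sup>2) \<le> 1 / real n *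
         (\<Sum>x=1..n. 2 * (r n x 0 - heat_sum \<gamma> Fbar K c 0 (real x / real n))\<^sup>2 + 2 * (\<alpha> 0 n)\<^sup>2)"
        by (intro mult_left_mono) auto
      also have "\<dots> = 2 * (1 / real n * (\<Sum>x=1..n. (r n x 0 - heat_sum \<gamma> Fbar K c 0 (real x / real n))\<^sup>2)) + 2 * (\<alpha> 0 n)\<^sup>2"
        using n by (simp add: sum.distrib distrib_left sum_distrib_left[symmetric])
      finally show ?thesis using elim by linarith
    qed
    have P2: "(\<Sum>x\<le>n. (P n x s)\<^sup>2) \<le> 2 * real n * (\<beta> n)\<^sup>2" if "s \<ge> 0" for s
    proof -
      have "(\<Sum>x\<le>n. (P n x s)\<^sup>2) \<le> (\<Sum>x\<le>n. (\<beta> n)\<^sup>2)"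
        by (intro sum_mono sq_mono P_small that)
      also have "\<dots> = (real n + 1) * (\<beta> n)\<^sup>2" by (simp add: add.commute)
      also have "\<dots> \<le> 2 * real n * (\<beta> n)\<^sup>2" using n by (intro mult_right_mono) auto
      finally show ?thesis .
    qed
    have E0: "chain_energy n ?dr ?dp 0 \<le> real n * \<Xi> n"
    proof -
      have "(\<Sum>x=1..n. (R n x 0)\<^sup>2) \<le> (\<Sum>x=1..n. (\<alpha> 0 n + V)\<^sup>2)"
      proof (intro sum_mono sq_mono)
        fix x assume "x \<in> {1..n}"
        then show "\<bar>R n x 0\<bar> \<le> \<alpha> 0 n + V"
          using R_close[of x n 0] V[of "real x / real n"] by (auto simp: abs_le_iff) 
      qed
      then have "chain_energy n (R n) (P n) 0 \<le> real n * (\<alpha> 0 n + V)\<^sup>2 + 2 * real n * (\<beta> n)\<^sup>2"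
        using P2[of 0] unfolding chain_energy_def by simp
      then show ?thesis
        using chain_energy_diff_le[of n "r n" "R n" "p n" "P n" 0] H[OF n]
        unfolding \<Xi>_def by (simp add: algebra_simps)
    qed
    have E: "1 / real n * chain_energy n ?dr ?dp ?T \<le>
       2 / t * (4 * \<gamma> * (2 * \<epsilon>' + 2 * (\<alpha> 0 n)\<^sup>2) + 5 / (4 * \<gamma>) * \<Xi> n / (real n)\<^sup>2)
      + 3 * (\<epsilon>\<^sup>2 + real n * (real n + 1) * (C3 / (real n + 1) ^ 3)\<^sup>2 + (\<kappa> n)\<^sup>2)
          * (t / \<gamma> + 1 / (2 * \<gamma>\<^sup>2) / (real n)\<^sup>2)" (is "_ \<le> ?rhs")
    proof -
      have "1 / real n * chain_energy n ?dr ?dp ?T \<le> 1 / real n * (2 / ?T * (4 * \<gamma> * (real n)\<^sup>2 * (\<Sum>x=1..n. (?dr x 0)\<^sup>2)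
        + 5 / (4 * \<gamma>) * chain_energy n ?dr ?dp 0) + \<delta> n * (?T / \<gamma> + 1 / (2 * \<gamma>\<^sup>2)))"
        by (intro mult_left_mono decay) simp
      \<comment> \<open>The factor \<open>n^2\<close> in front of the stretches cancels against
        \<open>T\<close>, the energy keeps \<open>1 / n^2\<close>, and \<open>\<delta> n\<close>
        gains a factor \<open>n\<close> from \<open>T / n = n t\<close>.\<close>
      also have "\<dots> = 2 / t * (4 * \<gamma> * (1 / real n * (\<Sum>x=1..n. (?dr x 0)\<^sup>2))
        + 5 / (4 * \<gamma>) * (chain_energy n ?dr ?dp 0 / real n) / (real n)\<^sup>2)
        + (real n * \<delta> n) * (t / \<gamma> + 1 / (2 * \<gamma>\<^sup>2) / (real n)\<^sup>2)"
        using n t \<gamma> by (simp add: field_simps power2_eq_square)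
      also have "\<dots> \<le> 2 / t * (4 * \<gamma> * (2 * \<epsilon>' + 2 * (\<alpha> 0 n)\<^sup>2) + 5 / (4 * \<gamma>) * \<Xi> n / (real n)\<^sup>2)
        + (real n * \<delta> n) * (t / \<gamma> + 1 / (2 * \<gamma>\<^sup>2) / (real n)\<^sup>2)"
      proof -
        have "chain_energy n ?dr ?dp 0 / real n \<le> \<Xi> n" using E0 n by (simp add: field_simps)
        then show ?thesis using r0 t \<gamma>
          by (intro add_right_mono, intro add_mono mult_left_mono divide_right_mono) auto
      qed
      also have "real n * \<delta> n = 3 * (\<epsilon>\<^sup>2 + real n * (real n + 1) * (C3 / (real n + 1) ^ 3)\<^sup>2 + (\<kappa> n)\<^sup>2)"
        using n unfolding \<delta>_def by (simp add: distrib_left)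
      finally show ?thesis .
    qed
    have "(\<Sum>x=1..n. (r n x ?T - heat_sum \<gamma> Fbar K c t (real x / real n))\<^sup>2) \<le> (\<Sum>x=1..n. 2 * (?dr x ?T)\<^sup>2 + 2 * (\<alpha> t n)\<^sup>2)"
    proof (rule sum_mono)
      fix x assume x: "x \<in> {1..n}"
      let ?h = "heat_sum \<gamma> Fbar K c t (real x / real n)"
      have "(r n x ?T - ?h)\<^sup>2 = (?dr x ?T + (R n x ?T - ?h))\<^sup>2" by simp
      also have "\<dots> \<le> 2 * (?dr x ?T)\<^sup>2 + 2 * (R n x ?T - ?h)\<^sup>2" by (rule two)
      also have "(R n x ?T - ?h)\<^sup>2 \<le> (\<alpha> t n)\<^sup>2"
        using R_close[of x n t] x t by (intro sq_mono) simp
      finally show "(r n x ?T - ?h)\<^sup>2 \<le> 2 * (?dr x ?T)\<^sup>2 + 2 * (\<alpha> t n)\<^sup>2" by simp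
    qed
    also have "\<dots> = 2 * (\<Sum>x=1..n. (?dr x ?T)\<^sup>2) + 2 * real n * (\<alpha> t n)\<^sup>2"
      by (simp add: sum.distrib sum_distrib_left)
    finally have 1: "(\<Sum>x=1..n. (r n x ?T - heat_sum \<gamma> Fbar K c t (real x / real n))\<^sup>2)
       \<le> 2 * (\<Sum>x=1..n. (?dr x ?T)\<^sup>2) + 2 * real n * (\<alpha> t n)\<^sup>2" .
    have "(\<Sum>x\<le>n. (p n x ?T)\<^sup>2) \<le> (\<Sum>x\<le>n. 2 * (?dp x ?T)\<^sup>2 + 2 * (P n x ?T)\<^sup>2)"
      by (rule sum_mono) (use two in \<open>metis diff_add_cancel\<close>)
    also have "\<dots> = 2 * (\<Sum>x\<le>n. (?dp x ?T)\<^sup>2) + 2 * (\<Sum>x\<le>n. (P n x ?T)\<^sup>2)"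
      by (simp add: sum.distrib sum_distrib_left)
    also have "\<dots> \<le> 2 * (\<Sum>x\<le>n. (?dp x ?T)\<^sup>2) + 4 * real n * (\<beta> n)\<^sup>2"
      using P2[of ?T] T by simp
    finally have "(\<Sum>x=1..n. (r n x ?T - heat_sum \<gamma> Fbar K c t (real x / real n))\<^sup>2) + (\<Sum>x\<le>n. (p n x ?T)\<^sup>2)
       \<le> 2 * chain_energy n ?dr ?dp ?T + 2 * real n * (\<alpha> t n)\<^sup>2 + 4 * real n * (\<beta> n)\<^sup>2"
      using 1 unfolding chain_energy_def by simp
    then have "1 / real n * ((\<Sum>x=1..n. (r n x ?T - heat_sum \<gamma> Fbar K c t (real x / real n))\<^sup>2) + (\<Sum>x\<le>n. (p n x ?T)\<^sup>2))
       \<le> 1 / real n * (2 * chain_energy n ?dr ?dp ?T + 2 * real n * (\<alpha> t n)\<^sup>2 + 4 * real n * (\<beta> n)\<^sup>2)"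
      by (intro mult_left_mono) auto
    also have "\<dots> = 2 * (1 / real n * chain_energy n ?dr ?dp ?T) + 2 * (\<alpha> t n)\<^sup>2 + 4 * (\<beta> n)\<^sup>2"
      using n by (simp add: field_simps)
    also have "\<dots> \<le> BB n" unfolding BB_def by (intro add_right_mono mult_left_mono E) simp
    finally show ?case using elim by (simp add: distrib_left)
  qed
qed

subsection \<open>Density of sine polynomials\<close>

text \<open>Scalars are part of the generators, so closure under sums already makes this the linear
  span of the sines of positive frequency.\<close>

inductive_set sine_span :: "(real \<Rightarrow> real) set" where
  basis: "(\<lambda>u. c * sin (pi * real k * u)) \<in> sine_span" if "k \<noteq> 0"
| add: "(\<lambda>u. f u + g u) \<in> sine_span" if "f \<in> sine_span" "g \<in> sine_span"

lemma sine_span_mult_cos: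
  assumes "f \<in> sine_span"
  shows "(\<lambda>u. a * f u * cos (pi * u)) \<in> sine_span"
  using assms
proof induction
  case (basis k c)
  have eq: "a * (c * sin (pi * real k * u)) * cos (pi * u)
    = a * c / 2 * sin (pi * real (Suc k) * u) + a * c / 2 * sin (pi * real (k - 1) * u)" for u
  proof -
    have "pi * real (Suc k) * u = pi * real k * u + pi * u" "pi * real (k - 1) * u = pi * real k * u - pi * u"
      using basis by (simp_all add: of_nat_diff algebra_simps)
    then show ?thesis by (simp only: sin_add sin_diff) (simp add: field_simps)
  qed
  show ?case
  \<comment> \<open>For \<open>k = 1\<close> the lower frequency \<open>k - 1\<close> is zero: this
    is not a generator, but its sine vanishes.\<close>
  proof (cases "k = 1")
    case True
    then have "(\<lambda>u. a * (c * sin (pi * real k * u)) * cos (pi * u)) = (\<lambda>u. a * c / 2 * sin (pi * real (Suc k) * u))"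
      unfolding eq by simp
    then show ?thesis using sine_span.basis[of "Suc k" "a * c / 2"] by simp
  next
    case False
    show ?thesis unfolding eq
      by (intro sine_span.add sine_span.basis) (use basis False in auto)
  qed
next
  case (add f g)
  then show ?case using sine_span.add[OF add.IH] by (simp add: algebra_simps)
qed

text \<open>Horner's scheme: each \<open>pCons\<close> multiplies by the cosine once more, under
  which the span is closed.\<close>

lemma sine_span_sin_mult_poly_cos: "(\<lambda>u. sin (pi * u) * poly p (cos (pi * u))) \<in> sine_span"
proof (induction p)
  case 0
  show ?case using sine_span.basis[of 1 0] by simp
next
  case (pCons a p)
  have "(\<lambda>u. sin (pi * u) * poly (pCons a p) (cos (pi * u)))
     = (\<lambda>u. a * sin (pi * real 1 * u) + 1 * (sin (pi * u) * poly p (cos (pi * u))) * cos (pi * u))"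
    by (simp add: fun_eq_iff algebra_simps)
  then show ?case
    using sine_span.add[OF sine_span.basis[of 1 a] sine_span_mult_cos[OF pCons.IH, of 1]] by simp
qed

text \<open>Requiring \<open>c\<close> to vanish off \<open>K\<close> allows two representations to
  be added over the union of their index sets, and later lets \<open>c\<close> be read as a full
  coefficient sequence.\<close>

lemma sine_span_sum:
  assumes "f \<in> sine_span"
  shows "\<exists>K c. finite K \<and> 0 \<notin> K \<and> (\<forall>k. k \<notin> K \<longrightarrow> c k = 0) \<and> (\<forall>u. f u = (\<Sum>k\<in>K. c k * sin (pi * real k * u)))"
  using assms
proof induction
  case (basis k c)
  then show ?case
    by (intro exI[of _ "{k}"] exI[of _ "\<lambda>j. if j = k then c else 0"]) auto
next
  case (add f g)
  then obtain K c K' c' where K: "finite K" "0 \<notin> K" "\<forall>k. k \<notin> K \<longrightarrow> c k = 0"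
      "\<forall>u. f u = (\<Sum>k\<in>K. c k * sin (pi * real k * u))"
    and K': "finite K'" "0 \<notin> K'" "\<forall>k. k \<notin> K' \<longrightarrow> c' k = 0"
      "\<forall>u. g u = (\<Sum>k\<in>K'. c' k * sin (pi * real k * u))" by blast
  have "f u = (\<Sum>k\<in>K \<union> K'. c k * sin (pi * real k * u))" "g u = (\<Sum>k\<in>K \<union> K'. c' k * sin (pi * real k * u))" for u
    using K K' by (auto intro!: sum.mono_neutral_left)
  then show ?case
    using K K' by (intro exI[of _ "K \<union> K'"] exI[of _ "\<lambda>k. c k + c' k"])
      (auto simp: sum.distrib distrib_right)
qed

lemma sine_span_continuous:
  assumes "f \<in> sine_span"
  shows "continuous_on A f"
  using assms by induction (auto intro!: continuous_intros)

lemma cos_pi_inj: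
  assumes "x \<in> {0..1}" "y \<in> {0..1}" "cos (pi * x) = cos (pi * y)"
  shows "x = y"
  using cos_inj_pi[of "pi * x" "pi * y"] assms by (auto simp: mult_le_cancel_left1)

text \<open>The factor \<open>1 - (1 - sin) ^ m\<close> makes the target divisible by the sine; what is left over is
  approximated by polynomials in the cosine, which separates the points of the interval.\<close>

lemma sine_span_approx:
  fixes f :: "real \<Rightarrow> real"
  assumes f: "continuous_on {0..1} f" and e: "e > 0"
  obtains P where "P \<in> sine_span" "\<And>u. u \<in> {0..1} \<Longrightarrow> \<bar>P u - f u * (1 - (1 - sin (pi * u)) ^ m)\<bar> \<le> e"
proof -
  \<comment> \<open>By the finite geometric sum, \<open>sin (pi * u) * h u\<close> is the target
    function. It therefore suffices to approximate \<open>h\<close> by polynomials in the cosine and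
    to multiply by the sine.\<close>
  define h where "h u = f u * (\<Sum>i<m. (1 - sin (pi * u)) ^ i)" for u
  have h: "continuous_on {0..1} h"
    unfolding h_def[abs_def] by (intro continuous_intros f)
  interpret R: function_ring_on "range (\<lambda>p u. poly p (cos (pi * u)))" "{0..1::real}"
  proof
    fix F G assume "F \<in> range (\<lambda>p u. poly p (cos (pi * u)))" "G \<in> range (\<lambda>p u. poly p (cos (pi * u)))"
    then obtain p q where pq: "F = (\<lambda>u::real. poly p (cos (pi * u)))" "G = (\<lambda>u. poly q (cos (pi * u)))" by auto
    show "(\<lambda>x. F x + G x) \<in> range (\<lambda>p u. poly p (cos (pi * u)))"
      unfolding pq by (rule range_eqI[of _ _ "p + q"]) simp
    show "(\<lambda>x. F x * G x) \<in> range (\<lambda>p u. poly p (cos (pi * u)))"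
      unfolding pq by (rule range_eqI[of _ _ "p * q"]) simp
  next
    fix F assume "F \<in> range (\<lambda>p u. poly p (cos (pi * u)))"
    then show "continuous_on {0..1::real} F" by (auto intro!: continuous_intros)
  next
    fix c show "(\<lambda>_. c) \<in> range (\<lambda>p u. poly p (cos (pi * u)))"
      by (rule range_eqI[of _ _ "[:c:]"]) simp
  next
    fix x y :: real assume "x \<in> {0..1}" "y \<in> {0..1}" "x \<noteq> y"
    then have "poly [:0, 1:] (cos (pi * x)) \<noteq> poly [:0, 1:] (cos (pi * y))"
      using cos_pi_inj[of x y] by auto
    then show "\<exists>f\<in>range (\<lambda>p u. poly p (cos (pi * u))). f x \<noteq> f y"
      by (intro bexI[where x="\<lambda>u. poly [:0, 1:] (cos (pi * u))"] range_eqI[OF refl]) 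
  qed auto
  obtain p where p: "\<And>u. u \<in> {0..1} \<Longrightarrow> \<bar>h u - poly p (cos (pi * u))\<bar> < e"
  proof -
    obtain g where g: "g \<in> range (\<lambda>p u. poly p (cos (pi * u)))" "\<forall>u\<in>{0..1}. \<bar>h u - g u\<bar> < e"
      using R.Stone_Weierstrass_basic[OF h e] by blast
    from g(1) obtain p where "g = (\<lambda>u. poly p (cos (pi * u)))" by (rule rangeE)
    with g(2) show thesis using that by blast
  qed
  show thesis
  proof (rule that)
    show "(\<lambda>u. sin (pi * u) * poly p (cos (pi * u))) \<in> sine_span"
      by (rule sine_span_sin_mult_poly_cos)
    fix u :: real assume u: "u \<in> {0..1}"
    have "f u * (1 - (1 - sin (pi * u)) ^ m) = sin (pi * u) * h u"
      unfolding h_def one_diff_power_eq by simp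
    then have "\<bar>sin (pi * u) * poly p (cos (pi * u)) - f u * (1 - (1 - sin (pi * u)) ^ m)\<bar>
      = \<bar>sin (pi * u)\<bar> * \<bar>h u - poly p (cos (pi * u))\<bar>"
      by (simp add: right_diff_distrib[symmetric] abs_mult abs_minus_commute)
    also have "\<dots> \<le> 1 * e"
      by (rule mult_mono[OF abs_sin_le_one less_imp_le[OF p[OF u]]]) auto
    finally show "\<bar>sin (pi * u) * poly p (cos (pi * u)) - f u * (1 - (1 - sin (pi * u)) ^ m)\<bar> \<le> e" by simp
  qed
qed

lemma one_minus_sin_pi:
  assumes "u \<in> {0<..<1}"
  shows "0 \<le> 1 - sin (pi * u)" "1 - sin (pi * u) < 1"
  using sin_gt_zero[of "pi * u"] assms by auto

lemma one_minus_sin_pi_power_tendsto: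
  assumes "u \<in> {0<..<1}"
  shows "(\<lambda>m. (1 - sin (pi * u)) ^ m) \<longlonglongrightarrow> 0"
  using one_minus_sin_pi[OF assms] by (intro LIMSEQ_power_zero) simp

lemma one_minus_sin_pi_power_bounds:
  assumes "u \<in> {0..1}"
  shows "0 \<le> (1 - sin (pi * u)) ^ m" "(1 - sin (pi * u)) ^ m \<le> 1"
proof -
  have "0 \<le> sin (pi * u)" by (rule sin_ge_zero) (use assms in \<open>auto simp: mult_left_le\<close>)
  then show "0 \<le> (1 - sin (pi * u)) ^ m" "(1 - sin (pi * u)) ^ m \<le> 1"
    by (auto intro!: zero_le_power power_le_one)
qed

lemma AE_open_unit: "AE u in lborel. u \<in> {0..1} \<longrightarrow> u \<in> {0<..<1::real}"
proof -
  have "AE u in lborel. u \<noteq> (0::real)" "AE u in lborel. u \<noteq> (1::real)"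
    by (rule AE_lborel_singleton)+
  then show ?thesis by eventually_elim auto
qed

lemma set_integrable_continuous01:
  fixes f :: "real \<Rightarrow> real"
  assumes "continuous_on {0..1} f"
  shows "set_integrable lborel {0..1} f"
  by (rule borel_integrable_atLeastAtMost'[OF assms])

lemma continuous01_bounded:
  fixes f :: "real \<Rightarrow> real"
  assumes "continuous_on {0..1} f"
  obtains B where "B > 0" "\<And>u. u \<in> {0..1} \<Longrightarrow> \<bar>f u\<bar> \<le> B"
proof -
  have "bounded (f ` {0..1})"
    by (intro compact_imp_bounded compact_continuous_image assms) simp
  then show thesis using that unfolding bounded_pos by auto
qed

text \<open>A function that is nonzero at an endpoint is not a uniform limit of sine polynomials.
  The discarded factor \<open>(1 - sin (pi * u)) ^ m\<close> is bounded and tends to zero away from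
  the endpoints, so its contribution to the squared norm vanishes by dominated convergence.\<close>

lemma sine_span_L2_dense:
  fixes f :: "real \<Rightarrow> real"
  assumes f: "continuous_on {0..1} f" and e: "e > 0"
  obtains P where "P \<in> sine_span" "(LBINT u:{0..1}. (f u - P u)\<^sup>2) \<le> e"
proof -
  obtain B where B: "B > 0" "\<And>u. u \<in> {0..1} \<Longrightarrow> \<bar>f u\<bar> \<le> B"
    using continuous01_bounded[OF f] by blast
  have "(\<lambda>m. LBINT u:{0..1}. (f u * (1 - sin (pi * u)) ^ m)\<^sup>2) \<longlonglongrightarrow> (LBINT u:{0..1::real}. 0)"
    unfolding set_lebesgue_integral_def
  proof (rule integral_dominated_convergence[where w="\<lambda>u. indicator {0..1} u * B\<^sup>2"])
    show "AE u in lborel. (\<lambda>m. indicator {0..1} u *\<^sub>R (f u * (1 - sin (pi * u)) ^ m)\<^sup>2) \<longlonglongrightarrow> indicator {0..1} u *\<^sub>R 0"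
      using AE_open_unit
    proof eventually_elim
      case (elim u)
      show ?case
      proof (cases "u \<in> {0..1}")
        case True
        with elim have "(\<lambda>m. indicator {0..1} u *\<^sub>R (f u * (1 - sin (pi * u)) ^ m)\<^sup>2) \<longlonglongrightarrow> indicator {0..1} u *\<^sub>R (f u * 0)\<^sup>2"
          by (intro tendsto_intros one_minus_sin_pi_power_tendsto) auto
        then show ?thesis by simp
      qed simp
    qed
    show "AE u in lborel. norm (indicator {0..1} u *\<^sub>R (f u * (1 - sin (pi * u)) ^ m)\<^sup>2) \<le> indicator {0..1} u * B\<^sup>2" for m
    proof (rule AE_I2)
      fix u :: real
      have "(f u * (1 - sin (pi * u)) ^ m)\<^sup>2 \<le> B\<^sup>2" if "u \<in> {0..1}"
      proof -
        have "\<bar>f u\<bar> * \<bar>(1 - sin (pi * u)) ^ m\<bar> \<le> B * 1"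
          by (rule mult_mono) (use B that one_minus_sin_pi_power_bounds[OF that, of m] in auto)
        then have "\<bar>f u * (1 - sin (pi * u)) ^ m\<bar> \<le> \<bar>B\<bar>" using B by (simp add: abs_mult)
        then show ?thesis by (simp only: abs_le_square_iff)
      qed
      then show "norm (indicator {0..1} u *\<^sub>R (f u * (1 - sin (pi * u)) ^ m)\<^sup>2) \<le> indicator {0..1} u * B\<^sup>2"
        by (auto split: split_indicator)
    qed
    show "(\<lambda>u. indicator {0..1} u *\<^sub>R (f u * (1 - sin (pi * u)) ^ m)\<^sup>2) \<in> borel_measurable lborel" for m
    proof -
      have "set_integrable lborel {0..1} (\<lambda>u. (f u * (1 - sin (pi * u)) ^ m)\<^sup>2)"
        by (intro set_integrable_continuous01 continuous_intros f)
      then show ?thesis unfolding set_integrable_def by (rule borel_measurable_integrable)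
    qed
    show "integrable lborel (\<lambda>u::real. indicator {0..1} u * B\<^sup>2)" by simp
  qed simp
  then have "\<forall>\<^sub>F m in sequentially. (LBINT u:{0..1}. (f u * (1 - sin (pi * u)) ^ m)\<^sup>2) < e / 4"
    using e by (intro order_tendstoD) auto
  then obtain m where m: "(LBINT u:{0..1}. (f u * (1 - sin (pi * u)) ^ m)\<^sup>2) < e / 4"
    by (auto simp: eventually_sequentially)
  obtain P where P: "P \<in> sine_span" "\<And>u. u \<in> {0..1} \<Longrightarrow> \<bar>P u - f u * (1 - (1 - sin (pi * u)) ^ m)\<bar> \<le> sqrt (e / 4)"
    using sine_span_approx[OF f, of "sqrt (e / 4)"] e by auto
  have "(LBINT u:{0..1}. (f u - P u)\<^sup>2) \<le> (LBINT u:{0..1}. 2 * (f u * (1 - sin (pi * u)) ^ m)\<^sup>2 + 2 * (e / 4))"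
  proof (rule set_integral_mono)
    show "set_integrable lborel {0..1} (\<lambda>u. (f u - P u)\<^sup>2)"
      by (intro set_integrable_continuous01 continuous_intros f sine_span_continuous P)
    show "set_integrable lborel {0..1} (\<lambda>u. 2 * (f u * (1 - sin (pi * u)) ^ m)\<^sup>2 + 2 * (e / 4))"
      by (intro set_integrable_continuous01 continuous_intros f)
    fix u :: real assume u: "u \<in> {0..1}"
    define a where "a = f u * (1 - sin (pi * u)) ^ m"
    define b where "b = P u - f u * (1 - (1 - sin (pi * u)) ^ m)"
    have "b\<^sup>2 \<le> (sqrt (e / 4))\<^sup>2"
      using P(2)[OF u] unfolding b_def by (metis abs_ge_zero abs_le_square_iff abs_of_nonneg order.trans)
    then have b: "b\<^sup>2 \<le> e / 4" using e by simp
    have "(a - b)\<^sup>2 \<le> 2 * a\<^sup>2 + 2 * b\<^sup>2"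
      using sum_squares_bound[of a "-b"] by (simp add: power2_diff)
    moreover have "f u - P u = a - b" by (simp add: a_def b_def algebra_simps)
    ultimately show "(f u - P u)\<^sup>2 \<le> 2 * (f u * (1 - sin (pi * u)) ^ m)\<^sup>2 + 2 * (e / 4)"
      using b unfolding a_def by simp
  qed
  also have "\<dots> = 2 * (LBINT u:{0..1}. (f u * (1 - sin (pi * u)) ^ m)\<^sup>2) + e / 2"
  proof -
    have "(LBINT u:{0..1::real}. 2 * (e / 4)) = e / 2"
      by (simp add: set_lebesgue_integral_def)
    then show ?thesis
      by (subst set_integral_add) (auto intro!: set_integrable_continuous01 continuous_intros f)
  qed
  also have "\<dots> \<le> e" using m by simp
  finally show thesis using that P(1) by blast
qed

text \<open>As \<open>h\<close> is only integrable, Hilbert space arguments do not apply. The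
  vanishing is carried from sines to continuous test functions by bounded pointwise approximation,
  from these to indicators of half-lines, and from half-lines to all Borel sets.\<close>

lemma sine_coefficients_zero:
  fixes h :: "real \<Rightarrow> real"
  assumes h: "set_integrable lborel {0..1} h"
    and z: "\<And>k. k \<noteq> 0 \<Longrightarrow> (LBINT u:{0..1}. h u * sin (pi * real k * u)) = 0"
  shows "AE u in lborel. u \<in> {0..1} \<longrightarrow> h u = 0"
proof -
  define H where "H u = indicator {0..1} u * h u" for u
  have H: "integrable lborel H" using h by (simp add: set_integrable_def H_def[abs_def])
  have [measurable]: "H \<in> borel_measurable borel" using borel_measurable_integrable[OF H] by simp
  have HF: "integrable lborel (\<lambda>u. H u * F u)"
    if "F \<in> borel_measurable borel" "\<And>u. u \<in> {0..1} \<Longrightarrow> \<bar>F u\<bar> \<le> B" for F :: "real \<Rightarrow> real" and B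
  proof (rule Bochner_Integration.integrable_bound)
    show "integrable lborel (\<lambda>u. B * H u)" using H by simp
    show "(\<lambda>u. H u * F u) \<in> borel_measurable lborel" using that(1) by simp
    show "AE u in lborel. norm (H u * F u) \<le> norm (B * H u)"
    proof (rule AE_I2)
      fix u
      have "\<bar>h u\<bar> * \<bar>F u\<bar> \<le> \<bar>h u\<bar> * \<bar>B\<bar>" if "u \<in> {0..1}"
        using \<open>u \<in> {0..1} \<Longrightarrow> \<bar>F u\<bar> \<le> B\<close>[OF that] by (intro mult_left_mono) auto
      then show "norm (H u * F u) \<le> norm (B * H u)"
        by (auto simp: H_def abs_mult mult.commute split: split_indicator)
    qed
  qed
  have span: "(\<integral>u. H u * P u \<partial>lborel) = 0" if "P \<in> sine_span" for P
    using that
  proof induction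
    case (basis k c)
    have "(\<integral>u. H u * (c * sin (pi * real k * u)) \<partial>lborel) = c * (LBINT u:{0..1}. h u * sin (pi * real k * u))"
      unfolding set_lebesgue_integral_def H_def by (simp add: ac_simps flip: integral_mult_right_zero)
    then show ?case using z basis by simp
  next
    case (add f g)
    have i: "integrable lborel (\<lambda>u. H u * f u)" if f: "f \<in> sine_span" for f
    proof -
      obtain B where "\<And>u. u \<in> {0..1} \<Longrightarrow> \<bar>f u\<bar> \<le> B"
        using continuous01_bounded[OF sine_span_continuous[OF f]] by blast
      then show ?thesis
        by (intro HF borel_measurable_continuous_onI sine_span_continuous f)
    qed
    show ?case using add i by (simp add: distrib_left)
  qed
  have cont: "(\<integral>u. H u * f u \<partial>lborel) = 0" if f: "continuous_on UNIV f" for f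
  proof -
    have f01: "continuous_on {0..1} f" using f by (rule continuous_on_subset) simp
    obtain B where B: "B > 0" "\<And>u. u \<in> {0..1} \<Longrightarrow> \<bar>f u\<bar> \<le> B"
      using continuous01_bounded[OF f01] by blast
    \<comment> \<open>Precision and exponent are tied to the same index \<open>m\<close>, so the
      approximants converge pointwise on the open interval and stay bounded by
      \<open>B + 1\<close>.\<close>
    have "\<exists>P\<in>sine_span. \<forall>u\<in>{0..1}. \<bar>P u - f u * (1 - (1 - sin (pi * u)) ^ m)\<bar> \<le> 1 / Suc m" for m
    proof -
      obtain P where "P \<in> sine_span" "\<And>u. u \<in> {0..1} \<Longrightarrow> \<bar>P u - f u * (1 - (1 - sin (pi * u)) ^ m)\<bar> \<le> 1 / Suc m"
        by (rule sine_span_approx[OF f01, of "1 / Suc m" m]) auto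
      then show ?thesis by blast
    qed
    then obtain P where P: "\<And>m. P m \<in> sine_span"
      "\<And>m u. u \<in> {0..1} \<Longrightarrow> \<bar>P m u - f u * (1 - (1 - sin (pi * u)) ^ m)\<bar> \<le> 1 / Suc m" by metis
    have "(\<lambda>m. \<integral>u. H u * P m u \<partial>lborel) \<longlonglongrightarrow> (\<integral>u. H u * f u \<partial>lborel)"
    proof (rule integral_dominated_convergence[where w="\<lambda>u. (B + 1) * \<bar>H u\<bar>"])
      show "(\<lambda>u. H u * f u) \<in> borel_measurable lborel"
        using borel_measurable_continuous_onI[OF f] by simp
      show "(\<lambda>u. H u * P m u) \<in> borel_measurable lborel" for m
        using borel_measurable_continuous_onI[OF sine_span_continuous[OF P(1)], of m] by simp
      show "integrable lborel (\<lambda>u. (B + 1) * \<bar>H u\<bar>)" using H by simp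
      show "AE u in lborel. (\<lambda>m. H u * P m u) \<longlonglongrightarrow> H u * f u"
        using AE_open_unit
      proof eventually_elim
        case (elim u)
        show ?case
        proof (cases "u \<in> {0..1}")
          case True
          have "(\<lambda>m. P m u - f u * (1 - (1 - sin (pi * u)) ^ m)) \<longlonglongrightarrow> 0"
          proof (rule Lim_null_comparison[OF always_eventually LIMSEQ_inverse_real_of_nat], rule allI)
            fix m
            show "norm (P m u - f u * (1 - (1 - sin (pi * u)) ^ m)) \<le> inverse (real (Suc m))"
              using P(2)[OF True, of m] by (simp only: real_norm_def inverse_eq_divide)
          qed
          moreover have "(\<lambda>m. f u * (1 - (1 - sin (pi * u)) ^ m)) \<longlonglongrightarrow> f u * (1 - 0)"
            using elim True by (intro tendsto_intros one_minus_sin_pi_power_tendsto) auto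
          ultimately have "(\<lambda>m. P m u - f u * (1 - (1 - sin (pi * u)) ^ m) + f u * (1 - (1 - sin (pi * u)) ^ m)) \<longlonglongrightarrow> 0 + f u * (1 - 0)"
            by (rule tendsto_add)
          then show ?thesis by (intro tendsto_intros) simp
        qed (simp add: H_def)
      qed
      show "AE u in lborel. norm (H u * P m u) \<le> (B + 1) * \<bar>H u\<bar>" for m
      proof (rule AE_I2)
        fix u
        have "\<bar>P m u\<bar> \<le> B + 1" if u: "u \<in> {0..1}"
        proof -
          have "\<bar>f u\<bar> * \<bar>1 - (1 - sin (pi * u)) ^ m\<bar> \<le> B * 1"
            by (rule mult_mono) (use B u one_minus_sin_pi_power_bounds[OF u, of m] in auto)
          then have "\<bar>f u * (1 - (1 - sin (pi * u)) ^ m)\<bar> \<le> B" by (simp add: abs_mult)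
          moreover have "1 / real (Suc m) \<le> 1" by simp
          ultimately show ?thesis using P(2)[OF u, of m] by linarith
        qed
        then show "norm (H u * P m u) \<le> (B + 1) * \<bar>H u\<bar>"
          by (cases "u \<in> {0..1}") (auto simp: H_def abs_mult mult.commute intro!: mult_left_mono)
      qed
    qed
    then show ?thesis using span[OF P(1)] by (simp add: LIMSEQ_const_iff)
  qed
  have ray: "(\<integral>u. H u * indicator {a<..} u \<partial>lborel) = 0" for a
  proof -
    \<comment> \<open>Continuous ramps of slope \<open>m\<close> starting at \<open>a\<close>,
      increasing to the indicator of the ray.\<close>
    define f where "f m u = min 1 (max 0 (real m * (u - a)))" for m :: nat and u :: real
    have "(\<lambda>m. \<integral>u. H u * f m u \<partial>lborel) \<longlonglongrightarrow> (\<integral>u. H u * indicator {a<..} u \<partial>lborel)"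
    proof (rule integral_dominated_convergence[where w="\<lambda>u. \<bar>H u\<bar>"])
      show "(\<lambda>u. H u * indicator {a<..} u) \<in> borel_measurable lborel" by simp
      show "(\<lambda>u. H u * f m u) \<in> borel_measurable lborel" for m by (simp add: f_def)
      show "integrable lborel (\<lambda>u. \<bar>H u\<bar>)" using H by simp
      show "AE u in lborel. norm (H u * f m u) \<le> \<bar>H u\<bar>" for m
        by (rule AE_I2) (auto simp: f_def abs_mult intro!: mult_left_le)
      show "AE u in lborel. (\<lambda>m. H u * f m u) \<longlonglongrightarrow> H u * indicator {a<..} u"
      proof (rule AE_I2, intro tendsto_mult tendsto_const)
        fix u
        show "(\<lambda>m. f m u) \<longlonglongrightarrow> indicator {a<..} u"
        proof (cases "u > a")
          case True
          obtain m0 :: nat where m0: "1 / (u - a) < real m0" using reals_Archimedean2 by blast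
          have "f m u = 1" if "m \<ge> m0" for m
          proof -
            have "1 / (u - a) \<le> real m" using m0 that by linarith
            then have "1 \<le> real m * (u - a)" using True by (simp add: field_simps)
            then show ?thesis by (simp add: f_def)
          qed
          then have "\<forall>\<^sub>F m in sequentially. f m u = 1" by (auto simp: eventually_sequentially)
          then show ?thesis using True by (simp add: tendsto_eventually)
        next
          case False
          then have "f m u = 0" for m by (simp add: f_def mult_nonneg_nonpos)
          then show ?thesis using False by simp
        qed
      qed
    qed
    moreover have "(\<integral>u. H u * f m u \<partial>lborel) = 0" for m
      by (rule cont) (auto simp: f_def[abs_def] intro!: continuous_intros)
    ultimately show ?thesis by (simp add: LIMSEQ_const_iff)
  qed
  have Hp: "integrable lborel (\<lambda>u. max 0 (H u))" "integrable lborel (\<lambda>u. max 0 (- H u))"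
    using H by auto
  have em: "emeasure (density lborel (\<lambda>u. ennreal (max 0 (G u)))) {a<..} = ennreal (\<integral>u. max 0 (G u) * indicator {a<..} u \<partial>lborel)"
    if G: "integrable lborel (\<lambda>u. max 0 (G u))" "G \<in> borel_measurable borel" for G :: "real \<Rightarrow> real" and a
  proof -
    have "emeasure (density lborel (\<lambda>u. ennreal (max 0 (G u)))) {a<..} = (\<integral>\<^sup>+u. ennreal (max 0 (G u) * indicator {a<..} u) \<partial>lborel)"
      using G(2) by (subst emeasure_density) (auto intro!: nn_integral_cong split: split_indicator)
    also have "\<dots> = ennreal (\<integral>u. max 0 (G u) * indicator {a<..} u \<partial>lborel)"
      using G by (intro nn_integral_eq_integral integrable_real_mult_indicator) auto
    finally show ?thesis .
  qed
  have mH: "(\<lambda>u. - H u) \<in> borel_measurable borel" by simp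
  note em_H = em[where G = H, OF Hp(1) \<open>H \<in> borel_measurable borel\<close>] em[where G = "\<lambda>u. - H u", OF Hp(2) mH]
  \<comment> \<open>The positive and negative parts of \<open>H\<close> define finite measures that
    agree on all rays \<open>{a<..}\<close>, hence everywhere. Uniqueness of densities then forces
    \<open>H = 0\<close> almost everywhere.\<close>
  have "density lborel (\<lambda>u. ennreal (max 0 (H u))) = density lborel (\<lambda>u. ennreal (max 0 (- H u)))"
  proof (rule measure_eqI_lessThan)
    fix a
    have "(\<integral>u. max 0 (H u) * indicator {a<..} u \<partial>lborel) - (\<integral>u. max 0 (- H u) * indicator {a<..} u \<partial>lborel)
      = (\<integral>u. max 0 (H u) * indicator {a<..} u - max 0 (- H u) * indicator {a<..} u \<partial>lborel)"
      using Hp by (intro Bochner_Integration.integral_diff[symmetric] integrable_real_mult_indicator) auto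
    also have "\<dots> = (\<integral>u. H u * indicator {a<..} u \<partial>lborel)"
      by (intro Bochner_Integration.integral_cong) (auto split: split_indicator)
    finally have "(\<integral>u. max 0 (H u) * indicator {a<..} u \<partial>lborel) = (\<integral>u. max 0 (- H u) * indicator {a<..} u \<partial>lborel)"
      using ray[of a] by simp
    then show "emeasure (density lborel (\<lambda>u. ennreal (max 0 (H u)))) {a<..} = emeasure (density lborel (\<lambda>u. ennreal (max 0 (- H u)))) {a<..}"
      by (simp only: em_H)
    show "emeasure (density lborel (\<lambda>u. ennreal (max 0 (H u)))) {a<..} < \<infinity>"
      by (simp only: em_H) simp
  qed auto
  then have "AE u in lborel. ennreal (max 0 (H u)) = ennreal (max 0 (- H u))"
    by (intro sigma_finite_measure.density_unique[OF sigma_finite_lborel]) auto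
  then show ?thesis
    by eventually_elim (auto simp: H_def max_def split: if_splits)
qed

subsection \<open>Integrals and Riemann sums on the unit interval\<close>

lemma LBINT_FTC:
  fixes f F :: "real \<Rightarrow> real"
  assumes "a \<le> b" "\<And>x. (F has_real_derivative f x) (at x)" "continuous_on UNIV f"
  shows "(LBINT x:{a..b}. f x) = F b - F a"
proof -
  have "(\<integral>x. f x * indicator {a..b} x \<partial>lborel) = F b - F a"
    by (rule integral_FTC_Icc_real)
      (use assms in \<open>auto simp: continuous_on_eq_continuous_at\<close>)
  then show ?thesis by (simp add: set_lebesgue_integral_def mult.commute)
qed

lemma LBINT_cos:
  "(LBINT u:{0..1}. cos (pi * real k * u)) = (if k = 0 then 1 else 0)"
proof (cases "k = 0")
  case False
  have "(LBINT u:{0..1}. cos (pi * real k * u)) = sin (pi * real k * 1) / (pi * real k) - sin (pi * real k * 0) / (pi * real k)"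
    by (rule LBINT_FTC) (use False in \<open>auto intro!: derivative_eq_intros continuous_intros\<close>)
  then show ?thesis using False sin_npi2[of k] by simp
qed (simp add: set_lebesgue_integral_def)

lemma LBINT_sin_sin:
  assumes "j \<noteq> 0" "k \<noteq> 0"
  shows "(LBINT u:{0..1}. sin (pi * real j * u) * sin (pi * real k * u)) = (if j = k then 1 / 2 else 0)"
proof -
  let ?d = "if j \<le> k then k - j else j - k"
  have eq: "sin (pi * real j * u) * sin (pi * real k * u)
     = 1 / 2 * cos (pi * real ?d * u) - 1 / 2 * cos (pi * real (j + k) * u)" for u
  proof -
    have "cos (pi * real ?d * u) = cos (pi * real j * u - pi * real k * u)"
    proof (cases "j \<le> k")
      case True
      then have "pi * real ?d * u = - (pi * real j * u - pi * real k * u)" by (simp add: of_nat_diff algebra_simps)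
      then show ?thesis by (simp only: cos_minus)
    next
      case False
      then show ?thesis by (simp add: of_nat_diff algebra_simps)
    qed
    moreover have "cos (pi * real (j + k) * u) = cos (pi * real j * u + pi * real k * u)"
      by (simp add: algebra_simps)
    ultimately show ?thesis by (simp add: cos_add cos_diff field_simps)
  qed
  have "(LBINT u:{0..1}. sin (pi * real j * u) * sin (pi * real k * u))
     = 1 / 2 * (LBINT u:{0..1}. cos (pi * real ?d * u)) - 1 / 2 * (LBINT u:{0..1}. cos (pi * real (j + k) * u))"
    unfolding eq
    by (subst set_integral_diff) (auto intro!: set_integrable_continuous01 continuous_intros)
  also have "\<dots> = (if j = k then 1 / 2 else 0)"
    using assms unfolding LBINT_cos by auto
  finally show ?thesis .
qed

lemma LBINT_ident_mult_sin:
  assumes "k \<noteq> 0"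
  shows "(LBINT u:{0..1}. u * sin (pi * real k * u)) = - cos (pi * real k) / (pi * real k)"
proof -
  let ?F = "\<lambda>u. - (u * cos (pi * real k * u)) / (pi * real k) + sin (pi * real k * u) / (pi * real k)\<^sup>2"
  have "(LBINT u:{0..1}. u * sin (pi * real k * u)) = ?F 1 - ?F 0"
    by (rule LBINT_FTC)
      (use assms in \<open>auto intro!: derivative_eq_intros continuous_intros simp: field_simps power2_eq_square\<close>)
  then show ?thesis using sin_npi2[of k] by simp
qed

lemma riemann_sum_tendsto:
  fixes f :: "real \<Rightarrow> real"
  assumes f: "continuous_on {0..1} f"
  shows "(\<lambda>n. 1 / real n * (\<Sum>x=1..n. f (real x / real n))) \<longlonglongrightarrow> (LBINT u:{0..1}. f u)"
proof -
  define a where "a n x = real x / real n" for n x :: nat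
  have split: "(LBINT u:{0..1}. f u) = (\<Sum>x=1..n. LBINT u:{a n (x - 1)..a n x}. f u)" if n: "n \<ge> 1" for n
  proof -
    have "(LBINT u:{0..a n m}. f u) = (\<Sum>x=1..m. LBINT u:{a n (x - 1)..a n x}. f u)" if "m \<le> n" for m
      using that
    proof (induction m)
      case 0
      have "(LBINT u:{0..0::real}. f u) = 0"
        using set_borel_integral_eq_integral(2)[OF set_integrable_subset[OF set_integrable_continuous01[OF f], of "{0..0}"]] by simp
      then show ?case by (simp add: a_def)
    next
      case (Suc m)
      have le: "0 \<le> a n m" "a n m \<le> a n (Suc m)" "a n (Suc m) \<le> 1"
        using n Suc.prems by (auto simp: a_def divide_simps)
      have i: "set_integrable lborel A f" if "A \<in> sets borel" "A \<subseteq> {0..1}" for A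
        using set_integrable_subset[OF set_integrable_continuous01[OF f], of A] that by simp
      have "integral {0..a n m} f + integral {a n m..a n (Suc m)} f = integral {0..a n (Suc m)} f"
        by (rule Henstock_Kurzweil_Integration.integral_combine) (use le in \<open>auto intro!: set_borel_integral_eq_integral i\<close>)
      then have "(LBINT u:{0..a n (Suc m)}. f u) = (LBINT u:{0..a n m}. f u) + (LBINT u:{a n m..a n (Suc m)}. f u)"
        using le by (simp add: set_borel_integral_eq_integral i)
      then show ?case using Suc by simp
    qed
    from this[of n] show ?thesis using n by (simp add: a_def)
  qed
  have "\<exists>n0. \<forall>n\<ge>n0. \<bar>1 / real n * (\<Sum>x=1..n. f (a n x)) - (LBINT u:{0..1}. f u)\<bar> < e" if e: "e > 0" for e
  proof -
    have "uniformly_continuous_on {0..1} f" by (rule compact_uniformly_continuous[OF f]) simp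
    then obtain d where d: "d > 0" "\<And>x y. x \<in> {0..1} \<Longrightarrow> y \<in> {0..1} \<Longrightarrow> dist y x < d \<Longrightarrow> dist (f y) (f x) < e / 2"
      using e unfolding uniformly_continuous_on_def by (meson half_gt_zero)
    obtain n0 :: nat where n0: "1 / d < real n0" using reals_Archimedean2 by blast
    have "\<bar>1 / real n * (\<Sum>x=1..n. f (a n x)) - (LBINT u:{0..1}. f u)\<bar> < e" if "n \<ge> max 1 n0" for n
    proof -
      have n: "n \<ge> 1" and "1 / d < real n" using that n0 by auto
      then have nd: "1 / real n < d" using d(1) by (simp add: field_simps)
      have cell: "\<bar>(LBINT u:{a n (x - 1)..a n x}. f u) - 1 / real n * f (a n x)\<bar> \<le> 1 / real n * (e / 2)"
        if x: "x \<in> {1..n}" for x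
      proof -
        let ?I = "{a n (x - 1)..a n x}"
        have le: "0 \<le> a n (x - 1)" "a n (x - 1) \<le> a n x" "a n x \<le> 1" "a n x - a n (x - 1) = 1 / real n"
          using x n by (auto simp: a_def divide_simps of_nat_diff)
        have i: "set_integrable lborel ?I f"
          using set_integrable_subset[OF set_integrable_continuous01[OF f], of ?I] le by simp
        have ic: "set_integrable lborel ?I (\<lambda>_. c)" for c :: real
          by (rule borel_integrable_atLeastAtMost') simp
        have m: "(LBINT u:?I. c) = 1 / real n * c" for c :: real
          using le by (simp add: set_lebesgue_integral_def)
        have "\<bar>LBINT u:?I. f u - f (a n x)\<bar> \<le> (LBINT u:?I. \<bar>f u - f (a n x)\<bar>)"
          using set_integral_norm_bound[of lborel ?I "\<lambda>u. f u - f (a n x)"] i ic by simp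
        also have "\<dots> \<le> (LBINT u:?I. e / 2)"
        proof (rule set_integral_mono)
          show "set_integrable lborel ?I (\<lambda>u. \<bar>f u - f (a n x)\<bar>)"
            by (intro set_integrable_abs set_integral_diff i ic)
          fix u assume u: "u \<in> ?I"
          have "dist u (a n x) < d" using u le nd by (auto simp: dist_real_def)
          then have "dist (f u) (f (a n x)) < e / 2" using u le by (intro d(2)) auto
          then show "\<bar>f u - f (a n x)\<bar> \<le> e / 2" by (simp add: dist_real_def)
        qed (rule ic)
        finally show ?thesis using m i ic by (simp add: set_integral_diff)
      qed
      have "\<bar>1 / real n * (\<Sum>x=1..n. f (a n x)) - (LBINT u:{0..1}. f u)\<bar>
        = \<bar>\<Sum>x=1..n. (LBINT u:{a n (x - 1)..a n x}. f u) - 1 / real n * f (a n x)\<bar>"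
        unfolding split[OF n] sum_subtractf sum_distrib_left by (rule abs_minus_commute)
      also have "\<dots> \<le> (\<Sum>x=1..n. 1 / real n * (e / 2))"
        by (rule order.trans[OF sum_abs], rule sum_mono) (use cell in auto)
      also have "\<dots> = e / 2" using n by simp
      finally show ?thesis using e by simp
    qed
    then show ?thesis by blast
  qed
  then show ?thesis unfolding LIMSEQ_iff a_def by simp
qed

text \<open>\<open>signed_density\<close> only speaks about sets. Step functions on cells of length
  \<open>1 / Suc m\<close> turn both sides into the same finite sums, and dominated convergence
  passes to continuous \<open>\<phi>\<close>.\<close>

lemma signed_integral_density:
  assumes \<nu>: "signed_measure01 \<nu>" and d: "signed_density \<nu> f" and \<phi>: "continuous_on {0..1} \<phi>"
  shows "signed_integral \<nu> \<phi> = (LBINT u:{0..1}. f u * \<phi> u)"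
proof -
  obtain B where B: "B > 0" "\<And>u. u \<in> {0..1} \<Longrightarrow> \<bar>\<phi> u\<bar> \<le> B"
    using continuous01_bounded[OF \<phi>] by blast
  \<comment> \<open>The index \<open>i\<close> has to run up to \<open>Suc m\<close>, because the
    right endpoint \<open>u = 1\<close> forms a cell of its own.\<close>
  define A where "A m i = {u::real. 0 \<le> u \<and> u \<le> 1 \<and> \<lfloor>real (Suc m) * u\<rfloor> = int i}" for m i :: nat
  have A[measurable]: "A m i \<in> sets borel" for m i unfolding A_def by measurable
  have A_sub: "A m i \<subseteq> {0..1}" for m i by (auto simp: A_def)
  define \<psi> where "\<psi> m u = (\<Sum>i\<le>Suc m. \<phi> (real i / real (Suc m)) * indicator (A m i) u)" for m u
  have \<psi>_eq: "\<psi> m u = \<phi> (of_int \<lfloor>real (Suc m) * u\<rfloor> / real (Suc m))" "of_int \<lfloor>real (Suc m) * u\<rfloor> / real (Suc m) \<in> {0..1}"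
    if u: "u \<in> {0..1}" for m u
  proof -
    define i where "i = nat \<lfloor>real (Suc m) * u\<rfloor>"
    have i: "\<lfloor>real (Suc m) * u\<rfloor> = int i" using u by (simp add: i_def)
    have "real (Suc m) * u \<le> real (Suc m) * 1" using u by (intro mult_left_mono) auto
    then have "of_int \<lfloor>real (Suc m) * u\<rfloor> \<le> real (Suc m)"
      by (intro order.trans[OF of_int_floor_le]) (simp only: mult_1_right)
    then have le: "i \<le> Suc m" unfolding i by simp
    have "\<psi> m u = (\<Sum>j\<le>Suc m. if j = i then \<phi> (real i / real (Suc m)) else 0)"
      unfolding \<psi>_def using u i by (intro sum.cong) (auto simp: A_def)
    then show "\<psi> m u = \<phi> (of_int \<lfloor>real (Suc m) * u\<rfloor> / real (Suc m))" unfolding i using le by (simp add: sum.delta del: sum.atMost_Suc of_nat_Suc)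
    show "of_int \<lfloor>real (Suc m) * u\<rfloor> / real (Suc m) \<in> {0..1}"
      unfolding i using le by (simp add: divide_simps)
  qed
  have \<psi>_bound: "\<bar>\<psi> m u\<bar> \<le> B" if "u \<in> {0..1}" for m u
    using \<psi>_eq[OF that] B(2) by metis
  have \<psi>_lim: "(\<lambda>m. \<psi> m u) \<longlonglongrightarrow> \<phi> u" if u: "u \<in> {0..1}" for u
  proof -
    have "(\<lambda>m. of_int \<lfloor>real (Suc m) * u\<rfloor> / real (Suc m)) \<longlonglongrightarrow> u"
    proof (rule real_tendsto_sandwich[where f="\<lambda>m. u - 1 / real (Suc m)" and h="\<lambda>m. u"])
      show "\<forall>\<^sub>F m in sequentially. u - 1 / real (Suc m) \<le> of_int \<lfloor>real (Suc m) * u\<rfloor> / real (Suc m)"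
      proof (rule always_eventually, rule allI)
        fix m
        have "real (Suc m) * u - 1 \<le> of_int \<lfloor>real (Suc m) * u\<rfloor>" by linarith
        then have "(real (Suc m) * u - 1) / real (Suc m) \<le> of_int \<lfloor>real (Suc m) * u\<rfloor> / real (Suc m)"
          by (rule divide_right_mono) simp
        then show "u - 1 / real (Suc m) \<le> of_int \<lfloor>real (Suc m) * u\<rfloor> / real (Suc m)" 
          by (simp add: diff_divide_distrib del: of_nat_Suc)
      qed
      show "\<forall>\<^sub>F m in sequentially. of_int \<lfloor>real (Suc m) * u\<rfloor> / real (Suc m) \<le> u"
      proof (rule always_eventually, rule allI)
        fix m
        have "of_int \<lfloor>real (Suc m) * u\<rfloor> / real (Suc m) \<le> real (Suc m) * u / real (Suc m)"
          by (intro divide_right_mono of_int_floor_le) simp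
        then show "of_int \<lfloor>real (Suc m) * u\<rfloor> / real (Suc m) \<le> u" by (simp del: of_nat_Suc)
      qed
      show "(\<lambda>m. u - 1 / real (Suc m)) \<longlonglongrightarrow> u"
        using tendsto_diff[OF tendsto_const[of u] LIMSEQ_inverse_real_of_nat] by (simp add: inverse_eq_divide)
    qed simp
    from continuous_on_tendsto_compose[OF \<phi> this u] have
      "(\<lambda>m. \<phi> (of_int \<lfloor>real (Suc m) * u\<rfloor> / real (Suc m))) \<longlonglongrightarrow> \<phi> u"
      using \<psi>_eq(2)[OF u] by simp
    then show ?thesis using \<psi>_eq(1)[OF u] by simp
  qed
  have part: "(\<lambda>m. \<Sum>i\<le>Suc m. \<phi> (real i / real (Suc m)) * measure \<kappa> (A m i)) \<longlonglongrightarrow> (LINT u|\<kappa>. \<phi> u)"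
    if \<kappa>: "finite_measure \<kappa>" "sets \<kappa> = sets (restrict_space borel {0..1})" for \<kappa> :: "real measure"
  proof -
    interpret finite_measure \<kappa> by fact
    have sp: "space \<kappa> = {0..1}" using sets_eq_imp_space_eq[OF \<kappa>(2)] by (simp add: space_restrict_space)
    have As: "A m i \<in> sets \<kappa>" for m i
      unfolding \<kappa>(2) using A_sub by (auto simp: sets_restrict_space_iff)
    have "(\<lambda>m. LINT u|\<kappa>. \<psi> m u) \<longlonglongrightarrow> (LINT u|\<kappa>. \<phi> u)"
    proof (rule integral_dominated_convergence[where w="\<lambda>_. B"])
      show "\<phi> \<in> borel_measurable \<kappa>"
        using borel_measurable_continuous_on_restrict[OF \<phi>] measurable_cong_sets[OF \<kappa>(2) refl] by blast
      show "\<psi> m \<in> borel_measurable \<kappa>" for m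
        unfolding \<psi>_def[abs_def] using As by measurable
    qed (use \<psi>_lim \<psi>_bound sp in auto)
    moreover have "(LINT u|\<kappa>. \<psi> m u) = (\<Sum>i\<le>Suc m. \<phi> (real i / real (Suc m)) * measure \<kappa> (A m i))" for m
    proof -
      have "(LINT u|\<kappa>. \<psi> m u) = (\<Sum>i\<le>Suc m. LINT u|\<kappa>. \<phi> (real i / real (Suc m)) * indicator (A m i) u)"
        unfolding \<psi>_def 
        by (intro Bochner_Integration.integral_sum integrable_mult_right integrable_real_indicator As)
          (simp add: emeasure_eq_measure)
      also have "\<dots> = (\<Sum>i\<le>Suc m. \<phi> (real i / real (Suc m)) * measure \<kappa> (A m i))"
        using As sets.sets_into_space[OF As] by (intro sum.cong refl) (simp add: Int_absorb1 Int_absorb2)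
      finally show ?thesis .
    qed
    ultimately show ?thesis by simp
  qed
  have fi: "set_integrable lborel {0..1} f"
    and fd: "\<And>C. C \<in> sets borel \<Longrightarrow> C \<subseteq> {0..1} \<Longrightarrow> measure (fst \<nu>) C - measure (snd \<nu>) C = (LBINT u:C. f u)"
    using d by (auto simp: signed_density_def)
  have f_meas: "(\<lambda>u. indicator {0..1} u *\<^sub>R f u) \<in> borel_measurable lborel"
    using fi unfolding set_integrable_def by (rule borel_measurable_integrable)
  have "(\<lambda>m. \<integral>u. (indicator {0..1} u *\<^sub>R f u) * \<psi> m u \<partial>lborel) \<longlonglongrightarrow> (\<integral>u. (indicator {0..1} u *\<^sub>R f u) * (indicator {0..1} u *\<^sub>R \<phi> u) \<partial>lborel)"
  proof (rule integral_dominated_convergence[where w="\<lambda>u. B * \<bar>indicator {0..1} u *\<^sub>R f u\<bar>"])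
    have "(\<lambda>u. indicator {0..1} u *\<^sub>R \<phi> u) \<in> borel_measurable lborel"
      using set_integrable_continuous01[OF \<phi>] unfolding set_integrable_def by (rule borel_measurable_integrable)
    then show "(\<lambda>u. (indicator {0..1} u *\<^sub>R f u) * (indicator {0..1} u *\<^sub>R \<phi> u)) \<in> borel_measurable lborel"
      using f_meas by (rule borel_measurable_times[rotated])
    show "(\<lambda>u. (indicator {0..1} u *\<^sub>R f u) * \<psi> m u) \<in> borel_measurable lborel" for m
    proof -
      have "\<psi> m \<in> borel_measurable lborel" unfolding \<psi>_def[abs_def] by measurable
      then show ?thesis by (rule borel_measurable_times[OF f_meas])
    qed
    show "integrable lborel (\<lambda>u. B * \<bar>indicator {0..1} u *\<^sub>R f u\<bar>)"
      using fi unfolding set_integrable_def by (intro integrable_mult_right integrable_abs)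
    show "AE u in lborel. (\<lambda>m. (indicator {0..1} u *\<^sub>R f u) * \<psi> m u) \<longlonglongrightarrow> (indicator {0..1} u *\<^sub>R f u) * (indicator {0..1} u *\<^sub>R \<phi> u)"
      by (rule AE_I2) (auto intro!: tendsto_intros \<psi>_lim split: split_indicator)
    show "AE u in lborel. norm ((indicator {0..1} u *\<^sub>R f u) * \<psi> m u) \<le> B * \<bar>indicator {0..1} u *\<^sub>R f u\<bar>" for m
    proof (rule AE_I2)
      fix u :: real
      have "\<bar>f u\<bar> * \<bar>\<psi> m u\<bar> \<le> \<bar>f u\<bar> * B" if "u \<in> {0..1}"
        by (intro mult_left_mono \<psi>_bound that) simp
      then show "norm ((indicator {0..1} u *\<^sub>R f u) * \<psi> m u) \<le> B * \<bar>indicator {0..1} u *\<^sub>R f u\<bar>"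
        by (auto simp: abs_mult mult.commute split: split_indicator)
    qed
  qed
  moreover have "(\<integral>u. (indicator {0..1} u *\<^sub>R f u) * \<psi> m u \<partial>lborel)
     = (\<Sum>i\<le>Suc m. \<phi> (real i / real (Suc m)) * (measure (fst \<nu>) (A m i) - measure (snd \<nu>) (A m i)))" for m
  proof -
    have i: "integrable lborel (\<lambda>u. indicator (A m i) u *\<^sub>R f u)" for i
      using set_integrable_subset[OF fi _ A_sub, of m i] by (simp add: set_integrable_def)
    have "(indicator {0..1} u *\<^sub>R f u) * \<psi> m u = (\<Sum>i\<le>Suc m. \<phi> (real i / real (Suc m)) * (indicator (A m i) u *\<^sub>R f u))" for u
    proof -
      have "indicator (A m i) u * indicator {0..1} u = (indicator (A m i) u :: real)" for i
        using A_sub[of m i] by (auto split: split_indicator)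
      then have ieq: "indicator {0..1} u * f u * (\<phi> (real i / real (Suc m)) * indicator (A m i) u)
        = \<phi> (real i / real (Suc m)) * (indicator (A m i) u * f u)" for i
        by (metis (no_types, opaque_lifting) mult.assoc mult.commute)
      then show ?thesis
        unfolding \<psi>_def sum_distrib_left real_scaleR_def by (intro sum.cong refl)
    qed
    then have "(\<integral>u. (indicator {0..1} u *\<^sub>R f u) * \<psi> m u \<partial>lborel)
      = (\<integral>u. (\<Sum>i\<le>Suc m. \<phi> (real i / real (Suc m)) * (indicator (A m i) u *\<^sub>R f u)) \<partial>lborel)" by simp
    also have "\<dots> = (\<Sum>i\<le>Suc m. \<phi> (real i / real (Suc m)) * (LBINT u:A m i. f u))"
      unfolding set_lebesgue_integral_def
      by (subst Bochner_Integration.integral_sum) (use i in \<open>auto simp del: sum.atMost_Suc\<close>)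
    finally show ?thesis using fd[OF A A_sub] by simp
  qed
  moreover have "(\<lambda>m. \<Sum>i\<le>Suc m. \<phi> (real i / real (Suc m)) * (measure (fst \<nu>) (A m i) - measure (snd \<nu>) (A m i)))
     \<longlonglongrightarrow> signed_integral \<nu> \<phi>"
    unfolding signed_integral_def right_diff_distrib sum_subtractf
    by (intro tendsto_diff part) (use \<nu> in \<open>auto simp: signed_measure01_def\<close>)
  ultimately have "signed_integral \<nu> \<phi> = (\<integral>u. (indicator {0..1} u *\<^sub>R f u) * (indicator {0..1} u *\<^sub>R \<phi> u) \<partial>lborel)"
    by (simp add: LIMSEQ_unique del: sum.atMost_Suc of_nat_Suc)
  then show ?thesis
    unfolding set_lebesgue_integral_def
    by (auto intro!: Bochner_Integration.integral_cong split: split_indicator)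
qed

subsection \<open>The stretch equation\<close>

text \<open>Continuity of \<open>m\<close> makes the integral equation differentiable, and
  \<open>exp (a * t) * (m t + b / a)\<close> is then a constant of motion.\<close>

lemma linear_integral_equation:
  fixes m :: "real \<Rightarrow> real"
  assumes m: "continuous_on {0..} m" and a: "a > 0" and t: "t \<ge> 0"
    and eq: "\<And>t. t \<ge> 0 \<Longrightarrow> m t = m0 - a * (LBINT s:{0..t}. m s) - b * t"
  shows "m t = - b / a + exp (- (a * t)) * (m0 + b / a)"
proof -
  have int: "(LBINT s:{0..t}. m s) = integral {0..t} m" for t
    by (intro set_borel_integral_eq_integral borel_integrable_atLeastAtMost' continuous_on_subset[OF m]) auto
  have D: "(m has_real_derivative - a * m s - b) (at s within {0..})" if s: "s \<ge> 0" for s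
  proof -
    have "((\<lambda>t. m0 - a * integral {0..t} m - b * t) has_real_derivative 0 - a * m s - b * 1) (at s within {0..})"
      by (intro DERIV_diff DERIV_const DERIV_cmult DERIV_ident integral_deriv_within_atLeast m s)
    then have "((\<lambda>t. m0 - a * integral {0..t} m - b * t) has_real_derivative - a * m s - b) (at s within {0..})" by simp
    then show ?thesis
      by (rule has_field_derivative_transform_within[where d = 1]) (use s eq int in auto)
  qed
  define f where "f s = exp (a * s) * (m s + b / a)" for s
  have Df: "(f has_real_derivative 0) (at s within {0..})" if s: "s \<ge> 0" for s
  proof -
    have "(f has_real_derivative (exp (a * s) * a) * (m s + b / a) + (- a * m s - b) * exp (a * s)) (at s within {0..})"
      unfolding f_def[abs_def] by (auto intro!: derivative_eq_intros D s)
    moreover have "(exp (a * s) * a) * (m s + b / a) + (- a * m s - b) * exp (a * s) = 0"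
      using a by (simp add: field_simps)
    ultimately show ?thesis by simp
  qed
  have "f t \<le> f 0"
    by (rule nonincreasing_of_deriv[where f = f and f' = "\<lambda>_. 0"]) (use Df t in auto)
  moreover have "- f t \<le> - f 0"
    by (rule nonincreasing_of_deriv[where f = "\<lambda>s. - f s" and f' = "\<lambda>_. - 0"]) (use t DERIV_minus[OF Df] in auto)
  moreover have "m 0 = m0"
  proof -
    have "(LBINT s:{0..0}. m s) = 0" unfolding int by simp
    then show ?thesis using eq[of 0] by simp
  qed
  ultimately have "exp (a * t) * (m t + b / a) = m0 + b / a" by (simp add: f_def)
  then have "exp (- (a * t)) * (exp (a * t) * (m t + b / a)) = exp (- (a * t)) * (m0 + b / a)" by simp
  then show ?thesis by (simp add: mult.assoc[symmetric] flip: exp_add)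
qed

section \<open>The heat profile as a sine series\<close>

definition sine_coeff :: "real \<Rightarrow> (real \<Rightarrow> real) \<Rightarrow> nat \<Rightarrow> real" where
  "sine_coeff F f k = (LBINT u:{0..1}. (f u - F * u) * sin (pi * real k * u))"

text \<open>The sines have squared norm \<open>1 / 2\<close> on the unit interval, whence the factor
  2; the term \<open>k = 0\<close> vanishes. The subtraction of \<open>F * u\<close> in
  \<open>sine_coeff\<close> accounts for the boundary values \<open>0\<close> and
  \<open>F\<close>.\<close>

definition heat_profile :: "real \<Rightarrow> real \<Rightarrow> (real \<Rightarrow> real) \<Rightarrow> real \<Rightarrow> real \<Rightarrow> real" where
  "heat_profile \<gamma> F f t u = F * u +
     (\<Sum>k. 2 * sine_coeff F f k * (exp (- (pi\<^sup>2 * (real k)\<^sup>2 / (2 * \<gamma>) * t)) * sin (pi * real k * u)))"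

lemma LBINT_abs_bound:
  fixes f g :: "real \<Rightarrow> real"
  assumes "continuous_on {0..1} f" "continuous_on {0..1} g" "\<And>u. u \<in> {0..1} \<Longrightarrow> \<bar>g u\<bar> \<le> C"
  shows "\<bar>LBINT u:{0..1}. f u * g u\<bar> \<le> C * (LBINT u:{0..1}. \<bar>f u\<bar>)"
proof -
  have "\<bar>LBINT u:{0..1}. f u * g u\<bar> \<le> (LBINT u:{0..1}. \<bar>f u * g u\<bar>)"
    using set_integral_norm_bound[of lborel "{0..1}" "\<lambda>u. f u * g u"]
      set_integrable_continuous01[OF continuous_on_mult[OF assms(1,2)]] by simp
  also have "\<dots> \<le> (LBINT u:{0..1}. C * \<bar>f u\<bar>)"
  proof (rule set_integral_mono)
    show "set_integrable lborel {0..1} (\<lambda>u. \<bar>f u * g u\<bar>)" "set_integrable lborel {0..1} (\<lambda>u. C * \<bar>f u\<bar>)"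
      by (intro set_integrable_continuous01 continuous_intros assms)+
    fix u :: real assume "u \<in> {0..1}"
    then show "\<bar>f u * g u\<bar> \<le> C * \<bar>f u\<bar>"
      unfolding abs_mult mult.commute[of C] by (intro mult_left_mono assms) auto
  qed
  finally show ?thesis by simp
qed

text \<open>Since \<open>k <= k^2\<close> for natural numbers, the Gaussian decay in
  \<open>k\<close> is majorised by a geometric series with an explicit sum.\<close>

lemma exp_square_le_power:
  assumes "a \<ge> 0"
  shows "exp (- (a * (real k)\<^sup>2)) \<le> exp (- a) ^ k"
proof -
  have "real k \<le> (real k)\<^sup>2" by (cases k) (auto simp: power2_eq_square)
  then have "a * real k \<le> a * (real k)\<^sup>2" using assms by (intro mult_left_mono) auto
  then show ?thesis by (simp add: exp_of_nat_mult[symmetric] mult.commute)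
qed

lemma heat_term_bound:
  assumes "\<gamma> > 0" "t > 0"
  shows "\<bar>c * (exp (- (pi\<^sup>2 * (real k)\<^sup>2 / (2 * \<gamma>) * t)) * sin (pi * real k * u))\<bar>
     \<le> \<bar>c\<bar> * exp (- (pi\<^sup>2 / (2 * \<gamma>) * t)) ^ k"
proof -
  have "exp (- (pi\<^sup>2 * (real k)\<^sup>2 / (2 * \<gamma>) * t)) = exp (- (pi\<^sup>2 / (2 * \<gamma>) * t * (real k)\<^sup>2))"
    by (simp add: field_simps)
  also have "\<dots> \<le> exp (- (pi\<^sup>2 / (2 * \<gamma>) * t)) ^ k"
    by (rule exp_square_le_power) (use assms in simp)
  finally have "exp (- (pi\<^sup>2 * (real k)\<^sup>2 / (2 * \<gamma>) * t)) * \<bar>sin (pi * real k * u)\<bar> \<le> exp (- (pi\<^sup>2 / (2 * \<gamma>) * t)) ^ k * 1"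
    by (intro mult_mono) auto
  then show ?thesis by (simp add: abs_mult mult_left_mono)
qed

lemma heat_decay_rate:
  assumes "\<gamma> > 0" "t > 0"
  shows "0 \<le> exp (- (pi\<^sup>2 / (2 * \<gamma>) * t))" "exp (- (pi\<^sup>2 / (2 * \<gamma>) * t)) < 1"
  using assms by auto

lemma heat_series_summable:
  assumes "\<gamma> > 0" "t > 0" "\<And>k. \<bar>c k\<bar> \<le> B"
  shows "summable (\<lambda>k. c k * (exp (- (pi\<^sup>2 * (real k)\<^sup>2 / (2 * \<gamma>) * t)) * sin (pi * real k * u)))"
proof (rule summable_comparison_test'[where N = 0])
  show "summable (\<lambda>k. B * exp (- (pi\<^sup>2 / (2 * \<gamma>) * t)) ^ k)"
    using heat_decay_rate[OF assms(1,2)] by (intro summable_mult summable_geometric) simp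
  fix k :: nat
  have "\<bar>c k\<bar> * exp (- (pi\<^sup>2 / (2 * \<gamma>) * t)) ^ k \<le> B * exp (- (pi\<^sup>2 / (2 * \<gamma>) * t)) ^ k"
    by (intro mult_right_mono assms) simp
  then show "norm (c k * (exp (- (pi\<^sup>2 * (real k)\<^sup>2 / (2 * \<gamma>) * t)) * sin (pi * real k * u)))
     \<le> B * exp (- (pi\<^sup>2 / (2 * \<gamma>) * t)) ^ k"
    using heat_term_bound[OF assms(1,2), of "c k" k u] unfolding real_norm_def by linarith
qed

lemma heat_series_bound:
  assumes "\<gamma> > 0" "t > 0" "\<And>k. \<bar>c k\<bar> \<le> B"
  shows "\<bar>\<Sum>k. c k * (exp (- (pi\<^sup>2 * (real k)\<^sup>2 / (2 * \<gamma>) * t)) * sin (pi * real k * u))\<bar>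
     \<le> B / (1 - exp (- (pi\<^sup>2 / (2 * \<gamma>) * t)))"
proof -
  let ?q = "exp (- (pi\<^sup>2 / (2 * \<gamma>) * t))"
  have q: "norm ?q < 1" using heat_decay_rate[OF assms(1,2)] by simp
  have *: "\<bar>c k * (exp (- (pi\<^sup>2 * (real k)\<^sup>2 / (2 * \<gamma>) * t)) * sin (pi * real k * u))\<bar> \<le> B * ?q ^ k" for k
  proof -
    have "\<bar>c k\<bar> * ?q ^ k \<le> B * ?q ^ k" by (intro mult_right_mono assms) simp
    then show ?thesis using heat_term_bound[OF assms(1,2), of "c k" k u] by linarith
  qed
  have "norm (\<Sum>k. c k * (exp (- (pi\<^sup>2 * (real k)\<^sup>2 / (2 * \<gamma>) * t)) * sin (pi * real k * u))) \<le> (\<Sum>k. B * ?q ^ k)"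
  proof -
    have g: "summable (\<lambda>k. B * ?q ^ k)" using q by (intro summable_mult summable_geometric)
    have n: "summable (\<lambda>k. norm (c k * (exp (- (pi\<^sup>2 * (real k)\<^sup>2 / (2 * \<gamma>) * t)) * sin (pi * real k * u))))"
      by (rule summable_comparison_test'[OF g, where N = 0]) (use * in simp)
    show ?thesis
      by (rule order.trans[OF summable_norm[OF n] suminf_le[OF _ n g]]) (use * in simp)
  qed
  also have "\<dots> = B / (1 - ?q)"
    using q by (simp add: suminf_mult suminf_geometric summable_geometric)
  finally show ?thesis by simp
qed

lemma sine_coeff_bound:
  assumes "continuous_on {0..1} f"
  obtains B where "\<And>k. \<bar>sine_coeff F f k\<bar> \<le> B"
proof (rule that)
  fix k
  show "\<bar>sine_coeff F f k\<bar> \<le> 1 * (LBINT u:{0..1}. \<bar>f u - F * u\<bar>)"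
    unfolding sine_coeff_def
    by (rule LBINT_abs_bound) (use assms in \<open>auto intro!: continuous_intros\<close>)
qed

lemma heat_profile_continuous:
  assumes "\<gamma> > 0" "t > 0" "continuous_on {0..1} f"
  shows "continuous_on UNIV (heat_profile \<gamma> F f t)"
proof -
  obtain B where B: "\<And>k. \<bar>sine_coeff F f k\<bar> \<le> B" using sine_coeff_bound[OF assms(3)] by blast
  let ?g = "\<lambda>k u. 2 * sine_coeff F f k * (exp (- (pi\<^sup>2 * (real k)\<^sup>2 / (2 * \<gamma>) * t)) * sin (pi * real k * u))"
  have "uniform_limit UNIV (\<lambda>n u. \<Sum>k<n. ?g k u) (\<lambda>u. \<Sum>k. ?g k u) sequentially"
  proof (rule Weierstrass_m_test)
    show "summable (\<lambda>k. 2 * B * exp (- (pi\<^sup>2 / (2 * \<gamma>) * t)) ^ k)"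
      using heat_decay_rate[OF assms(1,2)] by (intro summable_mult summable_geometric) simp
    fix k u
    have "\<bar>2 * sine_coeff F f k\<bar> * exp (- (pi\<^sup>2 / (2 * \<gamma>) * t)) ^ k \<le> 2 * B * exp (- (pi\<^sup>2 / (2 * \<gamma>) * t)) ^ k"
      by (intro mult_right_mono) (use B[of k] in auto)
    then show "norm (?g k u) \<le> 2 * B * exp (- (pi\<^sup>2 / (2 * \<gamma>) * t)) ^ k"
      using heat_term_bound[OF assms(1,2), of "2 * sine_coeff F f k" k u] unfolding real_norm_def by linarith
  qed
  then have "continuous_on UNIV (\<lambda>u. \<Sum>k. ?g k u)"
    by (rule uniform_limit_theorem[rotated]) (auto intro!: always_eventually continuous_intros)
  then show ?thesis unfolding heat_profile_def[abs_def] by (intro continuous_intros)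
qed

lemma sine_sum_coeff:
  assumes K: "finite K" "0 \<notin> K" "\<And>k. k \<notin> K \<Longrightarrow> c k = 0" and k: "k \<noteq> 0"
  shows "(LBINT u:{0..1}. (\<Sum>j\<in>K. c j * sin (pi * real j * u)) * sin (pi * real k * u)) = c k / 2"
proof -
  have "(LBINT u:{0..1}. (\<Sum>j\<in>K. c j * sin (pi * real j * u)) * sin (pi * real k * u))
      = (LBINT u:{0..1}. (\<Sum>j\<in>K. c j * (sin (pi * real j * u) * sin (pi * real k * u))))"
    by (simp add: sum_distrib_right mult.assoc)
  also have "\<dots> = (\<Sum>j\<in>K. LBINT u:{0..1}. c j * (sin (pi * real j * u) * sin (pi * real k * u)))"
    unfolding set_lebesgue_integral_def sum_distrib_left scaleR_sum_right
    by (intro Bochner_Integration.integral_sum set_integrable_continuous01[unfolded set_integrable_def] continuous_intros)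
  also have "\<dots> = (\<Sum>j\<in>K. c j * (if j = k then 1 / 2 else 0))"
  proof (rule sum.cong[OF refl])
    fix j assume "j \<in> K"
    then have j: "j \<noteq> 0" using K(2) by metis
    show "(LBINT u:{0..1}. c j * (sin (pi * real j * u) * sin (pi * real k * u))) = c j * (if j = k then 1 / 2 else 0)"
      unfolding set_integral_mult_right LBINT_sin_sin[OF j k] ..
  qed
  also have "\<dots> = c k / 2"
    using K by (auto simp: if_distrib sum.delta cong: if_cong)
  finally show ?thesis .
qed

text \<open>One sine polynomial close to \<open>f u - F * u\<close> in L2 gives all the estimates.
  L2 closeness bounds the L1 distance and with it every sine coefficient by \<open>e\<close>,
  uniformly in \<open>k\<close>; at time \<open>t > 0\<close> the geometric decay makes these
  coefficient errors summable.\<close>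

lemma heat_profile_approx:
  assumes \<gamma>: "\<gamma> > 0" and t: "t > 0" and f: "continuous_on {0..1} f" and e: "e > 0"
  obtains K c where "finite K"
    "(LBINT u:{0..1}. (f u - heat_sum \<gamma> F K c 0 u)\<^sup>2) \<le> e\<^sup>2"
    "\<And>u. \<bar>heat_profile \<gamma> F f t u - heat_sum \<gamma> F K c t u\<bar> \<le> 2 * e / (1 - exp (- (pi\<^sup>2 / (2 * \<gamma>) * t)))"
    "\<And>k. k \<noteq> 0 \<Longrightarrow> \<bar>(LBINT u:{0..1}. heat_sum \<gamma> F K c t u * sin (pi * real k * u))
        - (F * (LBINT u:{0..1}. u * sin (pi * real k * u))
          + exp (- (pi\<^sup>2 * (real k)\<^sup>2 / (2 * \<gamma>) * t)) * sine_coeff F f k)\<bar> \<le> e"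
proof -
  define v where "v u = f u - F * u" for u
  have v: "continuous_on {0..1} v" unfolding v_def[abs_def] by (intro continuous_intros f)
  obtain P where P: "P \<in> sine_span" "(LBINT u:{0..1}. (v u - P u)\<^sup>2) \<le> e\<^sup>2"
    using sine_span_L2_dense[OF v, of "e\<^sup>2"] e by auto
  obtain K c where K: "finite K" "0 \<notin> K" "\<And>k. k \<notin> K \<Longrightarrow> c k = 0"
      "\<And>u. P u = (\<Sum>k\<in>K. c k * sin (pi * real k * u))"
    using sine_span_sum[OF P(1)] by blast
  have Pc: "continuous_on {0..1} P" by (rule sine_span_continuous[OF P(1)])
  \<comment> \<open>The bound \<open>a <= a^2 / (2 * e) + e / 2\<close> for
    \<open>a = \<bar>v u - P u\<bar>\<close> yields exactly \<open>e\<close> after integration,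
    since the squared distance is at most \<open>e^2\<close>.\<close>
  have L1: "(LBINT u:{0..1}. \<bar>v u - P u\<bar>) \<le> e"
  proof -
    have "(LBINT u:{0..1}. \<bar>v u - P u\<bar>) \<le> (LBINT u:{0..1}. (v u - P u)\<^sup>2 / (2 * e) + e / 2)"
    proof (rule set_integral_mono)
      show "set_integrable lborel {0..1} (\<lambda>u. \<bar>v u - P u\<bar>)" "set_integrable lborel {0..1} (\<lambda>u. (v u - P u)\<^sup>2 / (2 * e) + e / 2)"
        by (intro set_integrable_continuous01 continuous_intros v Pc; use e in simp)+
      fix u
      show "\<bar>v u - P u\<bar> \<le> (v u - P u)\<^sup>2 / (2 * e) + e / 2"
        using mult_le_weighted_squares[of "1 / (2 * e)" "\<bar>v u - P u\<bar>" 1] e by (simp add: field_simps)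
    qed
    also have "\<dots> = (LBINT u:{0..1}. (v u - P u)\<^sup>2) / (2 * e) + e / 2"
    proof -
      have "(LBINT u:{0..1::real}. e / 2) = e / 2" by (simp add: set_lebesgue_integral_def)
      moreover have "set_integrable lborel {0..1} (\<lambda>u. (v u - P u)\<^sup>2 / (2 * e))"
        by (intro set_integrable_continuous01 continuous_intros v Pc) (use e in simp)
      moreover have "set_integrable lborel {0..1} (\<lambda>u::real. e / 2)"
        by (intro set_integrable_continuous01 continuous_intros)
      ultimately show ?thesis by (simp add: set_integral_add)
    qed
    also have "\<dots> \<le> e\<^sup>2 / (2 * e) + e / 2"
      using P(2) e by (intro add_right_mono divide_right_mono) auto
    also have "\<dots> = e" using e by (simp add: power2_eq_square)
    finally show ?thesis .
  qed
  have coeff: "\<bar>sine_coeff F f k - c k / 2\<bar> \<le> e" for k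
  proof (cases "k = 0")
    case True
    then show ?thesis using K(2,3) e by (auto simp: sine_coeff_def)
  next
    case False
    have "sine_coeff F f k - c k / 2 = (LBINT u:{0..1}. v u * sin (pi * real k * u)) - (LBINT u:{0..1}. P u * sin (pi * real k * u))"
      using sine_sum_coeff[OF K(1-3) False] by (simp add: sine_coeff_def v_def K(4))
    also have "\<dots> = (LBINT u:{0..1}. v u * sin (pi * real k * u) - P u * sin (pi * real k * u))"
      by (rule set_integral_diff(2)[symmetric]) (intro set_integrable_continuous01 continuous_intros v Pc)+
    also have "\<dots> = (LBINT u:{0..1}. (v u - P u) * sin (pi * real k * u))" by (simp add: left_diff_distrib)
    finally have eq: "sine_coeff F f k - c k / 2 = (LBINT u:{0..1}. (v u - P u) * sin (pi * real k * u))" .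
    have "\<bar>LBINT u:{0..1}. (v u - P u) * sin (pi * real k * u)\<bar> \<le> 1 * (LBINT u:{0..1}. \<bar>v u - P u\<bar>)"
      by (intro LBINT_abs_bound continuous_intros v Pc) simp
    then show ?thesis unfolding eq using L1 by simp
  qed
  show thesis
  proof (rule that)
    show "finite K" by fact
    have "f u - heat_sum \<gamma> F K c 0 u = v u - P u" for u
      by (simp add: heat_sum_def v_def K(4))
    then show "(LBINT u:{0..1}. (f u - heat_sum \<gamma> F K c 0 u)\<^sup>2) \<le> e\<^sup>2" using P(2) by simp
  next
    fix u
    let ?h = "\<lambda>k. exp (- (pi\<^sup>2 * (real k)\<^sup>2 / (2 * \<gamma>) * t)) * sin (pi * real k * u)"
    obtain B where B: "\<And>k. \<bar>sine_coeff F f k\<bar> \<le> B" using sine_coeff_bound[OF f] by blast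
    have B2: "\<bar>2 * sine_coeff F f k\<bar> \<le> 2 * B" for k using B[of k] by simp
    have s1: "summable (\<lambda>k. 2 * sine_coeff F f k * ?h k)"
      by (rule heat_series_summable[OF \<gamma> t B2])
    have s2: "(\<lambda>k. c k * ?h k) sums (\<Sum>k\<in>K. c k * ?h k)"
      by (rule sums_finite) (use K in auto)
    have "heat_profile \<gamma> F f t u - heat_sum \<gamma> F K c t u = (\<Sum>k. 2 * sine_coeff F f k * ?h k) - (\<Sum>k. c k * ?h k)"
      using sums_unique[OF s2] by (simp add: heat_profile_def heat_sum_def)
    also have "\<dots> = (\<Sum>k. (2 * sine_coeff F f k - c k) * ?h k)"
      using suminf_diff[OF s1 sums_summable[OF s2]] by (simp add: left_diff_distrib)
    finally have eq: "heat_profile \<gamma> F f t u - heat_sum \<gamma> F K c t u = (\<Sum>k. (2 * sine_coeff F f k - c k) * ?h k)" .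
    have "\<bar>2 * sine_coeff F f k - c k\<bar> \<le> 2 * e" for k using coeff[of k] by linarith
    then show "\<bar>heat_profile \<gamma> F f t u - heat_sum \<gamma> F K c t u\<bar> \<le> 2 * e / (1 - exp (- (pi\<^sup>2 / (2 * \<gamma>) * t)))"
      unfolding eq by (rule heat_series_bound[OF \<gamma> t])
  next
    fix k :: nat assume k: "k \<noteq> 0"
    define ek where "ek j = exp (- (pi\<^sup>2 * (real j)\<^sup>2 / (2 * \<gamma>) * t))" for j :: nat
    have "(LBINT u:{0..1}. heat_sum \<gamma> F K c t u * sin (pi * real k * u))
      = (LBINT u:{0..1}. F * (u * sin (pi * real k * u)) + (\<Sum>j\<in>K. (c j * ek j) * sin (pi * real j * u)) * sin (pi * real k * u))"
      by (simp add: heat_sum_def ek_def algebra_simps)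
    also have "\<dots> = F * (LBINT u:{0..1}. u * sin (pi * real k * u)) + c k * ek k / 2"
    proof -
      have "(LBINT u:{0..1}. (\<Sum>j\<in>K. (c j * ek j) * sin (pi * real j * u)) * sin (pi * real k * u)) = c k * ek k / 2"
        by (rule sine_sum_coeff[OF K(1,2) _ k]) (use K(3) in simp)
      then show ?thesis
        by (subst set_integral_add) (auto intro!: set_integrable_continuous01 continuous_intros)
    qed
    finally have "(LBINT u:{0..1}. heat_sum \<gamma> F K c t u * sin (pi * real k * u)) - (F * (LBINT u:{0..1}. u * sin (pi * real k * u))
          + ek k * sine_coeff F f k) = - (ek k * (sine_coeff F f k - c k / 2))"
      by (simp add: algebra_simps)
    moreover have "\<bar>ek k * (sine_coeff F f k - c k / 2)\<bar> \<le> 1 * e"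
      unfolding abs_mult by (rule mult_mono) (use coeff \<gamma> t in \<open>auto simp: ek_def\<close>)
    ultimately show "\<bar>(LBINT u:{0..1}. heat_sum \<gamma> F K c t u * sin (pi * real k * u))
        - (F * (LBINT u:{0..1}. u * sin (pi * real k * u))
          + exp (- (pi\<^sup>2 * (real k)\<^sup>2 / (2 * \<gamma>) * t)) * sine_coeff F f k)\<bar> \<le> e"
      unfolding ek_def by simp
  qed
qed

text \<open>Instead of integrating the series term by term, both sides are compared with those of a
  finite \<open>heat_sum\<close> up to a multiple of \<open>e\<close>, and \<open>e\<close> is
  arbitrary.\<close>

lemma heat_profile_sine_coeff:
  assumes \<gamma>: "\<gamma> > 0" and t: "t > 0" and f: "continuous_on {0..1} f" and k: "k \<noteq> 0"
  shows "(LBINT u:{0..1}. heat_profile \<gamma> F f t u * sin (pi * real k * u))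
    = F * (LBINT u:{0..1}. u * sin (pi * real k * u))
          + exp (- (pi\<^sup>2 * (real k)\<^sup>2 / (2 * \<gamma>) * t)) * sine_coeff F f k" (is "?l = ?r")
proof -
  define C where "C = 2 / (1 - exp (- (pi\<^sup>2 / (2 * \<gamma>) * t))) + 1"
  have C: "C > 0" using heat_decay_rate[OF \<gamma> t] by (simp add: C_def add_pos_pos)
  have hc: "continuous_on {0..1} (heat_profile \<gamma> F f t)"
    using heat_profile_continuous[OF \<gamma> t f] by (rule continuous_on_subset) simp
  have bound: "\<bar>?l - ?r\<bar> \<le> C * e" if e: "e > 0" for e
  proof -
    obtain K c where "finite K"
      "(LBINT u:{0..1}. (f u - heat_sum \<gamma> F K c 0 u)\<^sup>2) \<le> e\<^sup>2"
      and K2: "\<And>u. \<bar>heat_profile \<gamma> F f t u - heat_sum \<gamma> F K c t u\<bar> \<le> 2 * e / (1 - exp (- (pi\<^sup>2 / (2 * \<gamma>) * t)))"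
      and K3: "\<And>k. k \<noteq> 0 \<Longrightarrow> \<bar>(LBINT u:{0..1}. heat_sum \<gamma> F K c t u * sin (pi * real k * u))
        - (F * (LBINT u:{0..1}. u * sin (pi * real k * u))
          + exp (- (pi\<^sup>2 * (real k)\<^sup>2 / (2 * \<gamma>) * t)) * sine_coeff F f k)\<bar> \<le> e"
      by (rule heat_profile_approx[OF \<gamma> t f e]) (rule that; blast)
    have sc: "continuous_on {0..1} (heat_sum \<gamma> F K c t)"
      unfolding heat_sum_def[abs_def] by (intro continuous_intros)
    have "?l - (LBINT u:{0..1}. heat_sum \<gamma> F K c t u * sin (pi * real k * u))
      = (LBINT u:{0..1}. heat_profile \<gamma> F f t u * sin (pi * real k * u) - heat_sum \<gamma> F K c t u * sin (pi * real k * u))"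
      by (rule set_integral_diff(2)[symmetric]) (intro set_integrable_continuous01 continuous_intros hc sc)+
    also have "\<dots> = (LBINT u:{0..1}. sin (pi * real k * u) * (heat_profile \<gamma> F f t u - heat_sum \<gamma> F K c t u))"
      by (simp add: algebra_simps)
    finally have "\<bar>?l - (LBINT u:{0..1}. heat_sum \<gamma> F K c t u * sin (pi * real k * u))\<bar>
       \<le> 2 * e / (1 - exp (- (pi\<^sup>2 / (2 * \<gamma>) * t))) * (LBINT u:{0..1}. \<bar>sin (pi * real k * u)\<bar>)"
      by (simp only:) (intro LBINT_abs_bound K2 continuous_intros hc sc)
    also have "\<dots> \<le> 2 * e / (1 - exp (- (pi\<^sup>2 / (2 * \<gamma>) * t))) * 1"
    proof (rule mult_left_mono)
      have "(LBINT u:{0..1}. \<bar>sin (pi * real k * u)\<bar>) \<le> (LBINT u:{0..1::real}. 1)"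
        by (rule set_integral_mono) (auto intro!: set_integrable_continuous01 continuous_intros)
      then show "(LBINT u:{0..1}. \<bar>sin (pi * real k * u)\<bar>) \<le> 1" by (simp add: set_lebesgue_integral_def)
      show "0 \<le> 2 * e / (1 - exp (- (pi\<^sup>2 / (2 * \<gamma>) * t)))"
        using e heat_decay_rate[OF \<gamma> t] by simp
    qed
    finally have "\<bar>?l - ?r\<bar> \<le> 2 * e / (1 - exp (- (pi\<^sup>2 / (2 * \<gamma>) * t))) + e"
      using K3[OF k] by linarith
    then show ?thesis by (simp add: C_def algebra_simps)
  qed
  have "\<bar>?l - ?r\<bar> \<le> 0 + e" if e: "e > 0" for e
  proof -
    have "\<bar>?l - ?r\<bar> \<le> C * (e / C)" using e C by (intro bound) simp
    then show ?thesis using C by simp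
  qed
  then have "\<bar>?l - ?r\<bar> \<le> 0" by (rule field_le_epsilon)
  then show ?thesis by simp
qed

text \<open>The sine vanishes at both endpoints and is an eigenfunction of the second derivative, so
  the weak formulation closes into a scalar linear equation for this coefficient, with the boundary
  force as a constant source.\<close>

lemma stretch_solution_sine_coeff:
  assumes R: "stretch_solution \<gamma> F f R" and \<gamma>: "\<gamma> > 0" and t: "t \<ge> 0" and f: "continuous_on {0..1} f" and k: "k \<noteq> 0"
  shows "signed_integral (R t) (\<lambda>u. sin (pi * real k * u))
    = F * (LBINT u:{0..1}. u * sin (pi * real k * u))
          + exp (- (pi\<^sup>2 * (real k)\<^sup>2 / (2 * \<gamma>) * t)) * sine_coeff F f k"
proof -
  define s where "s u = sin (pi * real k * u)" for u
  define m where "m t = signed_integral (R t) s" for t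
  define a where "a = (pi * real k)\<^sup>2 / (2 * \<gamma>)"
  define b where "b = F * (pi * real k * cos (pi * real k)) / (2 * \<gamma>)"
  have a: "a > 0" using \<gamma> k by (simp add: a_def)
  have s_cont: "continuous_on {0..1} s" unfolding s_def[abs_def] by (intro continuous_intros)
  have m_cont: "continuous_on {0..} m"
    using R s_cont unfolding stretch_solution_def m_def[abs_def] by blast
  have weak: "signed_integral (R t) \<phi> - (LBINT u:{0..1}. \<phi> u * f u) =
      1 / (2 * \<gamma>) * (LBINT s:{0..t}. signed_integral (R s) \<phi>'') - F * t / (2 * \<gamma>) * \<phi>' 1"
    if "\<forall>u\<in>{0..1}. (\<phi> has_real_derivative \<phi>' u) (at u within {0..1})"
      "\<forall>u\<in>{0..1}. (\<phi>' has_real_derivative \<phi>'' u) (at u within {0..1})"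
      "continuous_on {0..1} \<phi>''" "\<phi> 0 = 0" "\<phi> 1 = 0" "t \<ge> 0" for \<phi> \<phi>' \<phi>'' t
    using R that unfolding stretch_solution_def by blast
  have eq: "m t = (LBINT u:{0..1}. s u * f u) - a * (LBINT s:{0..t}. m s) - b * t" if t: "t \<ge> 0" for t
  proof -
    have "signed_integral (R t) s - (LBINT u:{0..1}. s u * f u) =
        1 / (2 * \<gamma>) * (LBINT v:{0..t}. signed_integral (R v) (\<lambda>u. - ((pi * real k)\<^sup>2) * s u))
        - F * t / (2 * \<gamma>) * (pi * real k * cos (pi * real k * 1))"
    proof -
      have "(s has_real_derivative pi * real k * cos (pi * real k * u)) (at u within {0..1})" for u
        unfolding s_def[abs_def] by (auto intro!: derivative_eq_intros)
      moreover have "((\<lambda>u. pi * real k * cos (pi * real k * u)) has_real_derivative - ((pi * real k)\<^sup>2) * s u) (at u within {0..1})" for u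
        unfolding s_def[abs_def] by (auto intro!: derivative_eq_intros simp: power2_eq_square)
      moreover have "continuous_on {0..1} (\<lambda>u. - ((pi * real k)\<^sup>2) * s u)"
        by (intro continuous_intros s_cont)
      moreover have "s 0 = 0" "s 1 = 0" using sin_npi2[of k] by (simp_all add: s_def)
      ultimately show ?thesis by (intro weak[where \<phi>' = "\<lambda>u. pi * real k * cos (pi * real k * u)"] ballI t)
    qed
    moreover have "signed_integral (R v) (\<lambda>u. - ((pi * real k)\<^sup>2) * s u) = - ((pi * real k)\<^sup>2) * m v" for v
      unfolding signed_integral_def m_def by (simp add: right_diff_distrib)
    moreover have "(LBINT v:{0..t}. - ((pi * real k)\<^sup>2) * m v) = - ((pi * real k)\<^sup>2) * (LBINT v:{0..t}. m v)"
      by (rule set_integral_mult_right)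
    ultimately have "m t - (LBINT u:{0..1}. s u * f u) =
        1 / (2 * \<gamma>) * (- ((pi * real k)\<^sup>2) * (LBINT v:{0..t}. m v)) - F * t / (2 * \<gamma>) * (pi * real k * cos (pi * real k * 1))"
      by (simp only: m_def)
    moreover have "1 / (2 * \<gamma>) * (- ((pi * real k)\<^sup>2) * (LBINT v:{0..t}. m v)) = - (a * (LBINT v:{0..t}. m v))"
      by (simp add: a_def)
    moreover have "F * t / (2 * \<gamma>) * (pi * real k * cos (pi * real k * 1)) = b * t"
      by (simp add: b_def)
    ultimately show ?thesis by linarith
  qed
  have "m t = - b / a + exp (- (a * t)) * ((LBINT u:{0..1}. s u * f u) + b / a)"
    by (rule linear_integral_equation[OF m_cont a t eq])
  \<comment> \<open>The equilibrium of the scalar equation is the sine coefficient of the stationary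
    profile \<open>F * u\<close>.\<close>
  moreover have ba: "- b / a = F * (LBINT u:{0..1}. u * s u)"
    unfolding s_def LBINT_ident_mult_sin[OF k] a_def b_def using \<gamma> k by (simp add: field_simps power2_eq_square)
  moreover have "(LBINT u:{0..1}. s u * f u) + b / a = sine_coeff F f k"
  proof -
    have "sine_coeff F f k = (LBINT u:{0..1}. s u * f u - F * (u * s u))"
      unfolding sine_coeff_def s_def by (simp add: algebra_simps)
    also have "\<dots> = (LBINT u:{0..1}. s u * f u) - F * (LBINT u:{0..1}. u * s u)"
      by (subst set_integral_diff) (auto intro!: set_integrable_continuous01 continuous_intros s_cont f)
    finally show ?thesis using ba by simp
  qed
  ultimately have "m t = F * (LBINT u:{0..1}. u * s u) + exp (- (a * t)) * sine_coeff F f k"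
    by (simp only:)
  then show ?thesis unfolding m_def s_def[abs_def] a_def power_mult_distrib .
qed

text \<open>Both functions have the same sine coefficients, so completeness of the sines identifies
  them. A density is determined only almost everywhere.\<close>

lemma stretch_density_eq_heat_profile:
  assumes R: "stretch_solution \<gamma> F f R" and \<gamma>: "\<gamma> > 0" and t: "t > 0" and f: "continuous_on {0..1} f"
    and d: "signed_density (R t) \<rho>"
  shows "AE u in lborel. u \<in> {0..1} \<longrightarrow> \<rho> u = heat_profile \<gamma> F f t u"
proof -
  have hc: "continuous_on {0..1} (heat_profile \<gamma> F f t)"
    using heat_profile_continuous[OF \<gamma> t f] by (rule continuous_on_subset) simp
  have \<rho>: "set_integrable lborel {0..1} \<rho>" using d by (simp add: signed_density_def)
  have "AE u in lborel. u \<in> {0..1} \<longrightarrow> \<rho> u - heat_profile \<gamma> F f t u = 0"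
  proof (rule sine_coefficients_zero)
    show "set_integrable lborel {0..1} (\<lambda>u. \<rho> u - heat_profile \<gamma> F f t u)"
      by (intro set_integral_diff \<rho> set_integrable_continuous01 hc)
    fix k :: nat assume k: "k \<noteq> 0"
    have sm: "signed_measure01 (R t)" using R t by (simp add: stretch_solution_def)
    have i: "set_integrable lborel {0..1} (\<lambda>u. \<rho> u * sin (pi * real k * u))"
      unfolding set_integrable_def
    proof (rule Bochner_Integration.integrable_bound)
      show "integrable lborel (\<lambda>u. indicator {0..1} u *\<^sub>R \<rho> u)" using \<rho> by (simp only: set_integrable_def)
      have "(\<lambda>u. (indicator {0..1} u *\<^sub>R \<rho> u) * sin (pi * real k * u)) \<in> borel_measurable lborel"
        by (rule borel_measurable_times[OF borel_measurable_integrable[OF \<rho>[unfolded set_integrable_def]]]) simp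
      then show "(\<lambda>u. indicator {0..1} u *\<^sub>R (\<rho> u * sin (pi * real k * u))) \<in> borel_measurable lborel"
        by (simp add: mult.assoc)
      show "AE u in lborel. norm (indicator {0..1} u *\<^sub>R (\<rho> u * sin (pi * real k * u))) \<le> norm (indicator {0..1} u *\<^sub>R \<rho> u)"
        by (rule AE_I2) (auto simp: abs_mult mult_left_le split: split_indicator)
    qed
    have "(LBINT u:{0..1}. (\<rho> u - heat_profile \<gamma> F f t u) * sin (pi * real k * u))
      = (LBINT u:{0..1}. \<rho> u * sin (pi * real k * u)) - (LBINT u:{0..1}. heat_profile \<gamma> F f t u * sin (pi * real k * u))"
      unfolding left_diff_distrib
      by (intro set_integral_diff i) (intro set_integrable_continuous01 continuous_intros hc)
    also have "(LBINT u:{0..1}. \<rho> u * sin (pi * real k * u)) = signed_integral (R t) (\<lambda>u. sin (pi * real k * u))"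
      by (rule signed_integral_density[symmetric, OF sm d]) (intro continuous_intros)
    finally show "(LBINT u:{0..1}. (\<rho> u - heat_profile \<gamma> F f t u) * sin (pi * real k * u)) = 0"
      using stretch_solution_sine_coeff[OF R \<gamma> _ f k] heat_profile_sine_coeff[OF \<gamma> t f k] t by simp
  qed
  then show ?thesis by simp
qed

subsection \<open>Hydrodynamic limit of the averaged chain\<close>

lemma force_series_uniform:
  assumes "force_coeffs Fhat"
  shows "uniform_limit UNIV
    (\<lambda>L t. \<Sum>l\<in>L. Fhat l * exp (\<i> * of_int l * of_real (2 * pi / \<theta>) * of_real t))
    (\<lambda>t::real. \<Sum>\<^sub>\<infinity>l\<in>-{0}. Fhat l * exp (\<i> * of_int l * of_real (2 * pi / \<theta>) * of_real t))
    (finite_subsets_at_top (-{0}))"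
proof (rule Weierstrass_m_test_general)
  \<comment> \<open>Exponent zero in the decay condition gives absolute summability of the
    coefficients.\<close>
  have "(\<lambda>l. \<bar>real_of_int l\<bar> ^ 0 * norm (Fhat l)) summable_on -{0}"
    using assms unfolding force_coeffs_def by blast
  then show "(\<lambda>l. norm (Fhat l)) summable_on -{0}" by simp
  fix l :: int and t :: real
  have "norm (exp (\<i> * of_int l * of_real (2 * pi / \<theta>) * of_real t) :: complex) = 1"
    using norm_exp_i_times_real[of "of_int l * (2 * pi / \<theta>)" t] by (simp add: mult.assoc)
  then show "norm (Fhat l * exp (\<i> * of_int l * of_real (2 * pi / \<theta>) * of_real t)) \<le> norm (Fhat l)"
    by (simp add: norm_mult)
qed

lemma force_continuous:
  assumes "force_coeffs Fhat"
  shows "continuous_on A (force \<theta> Fbar Fhat n)"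
proof -
  have "continuous_on UNIV (\<lambda>t::real. \<Sum>\<^sub>\<infinity>l\<in>-{0}. Fhat l * exp (\<i> * of_int l * of_real (2 * pi / \<theta>) * of_real t))"
  proof (rule uniform_limit_theorem[OF _ force_series_uniform[OF assms]])
    define c where "c = 2 * pi / \<theta>"
    show "\<forall>\<^sub>F L in finite_subsets_at_top (-{0}). continuous_on UNIV
        (\<lambda>t::real. \<Sum>l\<in>L. Fhat l * exp (\<i> * of_int l * of_real (2 * pi / \<theta>) * of_real t))"
      unfolding c_def[symmetric] by (intro always_eventually allI continuous_intros)
  qed simp
  then have "continuous_on UNIV (force \<theta> Fbar Fhat n)"
    unfolding force_def[abs_def] by (intro continuous_intros)
  then show ?thesis by (rule continuous_on_subset) simp
qed

text \<open>The amplitude \<open>1 / sqrt n\<close> factors out of the series, so one finite mode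
  set \<open>L\<close> serves all \<open>n\<close> and \<open>t\<close>, with an error carrying the
  same amplitude.\<close>

lemma force_truncation:
  assumes "force_coeffs Fhat" "e > 0"
  shows "\<exists>L. finite L \<and> 0 \<notin> L \<and> (\<forall>n t. n \<ge> 1 \<longrightarrow> \<bar>force \<theta> Fbar Fhat n t - Fbar - 1 / sqrt (real n) *
     (\<Sum>l\<in>L. Re (Fhat l * exp (\<i> * of_real (of_int l * (2 * pi / \<theta>)) * of_real t)))\<bar> \<le> e / sqrt (real n))"
proof -
  let ?S = "\<lambda>L t. \<Sum>l\<in>L. Fhat l * exp (\<i> * of_int l * of_real (2 * pi / \<theta>) * of_real t)"
  let ?I = "\<lambda>t::real. \<Sum>\<^sub>\<infinity>l\<in>-{0}. Fhat l * exp (\<i> * of_int l * of_real (2 * pi / \<theta>) * of_real t)"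
  have "\<exists>L. finite L \<and> L \<subseteq> -{0} \<and> (\<forall>Y. finite Y \<and> L \<subseteq> Y \<and> Y \<subseteq> -{0} \<longrightarrow> (\<forall>t\<in>UNIV. dist (?S Y t) (?I t) < e))"
    using uniform_limitD[OF force_series_uniform[OF assms(1), of \<theta>] assms(2)]
    unfolding eventually_finite_subsets_at_top .
  then obtain L where L: "finite L" "L \<subseteq> -{0}"
    and L': "\<forall>Y. finite Y \<and> L \<subseteq> Y \<and> Y \<subseteq> -{0} \<longrightarrow> (\<forall>t\<in>UNIV. dist (?S Y t) (?I t) < e)"
    by (elim exE conjE)
  have close: "dist (?S L t) (?I t) < e" for t
    using L'[rule_format, of L t] L by simp
  have "\<bar>force \<theta> Fbar Fhat n t - Fbar - 1 / sqrt (real n) *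
     (\<Sum>l\<in>L. Re (Fhat l * exp (\<i> * of_real (of_int l * (2 * pi / \<theta>)) * of_real t)))\<bar> \<le> e / sqrt (real n)"
    if "n \<ge> 1" for n :: nat and t :: real
  proof -
    let ?S = "?S L t" and ?I = "?I t"
    have S: "(\<Sum>l\<in>L. Re (Fhat l * exp (\<i> * of_real (of_int l * (2 * pi / \<theta>)) * of_real t))) = Re ?S"
      unfolding Re_sum by (intro sum.cong refl) (simp add: mult.assoc)
    have "\<bar>Re ?I - Re ?S\<bar> \<le> e"
      using abs_Re_le_cmod[of "?I - ?S"] close[of t] by (simp add: dist_norm norm_minus_commute)
    then have "1 / sqrt (real n) * \<bar>Re ?I - Re ?S\<bar> \<le> 1 / sqrt (real n) * e"
      by (intro mult_left_mono) auto
    moreover have "\<bar>force \<theta> Fbar Fhat n t - Fbar - 1 / sqrt (real n) * Re ?S\<bar> = 1 / sqrt (real n) * \<bar>Re ?I - Re ?S\<bar>"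
    proof -
      have "force \<theta> Fbar Fhat n t - Fbar - 1 / sqrt (real n) * Re ?S = 1 / sqrt (real n) * (Re ?I - Re ?S)"
        unfolding force_def by (simp only: right_diff_distrib add_diff_cancel_left')
      then show ?thesis by (simp add: abs_mult)
    qed
    ultimately show ?thesis unfolding S by simp
  qed
  then show ?thesis using L by blast
qed

text \<open>For each \<open>e\<close> the initial profile and the force are replaced by finitely
  many modes. Then \<open>chain_hydrodynamic_finite\<close>, together with the distance of
  \<open>heat_sum\<close> from \<open>heat_profile\<close>, bounds the limit superior by
  \<open>C * e^2\<close> with \<open>C\<close> independent of \<open>e\<close>.\<close>

lemma chain_hydrodynamic_limit:
  fixes r p :: "nat \<Rightarrow> nat \<Rightarrow> real \<Rightarrow> real"
  assumes \<gamma>: "\<gamma> > 0" and t: "t > 0" and \<theta>: "\<theta> > 0" and Fhat: "force_coeffs Fhat"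
    and rini: "continuous_on {0..1} rini"
    and ode: "\<And>n. n \<ge> 1 \<Longrightarrow> chain_ode n \<gamma> (r n) (p n) (\<lambda>x s. if x = n then force \<theta> Fbar Fhat n s else 0)"
    and H: "\<And>n. n \<ge> 1 \<Longrightarrow> chain_energy n (r n) (p n) 0 \<le> H * real n"
    and init: "(\<lambda>n. 1 / real n * (\<Sum>x=1..n. (r n x 0 - rini (real x / real n))\<^sup>2)) \<longlonglongrightarrow> 0"
  shows "(\<lambda>n. 1 / real n * (\<Sum>x=1..n. (r n x ((real n)\<^sup>2 * t) - heat_profile \<gamma> Fbar rini t (real x / real n))\<^sup>2)
     + 1 / real n * (\<Sum>x\<le>n. (p n x ((real n)\<^sup>2 * t))\<^sup>2)) \<longlonglongrightarrow> 0" (is "?D \<longlonglongrightarrow> 0")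
proof -
  define q where "q = exp (- (pi\<^sup>2 / (2 * \<gamma>) * t))"
  \<comment> \<open>The bracket is the bound of \<open>chain_hydrodynamic_finite\<close> for initial
    mismatch \<open>5 * e^2\<close>, force error \<open>e\<close> and slack \<open>e^2\<close>. The
    last term comes from truncating the profile at time \<open>t\<close>; both factors 2 in front
    come from splitting a square.\<close>
  define C where "C = 2 * (32 * \<gamma> / t * 5 + 6 * t / \<gamma> + 1) + 2 * (2 / (1 - q))\<^sup>2"
  have C: "C > 0"
  proof -
    have "0 < 32 * \<gamma> / t * 5 + 6 * t / \<gamma> + 1" using \<gamma> t by (intro add_nonneg_pos add_nonneg_nonneg) auto
    then show ?thesis unfolding C_def by (rule add_pos_nonneg[OF mult_pos_pos, rotated]) simp_all
  qed
  have D0: "?D n \<ge> 0" for n by (simp add: sum_nonneg)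
  have main: "\<forall>\<^sub>F n in sequentially. ?D n \<le> C * e\<^sup>2" if e: "e > 0" for e
  proof -
    obtain K c where K: "finite K"
      and K1: "(LBINT u:{0..1}. (rini u - heat_sum \<gamma> Fbar K c 0 u)\<^sup>2) \<le> e\<^sup>2"
      and K2: "\<And>u. \<bar>heat_profile \<gamma> Fbar rini t u - heat_sum \<gamma> Fbar K c t u\<bar> \<le> 2 * e / (1 - exp (- (pi\<^sup>2 / (2 * \<gamma>) * t)))"
      and "\<And>k. k \<noteq> 0 \<Longrightarrow> \<bar>(LBINT u:{0..1}. heat_sum \<gamma> Fbar K c t u * sin (pi * real k * u))
        - (Fbar * (LBINT u:{0..1}. u * sin (pi * real k * u))
          + exp (- (pi\<^sup>2 * (real k)\<^sup>2 / (2 * \<gamma>) * t)) * sine_coeff Fbar rini k)\<bar> \<le> e"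
      by (rule heat_profile_approx[OF \<gamma> t rini e, where F = Fbar]) (rule that; blast)
    obtain L where L: "finite L" "0 \<notin> L" and LF': "\<forall>n t. n \<ge> 1 \<longrightarrow> \<bar>force \<theta> Fbar Fhat n t - Fbar - 1 / sqrt (real n) *
       (\<Sum>l\<in>L. Re (Fhat l * exp (\<i> * of_real (of_int l * (2 * pi / \<theta>)) * of_real t)))\<bar> \<le> e / sqrt (real n)"
      using force_truncation[OF Fhat e, where \<theta> = \<theta> and Fbar = Fbar] by (elim exE conjE)
    note LF = LF'[rule_format]
    have sq: "(a + b)\<^sup>2 \<le> 2 * a\<^sup>2 + 2 * b\<^sup>2" for a b :: real
      using sum_squares_bound[of a b] by (simp add: power2_sum)
    \<comment> \<open>The majorant converges to at most \<open>2 * e^2\<close>; the constant 5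
      merely leaves room above this limit.\<close>
    have "\<forall>\<^sub>F n in sequentially. 1 / real n * (\<Sum>x=1..n. (r n x 0 - heat_sum \<gamma> Fbar K c 0 (real x / real n))\<^sup>2) \<le> 5 * e\<^sup>2"
    proof -
      have hc: "continuous_on {0..1} (\<lambda>u. (rini u - heat_sum \<gamma> Fbar K c 0 u)\<^sup>2)"
        unfolding heat_sum_def by (intro continuous_intros rini)
      have "(\<lambda>n. 2 * (1 / real n * (\<Sum>x=1..n. (r n x 0 - rini (real x / real n))\<^sup>2))
         + 2 * (1 / real n * (\<Sum>x=1..n. (rini (real x / real n) - heat_sum \<gamma> Fbar K c 0 (real x / real n))\<^sup>2)))
         \<longlonglongrightarrow> 2 * 0 + 2 * (LBINT u:{0..1}. (rini u - heat_sum \<gamma> Fbar K c 0 u)\<^sup>2)"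
        by (intro tendsto_add tendsto_mult tendsto_const init riemann_sum_tendsto[OF hc])
      moreover have "2 * 0 + 2 * (LBINT u:{0..1}. (rini u - heat_sum \<gamma> Fbar K c 0 u)\<^sup>2) < 5 * e\<^sup>2"
      proof -
        have "0 < e\<^sup>2" using e by simp
        then show ?thesis using K1 by linarith
      qed
      ultimately have "\<forall>\<^sub>F n in sequentially. 2 * (1 / real n * (\<Sum>x=1..n. (r n x 0 - rini (real x / real n))\<^sup>2))
         + 2 * (1 / real n * (\<Sum>x=1..n. (rini (real x / real n) - heat_sum \<gamma> Fbar K c 0 (real x / real n))\<^sup>2)) < 5 * e\<^sup>2"
        by (rule order_tendstoD)
      then show ?thesis
      proof eventually_elim
        case (elim n)
        have "(\<Sum>x=1..n. (r n x 0 - heat_sum \<gamma> Fbar K c 0 (real x / real n))\<^sup>2)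
           \<le> (\<Sum>x=1..n. 2 * (r n x 0 - rini (real x / real n))\<^sup>2 + 2 * (rini (real x / real n) - heat_sum \<gamma> Fbar K c 0 (real x / real n))\<^sup>2)"
          by (rule sum_mono) (use sq in \<open>metis diff_add_cancel add_diff_eq\<close>)
        then have "1 / real n * (\<Sum>x=1..n. (r n x 0 - heat_sum \<gamma> Fbar K c 0 (real x / real n))\<^sup>2)
           \<le> 1 / real n * (\<Sum>x=1..n. 2 * (r n x 0 - rini (real x / real n))\<^sup>2 + 2 * (rini (real x / real n) - heat_sum \<gamma> Fbar K c 0 (real x / real n))\<^sup>2)"
          by (intro mult_left_mono) auto
        also have "\<dots> = 2 * (1 / real n * (\<Sum>x=1..n. (r n x 0 - rini (real x / real n))\<^sup>2))
         + 2 * (1 / real n * (\<Sum>x=1..n. (rini (real x / real n) - heat_sum \<gamma> Fbar K c 0 (real x / real n))\<^sup>2))"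
          by (simp only: sum.distrib sum_distrib_left[symmetric] distrib_left mult.left_commute[of 2])
        finally show ?case using elim by linarith
      qed
    qed
    then have "\<forall>\<^sub>F n in sequentially.
       1 / real n * (\<Sum>x=1..n. (r n x ((real n)\<^sup>2 * t) - heat_sum \<gamma> Fbar K c t (real x / real n))\<^sup>2)
         + 1 / real n * (\<Sum>x\<le>n. (p n x ((real n)\<^sup>2 * t))\<^sup>2)
       \<le> 32 * \<gamma> / t * (5 * e\<^sup>2) + 6 * t / \<gamma> * e\<^sup>2 + e\<^sup>2"
      by (intro chain_hydrodynamic_finite[where f = Fhat and \<omega> = "\<lambda>l. of_int l * (2 * pi / \<theta>)" and L = L, OF \<gamma> t K L(1) _ ode LF H])
        (use L(2) \<theta> e in auto)
    then show ?thesis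
    proof eventually_elim
      case (elim n)
      show ?case
      proof (cases "n = 0")
        case True
        then show ?thesis using C by simp
      next
        case False
        let ?h = "\<lambda>x. heat_sum \<gamma> Fbar K c t (real x / real n)" and ?v = "\<lambda>x. heat_profile \<gamma> Fbar rini t (real x / real n)"
        let ?r = "\<lambda>x. r n x ((real n)\<^sup>2 * t)"
        have hv: "(?h x - ?v x)\<^sup>2 \<le> (2 / (1 - q))\<^sup>2 * e\<^sup>2" for x
        proof -
          have "\<bar>?h x - ?v x\<bar> \<le> 2 * e / (1 - q)"
            using K2[of "real x / real n"] by (simp add: q_def abs_minus_commute)
          then have "(?h x - ?v x)\<^sup>2 \<le> (2 * e / (1 - q))\<^sup>2"
            by (metis abs_ge_zero abs_le_square_iff abs_of_nonneg order.trans)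
          then show ?thesis by (simp add: power_divide power_mult_distrib)
        qed
        have "(\<Sum>x=1..n. (?r x - ?v x)\<^sup>2) \<le> (\<Sum>x=1..n. 2 * (?r x - ?h x)\<^sup>2 + 2 * ((2 / (1 - q))\<^sup>2 * e\<^sup>2))"
        proof (rule sum_mono)
          fix x
          show "(?r x - ?v x)\<^sup>2 \<le> 2 * (?r x - ?h x)\<^sup>2 + 2 * ((2 / (1 - q))\<^sup>2 * e\<^sup>2)"
            using sq[of "?r x - ?h x" "?h x - ?v x"] hv[of x] by simp
        qed
        also have "\<dots> = 2 * (\<Sum>x=1..n. (?r x - ?h x)\<^sup>2) + real n * (2 * ((2 / (1 - q))\<^sup>2 * e\<^sup>2))"
          by (simp add: sum.distrib sum_distrib_left)
        finally have "1 / real n * (\<Sum>x=1..n. (?r x - ?v x)\<^sup>2) \<le> 1 / real n * (2 * (\<Sum>x=1..n. (?r x - ?h x)\<^sup>2) + real n * (2 * ((2 / (1 - q))\<^sup>2 * e\<^sup>2)))"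
          by (intro mult_left_mono) auto
        also have "\<dots> = 2 * (1 / real n * (\<Sum>x=1..n. (?r x - ?h x)\<^sup>2)) + 2 * ((2 / (1 - q))\<^sup>2 * e\<^sup>2)"
          using False by (simp add: distrib_left)
        finally have 1: "1 / real n * (\<Sum>x=1..n. (?r x - ?v x)\<^sup>2) \<le> 2 * (1 / real n * (\<Sum>x=1..n. (?r x - ?h x)\<^sup>2)) + 2 * ((2 / (1 - q))\<^sup>2 * e\<^sup>2)" .
        have 2: "1 / real n * (\<Sum>x\<le>n. (p n x ((real n)\<^sup>2 * t))\<^sup>2) \<ge> 0" by (simp add: sum_nonneg)
        have 3: "C * e\<^sup>2 = 2 * (32 * \<gamma> / t * (5 * e\<^sup>2) + 6 * t / \<gamma> * e\<^sup>2 + e\<^sup>2) + 2 * ((2 / (1 - q))\<^sup>2 * e\<^sup>2)"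
          unfolding C_def by (simp add: distrib_right)
        have arith: "z + y \<le> 2 * c + d" if "w + y \<le> c" "z \<le> 2 * w + d" "0 \<le> y" for w y z c d :: real
          using that by linarith
        show ?thesis unfolding 3 by (rule arith[OF elim 1 2])
      qed
    qed
  qed
  show ?thesis
  proof (rule order_tendstoI)
    fix a :: real assume "a < 0"
    then show "\<forall>\<^sub>F n in sequentially. a < ?D n"
      using D0 by (intro always_eventually allI) (meson less_le_trans)
  next
    fix a :: real assume a: "0 < a"
    \<comment> \<open>This choice of \<open>e\<close> gives \<open>C * e^2 = a / 2\<close>.\<close>
    have "\<forall>\<^sub>F n in sequentially. ?D n \<le> C * (sqrt (a / (2 * C)))\<^sup>2"
      by (rule main) (use a C in simp)
    moreover have "C * (sqrt (a / (2 * C)))\<^sup>2 < a" using a C by simp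
    ultimately show "\<forall>\<^sub>F n in sequentially. ?D n < a"
      by (auto elim!: eventually_mono)
  qed
qed

text \<open>Mean square closeness of \<open>r\<close> to \<open>v\<close> suffices for both
  averages. The linear one uses Cauchy-Schwarz. For the quadratic one \<open>r^2\<close> is expanded
  around \<open>v\<close>, so that only the averaged square of \<open>r - v\<close> and a linear
  average with weight \<open>\<phi> * v\<close> have to vanish; no pointwise bound on
  \<open>r\<close> enters.\<close>

lemma average_limits:
  fixes r p :: "nat \<Rightarrow> nat \<Rightarrow> real" and v \<phi> :: "real \<Rightarrow> real"
  assumes v: "continuous_on {0..1} v" and \<phi>: "continuous_on {0..1} \<phi>" and r0: "\<And>n. r n 0 = 0"
    and D: "(\<lambda>n. 1 / real n * (\<Sum>x=1..n. (r n x - v (real x / real n))\<^sup>2) + 1 / real n * (\<Sum>x\<le>n. (p n x)\<^sup>2)) \<longlonglongrightarrow> 0"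
  shows "(\<lambda>n. 1 / real n * (\<Sum>x=1..n. \<phi> (real x / real n) * r n x)) \<longlonglongrightarrow> (LBINT u:{0..1}. v u * \<phi> u)"
    and "(\<lambda>n. 1 / real n * (\<Sum>x=0..n. \<phi> (real x / real n) * (1 / 2 * ((p n x)\<^sup>2 + (r n x)\<^sup>2))))
       \<longlonglongrightarrow> (LBINT u:{0..1}. \<phi> u * (1 / 2 * (v u)\<^sup>2))"
proof -
  obtain B where B: "B > 0" "\<And>u. u \<in> {0..1} \<Longrightarrow> \<bar>\<phi> u\<bar> \<le> B" using continuous01_bounded[OF \<phi>] by blast
  obtain V where V: "V > 0" "\<And>u. u \<in> {0..1} \<Longrightarrow> \<bar>v u\<bar> \<le> V" using continuous01_bounded[OF v] by blast
  define A where "A n = 1 / real n * (\<Sum>x=1..n. (r n x - v (real x / real n))\<^sup>2)" for n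
  define P where "P n = 1 / real n * (\<Sum>x\<le>n. (p n x)\<^sup>2)" for n
  have A0: "A n \<ge> 0" and P0: "P n \<ge> 0" for n by (simp_all add: A_def P_def sum_nonneg)
  have D: "(\<lambda>n. A n + P n) \<longlonglongrightarrow> 0" using D by (simp only: A_def P_def)
  have A: "A \<longlonglongrightarrow> 0" and P: "P \<longlonglongrightarrow> 0"
    by (rule tendsto_sandwich[OF _ _ tendsto_const D]; use A0 P0 in simp)+
  have sA: "(\<lambda>n. sqrt (A n)) \<longlonglongrightarrow> 0" using tendsto_real_sqrt[OF A] by simp
  have unit: "real x / real n \<in> {0..1}" if "x \<le> n" for x n :: nat
    using that by (auto simp: divide_simps)
  have L1: "1 / real n * (\<Sum>x=1..n. \<bar>r n x - v (real x / real n)\<bar>) \<le> sqrt (A n)" for n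
  proof (cases "n = 0")
    case False
    let ?d = "\<lambda>x. \<bar>r n x - v (real x / real n)\<bar>"
    have "(\<Sum>x=1..n. ?d x)\<^sup>2 \<le> real (card {1..n}) * (\<Sum>x=1..n. (?d x)\<^sup>2)"
      using sum_squared_le_sum_of_squares[of ?d "{1..n}"] by (simp add: mult.commute)
    then have "(1 / real n * (\<Sum>x=1..n. ?d x))\<^sup>2 \<le> A n"
      using False by (simp add: A_def power_mult_distrib power2_eq_square field_simps)
    then show ?thesis by (rule real_le_rsqrt)
  qed (simp add: A_def)
  \<comment> \<open>Stated for a general bounded weight, since it is used with \<open>\<phi>\<close>
    for the stretch and with \<open>\<phi> * v\<close> for the cross term of the energy.\<close>
  have lin: "(\<lambda>n. 1 / real n * (\<Sum>x=1..n. \<psi> (real x / real n) * (r n x - v (real x / real n)))) \<longlonglongrightarrow> 0"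
    if \<psi>: "\<And>u. u \<in> {0..1} \<Longrightarrow> \<bar>\<psi> u\<bar> \<le> W" for \<psi> W
  proof (rule Lim_null_comparison[OF always_eventually])
    show "(\<lambda>n. W * sqrt (A n)) \<longlonglongrightarrow> 0" using tendsto_mult[OF tendsto_const sA, of W] by simp
    have W: "W \<ge> 0" using \<psi>[of 0] by simp
    show "\<forall>n. norm (1 / real n * (\<Sum>x=1..n. \<psi> (real x / real n) * (r n x - v (real x / real n)))) \<le> W * sqrt (A n)"
    proof
      fix n
      have "\<bar>\<Sum>x=1..n. \<psi> (real x / real n) * (r n x - v (real x / real n))\<bar> \<le> (\<Sum>x=1..n. W * \<bar>r n x - v (real x / real n)\<bar>)"
        by (rule order.trans[OF sum_abs], rule sum_mono, unfold abs_mult)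
          (intro mult_right_mono \<psi> unit, auto)
      then have "1 / real n * \<bar>\<Sum>x=1..n. \<psi> (real x / real n) * (r n x - v (real x / real n))\<bar>
         \<le> 1 / real n * (\<Sum>x=1..n. W * \<bar>r n x - v (real x / real n)\<bar>)" by (intro mult_left_mono) auto
      also have "\<dots> = W * (1 / real n * (\<Sum>x=1..n. \<bar>r n x - v (real x / real n)\<bar>))"
        by (simp add: sum_distrib_left[symmetric])
      also have "\<dots> \<le> W * sqrt (A n)" by (intro mult_left_mono L1 W)
      finally show "norm (1 / real n * (\<Sum>x=1..n. \<psi> (real x / real n) * (r n x - v (real x / real n)))) \<le> W * sqrt (A n)"
        by (simp add: abs_mult)
    qed
  qed
  have "(\<lambda>n. 1 / real n * (\<Sum>x=1..n. v (real x / real n) * \<phi> (real x / real n))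
      + 1 / real n * (\<Sum>x=1..n. \<phi> (real x / real n) * (r n x - v (real x / real n))))
      \<longlonglongrightarrow> (LBINT u:{0..1}. v u * \<phi> u) + 0"
    by (intro tendsto_add riemann_sum_tendsto[where f = "\<lambda>u. v u * \<phi> u"] lin[OF B(2)] continuous_intros v \<phi>)
  moreover have "1 / real n * (\<Sum>x=1..n. v (real x / real n) * \<phi> (real x / real n))
      + 1 / real n * (\<Sum>x=1..n. \<phi> (real x / real n) * (r n x - v (real x / real n)))
      = 1 / real n * (\<Sum>x=1..n. \<phi> (real x / real n) * r n x)" for n
    unfolding distrib_left[symmetric] sum.distrib[symmetric] by (simp add: algebra_simps)
  ultimately show "(\<lambda>n. 1 / real n * (\<Sum>x=1..n. \<phi> (real x / real n) * r n x)) \<longlonglongrightarrow> (LBINT u:{0..1}. v u * \<phi> u)"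
    by simp
  have sq: "(\<lambda>n. 1 / real n * (\<Sum>x=1..n. \<phi> (real x / real n) * (1 / 2 * (r n x - v (real x / real n))\<^sup>2))) \<longlonglongrightarrow> 0"
  proof (rule Lim_null_comparison[OF always_eventually])
    show "(\<lambda>n. B / 2 * A n) \<longlonglongrightarrow> 0" using tendsto_mult[OF tendsto_const A, of "B / 2"] by simp
    show "\<forall>n. norm (1 / real n * (\<Sum>x=1..n. \<phi> (real x / real n) * (1 / 2 * (r n x - v (real x / real n))\<^sup>2))) \<le> B / 2 * A n"
    proof
      fix n
      have "\<bar>\<Sum>x=1..n. \<phi> (real x / real n) * (1 / 2 * (r n x - v (real x / real n))\<^sup>2)\<bar> \<le> (\<Sum>x=1..n. B * (1 / 2 * (r n x - v (real x / real n))\<^sup>2))"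
      proof (rule order.trans[OF sum_abs], rule sum_mono)
        fix x assume "x \<in> {1..n}"
        then show "\<bar>\<phi> (real x / real n) * (1 / 2 * (r n x - v (real x / real n))\<^sup>2)\<bar> \<le> B * (1 / 2 * (r n x - v (real x / real n))\<^sup>2)"
          unfolding abs_mult[of "\<phi> _"] using B(2)[OF unit[of x n]] by (simp add: mult_right_mono)
      qed
      then have "1 / real n * \<bar>\<Sum>x=1..n. \<phi> (real x / real n) * (1 / 2 * (r n x - v (real x / real n))\<^sup>2)\<bar>
        \<le> 1 / real n * (\<Sum>x=1..n. B * (1 / 2 * (r n x - v (real x / real n))\<^sup>2))" by (intro mult_left_mono) auto
      also have "\<dots> = B / 2 * A n" by (simp add: A_def sum_distrib_left ac_simps)
      finally show "norm (1 / real n * (\<Sum>x=1..n. \<phi> (real x / real n) * (1 / 2 * (r n x - v (real x / real n))\<^sup>2))) \<le> B / 2 * A n"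
        by (simp add: abs_mult)
    qed
  qed
  have kin: "(\<lambda>n. 1 / real n * (\<Sum>x\<le>n. \<phi> (real x / real n) * (1 / 2 * (p n x)\<^sup>2))) \<longlonglongrightarrow> 0"
  proof (rule Lim_null_comparison[OF always_eventually])
    show "(\<lambda>n. B / 2 * P n) \<longlonglongrightarrow> 0" using tendsto_mult[OF tendsto_const P, of "B / 2"] by simp
    show "\<forall>n. norm (1 / real n * (\<Sum>x\<le>n. \<phi> (real x / real n) * (1 / 2 * (p n x)\<^sup>2))) \<le> B / 2 * P n"
    proof
      fix n
      have "\<bar>\<Sum>x\<le>n. \<phi> (real x / real n) * (1 / 2 * (p n x)\<^sup>2)\<bar> \<le> (\<Sum>x\<le>n. B * (1 / 2 * (p n x)\<^sup>2))"
      proof (rule order.trans[OF sum_abs], rule sum_mono)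
        fix x assume "x \<in> {..n}"
        then show "\<bar>\<phi> (real x / real n) * (1 / 2 * (p n x)\<^sup>2)\<bar> \<le> B * (1 / 2 * (p n x)\<^sup>2)"
          unfolding abs_mult[of "\<phi> _"] using B(2)[OF unit[of x n]] by (simp add: mult_right_mono)
      qed
      then have "1 / real n * \<bar>\<Sum>x\<le>n. \<phi> (real x / real n) * (1 / 2 * (p n x)\<^sup>2)\<bar>
        \<le> 1 / real n * (\<Sum>x\<le>n. B * (1 / 2 * (p n x)\<^sup>2))" by (intro mult_left_mono) auto
      also have "\<dots> = B / 2 * P n" by (simp add: P_def sum_distrib_left ac_simps)
      finally show "norm (1 / real n * (\<Sum>x\<le>n. \<phi> (real x / real n) * (1 / 2 * (p n x)\<^sup>2))) \<le> B / 2 * P n"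
        by (simp add: abs_mult)
    qed
  qed
  have \<phi>v: "\<bar>\<phi> u * v u\<bar> \<le> B * V" if "u \<in> {0..1}" for u
    unfolding abs_mult using B V that by (intro mult_mono) auto
  have "(\<lambda>n. 1 / real n * (\<Sum>x\<le>n. \<phi> (real x / real n) * (1 / 2 * (p n x)\<^sup>2))
      + 1 / real n * (\<Sum>x=1..n. \<phi> (real x / real n) * (1 / 2 * (r n x - v (real x / real n))\<^sup>2))
      + 1 / real n * (\<Sum>x=1..n. (\<phi> (real x / real n) * v (real x / real n)) * (r n x - v (real x / real n)))
      + 1 / real n * (\<Sum>x=1..n. \<phi> (real x / real n) * (1 / 2 * (v (real x / real n))\<^sup>2)))
      \<longlonglongrightarrow> 0 + 0 + 0 + (LBINT u:{0..1}. \<phi> u * (1 / 2 * (v u)\<^sup>2))"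
    by (intro tendsto_add kin sq lin[where \<psi> = "\<lambda>u. \<phi> u * v u", OF \<phi>v]
        riemann_sum_tendsto[where f = "\<lambda>u. \<phi> u * (1 / 2 * (v u)\<^sup>2)"] continuous_intros v \<phi>) auto
  moreover have "1 / real n * (\<Sum>x\<le>n. \<phi> (real x / real n) * (1 / 2 * (p n x)\<^sup>2))
      + 1 / real n * (\<Sum>x=1..n. \<phi> (real x / real n) * (1 / 2 * (r n x - v (real x / real n))\<^sup>2))
      + 1 / real n * (\<Sum>x=1..n. (\<phi> (real x / real n) * v (real x / real n)) * (r n x - v (real x / real n)))
      + 1 / real n * (\<Sum>x=1..n. \<phi> (real x / real n) * (1 / 2 * (v (real x / real n))\<^sup>2))
     = 1 / real n * (\<Sum>x=0..n. \<phi> (real x / real n) * (1 / 2 * ((p n x)\<^sup>2 + (r n x)\<^sup>2)))" for n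
  proof -
    have "(\<Sum>x=0..n. \<phi> (real x / real n) * (1 / 2 * (r n x)\<^sup>2)) = (\<Sum>x=1..n. \<phi> (real x / real n) * (1 / 2 * (r n x)\<^sup>2))"
      by (rule sum.mono_neutral_right) (auto simp: r0 not_less_eq_eq)
    moreover have "(\<Sum>x=1..n. \<phi> (real x / real n) * (1 / 2 * (r n x)\<^sup>2))
      = (\<Sum>x=1..n. \<phi> (real x / real n) * (1 / 2 * (r n x - v (real x / real n))\<^sup>2))
      + (\<Sum>x=1..n. (\<phi> (real x / real n) * v (real x / real n)) * (r n x - v (real x / real n)))
      + (\<Sum>x=1..n. \<phi> (real x / real n) * (1 / 2 * (v (real x / real n))\<^sup>2))"
      unfolding sum.distrib[symmetric]
      by (intro sum.cong refl) (simp add: power2_eq_square field_simps)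
    moreover have "(\<Sum>x=0..n. \<phi> (real x / real n) * (1 / 2 * ((p n x)\<^sup>2 + (r n x)\<^sup>2)))
      = (\<Sum>x\<le>n. \<phi> (real x / real n) * (1 / 2 * (p n x)\<^sup>2)) + (\<Sum>x=0..n. \<phi> (real x / real n) * (1 / 2 * (r n x)\<^sup>2))"
      by (simp add: sum.distrib[symmetric] distrib_left atLeast0AtMost)
    ultimately show ?thesis by (simp only: distrib_left add.assoc)
  qed
  ultimately show "(\<lambda>n. 1 / real n * (\<Sum>x=0..n. \<phi> (real x / real n) * (1 / 2 * ((p n x)\<^sup>2 + (r n x)\<^sup>2))))
       \<longlonglongrightarrow> (LBINT u:{0..1}. \<phi> u * (1 / 2 * (v u)\<^sup>2))" by simp
qed

subsection \<open>Right-continuous processes\<close>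

text \<open>Grid points are taken strictly to the right of \<open>v\<close>, by rounding down and
  adding 1, so that right continuity alone gives convergence.\<close>

lemma right_continuous_grid_limit:
  fixes f :: "real \<Rightarrow> real"
  assumes "continuous (at_right v) f"
  shows "(\<lambda>m. f ((of_int \<lfloor>real (Suc m) * v\<rfloor> + 1) / real (Suc m))) \<longlonglongrightarrow> f v"
proof -
  define x where "x m = (of_int \<lfloor>real (Suc m) * v\<rfloor> + 1) / real (Suc m)" for m
  have gt: "x m > v" and le: "x m \<le> v + 1 / real (Suc m)" for m
  proof -
    have "real (Suc m) * v < of_int \<lfloor>real (Suc m) * v\<rfloor> + 1" by linarith
    then show "x m > v" unfolding x_def by (subst pos_less_divide_eq) (simp_all only: mult.commute of_nat_0_less_iff zero_less_Suc)
    have "of_int \<lfloor>real (Suc m) * v\<rfloor> + 1 \<le> real (Suc m) * v + 1" by simp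
    then have "x m \<le> (real (Suc m) * v + 1) / real (Suc m)" unfolding x_def by (rule divide_right_mono) simp
    then show "x m \<le> v + 1 / real (Suc m)" by (simp add: add_divide_distrib del: of_nat_Suc)
  qed
  have "x \<longlonglongrightarrow> v"
  proof (rule real_tendsto_sandwich[where f = "\<lambda>_. v" and h = "\<lambda>m. v + 1 / real (Suc m)"])
    show "(\<lambda>m. v + 1 / real (Suc m)) \<longlonglongrightarrow> v"
      using tendsto_add[OF tendsto_const[of v] LIMSEQ_inverse_real_of_nat] by (simp add: inverse_eq_divide)
  qed (use gt le in \<open>auto intro!: always_eventually less_imp_le\<close>)
  then have "(f \<circ> x) \<longlonglongrightarrow> f v"
    using assms gt unfolding continuous_within_sequentially by auto
  then show ?thesis by (simp add: o_def x_def)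
qed

text \<open>Joint measurability, needed for Fubini. Each grid involves only countably many of the
  variables \<open>f u\<close>, and the grid versions converge by right continuity. The indicator
  hides negative times, about which nothing is assumed.\<close>

lemma right_continuous_process_measurable:
  fixes f :: "real \<Rightarrow> 'a \<Rightarrow> real"
  assumes f: "\<And>u. u \<ge> 0 \<Longrightarrow> f u \<in> borel_measurable M"
    and rc: "\<And>v \<omega>. v \<ge> 0 \<Longrightarrow> \<omega> \<in> space M \<Longrightarrow> continuous (at_right v) (\<lambda>u. f u \<omega>)"
  shows "(\<lambda>(v, \<omega>). indicator {0..} v * f v \<omega>) \<in> borel_measurable (lborel \<Otimes>\<^sub>M M)"
proof -
  define g where "g m i x = (if i \<ge> 0 then indicator {0..} (fst x) * f ((of_int i + 1) / real (Suc m)) (snd x) else 0)"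
    for m :: nat and i :: int and x :: "real \<times> 'a"
  have "(\<lambda>x. g m \<lfloor>real (Suc m) * fst x\<rfloor> x) \<in> borel_measurable (lborel \<Otimes>\<^sub>M M)" for m
  proof (rule measurable_compose_countable)
    fix i :: int
    show "g m i \<in> borel_measurable (lborel \<Otimes>\<^sub>M M)"
    proof (cases "i \<ge> 0")
      case True
      then have [measurable]: "f ((of_int i + 1) / real (Suc m)) \<in> borel_measurable M" by (intro f) simp
      have eq: "g m i = (\<lambda>x. indicator {0..} (fst x) * f ((of_int i + 1) / real (Suc m)) (snd x))"
        using True by (simp add: g_def fun_eq_iff)
      show ?thesis unfolding eq by measurable
    qed (simp add: g_def[abs_def])
    show "(\<lambda>x. \<lfloor>real (Suc m) * fst x\<rfloor>) \<in> (lborel \<Otimes>\<^sub>M M) \<rightarrow>\<^sub>M count_space UNIV"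
      by measurable
  qed
  then show ?thesis
  proof (rule borel_measurable_LIMSEQ_real[rotated])
    fix x :: "real \<times> 'a" assume x: "x \<in> space (lborel \<Otimes>\<^sub>M M)"
    then have \<omega>: "snd x \<in> space M" by (auto simp: space_pair_measure)
    show "(\<lambda>m. g m \<lfloor>real (Suc m) * fst x\<rfloor> x) \<longlonglongrightarrow> (case x of (v, \<omega>) \<Rightarrow> indicator {0..} v * f v \<omega>)"
    proof (cases "fst x \<ge> 0")
      case True
      have "(\<lambda>m. f ((of_int \<lfloor>real (Suc m) * fst x\<rfloor> + 1) / real (Suc m)) (snd x)) \<longlonglongrightarrow> f (fst x) (snd x)"
        by (rule right_continuous_grid_limit[OF rc[OF True \<omega>]])
      then show ?thesis using True by (simp add: g_def case_prod_beta del: of_nat_Suc)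
    next
      case False
      then have "g m i x = 0" for m i by (simp add: g_def)
      then show ?thesis using False by (simp add: case_prod_beta)
    qed
  qed
qed

text \<open>A deterministic path is a process over a one-point space.\<close>

lemma right_continuous_borel_measurable:
  fixes f :: "real \<Rightarrow> real"
  assumes "\<And>v. v \<ge> 0 \<Longrightarrow> continuous (at_right v) f"
  shows "(\<lambda>v. indicator {0..} v * f v) \<in> borel_measurable borel"
proof -
  have "(\<lambda>(v, \<omega>). indicator {0..} v * f v) \<in> borel_measurable (lborel \<Otimes>\<^sub>M count_space {()})"
    by (rule right_continuous_process_measurable[where f = "\<lambda>v _. f v"]) (use assms in auto)
  then have "(\<lambda>v. (\<lambda>(v, \<omega>). indicator {0..} v * f v) (v, ())) \<in> borel_measurable lborel"
    by (rule measurable_compose[rotated]) simp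
  then show ?thesis by simp
qed

lemma cadlag_bounded:
  assumes f: "cadlag f" and t: "t \<ge> 0"
  obtains B where "B > 0" "\<And>u. u \<in> {0..t} \<Longrightarrow> \<bar>f u\<bar> \<le> B"
proof -
  \<comment> \<open>The intersection with \<open>{0..}\<close> is there because the intervals in the
    compactness argument may reach below zero.\<close>
  define P where "P a b \<longleftrightarrow> (\<exists>B. \<forall>u\<in>{a..b} \<inter> {0..}. \<bar>f u\<bar> \<le> B)" for a b
  have "P 0 t"
  proof (rule Bolzano)
    show "0 \<le> t" by fact
  next
    fix a b c assume "P a b" "P b c"
    then obtain B B' where B: "\<forall>u\<in>{a..b} \<inter> {0..}. \<bar>f u\<bar> \<le> B" and B': "\<forall>u\<in>{b..c} \<inter> {0..}. \<bar>f u\<bar> \<le> B'"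
      unfolding P_def by blast
    have "\<forall>u\<in>{a..c} \<inter> {0..}. \<bar>f u\<bar> \<le> max B B'"
    proof
      fix u assume "u \<in> {a..c} \<inter> {0..}"
      then show "\<bar>f u\<bar> \<le> max B B'"
        using B B' by (cases "u \<le> b") (auto simp: le_max_iff_disj)
    qed
    then show "P a c" unfolding P_def by blast
  next
    fix x assume local: "0 \<le> x" "x \<le> t"
    have "(f \<longlongrightarrow> f x) (at_right x)" using f local unfolding cadlag_def continuous_within by auto
    from tendstoD[OF this zero_less_one] obtain d1 where d1: "d1 > x" "\<And>u. x < u \<Longrightarrow> u < d1 \<Longrightarrow> dist (f u) (f x) < 1"
      unfolding eventually_at_right_field by auto
    \<comment> \<open>At \<open>x = 0\<close> there is no left limit to use. The values
      \<open>x - 1\<close> and \<open>0\<close> are dummies, as no admissible \<open>u\<close> lies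
      below zero.\<close>
    have "\<exists>d2 l. d2 < x \<and> (\<forall>u. d2 < u \<and> u < x \<and> u \<ge> 0 \<longrightarrow> dist (f u) l < 1)"
    proof (cases "x > 0")
      case True
      then obtain l where "(f \<longlongrightarrow> l) (at_left x)" using f unfolding cadlag_def by auto
      from tendstoD[OF this zero_less_one] obtain d where "d < x" "\<And>u. d < u \<Longrightarrow> u < x \<Longrightarrow> dist (f u) l < 1"
        unfolding eventually_at_left_field by auto
      then show ?thesis by blast
    next
      case False
      then show ?thesis by (intro exI[of _ "x - 1"] exI[of _ 0]) auto
    qed
    then obtain d2 l where d2: "d2 < x" "\<And>u. d2 < u \<Longrightarrow> u < x \<Longrightarrow> u \<ge> 0 \<Longrightarrow> dist (f u) l < 1" by blast
    define d where "d = min (d1 - x) (x - d2)"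
    have "d > 0" using d1 d2 by (simp add: d_def)
    moreover have "P a b" if ab: "a \<le> x \<and> x \<le> b \<and> b - a < d" for a b
      unfolding P_def
    proof (intro exI ballI)
      fix u assume u: "u \<in> {a..b} \<inter> {0..}"
      consider "u < x" | "u = x" | "u > x" by linarith
      then show "\<bar>f u\<bar> \<le> \<bar>f x\<bar> + \<bar>l\<bar> + 1"
      proof cases
        case 1
        then have "dist (f u) l < 1" using u ab by (intro d2(2)) (auto simp: d_def)
        then show ?thesis by (simp add: dist_real_def)
      next
        case 3
        then have "dist (f u) (f x) < 1" using u ab by (intro d1(2)) (auto simp: d_def)
        then show ?thesis by (simp add: dist_real_def)
      qed simp
    qed
    ultimately show "\<exists>d>0. \<forall>a b. a \<le> x \<and> x \<le> b \<and> b - a < d \<longrightarrow> P a b" by blast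
  qed
  then obtain B where B: "\<forall>u\<in>{0..t} \<inter> {0..}. \<bar>f u\<bar> \<le> B" unfolding P_def by blast
  show thesis
  proof (rule that)
    show "max B 1 > 0" by simp
    fix u assume "u \<in> {0..t}"
    then show "\<bar>f u\<bar> \<le> max B 1" using B by (auto simp: le_max_iff_disj)
  qed
qed

lemma set_integrable_right_continuous_bounded:
  fixes f :: "real \<Rightarrow> real"
  assumes rc: "\<And>v. v \<ge> 0 \<Longrightarrow> continuous (at_right v) f" and B: "\<And>u. u \<in> {0..t} \<Longrightarrow> \<bar>f u\<bar> \<le> B"
  shows "set_integrable lborel {0..t} f"
  unfolding set_integrable_def
proof (rule Bochner_Integration.integrable_bound)
  show "integrable lborel (\<lambda>u. indicator {0..t} u * B)" by (cases "t \<ge> 0") simp_all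
  have "(\<lambda>u. indicator {0..t} u * (indicator {0..} u * f u)) \<in> borel_measurable borel"
    using right_continuous_borel_measurable[OF rc] by simp
  moreover have "(\<lambda>u. indicator {0..t} u * (indicator {0..} u * f u)) = (\<lambda>u. indicator {0..t} u *\<^sub>R f u)"
    by (auto simp: fun_eq_iff split: split_indicator)
  ultimately show "(\<lambda>u. indicator {0..t} u *\<^sub>R f u) \<in> borel_measurable lborel" by simp
  show "AE u in lborel. norm (indicator {0..t} u *\<^sub>R f u) \<le> norm (indicator {0..t} u * B)"
    by (rule AE_I2) (use B in \<open>auto split: split_indicator intro: order.trans[OF _ abs_ge_self]\<close>)
qed

lemma cadlag_right_continuous: "cadlag f \<Longrightarrow> v \<ge> 0 \<Longrightarrow> continuous (at_right v) f"
  by (simp add: cadlag_def)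

lemma cadlag_set_integrable:
  assumes "cadlag f"
  shows "set_integrable lborel {0..t} f"
proof (cases "t \<ge> 0")
  case True
  then show ?thesis
    using cadlag_bounded[OF assms True] set_integrable_right_continuous_bounded[OF cadlag_right_continuous[OF assms]] by metis
qed (simp add: set_integrable_def)

lemma continuous_on_imp_right_continuous:
  fixes f :: "real \<Rightarrow> real"
  assumes "continuous_on {0..} f" "v \<ge> 0"
  shows "continuous (at_right v) f"
proof -
  have "(f \<longlongrightarrow> f v) (at v within {0..})" using assms by (auto simp: continuous_on_def)
  then show ?thesis unfolding continuous_within
    by (rule tendsto_within_subset) (use assms in auto)
qed

lemma continuous_on_imp_cadlag:
  fixes f :: "real \<Rightarrow> real"
  assumes "continuous_on {0..} f"
  shows "cadlag f"
  unfolding cadlag_def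
proof (intro conjI allI impI)
  fix t :: real assume "t > 0"
  then have "(f \<longlongrightarrow> f t) (at t within {0..})" using assms by (auto simp: continuous_on_def)
  then have "(f \<longlongrightarrow> f t) (at t within {0<..<t})"
    by (rule tendsto_within_subset) auto
  moreover have "at t within {0<..<t} = at_left t"
    by (rule at_within_nhd[of _ "{0<..}"]) (use \<open>t > 0\<close> in auto)
  ultimately show "\<exists>l. (f \<longlongrightarrow> l) (at_left t)" by auto
qed (rule continuous_on_imp_right_continuous[OF assms])

text \<open>The bound \<open>K\<close> on first absolute moments, uniform over the compact time
  interval, supplies integrability on the product space for Fubini; joint measurability comes from
  right continuity.\<close>

lemma (in prob_space) expectation_time_integral:
  fixes f :: "real \<Rightarrow> 'a \<Rightarrow> real"
  assumes f: "\<And>u. u \<ge> 0 \<Longrightarrow> f u \<in> borel_measurable M"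
    and rc: "\<And>v \<omega>. v \<ge> 0 \<Longrightarrow> \<omega> \<in> space M \<Longrightarrow> continuous (at_right v) (\<lambda>u. f u \<omega>)"
    and int: "\<And>v. v \<in> {0..t} \<Longrightarrow> integrable M (f v)"
    and bound: "\<And>v. v \<in> {0..t} \<Longrightarrow> expectation (\<lambda>\<omega>. \<bar>f v \<omega>\<bar>) \<le> K"
  shows "integrable M (\<lambda>\<omega>. LBINT v:{0..t}. f v \<omega>)"
    and "set_integrable lborel {0..t} (\<lambda>v. expectation (f v))"
    and "expectation (\<lambda>\<omega>. LBINT v:{0..t}. f v \<omega>) = (LBINT v:{0..t}. expectation (f v))"
proof -
  interpret pair_sigma_finite lborel M ..
  define h where "h v \<omega> = indicator {0..t} v * f v \<omega>" for v \<omega>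
  have "(\<lambda>x. indicator {0..t} (fst x) * (\<lambda>(v, \<omega>). indicator {0..} v * f v \<omega>) x) \<in> borel_measurable (lborel \<Otimes>\<^sub>M M)"
    using right_continuous_process_measurable[OF f rc] by simp
  also have "(\<lambda>x. indicator {0..t} (fst x) * (\<lambda>(v, \<omega>). indicator {0..} v * f v \<omega>) x) = (\<lambda>(v, \<omega>). h v \<omega>)"
    by (auto simp: fun_eq_iff h_def split: split_indicator)
  finally have hm [measurable]: "(\<lambda>(v, \<omega>). h v \<omega>) \<in> borel_measurable (lborel \<Otimes>\<^sub>M M)" .
  have hi: "integrable M (h v)" for v
    using int[of v] by (cases "v \<in> {0..t}") (auto simp: h_def[abs_def])
  have hint: "integrable (lborel \<Otimes>\<^sub>M M) (\<lambda>(v, \<omega>). h v \<omega>)"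
  proof (rule Fubini_integrable[OF hm])
    show "integrable lborel (\<lambda>v. LINT \<omega>|M. norm (case (v, \<omega>) of (v, \<omega>) \<Rightarrow> h v \<omega>))"
    proof (rule Bochner_Integration.integrable_bound)
      show "integrable lborel (\<lambda>v. indicator {0..t} v * K)" by (cases "t \<ge> 0") simp_all
      have "(\<lambda>v. LINT \<omega>|M. norm (h v \<omega>)) \<in> borel_measurable lborel"
        by measurable
      then show "(\<lambda>v. LINT \<omega>|M. norm (case (v, \<omega>) of (v, \<omega>) \<Rightarrow> h v \<omega>)) \<in> borel_measurable lborel" by simp
      show "AE v in lborel. norm (LINT \<omega>|M. norm (case (v, \<omega>) of (v, \<omega>) \<Rightarrow> h v \<omega>)) \<le> norm (indicator {0..t} v * K)"
        by (rule AE_I2) (use bound in \<open>auto simp: h_def split: split_indicator intro: order.trans[OF _ abs_ge_self]\<close>)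
    qed
    show "AE v in lborel. integrable M (\<lambda>\<omega>. case (v, \<omega>) of (v, \<omega>) \<Rightarrow> h v \<omega>)" using hi by simp
  qed
  have 1: "(LBINT v:{0..t}. f v \<omega>) = (\<integral>v. h v \<omega> \<partial>lborel)" for \<omega>
    by (simp add: set_lebesgue_integral_def h_def)
  have 2: "indicator {0..t} v *\<^sub>R expectation (f v) = expectation (h v)" for v
    by (simp add: h_def[abs_def])
  show "integrable M (\<lambda>\<omega>. LBINT v:{0..t}. f v \<omega>)"
    unfolding 1 using integrable_snd[OF hint] by simp
  show "set_integrable lborel {0..t} (\<lambda>v. expectation (f v))"
    unfolding set_integrable_def 2 using integrable_fst[OF hint] by simp
  show "expectation (\<lambda>\<omega>. LBINT v:{0..t}. f v \<omega>) = (LBINT v:{0..t}. expectation (f v))"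
    unfolding 1 unfolding set_lebesgue_integral_def 2 using Fubini_integral[OF hint] by simp
qed

text \<open>Comparing \<open>z - a\<close> with its supremum in the norm weighted by \<open>exp (- 2 C u)\<close>, for which
  the integral operator is a contraction.\<close>

lemma gronwall_integral:
  fixes z a :: "real \<Rightarrow> real"
  assumes C: "C > 0" and T: "T \<ge> 0" and u: "u \<in> {0..T}"
    and z: "set_integrable lborel {0..T} z" "\<And>u. u \<in> {0..T} \<Longrightarrow> z u \<le> Z"
    and a: "set_integrable lborel {0..T} a" "\<And>u. u \<in> {0..T} \<Longrightarrow> 0 \<le> a u"
    and le: "\<And>u. u \<in> {0..T} \<Longrightarrow> z u \<le> a u + C * (LBINT v:{0..u}. z v)"
  shows "z u \<le> a u + 2 * C * exp (2 * C * T) * (LBINT v:{0..T}. a v)"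
proof -
  define \<alpha> where "\<alpha> = (LBINT v:{0..T}. a v)"
  define F where "F u = exp (- (2 * C * u)) * (z u - a u)" for u
  \<comment> \<open>The maximum with zero keeps \<open>S\<close> nonnegative, as required when it
    multiplies an inequality.\<close>
  define S where "S = max 0 (SUP u\<in>{0..T}. F u)"
  have bdd: "bdd_above (F ` {0..T})"
  proof (rule bdd_aboveI2)
    fix u assume u: "u \<in> {0..T}"
    have "F u \<le> exp (- (2 * C * u)) * max 0 Z"
      unfolding F_def using z(2)[OF u] a(2)[OF u] by (intro mult_left_mono) auto
    also have "\<dots> \<le> 1 * max 0 Z" using u C by (intro mult_right_mono) auto
    finally show "F u \<le> max 0 Z" by simp
  qed
  have zS: "z v \<le> a v + exp (2 * C * v) * S" if v: "v \<in> {0..T}" for v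
  proof -
    have "F v \<le> S" unfolding S_def using cSUP_upper[OF v bdd] by simp
    then have "exp (2 * C * v) * F v \<le> exp (2 * C * v) * S" by (intro mult_left_mono) auto
    moreover have "exp (2 * C * v) * F v = z v - a v"
      unfolding F_def by (simp add: mult.assoc[symmetric] flip: exp_add)
    ultimately show ?thesis by simp
  qed
  have sub: "set_integrable lborel {0..u} f" if "set_integrable lborel {0..T} f" "u \<in> {0..T}" for f :: "real \<Rightarrow> real" and u
    by (rule set_integrable_subset[OF that(1)]) (use that in auto)
  have e_int: "set_integrable lborel {0..u} (\<lambda>v. exp (2 * C * v) * S)" for u
    by (rule borel_integrable_atLeastAtMost') (intro continuous_intros)
  \<comment> \<open>The integral of \<open>exp (2 * C * v)\<close> is at most
    \<open>exp (2 * C * u) / (2 * C)\<close>, so the integral operator halves the weighted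
    supremum.\<close>
  have FS: "F u \<le> C * \<alpha> + S / 2" if u: "u \<in> {0..T}" for u
  proof -
    have "(LBINT v:{0..u}. z v) \<le> (LBINT v:{0..u}. a v + exp (2 * C * v) * S)"
      by (rule set_integral_mono) (use sub[OF z(1) u] sub[OF a(1) u] e_int zS u in auto)
    also have "\<dots> = (LBINT v:{0..u}. a v) + (LBINT v:{0..u}. exp (2 * C * v)) * S"
      by (subst set_integral_add) (use sub[OF a(1) u] e_int in auto)
    also have "(LBINT v:{0..u}. a v) \<le> \<alpha>"
      unfolding \<alpha>_def set_lebesgue_integral_def
      by (rule integral_mono)
        (use sub[OF a(1) u] a u in \<open>auto simp: set_integrable_def split: split_indicator\<close>)
    also have "(LBINT v:{0..u}. exp (2 * C * v)) = exp (2 * C * u) / (2 * C) - exp (2 * C * 0) / (2 * C)"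
      by (rule LBINT_FTC) (use u C in \<open>auto intro!: derivative_eq_intros continuous_intros\<close>)
    also have "(exp (2 * C * u) / (2 * C) - exp (2 * C * 0) / (2 * C)) * S \<le> exp (2 * C * u) / (2 * C) * S"
      using C by (intro mult_right_mono) (auto simp: S_def)
    finally have "C * (LBINT v:{0..u}. z v) \<le> C * (\<alpha> + exp (2 * C * u) / (2 * C) * S)"
      using C by (intro mult_left_mono) auto
    also have "\<dots> = C * \<alpha> + exp (2 * C * u) * (S / 2)" using C by (simp add: field_simps)
    finally have "z u - a u \<le> C * \<alpha> + exp (2 * C * u) * (S / 2)" using le[OF u] by linarith
    then have "F u \<le> exp (- (2 * C * u)) * (C * \<alpha> + exp (2 * C * u) * (S / 2))"
      unfolding F_def by (intro mult_left_mono) auto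
    also have "\<dots> = exp (- (2 * C * u)) * (C * \<alpha>) + S / 2"
      by (simp add: distrib_left mult.assoc[symmetric] flip: exp_add)
    also have "exp (- (2 * C * u)) * (C * \<alpha>) \<le> 1 * (C * \<alpha>)"
    proof (rule mult_right_mono)
      have "0 \<le> \<alpha>" unfolding \<alpha>_def set_lebesgue_integral_def
        by (rule integral_nonneg_AE, rule AE_I2) (use a in \<open>auto split: split_indicator\<close>)
      then show "0 \<le> C * \<alpha>" using C by simp
      show "exp (- (2 * C * u)) \<le> 1" using C u by simp
    qed
    finally show ?thesis by simp
  qed
  have \<alpha>0: "0 \<le> \<alpha>" unfolding \<alpha>_def set_lebesgue_integral_def
    by (rule integral_nonneg_AE, rule AE_I2) (use a in \<open>auto split: split_indicator\<close>)
  have "(SUP u\<in>{0..T}. F u) \<le> C * \<alpha> + S / 2"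
    by (rule cSUP_least) (use FS T in auto)
  moreover have "0 \<le> C * \<alpha> + S / 2" using C \<alpha>0 by (simp add: S_def)
  ultimately have "S \<le> C * \<alpha> + S / 2" by (simp add: S_def)
  then have S: "S \<le> 2 * C * \<alpha>" by simp
  have "exp (2 * C * u) * S \<le> exp (2 * C * T) * (2 * C * \<alpha>)"
    by (rule mult_mono) (use S u C in \<open>auto simp: S_def\<close>)
  then show ?thesis using zS[OF u] unfolding \<alpha>_def by (simp add: algebra_simps)
qed

subsection \<open>Linear systems with random signs\<close>

text \<open>A list, because a pair of index and time may occur repeatedly; the recursion in
  \<open>Y_decor\<close> prepends two factors at each step.\<close>

definition sign_product :: "('i \<Rightarrow> real \<Rightarrow> 'a \<Rightarrow> real) \<Rightarrow> ('i \<times> real) list \<Rightarrow> 'a \<Rightarrow> real" where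
  "sign_product s L \<omega> = (\<Prod>(i, u)\<leftarrow>L. s i u \<omega>)"

lemma sign_product_simps [simp]:
  "sign_product s [] \<omega> = 1"
  "sign_product s ((i, u) # L) \<omega> = s i u \<omega> * sign_product s L \<omega>"
  by (simp_all add: sign_product_def)

text \<open>Linear systems whose drift is conjugated by signs, as obtained by rewriting velocity flips
  in terms of the parity of the number of flips. Future sign changes are only assumed to be
  uncorrelated with products of past signs and one initial datum or noise value; the
  Gronwall argument below extends this to the solution itself, so that
  no adaptedness has to be established.\<close>

locale flip_system = prob_space M for M :: "'a measure" +
  fixes I :: "'i set" and B :: "'i \<Rightarrow> 'i \<Rightarrow> real" and b :: "'i \<Rightarrow> real \<Rightarrow> real"
    and s Y W :: "'i \<Rightarrow> real \<Rightarrow> 'a \<Rightarrow> real" and \<kappa> :: "'i \<Rightarrow> real" and c :: real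
  assumes fin: "finite I"
    and s_meas: "\<And>i u. i \<in> I \<Longrightarrow> u \<ge> 0 \<Longrightarrow> s i u \<in> borel_measurable M"
    and s_abs: "\<And>i u \<omega>. i \<in> I \<Longrightarrow> u \<ge> 0 \<Longrightarrow> \<omega> \<in> space M \<Longrightarrow> \<bar>s i u \<omega>\<bar> = 1"
    and s_rc: "\<And>i u \<omega>. i \<in> I \<Longrightarrow> u \<ge> 0 \<Longrightarrow> \<omega> \<in> space M \<Longrightarrow> continuous (at_right u) (\<lambda>u. s i u \<omega>)"
    and Y_meas: "\<And>i u. i \<in> I \<Longrightarrow> u \<ge> 0 \<Longrightarrow> Y i u \<in> borel_measurable M"
    and Y_cadlag: "\<And>i \<omega>. i \<in> I \<Longrightarrow> \<omega> \<in> space M \<Longrightarrow> cadlag (\<lambda>u. Y i u \<omega>)"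
    and W_cadlag: "\<And>i \<omega>. i \<in> I \<Longrightarrow> \<omega> \<in> space M \<Longrightarrow> cadlag (\<lambda>u. W i u \<omega>)"
    and W_int: "\<And>i u. i \<in> I \<Longrightarrow> u \<ge> 0 \<Longrightarrow> integrable M (W i u)"
    and W_mean: "\<And>i u. i \<in> I \<Longrightarrow> u \<ge> 0 \<Longrightarrow> expectation (W i u) = 0"
    and W_bound: "\<And>i u. i \<in> I \<Longrightarrow> u \<ge> 0 \<Longrightarrow> expectation (\<lambda>\<omega>. \<bar>W i u \<omega>\<bar>) \<le> c * (1 + u)"
    and b_cont: "\<And>i. i \<in> I \<Longrightarrow> continuous_on {0..} (b i)"
    and Y0_int: "\<And>i. i \<in> I \<Longrightarrow> integrable M (Y i 0)"
    and evol: "\<And>i u \<omega>. i \<in> I \<Longrightarrow> u \<ge> 0 \<Longrightarrow> \<omega> \<in> space M \<Longrightarrow> Y i u \<omega> = s i u \<omega> * s i 0 \<omega> * Y i 0 \<omega>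
        + (LBINT v:{0..u}. s i u \<omega> * s i v \<omega> * ((\<Sum>j\<in>I. B i j * Y j v \<omega>) + b i v)) + W i u \<omega>"
    and decor: "\<And>i u v L Z. i \<in> I \<Longrightarrow> 0 \<le> v \<Longrightarrow> v \<le> u \<Longrightarrow> set L \<subseteq> I \<times> {0..v} \<Longrightarrow>
        Z = (\<lambda>_. 1) \<or> (\<exists>j\<in>I. Z = Y j 0) \<or> (\<exists>j\<in>I. \<exists>x\<in>{0..v}. Z = W j x) \<Longrightarrow>
        expectation (\<lambda>\<omega>. sign_product s L \<omega> * (s i u \<omega> * s i v \<omega> - exp (- \<kappa> i * (u - v))) * Z \<omega>) = 0"
begin

text \<open>The added 1 keeps it positive even for a zero matrix, so that it can serve as a
  rate.\<close>

definition drift_norm :: real where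
  "drift_norm = (\<Sum>i\<in>I. \<Sum>j\<in>I. \<bar>B i j\<bar>) + 1"

lemma drift_norm_pos: "drift_norm > 0"
  unfolding drift_norm_def by (simp add: add_nonneg_pos sum_nonneg)

lemma row_sum_le:
  assumes "i \<in> I"
  shows "(\<Sum>j\<in>I. \<bar>B i j\<bar>) \<le> drift_norm"
  using member_le_sum[OF assms, of "\<lambda>i. \<Sum>j\<in>I. \<bar>B i j\<bar>"] fin
  by (simp add: drift_norm_def sum_nonneg)

definition drift :: "'i \<Rightarrow> real \<Rightarrow> 'a \<Rightarrow> real" where
  "drift i v \<omega> = (\<Sum>j\<in>I. B i j * Y j v \<omega>) + b i v"

lemma Y_rc: "i \<in> I \<Longrightarrow> u \<ge> 0 \<Longrightarrow> \<omega> \<in> space M \<Longrightarrow> continuous (at_right u) (\<lambda>u. Y i u \<omega>)"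
  using cadlag_right_continuous[OF Y_cadlag] .

lemma drift_rc:
  assumes "i \<in> I" "u \<ge> 0" "\<omega> \<in> space M"
  shows "continuous (at_right u) (\<lambda>v. drift i v \<omega>)"
  unfolding drift_def
  by (intro continuous_add continuous_sum continuous_mult continuous_const Y_rc
      continuous_on_imp_right_continuous b_cont assms) 

lemma drift_meas: "i \<in> I \<Longrightarrow> u \<ge> 0 \<Longrightarrow> drift i u \<in> borel_measurable M"
  unfolding drift_def[abs_def] using Y_meas by simp

lemma b_bounded:
  obtains b' where "b' \<ge> 0" "\<And>i v. i \<in> I \<Longrightarrow> v \<in> {0..T} \<Longrightarrow> \<bar>b i v\<bar> \<le> b'"
proof -
  have "\<exists>B. \<forall>v\<in>{0..T}. \<bar>b i v\<bar> \<le> B" if "i \<in> I" for i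
  proof -
    have "bounded (b i ` {0..T})"
      by (intro compact_imp_bounded compact_continuous_image continuous_on_subset[OF b_cont[OF that]]) auto
    then show ?thesis unfolding bounded_real by auto
  qed
  then obtain f where f: "\<And>i v. i \<in> I \<Longrightarrow> v \<in> {0..T} \<Longrightarrow> \<bar>b i v\<bar> \<le> f i" by metis
  show thesis
  proof (rule that)
    show "(\<Sum>i\<in>I. \<bar>f i\<bar>) \<ge> 0" by (simp add: sum_nonneg)
    fix i v assume i: "i \<in> I" and v: "v \<in> {0..T}"
    have "\<bar>b i v\<bar> \<le> \<bar>f i\<bar>" using f[OF i v] by linarith
    also have "\<dots> \<le> (\<Sum>i\<in>I. \<bar>f i\<bar>)" by (rule member_le_sum) (use i fin in auto)
    finally show "\<bar>b i v\<bar> \<le> (\<Sum>i\<in>I. \<bar>f i\<bar>)" .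
  qed
qed

text \<open>The signs have modulus 1 and drop out of the integral equation, leaving a Gronwall
  inequality for the sum of the absolute values. The bound is linear in initial data and noise, so
  their first moments are enough to take expectations.\<close>

lemma pathwise_bound:
  assumes T: "T \<ge> 0"
  obtains K1 K2 where "K1 \<ge> 0" "K2 \<ge> 0" "\<And>i u \<omega>. i \<in> I \<Longrightarrow> u \<in> {0..T} \<Longrightarrow> \<omega> \<in> space M \<Longrightarrow>
    \<bar>Y i u \<omega>\<bar> \<le> ((\<Sum>j\<in>I. \<bar>Y j 0 \<omega>\<bar> + \<bar>W j u \<omega>\<bar>) + K1)
      + K2 * (LBINT v:{0..T}. (\<Sum>j\<in>I. \<bar>Y j 0 \<omega>\<bar> + \<bar>W j v \<omega>\<bar>) + K1)"
proof -
  obtain b' where b': "b' \<ge> 0" "\<And>i v. i \<in> I \<Longrightarrow> v \<in> {0..T} \<Longrightarrow> \<bar>b i v\<bar> \<le> b'" using b_bounded[of T] by blast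
  define K1 where "K1 = real (card I) * (b' * T)"
  define C where "C = real (card I) * drift_norm + 1"
  have C: "C > 0" using drift_norm_pos by (simp add: C_def add_nonneg_pos)
  show thesis
  proof (rule that[of K1 "2 * C * exp (2 * C * T)"])
    show "K1 \<ge> 0" using b' T by (simp add: K1_def)
    show "2 * C * exp (2 * C * T) \<ge> 0" using C by simp
    fix i u \<omega> assume i: "i \<in> I" and u: "u \<in> {0..T}" and \<omega>: "\<omega> \<in> space M"
    define z where "z v = (\<Sum>j\<in>I. \<bar>Y j v \<omega>\<bar>)" for v
    define a where "a v = (\<Sum>j\<in>I. \<bar>Y j 0 \<omega>\<bar> + \<bar>W j v \<omega>\<bar>) + K1" for v
    have Yi: "set_integrable lborel {0..u} (\<lambda>v. Y j v \<omega>)" if "j \<in> I" for j u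
      by (rule cadlag_set_integrable[OF Y_cadlag[OF that \<omega>]])
    have Wi: "set_integrable lborel {0..u} (\<lambda>v. W j v \<omega>)" if "j \<in> I" for j u
      by (rule cadlag_set_integrable[OF W_cadlag[OF that \<omega>]])
    have ci: "set_integrable lborel {0..u} (\<lambda>v. k)" for k u :: real
      by (rule borel_integrable_atLeastAtMost') simp
    have zi: "set_integrable lborel {0..u} z" for u
      unfolding z_def[abs_def] set_integrable_def scaleR_sum_right
      by (intro Bochner_Integration.integrable_sum set_integrable_abs[OF Yi, unfolded set_integrable_def])
    have ai: "set_integrable lborel {0..u} a" for u
    proof -
      have "set_integrable lborel {0..u} (\<lambda>v. \<Sum>j\<in>I. \<bar>Y j 0 \<omega>\<bar> + \<bar>W j v \<omega>\<bar>)"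
        unfolding set_integrable_def scaleR_sum_right
        by (intro Bochner_Integration.integrable_sum set_integral_add(1)[OF ci set_integrable_abs[OF Wi], unfolded set_integrable_def])
      then show ?thesis unfolding a_def[abs_def] by (intro set_integral_add ci)
    qed
    have K1: "K1 \<ge> 0" by fact
    have one: "\<bar>Y i u \<omega>\<bar> \<le> \<bar>Y i 0 \<omega>\<bar> + \<bar>W i u \<omega>\<bar> + (drift_norm * (LBINT v:{0..u}. z v) + b' * T)"
      if i: "i \<in> I" and u: "u \<in> {0..T}" for i u
    proof -
      have u0: "u \<ge> 0" using u by simp
      have zb: "\<bar>s i u \<omega> * s i v \<omega> * ((\<Sum>j\<in>I. B i j * Y j v \<omega>) + b i v)\<bar> \<le> drift_norm * z v + b'"
        if v: "v \<in> {0..u}" for v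
      proof -
        have "\<bar>s i u \<omega> * s i v \<omega> * ((\<Sum>j\<in>I. B i j * Y j v \<omega>) + b i v)\<bar> = \<bar>(\<Sum>j\<in>I. B i j * Y j v \<omega>) + b i v\<bar>"
          using s_abs[OF i u0 \<omega>] s_abs[OF i _ \<omega>, of v] v by (simp add: abs_mult)
        also have "\<dots> \<le> (\<Sum>j\<in>I. \<bar>B i j\<bar> * \<bar>Y j v \<omega>\<bar>) + b'"
          using sum_abs[of "\<lambda>j. B i j * Y j v \<omega>" I] b'(2)[OF i, of v] u v by (simp add: abs_mult) 
        also have "(\<Sum>j\<in>I. \<bar>B i j\<bar> * \<bar>Y j v \<omega>\<bar>) \<le> (\<Sum>j\<in>I. drift_norm * \<bar>Y j v \<omega>\<bar>)"
        proof (intro sum_mono mult_right_mono)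
          fix j assume "j \<in> I"
          then have "\<bar>B i j\<bar> \<le> (\<Sum>j\<in>I. \<bar>B i j\<bar>)" using fin by (intro member_le_sum) auto
          then show "\<bar>B i j\<bar> \<le> drift_norm" using row_sum_le[OF i] by linarith
        qed simp
        finally show ?thesis by (simp add: z_def sum_distrib_left)
      qed
      have gi: "set_integrable lborel {0..u} (\<lambda>v. s i u \<omega> * s i v \<omega> * ((\<Sum>j\<in>I. B i j * Y j v \<omega>) + b i v))"
      proof -
        have zB: "\<exists>Z. \<forall>v\<in>{0..u}. drift_norm * z v + b' \<le> Z"
        proof -
          have "\<forall>j\<in>I. \<exists>Z. \<forall>v\<in>{0..u}. \<bar>Y j v \<omega>\<bar> \<le> Z"
            using cadlag_bounded[OF Y_cadlag[OF _ \<omega>] u0] by metis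
          then obtain Z where Z: "\<And>j v. j \<in> I \<Longrightarrow> v \<in> {0..u} \<Longrightarrow> \<bar>Y j v \<omega>\<bar> \<le> Z j" by metis
          then have "z v \<le> (\<Sum>j\<in>I. Z j)" if "v \<in> {0..u}" for v
            unfolding z_def using that by (intro sum_mono) auto
          then show ?thesis using drift_norm_pos by (meson add_right_mono less_imp_le mult_left_mono)
        qed
        then obtain Z where "\<And>v. v \<in> {0..u} \<Longrightarrow> drift_norm * z v + b' \<le> Z" by blast
        then have "\<And>v. v \<in> {0..u} \<Longrightarrow> \<bar>s i u \<omega> * s i v \<omega> * ((\<Sum>j\<in>I. B i j * Y j v \<omega>) + b i v)\<bar> \<le> Z"
          using zb by (meson order.trans)
        moreover have "continuous (at_right v) (\<lambda>v. s i u \<omega> * s i v \<omega> * ((\<Sum>j\<in>I. B i j * Y j v \<omega>) + b i v))" if "v \<ge> 0" for v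
          using drift_rc[OF i that \<omega>] unfolding drift_def
          by (intro continuous_mult continuous_const s_rc i \<omega> that)
        ultimately show ?thesis by (intro set_integrable_right_continuous_bounded)
      qed
      have "\<bar>LBINT v:{0..u}. s i u \<omega> * s i v \<omega> * ((\<Sum>j\<in>I. B i j * Y j v \<omega>) + b i v)\<bar>
         \<le> (LBINT v:{0..u}. \<bar>s i u \<omega> * s i v \<omega> * ((\<Sum>j\<in>I. B i j * Y j v \<omega>) + b i v)\<bar>)"
        using set_integral_norm_bound[OF gi] by simp
      also have "\<dots> \<le> (LBINT v:{0..u}. drift_norm * z v + b')"
        by (rule set_integral_mono) (use set_integrable_abs[OF gi] zi ci zb in auto)
      also have "\<dots> = drift_norm * (LBINT v:{0..u}. z v) + b' * u"
      proof -
        have "(LBINT v:{0..u}. b') = b' * u" using u by (simp add: set_lebesgue_integral_def)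
        then show ?thesis using zi ci by (subst set_integral_add) auto
      qed
      also have "b' * u \<le> b' * T" using b' u by (intro mult_left_mono) auto
      finally have 1: "\<bar>LBINT v:{0..u}. s i u \<omega> * s i v \<omega> * ((\<Sum>j\<in>I. B i j * Y j v \<omega>) + b i v)\<bar>
        \<le> drift_norm * (LBINT v:{0..u}. z v) + b' * T" by simp
      have "\<bar>s i u \<omega> * s i 0 \<omega> * Y i 0 \<omega>\<bar> = \<bar>Y i 0 \<omega>\<bar>"
        using s_abs[OF i u0 \<omega>] s_abs[OF i _ \<omega>, of 0] by (simp add: abs_mult)
      then show ?thesis using evol[OF i u0 \<omega>] 1 by linarith
    qed
    have zle: "z u \<le> a u + C * (LBINT v:{0..u}. z v)" if u: "u \<in> {0..T}" for u
    proof -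
      have int0: "(LBINT v:{0..u}. z v) \<ge> 0"
        unfolding set_lebesgue_integral_def z_def
        by (rule integral_nonneg_AE, rule AE_I2) (auto simp: sum_nonneg split: split_indicator)
      have "z u \<le> (\<Sum>i\<in>I. \<bar>Y i 0 \<omega>\<bar> + \<bar>W i u \<omega>\<bar> + (drift_norm * (LBINT v:{0..u}. z v) + b' * T))"
        unfolding z_def[of u] by (intro sum_mono one u)
      also have "\<dots> = a u + real (card I) * drift_norm * (LBINT v:{0..u}. z v)"
        by (simp add: sum.distrib a_def K1_def algebra_simps)
      also have "\<dots> \<le> a u + C * (LBINT v:{0..u}. z v)"
        using int0 by (simp add: C_def distrib_right)
      finally show ?thesis .
    qed
    have "\<forall>j\<in>I. \<exists>Z. \<forall>v\<in>{0..T}. \<bar>Y j v \<omega>\<bar> \<le> Z"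
      using cadlag_bounded[OF Y_cadlag[OF _ \<omega>] T] by metis
    then obtain Z where Z: "\<And>j v. j \<in> I \<Longrightarrow> v \<in> {0..T} \<Longrightarrow> \<bar>Y j v \<omega>\<bar> \<le> Z j" by metis
    have zZ: "z v \<le> (\<Sum>j\<in>I. Z j)" if "v \<in> {0..T}" for v
      unfolding z_def using that Z by (intro sum_mono) auto
    have a0: "0 \<le> a v" for v unfolding a_def using K1 by (simp add: sum_nonneg)
    have "\<bar>Y i u \<omega>\<bar> \<le> z u" unfolding z_def by (rule member_le_sum) (use i fin in auto)
    also have "z u \<le> a u + 2 * C * exp (2 * C * T) * (LBINT v:{0..T}. a v)"
      by (rule gronwall_integral[OF C T u zi zZ ai a0 zle])
    finally show "\<bar>Y i u \<omega>\<bar> \<le> ((\<Sum>j\<in>I. \<bar>Y j 0 \<omega>\<bar> + \<bar>W j u \<omega>\<bar>) + K1)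
      + 2 * C * exp (2 * C * T) * (LBINT v:{0..T}. (\<Sum>j\<in>I. \<bar>Y j 0 \<omega>\<bar> + \<bar>W j v \<omega>\<bar>) + K1)"
      by (simp only: a_def)
  qed
qed

lemma Y_moment:
  assumes T: "T \<ge> 0"
  obtains K where "K > 0" "\<And>i u. i \<in> I \<Longrightarrow> u \<in> {0..T} \<Longrightarrow> integrable M (Y i u)"
    "\<And>i u. i \<in> I \<Longrightarrow> u \<in> {0..T} \<Longrightarrow> expectation (\<lambda>\<omega>. \<bar>Y i u \<omega>\<bar>) \<le> K"
proof -
  obtain K1 K2 where K: "K1 \<ge> 0" "K2 \<ge> 0" "\<And>i u \<omega>. i \<in> I \<Longrightarrow> u \<in> {0..T} \<Longrightarrow> \<omega> \<in> space M \<Longrightarrow>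
    \<bar>Y i u \<omega>\<bar> \<le> ((\<Sum>j\<in>I. \<bar>Y j 0 \<omega>\<bar> + \<bar>W j u \<omega>\<bar>) + K1)
      + K2 * (LBINT v:{0..T}. (\<Sum>j\<in>I. \<bar>Y j 0 \<omega>\<bar> + \<bar>W j v \<omega>\<bar>) + K1)"
    using pathwise_bound[OF T] by blast
  define a where "a v \<omega> = (\<Sum>j\<in>I. \<bar>Y j 0 \<omega>\<bar> + \<bar>W j v \<omega>\<bar>) + K1" for v \<omega>
  define A where "A = (\<Sum>j\<in>I. expectation (\<lambda>\<omega>. \<bar>Y j 0 \<omega>\<bar>) + \<bar>c\<bar> * (1 + T)) + K1"
  have a_int: "integrable M (a v)" if "v \<ge> 0" for v
    unfolding a_def[abs_def] using Y0_int W_int that by auto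
  have a0: "0 \<le> a v \<omega>" for v \<omega> using K by (simp add: a_def sum_nonneg)
  have a_exp: "expectation (a v) \<le> A" if v: "v \<in> {0..T}" for v
  proof -
    have "expectation (a v) = (\<Sum>j\<in>I. expectation (\<lambda>\<omega>. \<bar>Y j 0 \<omega>\<bar>) + expectation (\<lambda>\<omega>. \<bar>W j v \<omega>\<bar>)) + K1"
      unfolding a_def[abs_def] using Y0_int W_int v by (simp add: prob_space)
    also have "\<dots> \<le> A"
    proof -
      have "expectation (\<lambda>\<omega>. \<bar>W j v \<omega>\<bar>) \<le> \<bar>c\<bar> * (1 + T)" if "j \<in> I" for j
      proof -
        have "expectation (\<lambda>\<omega>. \<bar>W j v \<omega>\<bar>) \<le> c * (1 + v)" using W_bound[OF that] v by simp
        also have "\<dots> \<le> \<bar>c\<bar> * (1 + T)" using v by (intro mult_mono) auto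
        finally show ?thesis .
      qed
      then show ?thesis unfolding A_def by (intro add_right_mono sum_mono add_left_mono) auto
    qed
    finally show ?thesis .
  qed
  have a_rc: "continuous (at_right v) (\<lambda>v. a v \<omega>)" if "v \<ge> 0" "\<omega> \<in> space M" for v \<omega>
    unfolding a_def
    by (intro continuous_add continuous_sum continuous_const continuous_rabs cadlag_right_continuous[OF W_cadlag] that)
  note fub = expectation_time_integral[where f = a and t = T and K = A]
  have fub1: "integrable M (\<lambda>\<omega>. LBINT v:{0..T}. a v \<omega>)"
    and fub2: "expectation (\<lambda>\<omega>. LBINT v:{0..T}. a v \<omega>) = (LBINT v:{0..T}. expectation (a v))"
    and fub3: "set_integrable lborel {0..T} (\<lambda>v. expectation (a v))"
    by (rule fub; use a_int a_rc a_exp a0 borel_measurable_integrable[OF a_int] in auto)+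
  have le: "expectation (\<lambda>\<omega>. LBINT v:{0..T}. a v \<omega>) \<le> A * T"
  proof -
    have "(LBINT v:{0..T}. expectation (a v)) \<le> (LBINT v:{0..T}. A)"
      by (rule set_integral_mono[OF fub3]) (auto intro!: borel_integrable_atLeastAtMost' simp: a_exp)
    also have "\<dots> = A * T" using T by (simp add: set_lebesgue_integral_def)
    finally show ?thesis using fub2 by simp
  qed
  have bound_int: "integrable M (\<lambda>\<omega>. a u \<omega> + K2 * (LBINT v:{0..T}. a v \<omega>))" if "u \<in> {0..T}" for u
    using a_int fub1 that by auto
  have Yle: "\<bar>Y i u \<omega>\<bar> \<le> a u \<omega> + K2 * (LBINT v:{0..T}. a v \<omega>)" if "i \<in> I" "u \<in> {0..T}" "\<omega> \<in> space M" for i u \<omega>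
    using K(3)[OF that] by (simp only: a_def)
  have Yint: "integrable M (Y i u)" if "i \<in> I" "u \<in> {0..T}" for i u
    by (rule Bochner_Integration.integrable_bound[OF bound_int[OF that(2)]])
      (use Y_meas Yle that in \<open>auto intro!: AE_I2 intro: order.trans[OF _ abs_ge_self]\<close>)
  show thesis
  proof (rule that[of "\<bar>A + K2 * (A * T)\<bar> + 1"])
    fix i u assume i: "i \<in> I" and u: "u \<in> {0..T}"
    show "integrable M (Y i u)" by (rule Yint[OF i u])
    have "expectation (\<lambda>\<omega>. \<bar>Y i u \<omega>\<bar>) \<le> expectation (\<lambda>\<omega>. a u \<omega> + K2 * (LBINT v:{0..T}. a v \<omega>))"
      by (rule integral_mono) (use Yint Yle bound_int i u in auto)
    also have "\<dots> = expectation (a u) + K2 * expectation (\<lambda>\<omega>. LBINT v:{0..T}. a v \<omega>)"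
      using a_int u fub1 by simp
    also have "\<dots> \<le> A + K2 * (A * T)"
      using a_exp[OF u] le K(2) by (intro add_mono mult_left_mono) auto
    finally show "expectation (\<lambda>\<omega>. \<bar>Y i u \<omega>\<bar>) \<le> \<bar>A + K2 * (A * T)\<bar> + 1" by linarith
  qed simp
qed

lemma Y_int:
  assumes "i \<in> I" "u \<ge> 0"
  shows "integrable M (Y i u)"
proof -
  obtain K where "\<And>j v. j \<in> I \<Longrightarrow> v \<in> {0..u} \<Longrightarrow> integrable M (Y j v)"
    using Y_moment[OF assms(2)] by metis
  then show ?thesis using assms by auto
qed

lemma drift_int:
  assumes "i \<in> I" "u \<ge> 0"
  shows "integrable M (drift i u)"
  unfolding drift_def[abs_def] using Y_int assms by auto

lemma drift_moment:
  assumes T: "T \<ge> 0"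
  obtains K where "K > 0" "\<And>i u. i \<in> I \<Longrightarrow> u \<in> {0..T} \<Longrightarrow> expectation (\<lambda>\<omega>. \<bar>drift i u \<omega>\<bar>) \<le> K"
proof -
  obtain K where K: "K > 0" "\<And>i u. i \<in> I \<Longrightarrow> u \<in> {0..T} \<Longrightarrow> expectation (\<lambda>\<omega>. \<bar>Y i u \<omega>\<bar>) \<le> K"
    using Y_moment[OF T] by metis
  obtain b' where b': "b' \<ge> 0" "\<And>i v. i \<in> I \<Longrightarrow> v \<in> {0..T} \<Longrightarrow> \<bar>b i v\<bar> \<le> b'" using b_bounded[of T] by blast
  show thesis
  proof (rule that[of "drift_norm * K + b'"])
    show "drift_norm * K + b' > 0" using K(1) drift_norm_pos b'(1) by (simp add: add_pos_nonneg)
    fix i u assume i: "i \<in> I" and u: "u \<in> {0..T}"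
    have Yi: "integrable M (Y j u)" if "j \<in> I" for j using Y_int[OF that] u by simp
    have "expectation (\<lambda>\<omega>. \<bar>drift i u \<omega>\<bar>) \<le> expectation (\<lambda>\<omega>. (\<Sum>j\<in>I. \<bar>B i j\<bar> * \<bar>Y j u \<omega>\<bar>) + b')"
    proof (rule integral_mono)
      show "integrable M (\<lambda>\<omega>. \<bar>drift i u \<omega>\<bar>)" using drift_int[OF i] u by simp
      show "integrable M (\<lambda>\<omega>. (\<Sum>j\<in>I. \<bar>B i j\<bar> * \<bar>Y j u \<omega>\<bar>) + b')" using Yi by auto
      fix \<omega>
      have "\<bar>\<Sum>j\<in>I. B i j * Y j u \<omega>\<bar> \<le> (\<Sum>j\<in>I. \<bar>B i j\<bar> * \<bar>Y j u \<omega>\<bar>)"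
        using sum_abs[of "\<lambda>j. B i j * Y j u \<omega>" I] by (simp add: abs_mult)
      then show "\<bar>drift i u \<omega>\<bar> \<le> (\<Sum>j\<in>I. \<bar>B i j\<bar> * \<bar>Y j u \<omega>\<bar>) + b'"
        unfolding drift_def using b'(2)[OF i u] by linarith
    qed
    also have "\<dots> = (\<Sum>j\<in>I. \<bar>B i j\<bar> * expectation (\<lambda>\<omega>. \<bar>Y j u \<omega>\<bar>)) + b'"
      using Yi by (simp add: prob_space)
    also have "\<dots> \<le> (\<Sum>j\<in>I. \<bar>B i j\<bar> * K) + b'"
      by (intro add_right_mono sum_mono mult_left_mono K(2) u) auto
    also have "\<dots> \<le> drift_norm * K + b'"
      using row_sum_le[OF i] K(1) by (simp add: sum_distrib_right[symmetric])
    finally show "expectation (\<lambda>\<omega>. \<bar>drift i u \<omega>\<bar>) \<le> drift_norm * K + b'" .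
  qed
qed

end

lemma (in prob_space) bounded_mult_expectation:
  fixes m Z :: "'a \<Rightarrow> real"
  assumes m: "m \<in> borel_measurable M" "\<And>\<omega>. \<omega> \<in> space M \<Longrightarrow> \<bar>m \<omega>\<bar> \<le> X" and Z: "integrable M Z"
  shows "integrable M (\<lambda>\<omega>. m \<omega> * Z \<omega>)" "expectation (\<lambda>\<omega>. \<bar>m \<omega> * Z \<omega>\<bar>) \<le> X * expectation (\<lambda>\<omega>. \<bar>Z \<omega>\<bar>)"
    "\<bar>expectation (\<lambda>\<omega>. m \<omega> * Z \<omega>)\<bar> \<le> X * expectation (\<lambda>\<omega>. \<bar>Z \<omega>\<bar>)"
proof -
  have le: "\<bar>m \<omega> * Z \<omega>\<bar> \<le> X * \<bar>Z \<omega>\<bar>" if "\<omega> \<in> space M" for \<omega>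
    unfolding abs_mult using m(2)[OF that] by (rule mult_right_mono) simp
  have XZ: "integrable M (\<lambda>\<omega>. X * \<bar>Z \<omega>\<bar>)" using Z by simp
  show int: "integrable M (\<lambda>\<omega>. m \<omega> * Z \<omega>)"
    by (rule Bochner_Integration.integrable_bound[OF XZ])
      (use m Z le in \<open>auto intro!: AE_I2 intro: order.trans[OF _ abs_ge_self] borel_measurable_times\<close>)
  show *: "expectation (\<lambda>\<omega>. \<bar>m \<omega> * Z \<omega>\<bar>) \<le> X * expectation (\<lambda>\<omega>. \<bar>Z \<omega>\<bar>)"
    using integral_mono[OF integrable_abs[OF int] XZ] le by simp
  have "\<bar>expectation (\<lambda>\<omega>. m \<omega> * Z \<omega>)\<bar> \<le> expectation (\<lambda>\<omega>. \<bar>m \<omega> * Z \<omega>\<bar>)"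
    by (rule integral_abs_bound)
  then show "\<bar>expectation (\<lambda>\<omega>. m \<omega> * Z \<omega>)\<bar> \<le> X * expectation (\<lambda>\<omega>. \<bar>Z \<omega>\<bar>)" using * by linarith
qed

context flip_system
begin

lemma sign_product_abs:
  assumes "set L \<subseteq> I \<times> {0..}" "\<omega> \<in> space M"
  shows "\<bar>sign_product s L \<omega>\<bar> = 1"
  using assms by (induction L) (auto simp: abs_mult s_abs)

lemma sign_product_meas:
  assumes "set L \<subseteq> I \<times> {0..}"
  shows "sign_product s L \<in> borel_measurable M"
  using assms
proof (induction L)
  case Nil
  then show ?case by (simp add: sign_product_def[abs_def])
next
  case (Cons p L)
  obtain i u where p: "p = (i, u)" by (cases p)
  have "(\<lambda>\<omega>. s i u \<omega> * sign_product s L \<omega>) \<in> borel_measurable M"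
    by (rule borel_measurable_times) (use Cons p in \<open>auto intro: s_meas\<close>)
  then show ?case by (simp add: p)
qed

text \<open>Substitute the integral equation for \<open>Y i u\<close>. The terms with the initial
  datum and the noise vanish by the locale assumption; the drift reproduces the same kind of
  expectation at earlier times \<open>v\<close>, with the signs at \<open>u\<close> and
  \<open>v\<close> added to the list. The family over all lists therefore closes on itself, and its
  weighted supremum satisfies \<open>Q <= Q / 2\<close>.\<close>

lemma Y_decor:
  assumes i0: "i0 \<in> I" and v0: "0 \<le> v0" "v0 \<le> u0" and i: "i \<in> I" and u: "u \<in> {0..v0}"
    and L: "set L \<subseteq> I \<times> {0..v0}"
  shows "expectation (\<lambda>\<omega>. sign_product s L \<omega> * (s i0 u0 \<omega> * s i0 v0 \<omega> - exp (- \<kappa> i0 * (u0 - v0))) * Y i u \<omega>) = 0"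
proof -
  \<comment> \<open>Fluctuation of the future sign change over \<open>[v0, u0]\<close> about its
    mean.\<close>
  define \<xi> where "\<xi> \<omega> = s i0 u0 \<omega> * s i0 v0 \<omega> - exp (- \<kappa> i0 * (u0 - v0))" for \<omega>
  define X where "X = 1 + exp (- \<kappa> i0 * (u0 - v0))"
  have X0: "X > 0" by (simp add: X_def add_pos_pos)
  define g where "g L i u = expectation (\<lambda>\<omega>. sign_product s L \<omega> * \<xi> \<omega> * Y i u \<omega>)" for L i u
  have L0: "set L \<subseteq> I \<times> {0..}" if "set L \<subseteq> I \<times> {0..v0}" for L :: "('i \<times> real) list"
    using that by auto
  have m_meas: "(\<lambda>\<omega>. sign_product s L \<omega> * \<xi> \<omega>) \<in> borel_measurable M" if "set L \<subseteq> I \<times> {0..}" for L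
  proof -
    have "\<xi> \<in> borel_measurable M"
      unfolding \<xi>_def[abs_def] using s_meas[OF i0] v0 by (intro borel_measurable_diff borel_measurable_times) auto
    then show ?thesis using sign_product_meas[OF that] by (intro borel_measurable_times)
  qed
  have m_bound: "\<bar>sign_product s L \<omega> * \<xi> \<omega>\<bar> \<le> X" if "set L \<subseteq> I \<times> {0..}" "\<omega> \<in> space M" for L \<omega>
  proof -
    have "\<bar>s i0 u0 \<omega> * s i0 v0 \<omega>\<bar> = 1" using s_abs[OF i0 _ that(2)] v0 by (simp add: abs_mult)
    then have "\<bar>\<xi> \<omega>\<bar> \<le> X" unfolding \<xi>_def X_def by (smt (verit) exp_gt_zero)
    then show ?thesis using sign_product_abs[OF that] by (simp add: abs_mult)
  qed
  obtain K where K: "K > 0" "\<And>i u. i \<in> I \<Longrightarrow> u \<in> {0..v0} \<Longrightarrow> expectation (\<lambda>\<omega>. \<bar>Y i u \<omega>\<bar>) \<le> K"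
    using Y_moment[OF v0(1)] by metis
  obtain K' where K': "\<And>i u. i \<in> I \<Longrightarrow> u \<in> {0..v0} \<Longrightarrow> expectation (\<lambda>\<omega>. \<bar>drift i u \<omega>\<bar>) \<le> K'"
    using drift_moment[OF v0(1)] by metis
  have g_bound: "\<bar>g L i u\<bar> \<le> X * K" if "set L \<subseteq> I \<times> {0..v0}" "i \<in> I" "u \<in> {0..v0}" for L i u
  proof -
    have "\<bar>g L i u\<bar> \<le> X * expectation (\<lambda>\<omega>. \<bar>Y i u \<omega>\<bar>)"
      unfolding g_def using that
      by (intro bounded_mult_expectation(3) m_meas m_bound L0 Y_int) auto
    also have "\<dots> \<le> X * K" using K(2)[OF that(2,3)] X0 by (intro mult_left_mono) auto
    finally show ?thesis .
  qed
  have dec: "expectation (\<lambda>\<omega>. sign_product s L \<omega> * \<xi> \<omega> * Z \<omega>) = 0"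
    if "set L \<subseteq> I \<times> {0..v0}" "Z = (\<lambda>_. 1) \<or> (\<exists>j\<in>I. Z = Y j 0) \<or> (\<exists>j\<in>I. \<exists>x\<in>{0..v0}. Z = W j x)" for L Z
    unfolding \<xi>_def by (rule decor[OF i0 v0 that])
  have drift_g: "expectation (\<lambda>\<omega>. sign_product s L \<omega> * \<xi> \<omega> * drift i v \<omega>) = (\<Sum>j\<in>I. B i j * g L j v)"
    if L: "set L \<subseteq> I \<times> {0..v0}" and i: "i \<in> I" and v: "v \<in> {0..v0}" for L i v
  proof -
    have int: "integrable M (\<lambda>\<omega>. sign_product s L \<omega> * \<xi> \<omega> * Y j v \<omega>)" if "j \<in> I" for j
      by (intro bounded_mult_expectation(1)[where X = X] m_meas m_bound L0 L Y_int that) (use v in auto)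
    have int1: "integrable M (\<lambda>\<omega>. sign_product s L \<omega> * \<xi> \<omega> * 1)"
      by (intro bounded_mult_expectation(1)[where X = X] m_meas m_bound L0 L) auto
    have "sign_product s L \<omega> * \<xi> \<omega> * drift i v \<omega>
      = (\<Sum>j\<in>I. B i j * (sign_product s L \<omega> * \<xi> \<omega> * Y j v \<omega>)) + b i v * (sign_product s L \<omega> * \<xi> \<omega> * 1)" for \<omega>
      by (simp add: drift_def distrib_left sum_distrib_left ac_simps)
    then have "expectation (\<lambda>\<omega>. sign_product s L \<omega> * \<xi> \<omega> * drift i v \<omega>)
      = expectation (\<lambda>\<omega>. (\<Sum>j\<in>I. B i j * (sign_product s L \<omega> * \<xi> \<omega> * Y j v \<omega>)) + b i v * (sign_product s L \<omega> * \<xi> \<omega> * 1))"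
      by (simp only:)
    also have "\<dots> = (\<Sum>j\<in>I. B i j * g L j v) + b i v * expectation (\<lambda>\<omega>. sign_product s L \<omega> * \<xi> \<omega> * 1)"
      unfolding g_def using int int1 
      by (subst Bochner_Integration.integral_add) (auto simp: Bochner_Integration.integral_sum)
    also have "expectation (\<lambda>\<omega>. sign_product s L \<omega> * \<xi> \<omega> * 1) = 0"
      using dec[OF L, of "\<lambda>_. 1"] by simp
    finally show ?thesis by simp
  qed
  \<comment> \<open>Both new entries lie at times at most \<open>u <= v0\<close>, so the longer list
    is again admissible.\<close>
  have rec: "g L i u = (LBINT v:{0..u}. \<Sum>j\<in>I. B i j * g ((i, u) # (i, v) # L) j v)"
    "set_integrable lborel {0..u} (\<lambda>v. \<Sum>j\<in>I. B i j * g ((i, u) # (i, v) # L) j v)"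
    if L: "set L \<subseteq> I \<times> {0..v0}" and i: "i \<in> I" and u: "u \<in> {0..v0}" for L i u
  proof -
    let ?m = "\<lambda>\<omega>. sign_product s L \<omega> * \<xi> \<omega>"
    define f where "f v \<omega> = sign_product s ((i, u) # (i, v) # L) \<omega> * \<xi> \<omega> * drift i v \<omega>" for v \<omega>
    have u0: "u \<ge> 0" using u by simp
    have Lv: "set ((i, u) # (i, v) # L) \<subseteq> I \<times> {0..v0}" if "v \<in> {0..u}" for v
      using that L i u by auto
    have Lv0: "set ((i, u) # (i, v) # L) \<subseteq> I \<times> {0..}" if "v \<ge> 0" for v
      using that L0[OF L] i u by auto
    have f_meas: "f v \<in> borel_measurable M" if "v \<ge> 0" for v
      unfolding f_def[abs_def] by (intro borel_measurable_times m_meas Lv0 that drift_meas i)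
    have f_rc: "continuous (at_right v) (\<lambda>v. f v \<omega>)" if "v \<ge> 0" "\<omega> \<in> space M" for v \<omega>
      unfolding f_def sign_product_simps
      by (intro continuous_mult continuous_const s_rc drift_rc i that)
    have f_int: "integrable M (f v)" and f_exp: "expectation (\<lambda>\<omega>. \<bar>f v \<omega>\<bar>) \<le> X * K'" if v: "v \<in> {0..u}" for v
    proof -
      have v': "v \<ge> 0" "v \<in> {0..v0}" using v u by auto
      show "integrable M (f v)" unfolding f_def[abs_def]
        by (intro bounded_mult_expectation(1)[where X = X] m_meas m_bound Lv0 v' drift_int i)
      have "expectation (\<lambda>\<omega>. \<bar>f v \<omega>\<bar>) \<le> X * expectation (\<lambda>\<omega>. \<bar>drift i v \<omega>\<bar>)" unfolding f_def
        by (intro bounded_mult_expectation(2)[where X = X] m_meas m_bound Lv0 v' drift_int i)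
      also have "\<dots> \<le> X * K'" using K'[OF i v'(2)] X0 by (intro mult_left_mono) auto
      finally show "expectation (\<lambda>\<omega>. \<bar>f v \<omega>\<bar>) \<le> X * K'" .
    qed
    note F = expectation_time_integral[where f = f and t = u, OF f_meas f_rc f_int f_exp]
    have Ef: "expectation (f v) = (\<Sum>j\<in>I. B i j * g ((i, u) # (i, v) # L) j v)" if v: "v \<in> {0..u}" for v
      unfolding f_def[abs_def] by (rule drift_g[OF Lv[OF v] i]) (use v u in auto)
    have eq: "?m \<omega> * Y i u \<omega> = sign_product s ((i, u) # (i, 0) # L) \<omega> * \<xi> \<omega> * Y i 0 \<omega> + (LBINT v:{0..u}. f v \<omega>) + ?m \<omega> * W i u \<omega>"
      if \<omega>: "\<omega> \<in> space M" for \<omega>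
    proof -
      have "(LBINT v:{0..u}. f v \<omega>) = ?m \<omega> * (LBINT v:{0..u}. s i u \<omega> * s i v \<omega> * drift i v \<omega>)"
        unfolding f_def sign_product_simps set_integral_mult_right[symmetric]
        by (simp add: ac_simps)
      then show ?thesis unfolding evol[OF i u0 \<omega>] drift_def[symmetric]
        by (simp add: algebra_simps)
    qed
    have "g L i u = expectation (\<lambda>\<omega>. sign_product s ((i, u) # (i, 0) # L) \<omega> * \<xi> \<omega> * Y i 0 \<omega> + (LBINT v:{0..u}. f v \<omega>) + ?m \<omega> * W i u \<omega>)"
      unfolding g_def by (rule Bochner_Integration.integral_cong[OF refl eq])
    also have "\<dots> = expectation (\<lambda>\<omega>. sign_product s ((i, u) # (i, 0) # L) \<omega> * \<xi> \<omega> * Y i 0 \<omega>) + expectation (\<lambda>\<omega>. LBINT v:{0..u}. f v \<omega>)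
      + expectation (\<lambda>\<omega>. ?m \<omega> * W i u \<omega>)"
    proof -
      have 1: "integrable M (\<lambda>\<omega>. sign_product s ((i, u) # (i, 0) # L) \<omega> * \<xi> \<omega> * Y i 0 \<omega>)"
        by (intro bounded_mult_expectation(1)[where X = X] m_meas m_bound Lv0 Y0_int i) auto
      have 2: "integrable M (\<lambda>\<omega>. ?m \<omega> * W i u \<omega>)"
        by (intro bounded_mult_expectation(1)[where X = X] m_meas m_bound L0 L W_int i u0)
      show ?thesis using 1 2 F(1) by (simp only: Bochner_Integration.integral_add Bochner_Integration.integrable_add)
    qed
    also have "expectation (\<lambda>\<omega>. sign_product s ((i, u) # (i, 0) # L) \<omega> * \<xi> \<omega> * Y i 0 \<omega>) = 0"
      by (rule dec[OF Lv]) (use u i in auto)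
    also have "expectation (\<lambda>\<omega>. ?m \<omega> * W i u \<omega>) = 0"
      by (rule dec[OF L]) (use u i in blast)
    also have "expectation (\<lambda>\<omega>. LBINT v:{0..u}. f v \<omega>) = (LBINT v:{0..u}. expectation (f v))" by (rule F(3))
    also have "\<dots> = (LBINT v:{0..u}. \<Sum>j\<in>I. B i j * g ((i, u) # (i, v) # L) j v)"
      by (rule set_lebesgue_integral_cong) (use Ef in auto)
    finally show "g L i u = (LBINT v:{0..u}. \<Sum>j\<in>I. B i j * g ((i, u) # (i, v) # L) j v)" by simp
    have "set_integrable lborel {0..u} (\<lambda>v. expectation (f v)) = set_integrable lborel {0..u} (\<lambda>v. \<Sum>j\<in>I. B i j * g ((i, u) # (i, v) # L) j v)"
      by (rule set_integrable_cong) (use Ef in auto)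
    then show "set_integrable lborel {0..u} (\<lambda>v. \<Sum>j\<in>I. B i j * g ((i, u) # (i, v) # L) j v)" using F(2) by blast
  qed
  \<comment> \<open>The rate is chosen so that \<open>drift_norm / l = 1 / 2\<close>, which produces
    the contraction factor.\<close>
  define l where "l = 2 * drift_norm"
  have l: "l > 0" using drift_norm_pos by (simp add: l_def)
  \<comment> \<open>The recursion lengthens the list at each step, so the supremum is taken over all
    lists, indices and times at once. It is finite since the bound \<open>X * K\<close> does not
    depend on the list.\<close>
  define S where "S = {(L, i, u). set L \<subseteq> I \<times> {0..v0} \<and> i \<in> I \<and> u \<in> {0..v0}}"
  define G where "G = (\<lambda>(L, i, u). exp (- (l * u)) * \<bar>g L i u\<bar>)"
  have S: "([], i0, 0) \<in> S" using i0 v0 by (simp add: S_def)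
  have bdd: "bdd_above (G ` S)"
  proof (rule bdd_aboveI2)
    fix x assume "x \<in> S"
    then obtain L i u where x: "x = (L, i, u)" "set L \<subseteq> I \<times> {0..v0}" "i \<in> I" "u \<in> {0..v0}" by (auto simp: S_def)
    have "exp (- (l * u)) * \<bar>g L i u\<bar> \<le> 1 * (X * K)"
      by (rule mult_mono) (use g_bound[OF x(2-4)] l x in auto)
    then show "G x \<le> X * K" by (simp add: G_def x)
  qed
  define Q where "Q = (SUP x\<in>S. G x)"
  have gQ: "\<bar>g L i u\<bar> \<le> exp (l * u) * Q" if "set L \<subseteq> I \<times> {0..v0}" "i \<in> I" "u \<in> {0..v0}" for L i u
  proof -
    have "G (L, i, u) \<le> Q" unfolding Q_def by (rule cSUP_upper[OF _ bdd]) (use that in \<open>auto simp: S_def\<close>)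
    then have "exp (l * u) * G (L, i, u) \<le> exp (l * u) * Q" by (intro mult_left_mono) auto
    moreover have "exp (l * u) * G (L, i, u) = \<bar>g L i u\<bar>"
      by (simp add: G_def mult.assoc[symmetric] flip: exp_add)
    ultimately show ?thesis by simp
  qed
  have "0 \<le> G ([], i0, 0)" by (simp add: G_def)
  also have "G ([], i0, 0) \<le> Q" unfolding Q_def by (rule cSUP_upper[OF S bdd])
  finally have Q0: "0 \<le> Q" .
  have "Q \<le> Q / 2" unfolding Q_def
  proof (rule cSUP_least)
    show "S \<noteq> {}" using S by auto
    fix x assume "x \<in> S"
    then obtain L i u where x: "x = (L, i, u)" and L: "set L \<subseteq> I \<times> {0..v0}" and i: "i \<in> I" and u: "u \<in> {0..v0}"
      by (auto simp: S_def)
    have e_int: "set_integrable lborel {0..u} (\<lambda>v. drift_norm * Q * exp (l * v))"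
      by (rule borel_integrable_atLeastAtMost') (intro continuous_intros)
    have "\<bar>g L i u\<bar> \<le> (LBINT v:{0..u}. \<bar>\<Sum>j\<in>I. B i j * g ((i, u) # (i, v) # L) j v\<bar>)"
      unfolding rec(1)[OF L i u] using set_integral_norm_bound[OF rec(2)[OF L i u]] by simp
    also have "\<dots> \<le> (LBINT v:{0..u}. drift_norm * Q * exp (l * v))"
    proof (rule set_integral_mono[OF set_integrable_abs[OF rec(2)[OF L i u]] e_int])
      fix v assume v: "v \<in> {0..u}"
      have "\<bar>\<Sum>j\<in>I. B i j * g ((i, u) # (i, v) # L) j v\<bar> \<le> (\<Sum>j\<in>I. \<bar>B i j\<bar> * (exp (l * v) * Q))"
      proof (rule order.trans[OF sum_abs], rule sum_mono)
        fix j assume "j \<in> I"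
        then have "\<bar>g ((i, u) # (i, v) # L) j v\<bar> \<le> exp (l * v) * Q" using L i u v by (intro gQ) auto
        then show "\<bar>B i j * g ((i, u) # (i, v) # L) j v\<bar> \<le> \<bar>B i j\<bar> * (exp (l * v) * Q)"
          unfolding abs_mult by (rule mult_left_mono) simp
      qed
      also have "\<dots> = (\<Sum>j\<in>I. \<bar>B i j\<bar>) * (exp (l * v) * Q)" by (simp add: sum_distrib_right)
      also have "\<dots> \<le> drift_norm * (exp (l * v) * Q)"
        by (intro mult_right_mono row_sum_le i) (use Q0 in simp)
      finally show "\<bar>\<Sum>j\<in>I. B i j * g ((i, u) # (i, v) # L) j v\<bar> \<le> drift_norm * Q * exp (l * v)"
        by (simp add: ac_simps)
    qed
    also have "\<dots> = drift_norm * Q * (exp (l * u) / l - exp (l * 0) / l)"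
    proof -
      have "(LBINT v:{0..u}. exp (l * v)) = exp (l * u) / l - exp (l * 0) / l"
        by (rule LBINT_FTC) (use u l in \<open>auto intro!: derivative_eq_intros continuous_intros\<close>)
      then show ?thesis by simp
    qed
    also have "\<dots> \<le> drift_norm * Q * (exp (l * u) / l)"
      using drift_norm_pos Q0 l by (intro mult_left_mono) auto
    also have "\<dots> = exp (l * u) * (Q / 2)"
      using drift_norm_pos by (simp add: l_def)
    finally have "exp (- (l * u)) * \<bar>g L i u\<bar> \<le> exp (- (l * u)) * (exp (l * u) * (Q / 2))"
      by (intro mult_left_mono) auto
    also have "\<dots> = Q / 2" by (simp add: mult.assoc[symmetric] flip: exp_add)
    finally show "G x \<le> (SUP x\<in>S. G x) / 2" by (simp add: x G_def Q_def)
  qed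
  then have "Q = 0" using Q0 by simp
  then have "g L i u = 0" using gQ[OF L i u] by simp
  then show ?thesis by (simp add: g_def \<xi>_def)
qed

lemma Y_sign_expectation:
  assumes "i \<in> I" "j \<in> I" "0 \<le> v" "v \<le> u"
  shows "expectation (\<lambda>\<omega>. s i u \<omega> * s i v \<omega> * Y j v \<omega>) = exp (- \<kappa> i * (u - v)) * expectation (Y j v)"
proof -
  have "expectation (\<lambda>\<omega>. (s i u \<omega> * s i v \<omega> - exp (- \<kappa> i * (u - v))) * Y j v \<omega>) = 0"
    using Y_decor[OF assms(1,3,4,2), of v "[]"] assms by simp
  moreover have "integrable M (\<lambda>\<omega>. s i u \<omega> * s i v \<omega> * Y j v \<omega>)"
    by (rule bounded_mult_expectation(1)[where X = 1])
      (use assms s_meas s_abs in \<open>auto simp: abs_mult intro!: Y_int borel_measurable_times\<close>)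
  moreover have "integrable M (Y j v)" by (rule Y_int) (use assms in auto)
  ultimately show ?thesis by (simp add: left_diff_distrib)
qed

lemma sign_expectation:
  assumes "i \<in> I" "0 \<le> v" "v \<le> u"
  shows "expectation (\<lambda>\<omega>. s i u \<omega> * s i v \<omega>) = exp (- \<kappa> i * (u - v))"
proof -
  have "expectation (\<lambda>\<omega>. (s i u \<omega> * s i v \<omega> - exp (- \<kappa> i * (u - v)))) = 0"
    using decor[OF assms, of "[]" "\<lambda>_. 1"] by simp
  moreover have "integrable M (\<lambda>\<omega>. s i u \<omega> * s i v \<omega> * 1)"
    by (rule bounded_mult_expectation(1)[where X = 1])
      (use assms s_meas s_abs in \<open>auto simp: abs_mult intro!: borel_measurable_times\<close>)
  ultimately show ?thesis by (simp add: prob_space)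
qed

text \<open>In expectation the sign change between \<open>v\<close> and \<open>u\<close> is replaced
  by its mean \<open>exp (- \<kappa> i * (u - v))\<close>, which is Duhamel's formula for a system
  with friction \<open>\<kappa>\<close>.\<close>

lemma mean_evolution:
  assumes i: "i \<in> I" and u: "u \<ge> 0"
  shows "expectation (Y i u) = exp (- \<kappa> i * u) * expectation (Y i 0)
      + (LBINT v:{0..u}. exp (- \<kappa> i * (u - v)) * ((\<Sum>j\<in>I. B i j * expectation (Y j v)) + b i v))"
proof -
  obtain K where K: "K > 0" "\<And>i v. i \<in> I \<Longrightarrow> v \<in> {0..u} \<Longrightarrow> expectation (\<lambda>\<omega>. \<bar>drift i v \<omega>\<bar>) \<le> K"
    using drift_moment[OF u] by metis
  define f where "f v \<omega> = (s i u \<omega> * s i v \<omega>) * drift i v \<omega>" for v \<omega>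
  have ss: "(\<lambda>\<omega>. s i u \<omega> * s i v \<omega>) \<in> borel_measurable M"
    "\<And>\<omega>. \<omega> \<in> space M \<Longrightarrow> \<bar>s i u \<omega> * s i v \<omega>\<bar> \<le> 1" if "v \<ge> 0" for v
    using s_meas s_abs i u that by (auto simp: abs_mult)
  have f_meas: "f v \<in> borel_measurable M" if "v \<ge> 0" for v
    unfolding f_def[abs_def] by (intro borel_measurable_times ss that drift_meas i)
  have f_rc: "continuous (at_right v) (\<lambda>v. f v \<omega>)" if "v \<ge> 0" "\<omega> \<in> space M" for v \<omega>
    unfolding f_def by (intro continuous_mult continuous_const s_rc drift_rc i that)
  have f_int: "integrable M (f v)" if "v \<in> {0..u}" for v
    unfolding f_def[abs_def] by (intro bounded_mult_expectation(1)[where X = 1] ss drift_int i) (use that in auto)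
  have f_exp: "expectation (\<lambda>\<omega>. \<bar>f v \<omega>\<bar>) \<le> K" if v: "v \<in> {0..u}" for v
  proof -
    have "expectation (\<lambda>\<omega>. \<bar>f v \<omega>\<bar>) \<le> 1 * expectation (\<lambda>\<omega>. \<bar>drift i v \<omega>\<bar>)"
      unfolding f_def by (intro bounded_mult_expectation(2) ss drift_int i) (use v in auto)
    then show ?thesis using K(2)[OF i v] by linarith
  qed
  note F = expectation_time_integral[where f = f and t = u, OF f_meas f_rc f_int f_exp]
  have Ef: "expectation (f v) = exp (- \<kappa> i * (u - v)) * ((\<Sum>j\<in>I. B i j * expectation (Y j v)) + b i v)"
    if v: "v \<in> {0..u}" for v
  proof -
    have v': "0 \<le> v" "v \<le> u" using v by auto
    have int: "integrable M (\<lambda>\<omega>. s i u \<omega> * s i v \<omega> * Y j v \<omega>)" if "j \<in> I" for j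
      by (intro bounded_mult_expectation(1)[where X = 1] ss Y_int that v')
    have int1: "integrable M (\<lambda>\<omega>. s i u \<omega> * s i v \<omega>)"
      using bounded_mult_expectation(1)[OF ss[OF v'(1)], of "\<lambda>_. 1"] by simp
    have "f v \<omega> = (\<Sum>j\<in>I. B i j * (s i u \<omega> * s i v \<omega> * Y j v \<omega>)) + b i v * (s i u \<omega> * s i v \<omega>)" for \<omega>
      by (simp add: f_def drift_def distrib_left sum_distrib_left ac_simps)
    then have "expectation (f v) = expectation (\<lambda>\<omega>. (\<Sum>j\<in>I. B i j * (s i u \<omega> * s i v \<omega> * Y j v \<omega>)) + b i v * (s i u \<omega> * s i v \<omega>))"
      by (simp only: f_def[abs_def])
    also have "\<dots> = (\<Sum>j\<in>I. B i j * expectation (\<lambda>\<omega>. s i u \<omega> * s i v \<omega> * Y j v \<omega>)) + b i v * expectation (\<lambda>\<omega>. s i u \<omega> * s i v \<omega>)"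
      using int int1 by (subst Bochner_Integration.integral_add) (auto simp: Bochner_Integration.integral_sum)
    also have "\<dots> = (\<Sum>j\<in>I. B i j * (exp (- \<kappa> i * (u - v)) * expectation (Y j v))) + b i v * exp (- \<kappa> i * (u - v))"
      using Y_sign_expectation[OF i _ v'] sign_expectation[OF i v'] by simp
    finally show ?thesis by (simp add: distrib_left sum_distrib_left ac_simps)
  qed
  have "expectation (Y i u) = expectation (\<lambda>\<omega>. s i u \<omega> * s i 0 \<omega> * Y i 0 \<omega> + (LBINT v:{0..u}. f v \<omega>) + W i u \<omega>)"
    by (rule Bochner_Integration.integral_cong[OF refl]) (simp add: evol[OF i u] f_def drift_def)
  also have "\<dots> = expectation (\<lambda>\<omega>. s i u \<omega> * s i 0 \<omega> * Y i 0 \<omega>) + expectation (\<lambda>\<omega>. LBINT v:{0..u}. f v \<omega>) + expectation (W i u)"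
  proof -
    have 1: "integrable M (\<lambda>\<omega>. s i u \<omega> * s i 0 \<omega> * Y i 0 \<omega>)"
      by (intro bounded_mult_expectation(1)[where X = 1] ss Y0_int i) auto
    show ?thesis using 1 F(1) W_int[OF i u]
      by (simp only: Bochner_Integration.integral_add Bochner_Integration.integrable_add)
  qed
  also have "expectation (\<lambda>\<omega>. s i u \<omega> * s i 0 \<omega> * Y i 0 \<omega>) = exp (- \<kappa> i * u) * expectation (Y i 0)"
    using Y_sign_expectation[OF i i _ u] by simp
  also have "expectation (\<lambda>\<omega>. LBINT v:{0..u}. f v \<omega>) = (LBINT v:{0..u}. expectation (f v))" by (rule F(3))
  also have "\<dots> = (LBINT v:{0..u}. exp (- \<kappa> i * (u - v)) * ((\<Sum>j\<in>I. B i j * expectation (Y j v)) + b i v))"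
    by (rule set_lebesgue_integral_cong) (use Ef in auto)
  finally show ?thesis using W_mean[OF i u] by simp
qed

lemma mean_set_integrable:
  assumes i: "i \<in> I"
  shows "set_integrable lborel {0..T} (\<lambda>v. expectation (Y i v))"
proof (cases "T \<ge> 0")
  case True
  obtain K where K: "\<And>i v. i \<in> I \<Longrightarrow> v \<in> {0..T} \<Longrightarrow> expectation (\<lambda>\<omega>. \<bar>Y i v \<omega>\<bar>) \<le> K"
    using Y_moment[OF True] by metis
  show ?thesis
    by (rule expectation_time_integral(2)[where f = "Y i" and K = K])
      (use i K Y_meas Y_rc Y_int in auto)
qed (simp add: set_integrable_def)

text \<open>Regularity is bootstrapped: the means are integrable in time, so the Duhamel integral
  \<open>G\<close> is continuous, hence the means are continuous, and only then is \<open>G\<close>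
  differentiable.\<close>

lemma mean_deriv:
  assumes i: "i \<in> I" and t: "t \<ge> 0"
  shows "((\<lambda>t. expectation (Y i t)) has_real_derivative
     (\<Sum>j\<in>I. B i j * expectation (Y j t)) + b i t - \<kappa> i * expectation (Y i t)) (at t within {0..})"
proof -
  define m where "m i t = expectation (Y i t)" for i t
  define h where "h i v = (\<Sum>j\<in>I. B i j * m j v) + b i v" for i v
  define G where "G i u = m i 0 + integral {0..u} (\<lambda>v. exp (\<kappa> i * v) * h i v)" for i u
  have h_int: "set_integrable lborel {0..T} (\<lambda>v. exp (\<kappa> i * v) * h i v)" if i: "i \<in> I" for i T
  proof -
    have hs: "set_integrable lborel {0..T} (h i)"
      unfolding h_def[abs_def]
    proof (rule set_integral_add(1))
      show "set_integrable lborel {0..T} (\<lambda>v. \<Sum>j\<in>I. B i j * m j v)"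
        using mean_set_integrable[of _ T] unfolding set_integrable_def m_def scaleR_sum_right
        by (auto intro!: Bochner_Integration.integrable_sum simp: mult.left_commute)
      show "set_integrable lborel {0..T} (b i)"
        by (rule borel_integrable_atLeastAtMost') (rule continuous_on_subset[OF b_cont[OF i]], auto)
    qed
    show ?thesis
      unfolding set_integrable_def
    proof (rule Bochner_Integration.integrable_bound)
      show "integrable lborel (\<lambda>v. exp (\<bar>\<kappa> i\<bar> * \<bar>T\<bar>) * (indicator {0..T} v *\<^sub>R h i v))"
        using hs by (simp add: set_integrable_def)
      have "(\<lambda>v. exp (\<kappa> i * v) * (indicator {0..T} v *\<^sub>R h i v)) \<in> borel_measurable lborel"
        by (rule borel_measurable_times[OF _ borel_measurable_integrable[OF hs[unfolded set_integrable_def]]]) simp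
      then show "(\<lambda>v. indicator {0..T} v *\<^sub>R (exp (\<kappa> i * v) * h i v)) \<in> borel_measurable lborel"
        by (simp add: mult.left_commute)
      show "AE v in lborel. norm (indicator {0..T} v *\<^sub>R (exp (\<kappa> i * v) * h i v)) \<le> norm (exp (\<bar>\<kappa> i\<bar> * \<bar>T\<bar>) * (indicator {0..T} v *\<^sub>R h i v))"
      proof (rule AE_I2)
        fix v
        have "exp (\<kappa> i * v) * \<bar>h i v\<bar> \<le> exp (\<bar>\<kappa> i\<bar> * \<bar>T\<bar>) * \<bar>h i v\<bar>" if "v \<in> {0..T}"
        proof (rule mult_right_mono)
          have "\<kappa> i * v \<le> \<bar>\<kappa> i\<bar> * \<bar>v\<bar>" by (metis abs_ge_self abs_mult)
          also have "\<dots> \<le> \<bar>\<kappa> i\<bar> * \<bar>T\<bar>" using that by (intro mult_left_mono) auto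
          finally show "exp (\<kappa> i * v) \<le> exp (\<bar>\<kappa> i\<bar> * \<bar>T\<bar>)" by simp
        qed simp
        then show "norm (indicator {0..T} v *\<^sub>R (exp (\<kappa> i * v) * h i v)) \<le> norm (exp (\<bar>\<kappa> i\<bar> * \<bar>T\<bar>) * (indicator {0..T} v *\<^sub>R h i v))"
          by (auto simp: abs_mult split: split_indicator)
      qed
    qed
  qed
  have m_eq: "m i u = exp (- \<kappa> i * u) * G i u" if i: "i \<in> I" and u: "u \<ge> 0" for i u
  proof -
    have "(LBINT v:{0..u}. exp (- \<kappa> i * (u - v)) * h i v) = (LBINT v:{0..u}. exp (- \<kappa> i * u) * (exp (\<kappa> i * v) * h i v))"
    proof -
      have "exp (- \<kappa> i * (u - v)) = exp (- \<kappa> i * u) * exp (\<kappa> i * v)" for v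
        unfolding exp_add[symmetric] by (simp add: algebra_simps)
      then show ?thesis by (simp only: mult.assoc)
    qed
    also have "\<dots> = exp (- \<kappa> i * u) * integral {0..u} (\<lambda>v. exp (\<kappa> i * v) * h i v)"
      by (simp add: set_borel_integral_eq_integral(2)[OF h_int[OF i]])
    finally show ?thesis
      using mean_evolution[OF i u] unfolding m_def[symmetric] h_def[symmetric] G_def by (simp add: distrib_left)
  qed
  have G_cont: "continuous_on {0..} (G i)" if i: "i \<in> I" for i
  proof (rule continuous_on_eq_continuous_within[THEN iffD2], rule ballI)
    fix x :: real assume x: "x \<in> {0..}"
    have "continuous_on {0..x + 1} (G i)"
      unfolding G_def[abs_def]
      by (intro continuous_intros indefinite_integral_continuous_1 set_borel_integral_eq_integral(1) h_int i)
    then have "continuous (at x within {0..x + 1}) (G i)" using x by (auto simp: continuous_on_eq_continuous_within)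
    moreover have "at x within {0..x + 1} = at x within {0..}"
      by (rule at_within_nhd[of _ "{..<x + 1}"]) (use x in auto)
    ultimately show "continuous (at x within {0..}) (G i)" by simp
  qed
  have m_cont: "continuous_on {0..} (m i)" if i: "i \<in> I" for i
  proof -
    have "continuous_on {0..} (\<lambda>u. exp (- \<kappa> i * u) * G i u)" by (intro continuous_intros G_cont i)
    then show ?thesis by (rule continuous_on_eq) (simp add: m_eq i)
  qed
  have h_cont: "continuous_on {0..} (\<lambda>v. exp (\<kappa> i * v) * h i v)"
    unfolding h_def by (intro continuous_intros m_cont b_cont i)
  have DG: "(G i has_real_derivative exp (\<kappa> i * t) * h i t) (at t within {0..})"
    unfolding G_def[abs_def]
    using DERIV_add[OF DERIV_const integral_deriv_within_atLeast[OF h_cont t]] by simp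
  have "((\<lambda>u. exp (- \<kappa> i * u) * G i u) has_real_derivative
      (exp (- \<kappa> i * t) * (- \<kappa> i)) * G i t + (exp (\<kappa> i * t) * h i t) * exp (- \<kappa> i * t)) (at t within {0..})"
    by (auto intro!: derivative_eq_intros DG)
  moreover have "(exp (- \<kappa> i * t) * (- \<kappa> i)) * G i t + (exp (\<kappa> i * t) * h i t) * exp (- \<kappa> i * t) = h i t - \<kappa> i * m i t"
    unfolding m_eq[OF i t] by (simp add: exp_minus)
  ultimately have "((\<lambda>u. exp (- \<kappa> i * u) * G i u) has_real_derivative h i t - \<kappa> i * m i t) (at t within {0..})" by simp
  then have "(m i has_real_derivative h i t - \<kappa> i * m i t) (at t within {0..})"
    by (rule has_field_derivative_transform_within[where d = 1]) (use t m_eq i in auto)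
  then show ?thesis unfolding h_def m_def[abs_def] .
qed

end

subsection \<open>Reflected paths and Poisson flips\<close>

lemma left_lim_eqI:
  assumes "(f \<longlongrightarrow> l) (at_left s)"
  shows "left_lim f s = l"
  unfolding left_lim_def by (rule tendsto_Lim[OF _ assms]) (rule trivial_limit_at_left_real)

lemma left_lim_const:
  assumes "a < s" "\<And>x. a \<le> x \<Longrightarrow> x < s \<Longrightarrow> f x = c"
  shows "left_lim f s = c"
proof (rule left_lim_eqI, rule tendsto_eventually)
  show "\<forall>\<^sub>F x in at_left s. f x = c"
    unfolding eventually_at_left_field using assms by (intro exI[of _ a]) auto
qed

text \<open>The sign changes at each jump exactly when the path is reflected, so their product is
  continuous. With at most one unit jump per cell of a grid this is checked cell by cell.\<close>

lemma reflected_path_sign: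
  fixes A :: "real \<Rightarrow> nat" and f g :: "real \<Rightarrow> real"
  assumes mono: "mono_on {0..} A"
    and rc: "\<And>t. t \<ge> 0 \<Longrightarrow> continuous (at_right t) (\<lambda>s. real (A s))"
    and f: "\<And>t. t \<ge> 0 \<Longrightarrow> f t = f 0 + (LBINT s:{0..t}. g s) - 2 * jump_integral f (\<lambda>s. real (A s)) t"
    and g: "\<And>t. set_integrable lborel {0..t} g"
    and sg: "\<And>t. set_integrable lborel {0..t} (\<lambda>s. (-1) ^ A s * g s)"
    and T: "T \<ge> 0" and m: "m \<ge> 1"
    and grid: "\<And>i. i < m \<Longrightarrow> A (real (Suc i) * (T / real m)) \<le> A (real i * (T / real m)) + 1"
    and t: "t \<in> {0..T}"
  shows "(-1) ^ A t * f t = (-1) ^ A 0 * f 0 + (LBINT s:{0..t}. (-1) ^ A s * g s)"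
proof -
  define \<Gamma> where "\<Gamma> t = (LBINT s:{0..t}. g s)" for t
  define E where "E t = (-1) ^ A 0 * f 0 + (LBINT s:{0..t}. (-1) ^ A s * g s)" for t
  define J where "J t = {s. 0 < s \<and> s \<le> t \<and> real (A s) \<noteq> left_lim (\<lambda>s. real (A s)) s}" for t
  define JI where "JI t = jump_integral f (\<lambda>s. real (A s)) t" for t
  \<comment> \<open>Finiteness of the jump set is carried along because \<open>jump_integral\<close>
    sums over that set, and such a sum is zero by default when the set is infinite.\<close>
  define P where "P a \<longleftrightarrow> finite (J a) \<and> (\<forall>t\<in>{0..a}. (-1) ^ A t * f t = E t)" for a
  have A_mono: "A x \<le> A y" if "0 \<le> x" "x \<le> y" for x y
    using mono that by (auto simp: mono_on_def)
  have int_cont: "continuous_on {0..b} (\<lambda>t. LBINT s:{0..t}. h s)" if "\<And>t. set_integrable lborel {0..t} h" for b and h :: "real \<Rightarrow> real"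
    unfolding set_borel_integral_eq_integral(2)[OF that]
    by (intro indefinite_integral_continuous_1 set_borel_integral_eq_integral(1) that)
  have int_left: "((\<lambda>t. LBINT s:{0..t}. h s) \<longlongrightarrow> (LBINT s:{0..\<tau>}. h s)) (at_left \<tau>)"
    if "\<And>t. set_integrable lborel {0..t} h" "\<tau> > 0" for \<tau> and h :: "real \<Rightarrow> real"
  proof -
    have "((\<lambda>t. LBINT s:{0..t}. h s) \<longlongrightarrow> (LBINT s:{0..\<tau>}. h s)) (at \<tau> within {0..\<tau>})"
      using int_cont[OF that(1), of \<tau>] that(2) by (auto simp: continuous_on_def)
    then have "((\<lambda>t. LBINT s:{0..t}. h s) \<longlongrightarrow> (LBINT s:{0..\<tau>}. h s)) (at \<tau> within {0<..<\<tau>})"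
      by (rule tendsto_within_subset) auto
    moreover have "at \<tau> within {0<..<\<tau>} = at_left \<tau>"
      by (rule at_within_nhd[of _ "{0<..}"]) (use that(2) in auto)
    ultimately show ?thesis by simp
  qed
  have combine: "(LBINT s:{0..t}. h s) = (LBINT s:{0..a}. h s) + (LBINT s:{a..t}. h s)"
    if h: "\<And>t. set_integrable lborel {0..t} h" and "0 \<le> a" "a \<le> t" for a t and h :: "real \<Rightarrow> real"
  proof -
    have at: "set_integrable lborel {a..t} h" by (rule set_integrable_subset[OF h[of t]]) (use that in auto)
    have "integral {0..a} h + integral {a..t} h = integral {0..t} h"
      by (rule Henstock_Kurzweil_Integration.integral_combine) (use that h in \<open>auto intro: set_borel_integral_eq_integral(1)\<close>)
    then show ?thesis by (simp add: set_borel_integral_eq_integral(2) h at)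
  qed
  have no_jump: "s \<notin> J t" if "0 \<le> a" "a < s" "\<And>x. a \<le> x \<Longrightarrow> x \<le> s \<Longrightarrow> A x = A s" for a s t
  proof -
    have "left_lim (\<lambda>s. real (A s)) s = real (A s)"
      by (rule left_lim_const[OF that(2)]) (use that(3) in \<open>metis less_imp_le\<close>)
    then show ?thesis by (simp add: J_def)
  qed
  \<comment> \<open>No flip between \<open>a\<close> and \<open>t\<close>: the jump integral does
    not change and \<open>f\<close> moves by the drift alone.\<close>
  have flat: "J t = J a \<and> JI t = JI a \<and> f t = f a + \<Gamma> t - \<Gamma> a" if "0 \<le> a" "a \<le> t" "A t = A a" for a t
  proof -
    have const: "A x = A a" if x: "a \<le> x" "x \<le> t" for x
    proof (rule antisym)
      show "A x \<le> A a" using A_mono[of x t] x \<open>0 \<le> a\<close> \<open>A t = A a\<close> by linarith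
      show "A a \<le> A x" using A_mono[of a x] x \<open>0 \<le> a\<close> by linarith
    qed
    have "J t = J a"
    proof (intro set_eqI iffI)
      fix s assume s: "s \<in> J t"
      show "s \<in> J a"
      proof (rule ccontr)
        assume "s \<notin> J a"
        then have as: "a < s" "s \<le> t" using s by (auto simp: J_def)
        have "A x = A s" if "a \<le> x" "x \<le> s" for x
          using const[of x] const[of s] that as by simp
        from no_jump[OF \<open>0 \<le> a\<close> as(1) this] s show False by blast
      qed
    qed (use \<open>a \<le> t\<close> in \<open>auto simp: J_def\<close>)
    moreover from this have "JI t = JI a" by (simp add: JI_def jump_integral_def J_def)
    moreover have "f t = f a + \<Gamma> t - \<Gamma> a"
      using f[of t] f[of a] that \<open>JI t = JI a\<close> by (simp add: \<Gamma>_def JI_def)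
    ultimately show ?thesis by simp
  qed
  have extend: "P b" if a: "0 \<le> a" "a \<le> b" "A b = A a" and Pa: "P a" for a b
  proof -
    have "(-1) ^ A t * f t = E t" if t: "t \<in> {0..b}" for t
    proof (cases "t \<le> a")
      case True
      then show ?thesis using Pa t by (auto simp: P_def)
    next
      case False
      then have at: "a \<le> t" by simp
      have const: "A x = A a" if x: "a \<le> x" "x \<le> t" for x
      proof (rule antisym)
        show "A x \<le> A a" using A_mono[of x b] x t a by simp
        show "A a \<le> A x" using A_mono[of a x] x a by simp
      qed
      have "E t = E a + (LBINT s:{a..t}. (-1) ^ A s * g s)"
        using combine[OF sg a(1) at] by (simp add: E_def)
      also have "(LBINT s:{a..t}. (-1) ^ A s * g s) = (LBINT s:{a..t}. (-1) ^ A a * g s)"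
      proof (rule set_lebesgue_integral_cong, simp, intro allI impI)
        fix x assume "x \<in> {a..t}"
        then have "A x = A a" by (intro const) auto
        then show "(-1) ^ A x * g x = (-1) ^ A a * g x" by simp
      qed
      also have "\<dots> = (-1) ^ A a * (\<Gamma> t - \<Gamma> a)"
        using combine[OF g a(1) at] by (simp add: \<Gamma>_def)
      also have "E a = (-1) ^ A a * f a" using Pa a(1) unfolding P_def by (metis atLeastAtMost_iff order_refl)
      finally have E: "E t = (-1) ^ A a * f a + (-1) ^ A a * (\<Gamma> t - \<Gamma> a)" .
      have At: "A t = A a" by (rule const[OF at order_refl])
      have "f t = f a + \<Gamma> t - \<Gamma> a" using flat[OF a(1) at At] by blast
      then show ?thesis unfolding E At by (simp only: distrib_left[symmetric]) simp
    qed
    then show ?thesis using Pa flat[OF a] by (simp add: P_def)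
  qed
  \<comment> \<open>At a single flip the left limit \<open>l\<close> enters the jump integral once
    with height 1, so \<open>f \<tau> = l - 2 * l = - l\<close>. The sign changes as well, so the
    signed path takes at \<open>\<tau>\<close> the value it approaches from the left.\<close>
  have jump: "P \<tau>" if a: "0 \<le> a" "a < \<tau>" and below: "\<And>x. a \<le> x \<Longrightarrow> x < \<tau> \<Longrightarrow> A x = A a"
      and at: "A \<tau> = A a + 1" and Pa: "P a" for a \<tau>
  proof -
    have Px: "P x" if "a \<le> x" "x < \<tau>" for x
      by (rule extend[OF a(1) that(1) below[OF that] Pa])
    define l where "l = f a + \<Gamma> \<tau> - \<Gamma> a"
    have ev: "\<forall>\<^sub>F x in at_left \<tau>. a \<le> x \<and> x < \<tau>"
      unfolding eventually_at_left_field using a by (intro exI[of _ a]) auto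
    have "((\<lambda>x. f a + \<Gamma> x - \<Gamma> a) \<longlongrightarrow> l) (at_left \<tau>)"
      unfolding l_def \<Gamma>_def using a by (intro tendsto_intros int_left g) auto
    moreover have "\<forall>\<^sub>F x in at_left \<tau>. f a + \<Gamma> x - \<Gamma> a = f x"
      using ev
    proof eventually_elim
      case (elim x)
      then show ?case using flat[OF a(1) _ below[of x]] by simp
    qed
    ultimately have fl: "(f \<longlongrightarrow> l) (at_left \<tau>)" by (rule Lim_transform_eventually)
    have Al: "left_lim (\<lambda>s. real (A s)) \<tau> = real (A a)"
      by (rule left_lim_const[OF a(2)]) (drule (1) below, simp)
    have J: "J \<tau> = insert \<tau> (J a)"
    proof (intro set_eqI iffI)
      fix s assume s: "s \<in> J \<tau>"
      show "s \<in> insert \<tau> (J a)"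
      proof (rule ccontr)
        assume n: "s \<notin> insert \<tau> (J a)"
        then have as: "a < s" "s < \<tau>" using s by (auto simp: J_def)
        have "A x = A s" if "a \<le> x" "x \<le> s" for x
          using below[of x] below[of s] that as by simp
        from no_jump[OF a(1) as(1) this] s show False by blast
      qed
    next
      fix s assume "s \<in> insert \<tau> (J a)"
      then show "s \<in> J \<tau>" using a Al at by (auto simp: J_def)
    qed
    have fin: "finite (J a)" using Pa by (simp add: P_def)
    have \<tau>: "\<tau> \<notin> J a" using a by (auto simp: J_def)
    have "JI \<tau> = left_lim f \<tau> * (real (A \<tau>) - left_lim (\<lambda>s. real (A s)) \<tau>) + JI a"
      unfolding JI_def jump_integral_def J_def[symmetric] J using fin \<tau> by simp
    then have "JI \<tau> = l + JI a" using left_lim_eqI[OF fl] Al at by simp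
    then have "f \<tau> = - l"
      using f[of \<tau>] f[of a] a by (simp add: l_def \<Gamma>_def JI_def)
    moreover have "(-1) ^ A a * l = E \<tau>"
    proof (rule tendsto_unique[OF trivial_limit_at_left_real])
      show "((\<lambda>x. (-1) ^ A a * f x) \<longlongrightarrow> (-1) ^ A a * l) (at_left \<tau>)" by (intro tendsto_intros fl)
      have "(E \<longlongrightarrow> E \<tau>) (at_left \<tau>)"
        unfolding E_def using a by (intro tendsto_intros int_left sg) auto
      moreover have "\<forall>\<^sub>F x in at_left \<tau>. E x = (-1) ^ A a * f x"
        using ev
      proof eventually_elim
        case (elim x)
        then have "(-1) ^ A x * f x = E x" using Px[of x] a by (auto simp: P_def)
        then show ?case using below[of x] elim by simp
      qed
      ultimately show "((\<lambda>x. (-1) ^ A a * f x) \<longlongrightarrow> E \<tau>) (at_left \<tau>)" by (rule Lim_transform_eventually)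
    qed
    ultimately have "(-1) ^ A \<tau> * f \<tau> = E \<tau>" using at by simp
    moreover have "(-1) ^ A x * f x = E x" if "x \<in> {0..\<tau>}" "x \<noteq> \<tau>" for x
      using Px[of "max a x"] that a by (auto simp: P_def)
    ultimately have "(-1) ^ A x * f x = E x" if "x \<in> {0..\<tau>}" for x
      using that by (cases "x = \<tau>") auto
    then show ?thesis using J fin unfolding P_def by simp
  qed
  have cell: "P b" if a: "0 \<le> a" "a \<le> b" "A b \<le> A a + 1" and Pa: "P a" for a b
  proof (cases "A b = A a")
    case True
    then show ?thesis using extend a Pa by blast
  next
    case False
    then have Ab: "A b = A a + 1" using A_mono[OF a(1,2)] a(3) by simp
    \<comment> \<open>The cell contains exactly one unit jump. Its time is the infimum of the times
      at which the higher value is reached, and right continuity shows that the value is attained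
      there.\<close>
    define U where "U = {u. a \<le> u \<and> u \<le> b \<and> A u = A a + 1}"
    have bU: "b \<in> U" using Ab a by (simp add: U_def)
    have bdd: "bdd_below U" by (rule bdd_belowI[of _ a]) (simp add: U_def)
    define \<tau> where "\<tau> = Inf U"
    have \<tau>: "a \<le> \<tau>" "\<tau> \<le> b" unfolding \<tau>_def using bU
      by (auto intro!: cInf_greatest cInf_lower bdd simp: U_def)
    have val: "A u = A a \<or> A u = A a + 1" if "a \<le> u" "u \<le> b" for u
      using A_mono[of a u] A_mono[of u b] that a Ab by auto
    have below: "A x = A a" if "a \<le> x" "x < \<tau>" for x
    proof (rule ccontr)
      assume "A x \<noteq> A a"
      then have "x \<in> U" using val[of x] that \<tau> by (auto simp: U_def)
      then have "\<tau> \<le> x" unfolding \<tau>_def by (rule cInf_lower[OF _ bdd])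
      then show False using that by simp
    qed
    have above: "A x = A a + 1" if x: "\<tau> < x" "x \<le> b" for x
    proof -
      obtain u where "u \<in> U" "u < x" using cInf_lessD[of U x] bU x unfolding \<tau>_def by auto
      then show ?thesis using A_mono[of u x] A_mono[of x b] x a Ab by (auto simp: U_def)
    qed
    have at: "A \<tau> = A a + 1"
    proof (cases "\<tau> = b")
      case False
      then have lt: "\<tau> < b" using \<tau> by simp
      have "((\<lambda>s. real (A s)) \<longlongrightarrow> real (A \<tau>)) (at_right \<tau>)"
        using rc[of \<tau>] \<tau> a by (simp add: continuous_within)
      moreover have "((\<lambda>s. real (A s)) \<longlongrightarrow> real (A a + 1)) (at_right \<tau>)"
      proof (rule tendsto_eventually)
        show "\<forall>\<^sub>F s in at_right \<tau>. real (A s) = real (A a + 1)"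
          unfolding eventually_at_right_field using lt above by (intro exI[of _ b]) auto
      qed
      ultimately have "real (A \<tau>) = real (A a + 1)"
        by (rule tendsto_unique[OF trivial_limit_at_right_real])
      then show ?thesis by simp
    qed (simp add: Ab)
    then have "a < \<tau>" using \<tau> by (cases "a = \<tau>") auto
    then have "P \<tau>" using jump[OF a(1) _ below at Pa] by blast
    then show ?thesis by (rule extend[rotated 3]) (use \<tau> a Ab at in auto)
  qed
  have "P (real k * (T / real m))" if "k \<le> m" for k
    using that
  proof (induction k)
    case 0
    have "J 0 = {}" by (auto simp: J_def)
    moreover have "E 0 = (-1) ^ A 0 * f 0"
      unfolding E_def set_borel_integral_eq_integral(2)[OF sg] by simp
    ultimately show ?case by (simp add: P_def)
  next
    case (Suc k)
    show ?case
    proof (rule cell)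
      show "0 \<le> real k * (T / real m)" using T by simp
      show "real k * (T / real m) \<le> real (Suc k) * (T / real m)"
        using T by (intro mult_right_mono) auto
      show "A (real (Suc k) * (T / real m)) \<le> A (real k * (T / real m)) + 1"
        using Suc.prems by (intro grid) simp
      show "P (real k * (T / real m))" using Suc by simp
    qed
  qed
  from this[of m] have "P T" using m by simp
  then have "(-1) ^ A t * f t = E t" using t unfolding P_def by blast
  then show ?thesis unfolding E_def .
qed

section \<open>Counts and parities of Poisson increments\<close>

lemma poisson_two_le:
  assumes "l > 0"
  shows "measure_pmf.prob (poisson_pmf l) {2..} \<le> l\<^sup>2"
proof -
  have "measure_pmf.prob (poisson_pmf l) {2..} = 1 - measure_pmf.prob (poisson_pmf l) {0, 1}"
  proof -
    have "{2..} = UNIV - {0, 1::nat}" by auto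
    then show ?thesis using measure_pmf.prob_compl[of "{0, 1}" "poisson_pmf l"] by simp
  qed
  also have "measure_pmf.prob (poisson_pmf l) {0, 1} = (1 + l) * exp (- l)"
    using assms by (simp add: measure_measure_pmf_finite pmf_poisson[OF assms] algebra_simps)
  \<comment> \<open>The lower bound \<open>1 - l\<close> for the exponential makes the left-hand
    side \<open>1 - l^2\<close>.\<close>
  also have "(1 + l) * (1 - l) \<le> (1 + l) * exp (- l)"
    using assms exp_ge_add_one_self[of "- l"] by (intro mult_left_mono) auto
  then have "1 - (1 + l) * exp (- l) \<le> l\<^sup>2" by (simp add: power2_eq_square algebra_simps)
  finally show ?thesis .
qed

text \<open>The generating function of the Poisson law at \<open>-1\<close>: the normalisation and
  the alternating series each contribute \<open>exp (- l)\<close>.\<close>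

lemma poisson_parity_expectation:
  assumes "l > 0"
  shows "measure_pmf.expectation (poisson_pmf l) (\<lambda>k. (-1) ^ k) = exp (- (2 * l))"
proof -
  have s: "(\<lambda>k. pmf (poisson_pmf l) k * (-1) ^ k) sums exp (- (2 * l))"
  proof -
    have "(\<lambda>k. exp (- l) * ((- l) ^ k /\<^sub>R fact k)) sums (exp (- l) * exp (- l))"
      by (rule sums_mult[OF exp_converges])
    moreover have "exp (- l) * ((- l) ^ k /\<^sub>R fact k) = pmf (poisson_pmf l) k * (-1) ^ k" for k
      using assms by (simp add: power_minus[of l] pmf_poisson[OF assms] field_simps)
    moreover have "exp (- l) * exp (- l) = exp (- (2 * l))" by (simp flip: exp_add)
    ultimately show ?thesis by simp
  qed
  have "measure_pmf.expectation (poisson_pmf l) (\<lambda>k. (-1) ^ k) = (LINT k|count_space UNIV. pmf (poisson_pmf l) k * (-1) ^ k)"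
    by (simp add: measure_pmf_eq_density integral_density)
  also have "\<dots> = (\<Sum>k. pmf (poisson_pmf l) k * (-1) ^ k)"
  proof (rule integral_count_space_nat)
    have "summable (\<lambda>k. exp (- l) * (l ^ k /\<^sub>R fact k))"
      by (intro summable_mult summable_exp_generic)
    moreover have "exp (- l) * (l ^ k /\<^sub>R fact k) = norm (pmf (poisson_pmf l) k * (-1) ^ k)" for k
      using assms by (simp add: abs_mult pmf_poisson[OF assms] field_simps)
    ultimately show "integrable (count_space UNIV) (\<lambda>k. pmf (poisson_pmf l) k * (-1) ^ k)"
      by (simp only: integrable_count_space_nat_iff)
  qed
  also have "\<dots> = exp (- (2 * l))" using s by (simp add: sums_iff)
  finally show ?thesis .
qed

context prob_space
begin

lemma poisson_increment_ge_2:
  assumes N: "unit_poisson_process M N" and st: "0 \<le> s" "s < t"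
  shows "prob {\<omega> \<in> space M. N t \<omega> - N s \<omega> \<ge> 2} \<le> (t - s)\<^sup>2"
proof -
  have [measurable]: "N t \<in> M \<rightarrow>\<^sub>M count_space UNIV" "N s \<in> M \<rightarrow>\<^sub>M count_space UNIV"
    using N st by (auto simp: unit_poisson_process_def)
  have "prob {\<omega> \<in> space M. N t \<omega> - N s \<omega> \<ge> 2} = measure (distr M (count_space UNIV) (\<lambda>\<omega>. N t \<omega> - N s \<omega>)) {2..}"
    by (subst measure_distr) (auto intro!: arg_cong[where f = prob])
  also have "\<dots> = measure_pmf.prob (poisson_pmf (t - s)) {2..}"
    using N st by (simp add: unit_poisson_process_def)
  also have "\<dots> \<le> (t - s)\<^sup>2" using st by (intro poisson_two_le) simp
  finally show ?thesis .
qed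

text \<open>A grid of \<open>m\<close> cells has an increment of at least 2 in some cell with
  probability at most \<open>m * (T / m)^2\<close>, which tends to zero. Hence almost surely some
  grid has increments of at most 1, the form in which \<open>reflected_path_sign\<close> uses unit
  jumps.\<close>

lemma poisson_unit_jumps:
  assumes N: "unit_poisson_process M N" and T: "T > 0"
  shows "AE \<omega> in M. \<exists>m\<ge>1. \<forall>i<m. N (real (Suc i) * (T / real m)) \<omega> \<le> N (real i * (T / real m)) \<omega> + 1"
proof -
  define B where "B m = (\<Union>i<m. {\<omega> \<in> space M. N (real (Suc i) * (T / real m)) \<omega> - N (real i * (T / real m)) \<omega> \<ge> 2})" for m
  have Nm: "N t \<in> M \<rightarrow>\<^sub>M count_space UNIV" if "t \<ge> 0" for t
    using N that by (auto simp: unit_poisson_process_def)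
  have ev: "{\<omega> \<in> space M. N (real (Suc i) * (T / real m)) \<omega> - N (real i * (T / real m)) \<omega> \<ge> 2} \<in> events" for i m
  proof -
    have [measurable]: "N (real (Suc i) * (T / real m)) \<in> M \<rightarrow>\<^sub>M count_space UNIV" "N (real i * (T / real m)) \<in> M \<rightarrow>\<^sub>M count_space UNIV"
      using T by (auto intro!: Nm)
    show ?thesis by measurable
  qed
  have B: "B m \<in> events" for m unfolding B_def using ev by (intro sets.countable_UN') auto
  have PB: "prob (B m) \<le> T\<^sup>2 / real m" if m: "m \<ge> 1" for m
  proof -
    have "prob (B m) \<le> (\<Sum>i<m. prob {\<omega> \<in> space M. N (real (Suc i) * (T / real m)) \<omega> - N (real i * (T / real m)) \<omega> \<ge> 2})"
      unfolding B_def by (rule finite_measure_subadditive_finite) (use ev in auto)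
    also have "\<dots> \<le> (\<Sum>i<m. (T / real m)\<^sup>2)"
    proof (rule sum_mono)
      fix i
      have "real (Suc i) * (T / real m) - real i * (T / real m) = T / real m" by (simp add: algebra_simps add_divide_distrib)
      moreover have "0 \<le> real i * (T / real m)" "real i * (T / real m) < real (Suc i) * (T / real m)"
        using T m by (simp_all del: of_nat_Suc) (intro divide_strict_right_mono mult_strict_right_mono; simp)
      ultimately show "prob {\<omega> \<in> space M. N (real (Suc i) * (T / real m)) \<omega> - N (real i * (T / real m)) \<omega> \<ge> 2} \<le> (T / real m)\<^sup>2"
        using poisson_increment_ge_2[OF N, of "real i * (T / real m)" "real (Suc i) * (T / real m)"] by simp
    qed
    also have "\<dots> = T\<^sup>2 / real m" using m by (simp add: power2_eq_square field_simps)
    finally show ?thesis .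
  qed
  define Bi where "Bi = (\<Inter>m. B (Suc m))"
  have Bi: "Bi \<in> events" unfolding Bi_def using B by auto
  have "prob Bi \<le> T\<^sup>2 / real (Suc m)" for m
  proof -
    have "Bi \<subseteq> B (Suc m)" by (auto simp: Bi_def)
    then have "prob Bi \<le> prob (B (Suc m))" by (rule finite_measure_mono) (rule B)
    also have "\<dots> \<le> T\<^sup>2 / real (Suc m)" by (rule PB) simp
    finally show ?thesis .
  qed
  moreover have "(\<lambda>m. T\<^sup>2 / real (Suc m)) \<longlonglongrightarrow> 0"
    using tendsto_mult[OF tendsto_const[of "T\<^sup>2"] LIMSEQ_inverse_real_of_nat] by (simp add: divide_inverse)
  ultimately have "prob Bi \<le> 0" by (intro LIMSEQ_le_const) auto
  then have "prob Bi = 0" using measure_nonneg[of M Bi] by linarith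
  then have null: "Bi \<in> null_sets M" using Bi by (simp add: null_sets_def emeasure_eq_measure)
  show ?thesis
  proof (rule AE_I'[OF null])
    show "{\<omega> \<in> space M. \<not> (\<exists>m\<ge>1. \<forall>i<m. N (real (Suc i) * (T / real m)) \<omega> \<le> N (real i * (T / real m)) \<omega> + 1)} \<subseteq> Bi"
    proof
      fix \<omega> assume "\<omega> \<in> {\<omega> \<in> space M. \<not> (\<exists>m\<ge>1. \<forall>i<m. N (real (Suc i) * (T / real m)) \<omega> \<le> N (real i * (T / real m)) \<omega> + 1)}"
      then have \<omega>: "\<omega> \<in> space M" and nex: "\<not> (\<exists>m\<ge>1. \<forall>i<m. N (real (Suc i) * (T / real m)) \<omega> \<le> N (real i * (T / real m)) \<omega> + 1)"
        unfolding mem_Collect_eq by blast+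
      have ex: "\<exists>i<m. N (real i * (T / real m)) \<omega> + 1 < N (real (Suc i) * (T / real m)) \<omega>" if "m \<ge> 1" for m
        using nex that by (meson not_le)
      have "\<omega> \<in> B (Suc m)" for m
      proof -
        obtain i where "i < Suc m" "N (real i * (T / real (Suc m))) \<omega> + 1 < N (real (Suc i) * (T / real (Suc m))) \<omega>"
          using ex[of "Suc m"] by auto
        then show ?thesis using \<omega> unfolding B_def by (intro UN_I[of i]) (auto simp del: of_nat_Suc)
      qed
      then show "\<omega> \<in> Bi" by (simp add: Bi_def)
    qed
  qed
qed

end

text \<open>Writes the parity change as a Borel function of the real increment \<open>a - b\<close>,
  the quantity whose independence is given by \<open>indep_increments\<close>.\<close>

lemma cos_pi_nat_diff: "cos (pi * (real a - real b)) = (-1) ^ a * (-1) ^ b"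
proof -
  have "cos (pi * (real a - real b)) = cos (pi * real a) * cos (pi * real b) + sin (pi * real a) * sin (pi * real b)"
    by (simp add: right_diff_distrib cos_diff)
  then show ?thesis by (simp add: cos_npi2 sin_npi2)
qed

lemma minus_one_power_square: "(-1) ^ a * (-1) ^ a = (1::real)"
  by (simp flip: power_mult_distrib)

context prob_space
begin

lemma poisson_parity_increment:
  assumes N: "unit_poisson_process M N" and st: "0 \<le> s" "s < t"
  shows "expectation (\<lambda>\<omega>. cos (pi * (real (N t \<omega>) - real (N s \<omega>)))) = exp (- (2 * (t - s)))"
proof -
  have Nm [measurable]: "N t \<in> M \<rightarrow>\<^sub>M count_space UNIV" "N s \<in> M \<rightarrow>\<^sub>M count_space UNIV"
    using N st by (auto simp: unit_poisson_process_def)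
  have dm: "(\<lambda>\<omega>. N t \<omega> - N s \<omega>) \<in> M \<rightarrow>\<^sub>M count_space UNIV" by measurable
  have "AE \<omega> in M. mono_on {0..} (\<lambda>t. N t \<omega>)"
    using N by (auto simp: unit_poisson_process_def)
  then have "AE \<omega> in M. cos (pi * (real (N t \<omega>) - real (N s \<omega>))) = (-1) ^ (N t \<omega> - N s \<omega>)"
  proof eventually_elim
    case (elim \<omega>)
    then have "N s \<omega> \<le> N t \<omega>" using st by (auto simp: mono_on_def)
    then have "real (N t \<omega>) - real (N s \<omega>) = real (N t \<omega> - N s \<omega>)" by (simp add: of_nat_diff)
    then show ?case by (simp only: cos_npi2)
  qed
  then have "expectation (\<lambda>\<omega>. cos (pi * (real (N t \<omega>) - real (N s \<omega>)))) = expectation (\<lambda>\<omega>. (-1) ^ (N t \<omega> - N s \<omega>))"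
    by (intro integral_cong_AE) (measurable, use dm in measurable)
  also have "\<dots> = integral\<^sup>L (distr M (count_space UNIV) (\<lambda>\<omega>. N t \<omega> - N s \<omega>)) (\<lambda>k. (-1) ^ k)"
    by (rule integral_distr[symmetric, OF dm]) simp
  also have "\<dots> = measure_pmf.expectation (poisson_pmf (t - s)) (\<lambda>k. (-1) ^ k)"
    using N st by (simp add: unit_poisson_process_def)
  also have "\<dots> = exp (- (2 * (t - s)))" by (rule poisson_parity_expectation) (use st in simp)
  finally show ?thesis .
qed

text \<open>The process starts at zero almost surely, so all past parities are products of parities
  of increments over a common partition of \<open>[0, s]\<close>. They are therefore independent of
  the increment over \<open>[s, t]\<close>, whose parity minus its mean has expectation
  zero.\<close>

lemma poisson_parity_product:
  assumes N: "unit_poisson_process M N" and st: "0 \<le> s" "s \<le> t" and us: "set us \<subseteq> {0..s}"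
  shows "expectation (\<lambda>\<omega>. (\<Prod>u\<leftarrow>us. (-1) ^ N u \<omega>) * ((-1) ^ N t \<omega> * (-1) ^ N s \<omega> - exp (- (2 * (t - s))))) = 0"
proof (cases "s = t")
  case True
  then show ?thesis by (simp add: minus_one_power_square)
next
  case False
  then have st': "s < t" using st by simp
  \<comment> \<open>Including \<open>0\<close> lets the parities telescope from the start, and
    including \<open>s\<close> makes \<open>[s, t]\<close> the last increment.\<close>
  define pts where "pts = sorted_list_of_set (insert 0 (insert s (set us)))"
  define k where "k = length pts"
  have sorted_list: "set (sorted_list_of_set A) = A" "sorted (sorted_list_of_set A)" if "finite A" for A :: "real set"
    using that by simp_all
  have pts: "set pts = insert 0 (insert s (set us))" "sorted pts"
    unfolding pts_def by (rule sorted_list; simp)+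
  have range: "x \<in> {0..s}" if "x \<in> set pts" for x using that us st by (auto simp: pts)
  have k: "k \<ge> 1" using pts(1) unfolding k_def by (cases pts) auto
  define ts where "ts i = (if i < k then pts ! i else t)" for i
  have ts0: "ts 0 = 0"
  proof -
    obtain i where i: "i < k" "pts ! i = 0" using pts(1) unfolding k_def by (metis in_set_conv_nth insertI1)
    have "pts ! 0 \<le> pts ! i" using i pts(2) by (intro sorted_nth_mono) (auto simp: k_def)
    moreover have "pts ! 0 \<in> {0..s}" using k by (intro range nth_mem) (auto simp: k_def)
    ultimately show ?thesis using i k by (simp add: ts_def)
  qed
  have tsk: "ts (k - 1) = s"
  proof -
    obtain i where i: "i < k" "pts ! i = s" using pts(1) unfolding k_def by (metis in_set_conv_nth insertI1 insertI2)
    have "pts ! i \<le> pts ! (k - 1)" using i pts(2) by (intro sorted_nth_mono) (auto simp: k_def)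
    moreover have "pts ! (k - 1) \<in> {0..s}" using k by (intro range nth_mem) (auto simp: k_def)
    ultimately show ?thesis using i k by (simp add: ts_def)
  qed
  have tst: "ts k = t" by (simp add: ts_def)
  have ts_mono: "ts i \<le> ts (Suc i)" if i: "i < k" for i
  proof (cases "Suc i < k")
    case True
    then show ?thesis using i pts(2) by (simp add: ts_def k_def sorted_nth_mono)
  next
    case False
    then have "i = k - 1" using i by simp
    then show ?thesis using tsk tst st k by simp
  qed
  have ts_nonneg: "ts i \<ge> 0" for i
    using range[OF nth_mem, of i] st by (auto simp: ts_def k_def)
  define X where "X l \<omega> = cos (pi * (real (N (ts (Suc l)) \<omega>) - real (N (ts l) \<omega>)))" for l \<omega>
  define e where "e = exp (- (2 * (t - s)))"
  have tele: "(\<Prod>l<j. X l \<omega>) = (-1) ^ N (ts j) \<omega>" if "N 0 \<omega> = 0" for j \<omega>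
  proof (induction j)
    case 0
    show ?case using that by (simp add: ts0)
  next
    case (Suc j)
    then show ?case
      by (simp add: X_def cos_pi_nat_diff mult.left_commute[of "(-1) ^ N (ts j) \<omega>"] minus_one_power_square)
  qed
  \<comment> \<open>Each past parity is the product of the increment parities up to its time;
    \<open>c l\<close> counts how often the increment \<open>l\<close> occurs.\<close>
  have "\<exists>c. \<forall>\<omega>. N 0 \<omega> = 0 \<longrightarrow> (\<Prod>u\<leftarrow>us. (-1) ^ N u \<omega>) = (\<Prod>l<k - 1. X l \<omega> ^ c l)"
    if "set us \<subseteq> set pts" for us
    using that
  proof (induction us)
    case Nil
    show ?case by (intro exI[of _ "\<lambda>_. 0"]) simp
  next
    case (Cons u us)
    then obtain c where c: "\<And>\<omega>. N 0 \<omega> = 0 \<Longrightarrow> (\<Prod>u\<leftarrow>us. (-1) ^ N u \<omega>) = (\<Prod>l<k - 1. X l \<omega> ^ c l)" by auto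
    obtain j where j: "j < k" "pts ! j = u" using Cons.prems unfolding k_def by (metis in_set_conv_nth list.set_intros(1) subsetD)
    have "(\<Prod>u\<leftarrow>u # us. (-1) ^ N u \<omega>) = (\<Prod>l<k - 1. X l \<omega> ^ (c l + (if l < j then 1 else 0)))" if "N 0 \<omega> = 0" for \<omega>
    proof -
      have "(\<Prod>l<k - 1. X l \<omega> ^ (if l < j then 1 else 0)) = (\<Prod>l<j. X l \<omega>)"
        by (rule prod.mono_neutral_cong_right) (use j in auto)
      also have "\<dots> = (-1) ^ N u \<omega>" using tele[OF that, of j] j by (simp add: ts_def)
      finally show ?thesis using c[OF that] by (simp add: power_add prod.distrib mult.commute)
    qed
    then show ?case by (intro exI[of _ "\<lambda>l. c l + (if l < j then 1 else 0)"]) blast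
  qed
  from this[of us] obtain c where c: "\<And>\<omega>. N 0 \<omega> = 0 \<Longrightarrow> (\<Prod>u\<leftarrow>us. (-1) ^ N u \<omega>) = (\<Prod>l<k - 1. X l \<omega> ^ c l)"
    using pts(1) by auto
  \<comment> \<open>The last index \<open>k - 1\<close> carries the centred factor for
    \<open>[s, t]\<close>, the earlier ones the powers from the past.\<close>
  define \<phi> where "\<phi> l d = (if l < k - 1 then cos (pi * d) ^ c l else cos (pi * d) - e)" for l :: nat and d :: real
  define Z where "Z l \<omega> = \<phi> l (real (N (ts (Suc l)) \<omega>) - real (N (ts l) \<omega>))" for l \<omega>
  have Nm: "N u \<in> M \<rightarrow>\<^sub>M count_space UNIV" if "u \<ge> 0" for u
    using N that by (auto simp: unit_poisson_process_def)
  have Nr: "(\<lambda>\<omega>. real (N u \<omega>)) \<in> borel_measurable M" if "u \<ge> 0" for u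
    by (rule measurable_compose[OF Nm[OF that]]) simp
  have "indep_vars (\<lambda>_. borel) (\<lambda>i \<omega>. real (N (ts (Suc i)) \<omega>) - real (N (ts i) \<omega>)) {..<k}"
    using N ts_mono ts0 unfolding unit_poisson_process_def indep_increments_def by simp
  then have ind: "indep_vars (\<lambda>_. borel) Z {..<k}"
    unfolding Z_def[abs_def] by (rule indep_vars_compose2) (simp add: \<phi>_def[abs_def])
  have Zm: "Z l \<in> borel_measurable M" for l
    unfolding Z_def[abs_def] \<phi>_def[abs_def] using Nr[OF ts_nonneg] by (cases "l < k - 1") simp_all
  have Zint: "integrable M (Z l)" for l
  proof (rule integrable_const_bound[where B = "1 + e"])
    have "\<bar>cos x ^ j\<bar> \<le> 1 + e" for x :: real and j
    proof -
      have "\<bar>cos x ^ j\<bar> \<le> 1" by (simp add: power_abs power_le_one)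
      moreover have "0 \<le> e" by (simp add: e_def)
      ultimately show ?thesis by linarith
    qed
    moreover have "\<bar>cos x - e\<bar> \<le> 1 + e" for x
      using abs_cos_le_one[of x] by (simp add: e_def abs_le_iff) (smt (verit) exp_gt_zero abs_cos_le_one)
    ultimately show "AE \<omega> in M. norm (Z l \<omega>) \<le> 1 + e"
      by (intro AE_I2) (auto simp: Z_def \<phi>_def)
  qed (rule Zm)
  have last: "expectation (Z (k - 1)) = 0"
  proof -
    have "integrable M (\<lambda>\<omega>. cos (pi * (real (N t \<omega>) - real (N s \<omega>))))"
      by (rule integrable_const_bound[where B = 1]) (use Nr st in auto)
    then have "expectation (\<lambda>\<omega>. cos (pi * (real (N t \<omega>) - real (N s \<omega>))) - e) = 0"
      using poisson_parity_increment[OF N st(1) st'] by (simp add: e_def prob_space)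
    then show ?thesis using k tsk tst by (simp add: Z_def[abs_def] \<phi>_def)
  qed
  have "expectation (\<lambda>\<omega>. (\<Prod>u\<leftarrow>us. (-1) ^ N u \<omega>) * ((-1) ^ N t \<omega> * (-1) ^ N s \<omega> - e)) = expectation (\<lambda>\<omega>. \<Prod>l<k. Z l \<omega>)"
  proof (rule integral_cong_AE)
    have "(\<lambda>\<omega>. \<Prod>u\<leftarrow>us. (-1) ^ N u \<omega> :: real) \<in> borel_measurable M"
      using us
    proof (induction us)
      case (Cons u us)
      have "(\<lambda>\<omega>. (-1) ^ N u \<omega> :: real) \<in> borel_measurable M"
        by (rule measurable_compose[OF Nm]) (use Cons in auto)
      then show ?case using Cons by simp
    qed simp
    moreover have "(\<lambda>\<omega>. (-1) ^ N u \<omega> :: real) \<in> borel_measurable M" if "u \<ge> 0" for u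
      by (rule measurable_compose[OF Nm[OF that]]) simp
    ultimately show "(\<lambda>\<omega>. (\<Prod>u\<leftarrow>us. (-1) ^ N u \<omega>) * ((-1) ^ N t \<omega> * (-1) ^ N s \<omega> - e)) \<in> borel_measurable M"
      using st by (intro borel_measurable_times borel_measurable_diff) auto
    show "(\<lambda>\<omega>. \<Prod>l<k. Z l \<omega>) \<in> borel_measurable M" using Zm by simp
    have "AE \<omega> in M. N 0 \<omega> = 0" using N by (auto simp: unit_poisson_process_def)
    then show "AE \<omega> in M. (\<Prod>u\<leftarrow>us. (-1) ^ N u \<omega>) * ((-1) ^ N t \<omega> * (-1) ^ N s \<omega> - e) = (\<Prod>l<k. Z l \<omega>)"
    proof eventually_elim
      case (elim \<omega>)
      have "(\<Prod>l<k. Z l \<omega>) = (\<Prod>l<k - 1. Z l \<omega>) * Z (k - 1) \<omega>"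
        using k prod.lessThan_Suc[of "\<lambda>l. Z l \<omega>" "k - 1"] by simp
      also have "(\<Prod>l<k - 1. Z l \<omega>) = (\<Prod>l<k - 1. X l \<omega> ^ c l)"
        by (rule prod.cong) (auto simp: Z_def \<phi>_def X_def)
      also have "Z (k - 1) \<omega> = (-1) ^ N t \<omega> * (-1) ^ N s \<omega> - e"
        using k tsk tst by (simp add: Z_def \<phi>_def cos_pi_nat_diff)
      finally show ?case using c[OF elim] by simp
    qed
  qed
  also have "\<dots> = (\<Prod>l<k. expectation (Z l))"
    by (rule indep_vars_lebesgue_integral[OF _ ind Zint]) simp
  also have "\<dots> = 0" by (rule prod_zero) (use last k in \<open>auto intro!: bexI[of _ "k - 1"]\<close>)
  finally show ?thesis unfolding e_def .
qed

section \<open>Independence of the noise sources and moments of the Wiener process\<close>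

lemma expectation_prod_sources:
  fixes X :: "'i \<Rightarrow> 'a \<Rightarrow> real"
  assumes ind: "indep_sets F I" and J: "finite J" "J \<subseteq> I"
    and X: "\<And>i. i \<in> J \<Longrightarrow> integrable M (X i)"
    and F: "\<And>i A. i \<in> J \<Longrightarrow> A \<in> sets borel \<Longrightarrow> X i -` A \<inter> space M \<in> F i"
  shows "expectation (\<lambda>\<omega>. \<Prod>i\<in>J. X i \<omega>) = (\<Prod>i\<in>J. expectation (X i))"
proof (rule indep_vars_lebesgue_integral[OF J(1) _ X])
  have "indep_sets (\<lambda>i. {X i -` A \<inter> space M |A. A \<in> sets borel}) J"
    by (rule indep_sets_mono[OF _ J(2) _, OF ind]) (use F in auto)
  then show "indep_vars (\<lambda>_. borel) X J"
    unfolding indep_vars_def2 using X borel_measurable_integrable by blast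
qed

lemma generated_sigma_measurable:
  assumes "f \<in> borel_measurable (sigma (space M) {X -` A \<inter> space M | X A. X \<in> \<X> \<and> A \<in> sets borel})" and A: "A \<in> sets borel"
  shows "f -` A \<inter> space M \<in> generated_sigma M \<X>"
proof -
  have sub: "{X -` A \<inter> space M | X A. X \<in> \<X> \<and> A \<in> sets borel} \<subseteq> Pow (space M)" by auto
  show ?thesis
    using measurable_sets[OF assms] sub by (simp add: generated_sigma_def sets_measure_of space_measure_of)
qed

lemma generator_measurable:
  fixes f :: "'a \<Rightarrow> real"
  assumes "f \<in> \<X>"
  shows "f \<in> borel_measurable (sigma (space M) {X -` A \<inter> space M | X A. X \<in> \<X> \<and> A \<in> sets borel})" (is "_ \<in> borel_measurable ?S")
proof (rule measurableI)
  have sub: "{X -` A \<inter> space M | X A. X \<in> \<X> \<and> A \<in> sets borel} \<subseteq> Pow (space M)" by auto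
  fix A :: "real set" assume A: "A \<in> sets borel"
  have "f -` A \<inter> space M \<in> {X -` A \<inter> space M | X A. X \<in> \<X> \<and> A \<in> sets borel}" using assms A by blast
  then show "f -` A \<inter> space ?S \<in> sets ?S"
    using sub by (simp add: sets_measure_of space_measure_of sigma_sets.Basic)
qed simp

lemma wiener_moments:
  assumes w: "wiener_process M w" and u: "u \<ge> 0"
  shows "integrable M (w u)" "expectation (w u) = 0" "expectation (\<lambda>\<omega>. \<bar>w u \<omega>\<bar>) \<le> 1 + u"
proof -
  have wm: "w u \<in> borel_measurable M" "w 0 \<in> borel_measurable M" using w u by (auto simp: wiener_process_def)
  have w0: "AE \<omega> in M. w 0 \<omega> = 0" using w by (auto simp: wiener_process_def)
  have "integrable M (w u) \<and> expectation (w u) = 0 \<and> expectation (\<lambda>\<omega>. \<bar>w u \<omega>\<bar>) \<le> 1 + u"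
  \<comment> \<open>A degenerate increment has no density; at time zero the process vanishes almost
    surely instead.\<close>
  proof (cases "u = 0")
    case True
    have "integrable M (w u)" by (subst integrable_cong_AE[where g = "\<lambda>_. 0"]) (use wm w0 True in auto)
    moreover have "expectation (w u) = expectation (\<lambda>_. 0)" by (rule integral_cong_AE) (use wm w0 True in auto)
    moreover have "expectation (\<lambda>\<omega>. \<bar>w u \<omega>\<bar>) = expectation (\<lambda>_. 0)"
      by (rule integral_cong_AE) (use wm w0 True in auto)
    ultimately show ?thesis using u by simp
  next
    case False
    then have u: "u > 0" using u by simp
    define f where "f \<omega> = w u \<omega> - w 0 \<omega>" for \<omega>
    have d: "distributed M lborel f (normal_density 0 (sqrt u))"
    proof -
      have "\<forall>s t. 0 \<le> s \<and> s < t \<longrightarrow>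
          distributed M lborel (\<lambda>\<omega>. w t \<omega> - w s \<omega>) (normal_density 0 (sqrt (t - s)))"
        using w unfolding wiener_process_def by (elim conjE)
      from this[rule_format, of 0 u] show ?thesis using u by (simp add: f_def[abs_def])
    qed
    have fi: "integrable M f"
    proof -
      have "integrable lborel (\<lambda>x. normal_density 0 (sqrt u) x * x)" by (rule integrable_normal_moment_nz_1) (use u in simp)
      then show ?thesis using distributed_integrable[OF d, of "\<lambda>x. x"] by simp
    qed
    have fe: "expectation f = 0"
      using distributed_integral[OF d, of "\<lambda>x. x"] has_bochner_integral_integral_eq[OF normal_moment_nz_1[of "sqrt u" 0]] u by simp
    have f2: "integrable M (\<lambda>\<omega>. (f \<omega>)\<^sup>2)"
    proof -
      have "integrable lborel (\<lambda>x. normal_density 0 (sqrt u) x * (x - 0) ^ 2)" by (rule integrable_normal_moment) (use u in simp)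
      then show ?thesis using distributed_integrable[OF d, of "\<lambda>x. x\<^sup>2"] by simp
    qed
    have f2e: "expectation (\<lambda>\<omega>. (f \<omega>)\<^sup>2) = u"
      using normal_distributed_variance[OF _ d] normal_distributed_expectation[OF _ d] u by simp
    have "expectation (\<lambda>\<omega>. \<bar>f \<omega>\<bar>) \<le> expectation (\<lambda>\<omega>. 1 + (f \<omega>)\<^sup>2)"
    proof (rule integral_mono)
      fix \<omega>
      have "0 \<le> (\<bar>f \<omega>\<bar> - 1)\<^sup>2" by simp
      then have "2 * \<bar>f \<omega>\<bar> \<le> 1 + (f \<omega>)\<^sup>2" by (simp add: power2_diff)
      then show "\<bar>f \<omega>\<bar> \<le> 1 + (f \<omega>)\<^sup>2" by simp
    qed (use fi f2 in auto)
    also have "\<dots> = 1 + u" using f2 f2e by (simp add: prob_space)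
    finally have fa: "expectation (\<lambda>\<omega>. \<bar>f \<omega>\<bar>) \<le> 1 + u" .
    have ae: "AE \<omega> in M. w u \<omega> = f \<omega>" using w0 by eventually_elim (simp add: f_def)
    have fm: "f \<in> borel_measurable M" using fi by simp
    have "integrable M (w u)" using integrable_cong_AE[OF wm(1) fm ae] fi by simp
    moreover have "expectation (w u) = 0" using integral_cong_AE[OF wm(1) fm ae] fe by simp
    moreover have "expectation (\<lambda>\<omega>. \<bar>w u \<omega>\<bar>) = expectation (\<lambda>\<omega>. \<bar>f \<omega>\<bar>)"
      by (rule integral_cong_AE) (use wm fm ae in auto)
    ultimately show ?thesis using fa by simp
  qed
  then show "integrable M (w u)" "expectation (w u) = 0" "expectation (\<lambda>\<omega>. \<bar>w u \<omega>\<bar>) \<le> 1 + u" by auto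
qed

end

subsection \<open>Averages of the chain\<close>

text \<open>The cosine expresses the parity through the real value of \<open>N\<close>, so
  measurability holds for any \<open>S\<close> that makes these real variables measurable, in
  particular for the sigma-algebra of a single noise source.\<close>

lemma parity_product_measurable:
  fixes N :: "real \<Rightarrow> 'a \<Rightarrow> nat"
  assumes "\<And>u. u \<ge> 0 \<Longrightarrow> (\<lambda>\<omega>. real (N u \<omega>)) \<in> borel_measurable S" "set us \<subseteq> {0..}"
  shows "(\<lambda>\<omega>. \<Prod>u\<leftarrow>us. (-1) ^ N u \<omega> :: real) \<in> borel_measurable S"
  using assms(2)
proof (induction us)
  case (Cons u us)
  have "(\<lambda>\<omega>. cos (real (N u \<omega>) * pi)) \<in> borel_measurable S"
    by (rule measurable_compose[OF assms(1)[of u], of "\<lambda>x. cos (x * pi)"]) (use Cons.prems in auto)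
  then have "(\<lambda>\<omega>. (-1) ^ N u \<omega> :: real) \<in> borel_measurable S" by (simp only: cos_npi)
  then show ?case using Cons by simp
qed simp

lemma parity_right_continuous:
  fixes N :: "real \<Rightarrow> nat"
  assumes rc: "\<And>t. t \<ge> 0 \<Longrightarrow> continuous (at_right t) (\<lambda>s. real (N s))" and \<gamma>: "\<gamma> > 0" and u: "u \<ge> 0"
  shows "continuous (at_right u) (\<lambda>s. real (N (\<gamma> * s)))"
    "continuous (at_right u) (\<lambda>s. (-1) ^ N (\<gamma> * s) :: real)"
proof -
  have "filterlim (\<lambda>s. \<gamma> * s) (at_right (\<gamma> * u)) (at_right u)"
    unfolding filterlim_at
  proof
    show "\<forall>\<^sub>F x in at_right u. \<gamma> * x \<in> {\<gamma> * u<..} \<and> \<gamma> * x \<noteq> \<gamma> * u"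
      using eventually_at_right_less[of u] by eventually_elim (use \<gamma> in auto)
    show "((\<lambda>s. \<gamma> * s) \<longlongrightarrow> \<gamma> * u) (at_right u)" by (intro tendsto_intros)
  qed
  moreover have "((\<lambda>s. real (N s)) \<longlongrightarrow> real (N (\<gamma> * u))) (at_right (\<gamma> * u))"
    using rc[of "\<gamma> * u"] \<gamma> u by (simp add: continuous_within)
  ultimately have l: "((\<lambda>s. real (N (\<gamma> * s))) \<longlongrightarrow> real (N (\<gamma> * u))) (at_right u)"
    by (rule filterlim_compose[rotated])
  then show "continuous (at_right u) (\<lambda>s. real (N (\<gamma> * s)))" by (simp add: continuous_within)
  have "((\<lambda>s. cos (real (N (\<gamma> * s)) * pi)) \<longlongrightarrow> cos (real (N (\<gamma> * u)) * pi)) (at_right u)"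
    by (intro tendsto_intros l)
  then show "continuous (at_right u) (\<lambda>s. (-1) ^ N (\<gamma> * s) :: real)"
    by (simp only: cos_npi continuous_within)
qed

text \<open>\<open>flip_system\<close> asks for its path properties at every point of the space,
  while the chain has them almost surely. The space is therefore cut down to a measurable set of
  full measure.\<close>

lemma (in prob_space) AE_full_set:
  assumes "AE \<omega> in M. P \<omega>"
  shows "\<exists>G\<in>events. emeasure M G = 1 \<and> (AE \<omega> in M. \<omega> \<in> G) \<and> (\<forall>\<omega>\<in>G. P \<omega>)"
proof -
  obtain N where N: "{\<omega> \<in> space M. \<not> P \<omega>} \<subseteq> N" "emeasure M N = 0" "N \<in> events"
    using AE_E[OF assms] by blast
  show ?thesis
  proof (intro bexI[of _ "space M - N"] conjI)
    show "space M - N \<in> events" using N by auto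
    show "emeasure M (space M - N) = 1"
      using N emeasure_compl[of N M] emeasure_space_1 by simp
    show "AE \<omega> in M. \<omega> \<in> space M - N"
      using AE_not_in[of N M] N AE_space by (auto simp: null_sets_def)
  qed (use N in auto)
qed

lemma (in prob_space) expectation_restrict:
  fixes f :: "'a \<Rightarrow> real"
  assumes G: "G \<in> events" "AE \<omega> in M. \<omega> \<in> G" and f: "f \<in> borel_measurable M"
  shows "integral\<^sup>L (restrict_space M G) f = expectation f"
proof -
  have "integral\<^sup>L (restrict_space M G) f = expectation (\<lambda>\<omega>. indicator G \<omega> *\<^sub>R f \<omega>)"
    by (rule integral_restrict_space) (use G in auto)
  also have "\<dots> = expectation f"
    by (rule integral_cong_AE) (use G f in auto)
  finally show ?thesis .
qed

lemma (in prob_space) integrable_restrict: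
  fixes f :: "'a \<Rightarrow> real"
  assumes G: "G \<in> events" and f: "integrable M f"
  shows "integrable (restrict_space M G) f"
  using integrable_restrict_space[of G M f] G f integrable_mult_indicator[OF G f] by simp

lemma sum_single_delta:
  fixes y :: "'i \<Rightarrow> real"
  assumes "finite I"
  shows "(\<Sum>j\<in>I. (if P \<and> j = k then c else 0) * y j) = (if P \<and> k \<in> I then c * y k else 0)"
  using assms by (cases P) (auto simp: if_distrib[of "\<lambda>z. z * _"] sum.delta cong: if_cong)

text \<open>Index \<open>(True, x)\<close> stands for the momentum at site \<open>x\<close>, index \<open>(False, x)\<close> for the stretch.\<close>

definition chain_index :: "nat \<Rightarrow> (bool \<times> nat) set" where
  "chain_index n = Pair True ` {0..n} \<union> Pair False ` {1..n}"

text \<open>Each entry has the shape \<open>if P \<and> j = k then c else 0\<close> of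
  \<open>sum_single_delta\<close>, hence the conjuncts \<open>True\<close>. Friction
  \<open>2 * \<gamma>\<close> appears at site 0 only; at the other momenta it arises from the
  flips.\<close>

definition chain_coeff :: "real \<Rightarrow> nat \<Rightarrow> bool \<times> nat \<Rightarrow> bool \<times> nat \<Rightarrow> real" where
  "chain_coeff \<gamma> n i j = (if fst i
     then (if snd i < n \<and> j = (False, Suc (snd i)) then 1 else 0)
        - (if 0 < snd i \<and> j = (False, snd i) then 1 else 0)
        - (if snd i = 0 \<and> j = i then 2 * \<gamma> else 0)
     else (if True \<and> j = (True, snd i) then 1 else 0) - (if True \<and> j = (True, snd i - 1) then 1 else 0))"

lemma chain_coeff_momentum:
  assumes "x \<le> n"
  shows "(\<Sum>j\<in>chain_index n. chain_coeff \<gamma> n (True, x) j * y j)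
    = (if x < n then y (False, Suc x) else 0) - (if 0 < x then y (False, x) else 0) - (if x = 0 then 2 * \<gamma> * y (True, 0) else 0)"
proof -
  have fin: "finite (chain_index n)" by (simp add: chain_index_def)
  show ?thesis
    unfolding chain_coeff_def fst_conv snd_conv if_True left_diff_distrib sum_subtractf sum_single_delta[OF fin]
    using assms by (auto simp: chain_index_def)
qed

lemma chain_coeff_stretch:
  assumes "1 \<le> x" "x \<le> n"
  shows "(\<Sum>j\<in>chain_index n. chain_coeff \<gamma> n (False, x) j * y j) = y (True, x) - y (True, x - 1)"
proof -
  have fin: "finite (chain_index n)" by (simp add: chain_index_def)
  show ?thesis
    unfolding chain_coeff_def fst_conv snd_conv if_False left_diff_distrib sum_subtractf sum_single_delta[OF fin]
    using assms by (auto simp: chain_index_def)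
qed

text \<open>Stretches and the momentum at site 0 are not flipped; for them the sign is constant and
  the decorrelation rate is zero.\<close>

definition chain_sign :: "real \<Rightarrow> (nat \<Rightarrow> real \<Rightarrow> 'a \<Rightarrow> nat) \<Rightarrow> bool \<times> nat \<Rightarrow> real \<Rightarrow> 'a \<Rightarrow> real" where
  "chain_sign \<gamma> N i u \<omega> = (if fst i \<and> 1 \<le> snd i then (-1) ^ N (snd i) (\<gamma> * u) \<omega> else 1)"

definition site_times :: "real \<Rightarrow> ((bool \<times> nat) \<times> real) list \<Rightarrow> nat \<Rightarrow> real list" where
  "site_times \<gamma> L y = map (\<lambda>(i, u). \<gamma> * u) (filter (\<lambda>(i, u). i = (True, y)) L)"

text \<open>Grouping the factors by site leaves one factor for each Poisson process, as needed to
  factorise over independent sources. Times are rescaled by \<open>\<gamma>\<close> to the clock of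
  the process.\<close>

lemma sign_product_chain:
  assumes "set L \<subseteq> chain_index n \<times> A"
  shows "sign_product (chain_sign \<gamma> N) L \<omega> = (\<Prod>y=1..n. \<Prod>u\<leftarrow>site_times \<gamma> L y. (-1) ^ N y u \<omega>)"
  using assms
proof (induction L)
  case Nil
  then show ?case by (simp add: site_times_def)
next
  case (Cons q L)
  obtain b y0 u where q: "q = ((b, y0), u)" by (metis prod.exhaust)
  have y0: "y0 \<le> n" using Cons.prems by (auto simp: q chain_index_def)
  have IH: "sign_product (chain_sign \<gamma> N) L \<omega> = (\<Prod>y=1..n. \<Prod>u\<leftarrow>site_times \<gamma> L y. (-1) ^ N y u \<omega>)"
    using Cons by simp
  have "(\<Prod>u\<leftarrow>site_times \<gamma> (q # L) y. (-1) ^ N y u \<omega>)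
     = (if y = y0 then (if b then (-1) ^ N y0 (\<gamma> * u) \<omega> else 1) else 1) * (\<Prod>u\<leftarrow>site_times \<gamma> L y. (-1) ^ N y u \<omega> :: real)" for y
    by (auto simp: site_times_def q)
  then have "(\<Prod>y=1..n. \<Prod>u\<leftarrow>site_times \<gamma> (q # L) y. (-1) ^ N y u \<omega> :: real)
     = (\<Prod>y=1..n. if y = y0 then (if b then (-1) ^ N y0 (\<gamma> * u) \<omega> else 1) else 1) * sign_product (chain_sign \<gamma> N) L \<omega>"
    by (simp add: prod.distrib IH)
  also have "(\<Prod>y=1..n. if y = y0 then (if b then (-1) ^ N y0 (\<gamma> * u) \<omega> else 1) else 1 :: real) = chain_sign \<gamma> N (b, y0) u \<omega>"
    using y0 by (simp add: chain_sign_def prod.delta)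
  finally show ?case by (simp add: q)
qed

text \<open>The integrand is a product of one factor per Poisson process and of \<open>Z\<close>,
  which comes from the initial data or from the Wiener process. By independence the expectation
  factorises, and the factor of site \<open>x\<close> has mean zero by
  \<open>poisson_parity_product\<close>.\<close>

lemma chain_decorrelation:
  assumes cp: "chain_process \<gamma> Tm F n M \<mu> w N r p" and \<gamma>: "\<gamma> > 0"
    and x: "1 \<le> x" "x \<le> n" and uv: "0 \<le> v" "v \<le> u" and L: "set L \<subseteq> chain_index n \<times> {0..v}"
    and src: "src \<in> {Init, Wiener}" and Z: "integrable M Z"
    and Zs: "\<And>A. A \<in> sets borel \<Longrightarrow> Z -` A \<inter> space M \<in> (case src of
          Init \<Rightarrow> generated_sigma M ((\<lambda>x. r x 0) ` {1..n} \<union> (\<lambda>x. p x 0) ` {0..n})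
        | Wiener \<Rightarrow> generated_sigma M (w ` {0..})
        | Poisson x \<Rightarrow> generated_sigma M ((\<lambda>t \<omega>. real (N x t \<omega>)) ` {0..}))"
  shows "(LINT \<omega>|M. sign_product (chain_sign \<gamma> N) L \<omega> *
     (chain_sign \<gamma> N (True, x) u \<omega> * chain_sign \<gamma> N (True, x) v \<omega> - exp (- (2 * \<gamma>) * (u - v))) * Z \<omega>) = 0"
proof -
  interpret prob_space M using cp by (simp add: chain_process_def)
  let ?F = "\<lambda>i. case i of
          Init \<Rightarrow> generated_sigma M ((\<lambda>x. r x 0) ` {1..n} \<union> (\<lambda>x. p x 0) ` {0..n})
        | Wiener \<Rightarrow> generated_sigma M (w ` {0..})
        | Poisson x \<Rightarrow> generated_sigma M ((\<lambda>t \<omega>. real (N x t \<omega>)) ` {0..})"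
  have ind: "indep_sets ?F ({Init, Wiener} \<union> Poisson ` {1..n})"
    and pois: "\<And>y. y \<in> {1..n} \<Longrightarrow> unit_poisson_process M (N y)"
    using cp by (auto simp: chain_process_def)
  define e where "e = exp (- (2 * (\<gamma> * u - \<gamma> * v)))"
  have e_eq: "exp (- (2 * \<gamma>) * (u - v)) = e" by (simp add: e_def algebra_simps)
  \<comment> \<open>Past parities of site \<open>y\<close>; the centred parity change is attached to
    the process of site \<open>x\<close>.\<close>
  define V where "V y \<omega> = (\<Prod>u\<leftarrow>site_times \<gamma> L y. (-1) ^ N y u \<omega>) *
     (if y = x then (-1) ^ N x (\<gamma> * u) \<omega> * (-1) ^ N x (\<gamma> * v) \<omega> - e else 1)" for y \<omega>
  define X where "X i = (case i of Poisson y \<Rightarrow> V y | _ \<Rightarrow> Z)" for i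
  define J where "J = insert src (Poisson ` {1..n})"
  have times: "set (site_times \<gamma> L y) \<subseteq> {0..\<gamma> * v}" for y
    using L \<gamma> by (auto simp: site_times_def intro!: mult_left_mono)
  have V_meas: "V y \<in> borel_measurable S" if S: "\<And>u. u \<ge> 0 \<Longrightarrow> (\<lambda>\<omega>. real (N y u \<omega>)) \<in> borel_measurable S" for y S
  proof -
    have 1: "(\<lambda>\<omega>. \<Prod>u\<leftarrow>us. (-1) ^ N y u \<omega> :: real) \<in> borel_measurable S" if "set us \<subseteq> {0..}" for us
      by (rule parity_product_measurable[OF S that])
    have 2: "(\<lambda>\<omega>. (-1) ^ N y u \<omega> :: real) \<in> borel_measurable S" if "u \<ge> 0" for u
      using 1[of "[u]"] that by simp
    have 3: "set (site_times \<gamma> L y) \<subseteq> {0..}" using times[of y] by auto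
    show ?thesis
    proof (cases "y = x")
      case True
      then show ?thesis unfolding V_def[abs_def] using uv \<gamma>
        by (auto intro!: borel_measurable_times borel_measurable_diff 1[OF 3, unfolded True] 2[unfolded True])
    qed (use 1[OF 3] in \<open>simp add: V_def[abs_def]\<close>)
  qed
  have Nm: "(\<lambda>\<omega>. real (N y u \<omega>)) \<in> borel_measurable M" if "y \<in> {1..n}" "u \<ge> 0" for y u
  proof -
    have "N y u \<in> M \<rightarrow>\<^sub>M count_space UNIV" using pois[OF that(1)] that(2) by (auto simp: unit_poisson_process_def)
    then show ?thesis by (rule measurable_compose) simp
  qed
  have V_int: "integrable M (V y)" if y: "y \<in> {1..n}" for y
  proof (rule integrable_const_bound[where B = "1 + e"])
    have p1: "\<bar>\<Prod>u\<leftarrow>us. (-1) ^ N y u \<omega> :: real\<bar> = 1" for us \<omega>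
      by (induction us) (auto simp: abs_mult power_abs)
    have e0: "0 < e" by (simp add: e_def)
    have "\<bar>V y \<omega>\<bar> \<le> 1 + e" for \<omega>
    proof -
      have "\<bar>(-1) ^ N x (\<gamma> * u) \<omega> * (-1) ^ N x (\<gamma> * v) \<omega> :: real\<bar> = 1" by (simp add: abs_mult power_abs)
      then have "\<bar>(-1) ^ N x (\<gamma> * u) \<omega> * (-1) ^ N x (\<gamma> * v) \<omega> - e\<bar> \<le> 1 + e" using e0 by linarith
      then show ?thesis unfolding V_def abs_mult p1 using e0 by simp
    qed
    then show "AE \<omega> in M. norm (V y \<omega>) \<le> 1 + e" by simp
    show "V y \<in> borel_measurable M" by (rule V_meas[OF Nm[OF y]])
  qed
  have "expectation (\<lambda>\<omega>. \<Prod>i\<in>J. X i \<omega>) = (\<Prod>i\<in>J. expectation (X i))"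
  proof (rule expectation_prod_sources[OF ind])
    show "finite J" "J \<subseteq> {Init, Wiener} \<union> Poisson ` {1..n}" using src by (auto simp: J_def)
    fix i assume i: "i \<in> J"
    show "integrable M (X i)" using i src Z V_int by (auto simp: J_def X_def)
    fix A :: "real set" assume A: "A \<in> sets borel"
    show "X i -` A \<inter> space M \<in> ?F i"
    proof (cases i)
      case (Poisson y)
      have "V y \<in> borel_measurable (sigma (space M) {X -` A \<inter> space M | X A. X \<in> (\<lambda>t \<omega>. real (N y t \<omega>)) ` {0..} \<and> A \<in> sets borel})"
        by (rule V_meas, rule generator_measurable) auto
      from generated_sigma_measurable[OF this A] show ?thesis by (simp add: Poisson X_def)
    qed (use i Zs[OF A] in \<open>auto simp: J_def X_def\<close>)
  qed
  also have "(\<Prod>i\<in>J. expectation (X i)) = 0"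
  proof (rule prod_zero)
    have "expectation (V x) = 0"
      using poisson_parity_product[OF pois, of x "\<gamma> * v" "\<gamma> * u" "site_times \<gamma> L x"] x uv \<gamma> times[of x]
      by (simp add: V_def[abs_def] e_def)
    then show "\<exists>i\<in>J. expectation (X i) = 0" using x by (intro bexI[of _ "Poisson x"]) (auto simp: X_def J_def)
  qed (simp add: J_def)
  also have "(\<lambda>\<omega>. \<Prod>i\<in>J. X i \<omega>) = (\<lambda>\<omega>. sign_product (chain_sign \<gamma> N) L \<omega> *
     (chain_sign \<gamma> N (True, x) u \<omega> * chain_sign \<gamma> N (True, x) v \<omega> - exp (- (2 * \<gamma>) * (u - v))) * Z \<omega>)"
  proof
    fix \<omega>
    have "(\<Prod>i\<in>J. X i \<omega>) = Z \<omega> * (\<Prod>y=1..n. V y \<omega>)"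
    proof -
      have "(\<Prod>i\<in>J. X i \<omega>) = X src \<omega> * (\<Prod>i\<in>Poisson ` {1..n}. X i \<omega>)"
        unfolding J_def by (rule prod.insert) (use src in auto)
      also have "(\<Prod>i\<in>Poisson ` {1..n}. X i \<omega>) = (\<Prod>y=1..n. V y \<omega>)"
        by (subst prod.reindex) (auto simp: inj_on_def X_def)
      finally show ?thesis using src by (auto simp: X_def)
    qed
    also have "(\<Prod>y=1..n. V y \<omega>) = sign_product (chain_sign \<gamma> N) L \<omega> * ((-1) ^ N x (\<gamma> * u) \<omega> * (-1) ^ N x (\<gamma> * v) \<omega> - e)"
      unfolding V_def prod.distrib sign_product_chain[OF L] using x by (simp add: prod.delta)
    finally show "(\<Prod>i\<in>J. X i \<omega>) = sign_product (chain_sign \<gamma> N) L \<omega> *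
     (chain_sign \<gamma> N (True, x) u \<omega> * chain_sign \<gamma> N (True, x) v \<omega> - exp (- (2 * \<gamma>) * (u - v))) * Z \<omega>"
      unfolding e_eq using x by (simp add: chain_sign_def ac_simps)
  qed
  finally show ?thesis .
qed

text \<open>The chain is a \<open>flip_system\<close>: flips give the momenta at sites
  \<open>1..n\<close> the decay rate \<open>2 * \<gamma>\<close>, and site 0 has the same friction
  explicitly, so that friction is uniform along the averaged chain.\<close>

lemma chain_mean_ode:
  assumes cp: "chain_process \<gamma> Tm F n M \<mu> w N r p" and \<gamma>: "\<gamma> > 0" and Tm: "Tm > 0" and n: "n \<ge> 1"
    and F: "continuous_on {0..} F"
  shows "chain_ode n \<gamma> (mean M r) (mean M p) (\<lambda>x t. if x = n then F t else 0)"
proof -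
  interpret prob_space M using cp by (simp add: chain_process_def)
  have w: "wiener_process M w"
    and pois: "\<And>y. y \<in> {1..n} \<Longrightarrow> unit_poisson_process M (N y)"
    and r_meas: "\<And>t x. t \<ge> 0 \<Longrightarrow> x \<in> {1..n} \<Longrightarrow> r x t \<in> borel_measurable M"
    and p_meas: "\<And>t x. t \<ge> 0 \<Longrightarrow> x \<in> {0..n} \<Longrightarrow> p x t \<in> borel_measurable M"
    and law: "distr M (config_space n) (\<lambda>\<omega>. (\<lambda>x\<in>{1..n}. r x 0 \<omega>, \<lambda>x\<in>{0..n}. p x 0 \<omega>)) = \<mu>"
    and \<mu>r: "\<And>x. x \<in> {1..n} \<Longrightarrow> integrable \<mu> (\<lambda>c. fst c x)"
    and \<mu>p: "\<And>x. x \<in> {0..n} \<Longrightarrow> integrable \<mu> (\<lambda>c. snd c x)"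
    and path: "AE \<omega> in M. chain_path \<gamma> Tm F n (\<lambda>t. w t \<omega>) (\<lambda>x t. N x t \<omega>) (\<lambda>x t. r x t \<omega>) (\<lambda>x t. p x t \<omega>)"
    using cp by (auto simp: chain_process_def)
  have init_meas: "(\<lambda>\<omega>. (\<lambda>x\<in>{1..n}. r x 0 \<omega>, \<lambda>x\<in>{0..n}. p x 0 \<omega>)) \<in> M \<rightarrow>\<^sub>M config_space n"
    unfolding config_space_def
    by (intro measurable_Pair measurable_restrict r_meas p_meas) auto
  have r0: "integrable M (r x 0)" if "x \<in> {1..n}" for x
    using integrable_distr[OF init_meas, of "\<lambda>c. fst c x"] \<mu>r[OF that] that unfolding law by simp
  have p0: "integrable M (p x 0)" if "x \<in> {0..n}" for x
    using integrable_distr[OF init_meas, of "\<lambda>c. snd c x"] \<mu>p[OF that] that unfolding law by simp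
  have "AE \<omega> in M. \<forall>x\<in>{1..n}. mono_on {0..} (\<lambda>t. N x t \<omega>) \<and> (\<forall>t\<ge>0. continuous (at_right t) (\<lambda>s. real (N x s \<omega>)))"
    using pois unfolding unit_poisson_process_def by (intro AE_finite_allI) (fastforce elim: eventually_mono)+
  \<comment> \<open>The countably many horizons \<open>Suc k\<close> cover all times, so one null
    set serves them all.\<close>
  moreover have "AE \<omega> in M. \<forall>x\<in>{1..n}. \<forall>k::nat. \<exists>m\<ge>1. \<forall>i<m.
      N x (real (Suc i) * (real (Suc k) / real m)) \<omega> \<le> N x (real i * (real (Suc k) / real m)) \<omega> + 1"
    by (intro AE_finite_allI AE_all_countable[THEN iffD2] allI poisson_unit_jumps pois) auto
  moreover have "AE \<omega> in M. continuous_on {0..} (\<lambda>t. w t \<omega>)"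
    using w unfolding wiener_process_def by (auto elim: eventually_mono)
  ultimately have "AE \<omega> in M. chain_path \<gamma> Tm F n (\<lambda>t. w t \<omega>) (\<lambda>x t. N x t \<omega>) (\<lambda>x t. r x t \<omega>) (\<lambda>x t. p x t \<omega>)
     \<and> (\<forall>x\<in>{1..n}. mono_on {0..} (\<lambda>t. N x t \<omega>) \<and> (\<forall>t\<ge>0. continuous (at_right t) (\<lambda>s. real (N x s \<omega>))))
     \<and> (\<forall>x\<in>{1..n}. \<forall>k::nat. \<exists>m\<ge>1. \<forall>i<m.
      N x (real (Suc i) * (real (Suc k) / real m)) \<omega> \<le> N x (real i * (real (Suc k) / real m)) \<omega> + 1)
     \<and> continuous_on {0..} (\<lambda>t. w t \<omega>)"
    using path by eventually_elim (intro conjI)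
  from AE_full_set[OF this] obtain G where G: "G \<in> events" "emeasure M G = 1" "AE \<omega> in M. \<omega> \<in> G"
    and good: "\<forall>\<omega>\<in>G. chain_path \<gamma> Tm F n (\<lambda>t. w t \<omega>) (\<lambda>x t. N x t \<omega>) (\<lambda>x t. r x t \<omega>) (\<lambda>x t. p x t \<omega>)
     \<and> (\<forall>x\<in>{1..n}. mono_on {0..} (\<lambda>t. N x t \<omega>) \<and> (\<forall>t\<ge>0. continuous (at_right t) (\<lambda>s. real (N x s \<omega>))))
     \<and> (\<forall>x\<in>{1..n}. \<forall>k::nat. \<exists>m\<ge>1. \<forall>i<m.
      N x (real (Suc i) * (real (Suc k) / real m)) \<omega> \<le> N x (real i * (real (Suc k) / real m)) \<omega> + 1)
     \<and> continuous_on {0..} (\<lambda>t. w t \<omega>)"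
    by (elim bexE conjE)
  have G_path: "chain_path \<gamma> Tm F n (\<lambda>t. w t \<omega>) (\<lambda>x t. N x t \<omega>) (\<lambda>x t. r x t \<omega>) (\<lambda>x t. p x t \<omega>)"
    and G_mono': "\<forall>x\<in>{1..n}. mono_on {0..} (\<lambda>t. N x t \<omega>) \<and> (\<forall>t\<ge>0. continuous (at_right t) (\<lambda>s. real (N x s \<omega>)))"
    and G_jumps': "\<forall>x\<in>{1..n}. \<forall>k::nat. \<exists>m\<ge>1. \<forall>i<m.
      N x (real (Suc i) * (real (Suc k) / real m)) \<omega> \<le> N x (real i * (real (Suc k) / real m)) \<omega> + 1"
    and G_w: "continuous_on {0..} (\<lambda>t. w t \<omega>)" if "\<omega> \<in> G" for \<omega>
    using bspec[OF good that] by - (elim conjE, assumption)+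
  have G_mono: "mono_on {0..} (\<lambda>t. N x t \<omega>)" if "\<omega> \<in> G" "x \<in> {1..n}" for \<omega> x
    using bspec[OF G_mono'[OF that(1)] that(2)] by (rule conjunct1)
  have G_rc: "continuous (at_right t) (\<lambda>s. real (N x s \<omega>))" if "\<omega> \<in> G" "x \<in> {1..n}" "t \<ge> 0" for \<omega> x t
    using bspec[OF G_mono'[OF that(1)] that(2)] that(3) by simp
  have G_jumps: "\<exists>m\<ge>1. \<forall>i<m.
      N x (real (Suc i) * (real (Suc k) / real m)) \<omega> \<le> N x (real i * (real (Suc k) / real m)) \<omega> + 1"
    if "\<omega> \<in> G" "x \<in> {1..n}" for \<omega> x k
    using bspec[OF G_jumps'[OF that(1)] that(2)] by (rule spec)
  \<comment> \<open>On \<open>M'\<close> every path is good, and expectations of functions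
    measurable on \<open>M\<close> are unchanged.\<close>
  define M' where "M' = restrict_space M G"
  interpret M': prob_space M' unfolding M'_def by (rule prob_space_restrict_space[OF G(1,2)])
  have space: "space M' = G" unfolding M'_def using sets.sets_into_space[OF G(1)] by (auto simp: space_restrict_space)
  have E: "integral\<^sup>L M' f = expectation f" if "f \<in> borel_measurable M" for f :: "_ \<Rightarrow> real"
    unfolding M'_def by (rule expectation_restrict[OF G(1,3) that])
  have int: "integrable M' f" if "integrable M f" for f :: "_ \<Rightarrow> real"
    unfolding M'_def by (rule integrable_restrict[OF G(1) that])
  have meas: "f \<in> borel_measurable M'" if "f \<in> borel_measurable M" for f :: "_ \<Rightarrow> real"
    unfolding M'_def by (rule measurable_restrict_space1[OF that])
  define I where "I = chain_index n"
  define s where "s = chain_sign \<gamma> N"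
  define Y where "Y i u \<omega> = (if fst i then p (snd i) u \<omega> else r (snd i) u \<omega>)" for i u \<omega>
  define c where "c = sqrt (4 * \<gamma> * Tm)"
  define W where "W i u \<omega> = (if i = (True, 0::nat) then c * w u \<omega> else 0)" for i u \<omega>
  define \<kappa> where "\<kappa> i = (if fst i \<and> 1 \<le> (snd i :: nat) then 2 * \<gamma> else 0)" for i
  define b where "b i u = (if i = (True, n) then F u else 0)" for i u
  have I: "i \<in> I \<longleftrightarrow> (\<exists>x. x \<le> n \<and> i = (True, x)) \<or> (\<exists>x. 1 \<le> x \<and> x \<le> n \<and> i = (False, x))" for i
    by (auto simp: I_def chain_index_def)
  have c0: "c \<ge> 0" using \<gamma> Tm by (simp add: c_def)
  have w_meas: "w u \<in> borel_measurable M" if "u \<ge> 0" for u using w that by (auto simp: wiener_process_def)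
  have W_int: "integrable M (W i u)" if "u \<ge> 0" for i u
    using wiener_moments(1)[OF w that] by (cases "i = (True, 0)") (simp_all add: W_def[abs_def])
  have s_meas: "s i u \<in> borel_measurable M" if "i \<in> I" "u \<ge> 0" for i u
  proof (cases "fst i \<and> 1 \<le> snd i")
    case True
    then have y: "snd i \<in> {1..n}" using that(1) by (auto simp: I)
    have "N (snd i) (\<gamma> * u) \<in> M \<rightarrow>\<^sub>M count_space UNIV"
      using pois[OF y] \<gamma> that(2) by (auto simp: unit_poisson_process_def)
    then have "(\<lambda>\<omega>. (-1) ^ N (snd i) (\<gamma> * u) \<omega> :: real) \<in> borel_measurable M"
      by (rule measurable_compose) simp
    then show ?thesis using True by (simp add: s_def chain_sign_def[abs_def])
  next
    case False
    then have "s i u = (\<lambda>_. 1)" by (auto simp: s_def chain_sign_def fun_eq_iff)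
    then show ?thesis by simp
  qed
  have Y_meas: "Y i u \<in> borel_measurable M" if "i \<in> I" "u \<ge> 0" for i u
    using that r_meas p_meas by (auto simp: I Y_def[abs_def])
  have sp_meas: "sign_product s L \<in> borel_measurable M" if "set L \<subseteq> I \<times> {0..}" for L
    using that
  proof (induction L)
    case Nil
    then show ?case by (simp add: sign_product_def[abs_def])
  next
    case (Cons q L)
    obtain i u where q: "q = (i, u)" by (cases q)
    have "(\<lambda>\<omega>. s i u \<omega> * sign_product s L \<omega>) \<in> borel_measurable M"
      by (rule borel_measurable_times) (use Cons q in \<open>auto intro: s_meas\<close>)
    then show ?case by (simp add: q)
  qed
  have F_int: "set_integrable lborel {0..t} F" for t
    by (rule borel_integrable_atLeastAtMost') (rule continuous_on_subset[OF F], auto)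
  interpret fs: flip_system M' I "chain_coeff \<gamma> n" b s Y W \<kappa> c
  proof
    show "finite I" by (simp add: I_def chain_index_def)
  next
    fix i and u :: real assume "i \<in> I" "u \<ge> 0"
    then show "s i u \<in> borel_measurable M'" by (intro meas s_meas)
  next
    fix i and u :: real and \<omega> assume "i \<in> I" "u \<ge> 0" "\<omega> \<in> space M'"
    show "\<bar>s i u \<omega>\<bar> = 1" by (simp add: s_def chain_sign_def power_abs)
  next
    fix i and u :: real and \<omega> assume i: "i \<in> I" and u: "u \<ge> 0" and \<omega>: "\<omega> \<in> space M'"
    show "continuous (at_right u) (\<lambda>u. s i u \<omega>)"
    proof (cases "fst i \<and> 1 \<le> snd i")
      case True
      then have y: "snd i \<in> {1..n}" using i by (auto simp: I)
      show ?thesis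
        using parity_right_continuous(2)[OF G_rc[OF _ y] \<gamma> u, of \<omega>] \<omega> True by (simp add: s_def chain_sign_def space)
    next
      case False
      then have "(\<lambda>u. s i u \<omega>) = (\<lambda>_. 1)" by (auto simp: s_def chain_sign_def fun_eq_iff)
      then show ?thesis by simp
    qed
  next
    fix i and u :: real assume "i \<in> I" "u \<ge> 0"
    then show "Y i u \<in> borel_measurable M'" by (intro meas Y_meas)
  next
    fix i \<omega> assume "i \<in> I" "\<omega> \<in> space M'"
    then show "cadlag (\<lambda>u. Y i u \<omega>)"
      using G_path[of \<omega>] by (auto simp: I Y_def space chain_path_def)
  next
    fix i \<omega> assume "i \<in> I" "\<omega> \<in> space M'"
    then have "continuous_on {0..} (\<lambda>u. W i u \<omega>)"
      using G_w[of \<omega>] by (cases "i = (True, 0)") (auto simp: W_def space intro!: continuous_intros)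
    then show "cadlag (\<lambda>u. W i u \<omega>)" by (rule continuous_on_imp_cadlag)
  next
    fix i and u :: real assume "i \<in> I" "u \<ge> 0"
    then show "integrable M' (W i u)" by (intro int W_int)
    show "integral\<^sup>L M' (W i u) = 0"
      unfolding E[OF borel_measurable_integrable[OF W_int[OF \<open>u \<ge> 0\<close>]]]
      using wiener_moments(2)[OF w \<open>u \<ge> 0\<close>] by (cases "i = (True, 0)") (simp_all add: W_def[abs_def])
    have "(\<lambda>\<omega>. \<bar>W i u \<omega>\<bar>) \<in> borel_measurable M"
      using borel_measurable_integrable[OF W_int[OF \<open>u \<ge> 0\<close>, of i]] by simp
    then have "integral\<^sup>L M' (\<lambda>\<omega>. \<bar>W i u \<omega>\<bar>) = expectation (\<lambda>\<omega>. \<bar>W i u \<omega>\<bar>)" by (rule E)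
    also have "\<dots> \<le> c * (1 + u)"
    proof (cases "i = (True, 0)")
      case True
      have "expectation (\<lambda>\<omega>. \<bar>W i u \<omega>\<bar>) = c * expectation (\<lambda>\<omega>. \<bar>w u \<omega>\<bar>)"
        using True c0 by (simp add: W_def abs_mult)
      also have "\<dots> \<le> c * (1 + u)" by (intro mult_left_mono wiener_moments(3)[OF w \<open>u \<ge> 0\<close>] c0)
      finally show ?thesis .
    qed (use c0 \<open>u \<ge> 0\<close> in \<open>simp add: W_def\<close>)
    finally show "integral\<^sup>L M' (\<lambda>\<omega>. \<bar>W i u \<omega>\<bar>) \<le> c * (1 + u)" .
  next
    fix i assume "i \<in> I"
    show "continuous_on {0..} (b i)"
      using F by (cases "i = (True, n)") (auto simp: b_def[abs_def])
  next
    fix i assume "i \<in> I"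
    then show "integrable M' (Y i 0)"
      using r0 p0 by (intro int) (auto simp: I Y_def[abs_def])
  next
    fix i and u :: real and \<omega> assume i: "i \<in> I" and u: "u \<ge> 0" and \<omega>: "\<omega> \<in> space M'"
    have \<omega>G: "\<omega> \<in> G" using \<omega> by (simp add: space)
    note P = G_path[OF \<omega>G, unfolded chain_path_def]
    note Pt = P[THEN conjunct2, THEN conjunct2, rule_format]
    note P_r = bspec[OF Pt[THEN conjunct1]] and P_0 = Pt[THEN conjunct2, THEN conjunct1]
      and P_x = bspec[OF Pt[THEN conjunct2, THEN conjunct2, THEN conjunct1]]
      and P_n = Pt[THEN conjunct2, THEN conjunct2, THEN conjunct2]
    from i consider x where "i = (False, x)" "1 \<le> x" "x \<le> n" | "i = (True, 0)" | x where "i = (True, x)" "1 \<le> x" "x \<le> n"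
      by (auto simp: I) (metis One_nat_def Suc_le_eq gr0I)
    then show "Y i u \<omega> = s i u \<omega> * s i 0 \<omega> * Y i 0 \<omega>
        + (LBINT v:{0..u}. s i u \<omega> * s i v \<omega> * ((\<Sum>j\<in>I. chain_coeff \<gamma> n i j * Y j v \<omega>) + b i v)) + W i u \<omega>"
    proof cases
      case 1
      have "(\<Sum>j\<in>I. chain_coeff \<gamma> n i j * Y j v \<omega>) = p x v \<omega> - p (x - 1) v \<omega>" for v
        unfolding 1(1) I_def using chain_coeff_stretch[OF 1(2,3), of \<gamma> "\<lambda>j. Y j v \<omega>"] by (simp add: Y_def)
      moreover have "r x u \<omega> = r x 0 \<omega> + (LBINT s:{0..u}. p x s \<omega> - p (x - 1) s \<omega>)"
        by (rule P_r[OF u]) (use 1 in simp)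
      ultimately show ?thesis using 1 by (simp add: s_def chain_sign_def Y_def W_def b_def)
    next
      case 2
      have "(\<Sum>j\<in>I. chain_coeff \<gamma> n i j * Y j v \<omega>) = r 1 v \<omega> - 2 * \<gamma> * p 0 v \<omega>" for v
        unfolding 2 I_def using chain_coeff_momentum[of 0 n \<gamma> "\<lambda>j. Y j v \<omega>"] n by (simp add: Y_def)
      moreover have "p 0 u \<omega> = p 0 0 \<omega> + (LBINT s:{0..u}. r 1 s \<omega> - 2 * \<gamma> * p 0 s \<omega>) + c * w u \<omega>"
        unfolding c_def by (rule P_0[OF u])
      ultimately show ?thesis using 2 n by (simp add: s_def chain_sign_def Y_def W_def b_def)
    next
      case 3
      define A where "A v = N x (\<gamma> * v) \<omega>" for v
      define g where "g v = (if x < n then r (Suc x) v \<omega> else 0) - r x v \<omega> + (if x = n then F v else 0)" for v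
      have x: "x \<in> {1..n}" using 3 by simp
      have drift: "(\<Sum>j\<in>I. chain_coeff \<gamma> n i j * Y j v \<omega>) + b i v = g v" for v
        unfolding 3(1) I_def using chain_coeff_momentum[OF 3(3), of \<gamma> "\<lambda>j. Y j v \<omega>"] 3(2) by (simp add: Y_def g_def b_def)
      have rc_g: "cadlag (\<lambda>v. r y v \<omega>)" if "y \<in> {1..n}" for y
        by (rule bspec[OF P[THEN conjunct1] that])
      have g_rc: "continuous (at_right v) g" if "v \<ge> 0" for v
      proof -
        have "continuous (at_right v) (\<lambda>v. if x < n then r (Suc x) v \<omega> else 0)"
          using cadlag_right_continuous[OF rc_g[of "Suc x"] that] by (cases "x < n") auto
        moreover have "continuous (at_right v) (\<lambda>v. if x = n then F v else 0)"
          using continuous_on_imp_right_continuous[OF F that] by (cases "x = n") auto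
        ultimately show ?thesis
          unfolding g_def[abs_def] by (intro continuous_add continuous_diff cadlag_right_continuous[OF rc_g[OF x] that])
      qed
      have g_bound: "\<exists>B. \<forall>v\<in>{0..t}. \<bar>g v\<bar> \<le> B" for t
      proof (cases "t \<ge> 0")
        case True
        have F_cadlag: "cadlag F" by (rule continuous_on_imp_cadlag[OF F])
        obtain B1 where B1: "\<And>v. v \<in> {0..t} \<Longrightarrow> \<bar>if x < n then r (Suc x) v \<omega> else 0\<bar> \<le> B1"
        proof (cases "x < n")
          case True
          then show ?thesis using cadlag_bounded[OF rc_g[of "Suc x"] \<open>t \<ge> 0\<close>] that by auto
        qed (use that[of 0] in auto)
        obtain B2 where B2: "\<And>v. v \<in> {0..t} \<Longrightarrow> \<bar>r x v \<omega>\<bar> \<le> B2"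
          using cadlag_bounded[OF rc_g[OF x] True] by metis
        obtain B3 where B3: "\<And>v. v \<in> {0..t} \<Longrightarrow> \<bar>F v\<bar> \<le> B3" "B3 > 0"
          using cadlag_bounded[OF F_cadlag True] by metis
        have "\<bar>g v\<bar> \<le> B1 + B2 + B3" if v: "v \<in> {0..t}" for v
        proof -
          have "\<bar>if x = n then F v else 0\<bar> \<le> B3" using B3 v by auto
          then show ?thesis unfolding g_def using B1[OF v] B2[OF v] by linarith
        qed
        then show ?thesis by blast
      qed auto
      have g_int: "set_integrable lborel {0..t} g" for t
        using g_bound[of t] set_integrable_right_continuous_bounded[OF g_rc] by blast
      have A_rc: "continuous (at_right v) (\<lambda>v. real (A v))" "continuous (at_right v) (\<lambda>v. (-1) ^ A v :: real)" if "v \<ge> 0" for v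
        unfolding A_def using parity_right_continuous[OF G_rc[OF \<omega>G x] \<gamma> that] by auto
      have sg_int: "set_integrable lborel {0..t} (\<lambda>v. (-1) ^ A v * g v)" for t
      proof -
        obtain B where B: "\<And>v. v \<in> {0..t} \<Longrightarrow> \<bar>g v\<bar> \<le> B" using g_bound[of t] by blast
        show ?thesis
          by (rule set_integrable_right_continuous_bounded[where B = B])
            (auto intro!: continuous_mult A_rc g_rc simp: abs_mult power_abs B)
      qed
      have A_mono: "mono_on {0..} A"
        using G_mono[OF \<omega>G x] \<gamma> unfolding A_def by (auto simp: mono_on_def)
      have f: "p x t \<omega> = p x 0 \<omega> + (LBINT s:{0..t}. g s) - 2 * jump_integral (\<lambda>v. p x v \<omega>) (\<lambda>s. real (A s)) t" if t: "t \<ge> 0" for t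
      proof (cases "x = n")
        case True
        have "p n t \<omega> = p n 0 \<omega> + (LBINT s:{0..t}. F s - r n s \<omega>)
          - 2 * jump_integral (\<lambda>v. p n v \<omega>) (\<lambda>s. real (N n (\<gamma> * s) \<omega>)) t"
          by (rule P_n[OF t])
        then show ?thesis using True by (simp add: g_def A_def)
      next
        case False
        then have "x \<in> {1..<n}" using x by auto
        from P_x[OF t this] have "p x t \<omega> = p x 0 \<omega> + (LBINT s:{0..t}. r (x + 1) s \<omega> - r x s \<omega>)
          - 2 * jump_integral (\<lambda>v. p x v \<omega>) (\<lambda>s. real (N x (\<gamma> * s) \<omega>)) t" .
        then show ?thesis using False x by (simp add: g_def A_def)
      qed
      obtain k :: nat where k: "\<gamma> * u \<le> real (Suc k)"
        using real_arch_simple[of "\<gamma> * u"] by (metis le_SucI of_nat_mono order.trans order_refl)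
      \<comment> \<open>A grid for \<open>N x\<close> on \<open>[0, Suc k]\<close> corresponds to a
        grid for the time-changed path \<open>A\<close> on \<open>[0, T]\<close>.\<close>
      define T where "T = real (Suc k) / \<gamma>"
      have T: "T \<ge> 0" "u \<in> {0..T}" using k \<gamma> u by (auto simp: T_def field_simps)
      obtain m where m: "m \<ge> 1" "\<And>i. i < m \<Longrightarrow>
          N x (real (Suc i) * (real (Suc k) / real m)) \<omega> \<le> N x (real i * (real (Suc k) / real m)) \<omega> + 1"
        using G_jumps[OF \<omega>G x] by blast
      have grid: "A (real (Suc i) * (T / real m)) \<le> A (real i * (T / real m)) + 1" if "i < m" for i
      proof -
        have "\<gamma> * (real j * (T / real m)) = real j * (real (Suc k) / real m)" for j
          using \<gamma> by (simp add: T_def)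
        then show ?thesis using m(2)[OF that] unfolding A_def by (simp only:)
      qed
      have R: "(-1) ^ A u * p x u \<omega> = (-1) ^ A 0 * p x 0 \<omega> + (LBINT s:{0..u}. (-1) ^ A s * g s)"
        by (rule reflected_path_sign[where f = "\<lambda>v. p x v \<omega>", OF A_mono A_rc(1) f g_int sg_int T(1) m(1) grid T(2)])
      \<comment> \<open>Multiplying by the sign once more solves for \<open>p\<close> and gives the
        integral equation with drift conjugated by signs, the form required by
        \<open>flip_system\<close>.\<close>
      have "p x u \<omega> = (-1) ^ A u * ((-1) ^ A u * p x u \<omega>)"
        by (simp add: mult.assoc[symmetric] minus_one_power_square)
      also have "\<dots> = (-1) ^ A u * (-1) ^ A 0 * p x 0 \<omega> + (LBINT s:{0..u}. (-1) ^ A u * (-1) ^ A s * g s)"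
        unfolding R distrib_left set_integral_mult_right[symmetric] by (simp only: mult.assoc)
      finally show ?thesis
        unfolding drift using 3 by (simp add: s_def chain_sign_def Y_def W_def A_def)
    qed
  next
    fix i and u v :: real and L Z
    assume i: "i \<in> I" and uv: "0 \<le> v" "v \<le> u" and L: "set L \<subseteq> I \<times> {0..v}"
      and Z: "Z = (\<lambda>_. 1) \<or> (\<exists>j\<in>I. Z = Y j 0) \<or> (\<exists>j\<in>I. \<exists>x\<in>{0..v}. Z = W j x)"
    have L0: "set L \<subseteq> I \<times> {0..}" using L by auto
    have Z_int: "integrable M Z"
      using Z r0 p0 W_int by (auto simp: I Y_def[abs_def])
    show "integral\<^sup>L M' (\<lambda>\<omega>. sign_product s L \<omega> * (s i u \<omega> * s i v \<omega> - exp (- \<kappa> i * (u - v))) * Z \<omega>) = 0"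
    proof (cases "fst i \<and> 1 \<le> snd i")
      \<comment> \<open>For an index without flips the sign change minus its mean is identically
        \<open>1 - exp 0 = 0\<close>.\<close>
      case False
      have "s i x \<omega> = 1" for x \<omega> unfolding s_def chain_sign_def using False by (rule if_not_P)
      moreover have "\<kappa> i = 0" unfolding \<kappa>_def using False by (rule if_not_P)
      ultimately show ?thesis by simp
    next
      case True
      then obtain x where x: "i = (True, x)" "1 \<le> x" "x \<le> n" using i by (auto simp: I)
      have "integral\<^sup>L M' (\<lambda>\<omega>. sign_product s L \<omega> * (s i u \<omega> * s i v \<omega> - exp (- \<kappa> i * (u - v))) * Z \<omega>)
         = expectation (\<lambda>\<omega>. sign_product s L \<omega> * (s i u \<omega> * s i v \<omega> - exp (- \<kappa> i * (u - v))) * Z \<omega>)"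
        by (intro E borel_measurable_times borel_measurable_diff sp_meas L0 s_meas i) (use uv Z_int in auto)
      also have "\<dots> = 0"
      proof -
        let ?\<G> = "\<lambda>\<X>. sigma (space M) {X -` A \<inter> space M | X A. X \<in> \<X> \<and> A \<in> sets borel}"
        let ?I = "(\<lambda>x. r x 0) ` {1..n} \<union> (\<lambda>x. p x 0) ` {0..n}"
        have main: ?thesis if "src \<in> {Init, Wiener}" "Z \<in> borel_measurable (?\<G> (if src = Init then ?I else w ` {0..}))" for src
        proof -
          have "expectation (\<lambda>\<omega>. sign_product (chain_sign \<gamma> N) L \<omega> *
             (chain_sign \<gamma> N (True, x) u \<omega> * chain_sign \<gamma> N (True, x) v \<omega> - exp (- (2 * \<gamma>) * (u - v))) * Z \<omega>) = 0"
          proof (rule chain_decorrelation[OF cp \<gamma> x(2,3) uv L[unfolded I_def] that(1) Z_int])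
            fix A :: "real set" assume A: "A \<in> sets borel"
            show "Z -` A \<inter> space M \<in> (case src of
                Init \<Rightarrow> generated_sigma M ((\<lambda>x. r x 0) ` {1..n} \<union> (\<lambda>x. p x 0) ` {0..n})
              | Wiener \<Rightarrow> generated_sigma M (w ` {0..})
              | Poisson x \<Rightarrow> generated_sigma M ((\<lambda>t \<omega>. real (N x t \<omega>)) ` {0..}))"
              using generated_sigma_measurable[OF that(2) A] that(1) by auto
          qed
          then show ?thesis using x by (simp add: s_def \<kappa>_def)
        qed
        have W_cases: "W j t = W (True, 0) t \<or> W j t = (\<lambda>_. 0)" for j t
          by (cases "j = (True, 0)") (simp_all add: W_def[abs_def])
        from Z consider "Z = (\<lambda>_. 1)" | j where "j \<in> I" "Z = Y j 0" | t where "t \<ge> 0" "Z = W (True, 0) t" | "Z = (\<lambda>_. 0)"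
          using W_cases by (metis atLeastAtMost_iff)
        then show ?thesis
        proof cases
          \<comment> \<open>A constant is measurable with respect to either source, so the initial
            data can be chosen.\<close>
          case 1
          show ?thesis by (rule main[of Init]) (simp_all add: 1)
        next
          case 2
          have Yp: "Y (True, y) 0 = p y 0" and Yr: "Y (False, y) 0 = r y 0" for y
            by (simp_all add: Y_def[abs_def])
          from 2(1) have "Y j 0 \<in> ?I"
            unfolding I
          proof (elim disjE exE conjE)
            fix y assume "y \<le> n" "j = (True, y)"
            then show ?thesis by (simp only: Yp) (intro UnI2 imageI, simp)
          next
            fix y assume "1 \<le> y" "y \<le> n" "j = (False, y)"
            then show ?thesis by (simp only: Yr) (intro UnI1 imageI, simp)
          qed
          then have "Z \<in> borel_measurable (?\<G> ?I)" unfolding 2(2) by (rule generator_measurable)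
          then show ?thesis by (intro main[of Init]) simp_all
        next
          case 3
          have "w t \<in> borel_measurable (?\<G> (w ` {0..}))" by (rule generator_measurable) (use 3(1) in simp)
          then have "(\<lambda>\<omega>. c * w t \<omega>) \<in> borel_measurable (?\<G> (w ` {0..}))"
            by (rule borel_measurable_times[OF borel_measurable_const])
          moreover have "Z = (\<lambda>\<omega>. c * w t \<omega>)" unfolding 3(2) by (simp add: W_def[abs_def])
          ultimately have "Z \<in> borel_measurable (?\<G> (w ` {0..}))" by (simp only:)
          then show ?thesis by (intro main[of Wiener]) simp_all
        next
          case 4
          then show ?thesis by simp
        qed
      qed
      finally show ?thesis .
    qed
  qed
  have deriv: "((\<lambda>t. expectation (Y i t)) has_real_derivative
     (\<Sum>j\<in>I. chain_coeff \<gamma> n i j * expectation (Y j t)) + b i t - \<kappa> i * expectation (Y i t)) (at t within {0..})"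
    if i: "i \<in> I" and t: "t \<ge> 0" for i t
  proof -
    have E': "M'.expectation (Y j v) = expectation (Y j v)" if "j \<in> I" "v \<ge> 0" for j v
      by (rule E[OF Y_meas[OF that]])
    have "((\<lambda>t. M'.expectation (Y i t)) has_real_derivative
       (\<Sum>j\<in>I. chain_coeff \<gamma> n i j * expectation (Y j t)) + b i t - \<kappa> i * expectation (Y i t)) (at t within {0..})"
      using fs.mean_deriv[OF i t] E'[OF _ t] i by (simp cong: sum.cong)
    then show ?thesis
      by (rule has_field_derivative_transform_within[where d = 1]) (use t E'[OF i] in auto)
  qed
  have EY: "expectation (Y (True, x) t) = mean M p x t" "expectation (Y (False, x) t) = mean M r x t" for x t
    by (simp_all add: Y_def[abs_def] mean_def)
  show ?thesis
  proof (rule chain_odeI)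
    fix t :: real and x assume t: "t \<ge> 0" and x: "1 \<le> x" "x \<le> n"
    have "(False, x) \<in> I" using x by (auto simp: I)
    from deriv[OF this t] show "(mean M r x has_real_derivative mean M p x t - mean M p (x - 1) t) (at t within {0..})"
      unfolding I_def chain_coeff_stretch[OF x] EY by (simp add: b_def \<kappa>_def)
  next
    fix t :: real and x assume t: "t \<ge> 0" and x: "x \<le> n"
    have "(True, x) \<in> I" using x by (auto simp: I)
    from deriv[OF this t] show "(mean M p x has_real_derivative
        (if x < n then mean M r (Suc x) t else 0) - (if 0 < x then mean M r x t else 0) - 2 * \<gamma> * mean M p x t
        + (if x = n then F t else 0)) (at t within {0..})"
      unfolding I_def chain_coeff_momentum[OF x] EY
      by (rule DERIV_cong) (cases "x = 0", auto simp: b_def \<kappa>_def)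
  qed
qed

subsection \<open>Convergence of stretch and mechanical energy\<close>

theorem theorem2p4:
  fixes \<gamma> Tm \<theta> Fbar Hbar :: real
    and Fhat :: "int \<Rightarrow> complex"
    and M :: "nat \<Rightarrow> 'a measure"
    and \<mu> :: "nat \<Rightarrow> ((nat \<Rightarrow> real) \<times> (nat \<Rightarrow> real)) measure"
    and w :: "nat \<Rightarrow> real \<Rightarrow> 'a \<Rightarrow> real"
    and N :: "nat \<Rightarrow> nat \<Rightarrow> real \<Rightarrow> 'a \<Rightarrow> nat"
    and r p :: "nat \<Rightarrow> nat \<Rightarrow> real \<Rightarrow> 'a \<Rightarrow> real"
    and rini :: "real \<Rightarrow> real"
    and R :: "real \<Rightarrow> signed_measure"
    and \<rho> :: "real \<Rightarrow> real \<Rightarrow> real"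
    and \<phi> :: "real \<Rightarrow> real"
    and t :: real
  assumes "\<gamma> > 0" and "Tm > 0" and "\<theta> > 0"
    and "force_coeffs Fhat"
    and "\<And>n. n \<ge> 1 \<Longrightarrow>
      chain_process \<gamma> Tm (force \<theta> Fbar Fhat n) n (M n) (\<mu> n) (w n) (N n) (r n) (p n)"
    and "Hbar > 0"
    and "\<And>n. n \<ge> 1 \<Longrightarrow>
      1 / real n * (\<Sum>x=0..n. (mean (M n) (r n) x 0)\<^sup>2 + (mean (M n) (p n) x 0)\<^sup>2) \<le> Hbar"
    and "continuous_on {0..1} rini"
    and "(\<lambda>n. 1 / real n * (\<Sum>x=1..n. (mean (M n) (r n) x 0 - rini (real x / real n))\<^sup>2))
      \<longlonglongrightarrow> 0"
    and "stretch_solution \<gamma> Fbar rini R"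
    and "\<And>s. s > 0 \<Longrightarrow> signed_density (R s) (\<rho> s)"
    and "continuous_on {0..1} \<phi>" and "t > 0"
  shows "(\<lambda>n. 1 / real n *
           (\<Sum>x=1..n. \<phi> (real x / real n) * mean (M n) (r n) x ((real n)\<^sup>2 * t)))
         \<longlonglongrightarrow> (LBINT u:{0..1}. \<rho> t u * \<phi> u)
       \<and> (\<lambda>n. 1 / real n *
           (\<Sum>x=0..n. \<phi> (real x / real n) * mech_energy (M n) (r n) (p n) x ((real n)\<^sup>2 * t)))
         \<longlonglongrightarrow> (LBINT u:{0..1}. \<phi> u * (1 / 2 * (\<rho> t u)\<^sup>2))"
proof -
  define rm where "rm n = mean (M n) (r n)" for n
  define pm where "pm n = mean (M n) (p n)" for n
  define v where "v = heat_profile \<gamma> Fbar rini t"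
  note \<gamma> = assms(1) and Fhat = assms(4) and cp = assms(5) and rini = assms(8) and sol = assms(10)
    and \<phi> = assms(12) and t = assms(13)
  have ode: "chain_ode n \<gamma> (rm n) (pm n) (\<lambda>x s. if x = n then force \<theta> Fbar Fhat n s else 0)" if "n \<ge> 1" for n
    unfolding rm_def pm_def by (rule chain_mean_ode[OF cp[OF that] \<gamma> assms(2) that force_continuous[OF Fhat]])
  have H: "chain_energy n (rm n) (pm n) 0 \<le> Hbar * real n" if n: "n \<ge> 1" for n
  proof -
    have "chain_energy n (rm n) (pm n) 0 \<le> (\<Sum>x=0..n. (rm n x 0)\<^sup>2 + (pm n x 0)\<^sup>2)"
      unfolding chain_energy_def sum.distrib atLeast0AtMost by (intro add_right_mono sum_mono2) auto
    also have "\<dots> \<le> Hbar * real n"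
      using assms(7)[OF n] n by (simp add: rm_def pm_def field_simps)
    finally show ?thesis .
  qed
  have init: "(\<lambda>n. 1 / real n * (\<Sum>x=1..n. (rm n x 0 - rini (real x / real n))\<^sup>2)) \<longlonglongrightarrow> 0"
    using assms(9) by (simp only: rm_def)
  have v: "continuous_on {0..1} v"
    unfolding v_def using heat_profile_continuous[OF \<gamma> t rini] by (rule continuous_on_subset) simp
  \<comment> \<open>The chains are given for \<open>n >= 1\<close> only, while
    \<open>average_limits\<close> asks for a zero value at site 0 for every \<open>n\<close>; this
    value is therefore set by hand.\<close>
  define r' where "r' n x = (if x = 0 then 0 else rm n x ((real n)\<^sup>2 * t))" for n x
  have D: "(\<lambda>n. 1 / real n * (\<Sum>x=1..n. (r' n x - v (real x / real n))\<^sup>2)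
      + 1 / real n * (\<Sum>x\<le>n. (pm n x ((real n)\<^sup>2 * t))\<^sup>2)) \<longlonglongrightarrow> 0"
  proof -
    have "(\<Sum>x=1..n. (r' n x - v (real x / real n))\<^sup>2)
      = (\<Sum>x=1..n. (rm n x ((real n)\<^sup>2 * t) - heat_profile \<gamma> Fbar rini t (real x / real n))\<^sup>2)" for n
      by (rule sum.cong) (auto simp: r'_def v_def)
    then show ?thesis
      using chain_hydrodynamic_limit[OF \<gamma> t assms(3) Fhat rini ode H init] by (simp only:)
  qed
  have r'0: "r' n 0 = 0" for n by (simp add: r'_def)
  have AE: "AE u in lborel. u \<in> {0..1} \<longrightarrow> \<rho> t u = v u"
    unfolding v_def by (rule stretch_density_eq_heat_profile[OF sol \<gamma> t rini assms(11)[OF t]])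
  have \<rho>_meas: "(\<lambda>u. indicator {0..1} u *\<^sub>R \<rho> t u) \<in> borel_measurable lborel"
    using assms(11)[OF t] unfolding signed_density_def set_integrable_def by (intro borel_measurable_integrable) blast
  have cont_meas: "(\<lambda>u. indicator {0..1} u *\<^sub>R f u) \<in> borel_measurable lborel" if "continuous_on {0..1} f" for f :: "real \<Rightarrow> real"
    using set_integrable_continuous01[OF that] unfolding set_integrable_def by (rule borel_measurable_integrable)
  \<comment> \<open>The averages converge to integrals of the continuous profile \<open>v\<close>.
    The density agrees with \<open>v\<close> only almost everywhere, which is enough under the
    integral.\<close>
  have lim1: "(LBINT u:{0..1}. v u * \<phi> u) = (LBINT u:{0..1}. \<rho> t u * \<phi> u)"
    unfolding set_lebesgue_integral_def
  proof (rule integral_cong_AE)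
    show "(\<lambda>u. indicator {0..1} u *\<^sub>R (v u * \<phi> u)) \<in> borel_measurable lborel"
      by (intro cont_meas continuous_intros v \<phi>)
    have "(\<lambda>u. (indicator {0..1} u *\<^sub>R \<rho> t u) * (indicator {0..1} u *\<^sub>R \<phi> u)) \<in> borel_measurable lborel"
      by (rule borel_measurable_times[OF \<rho>_meas cont_meas[OF \<phi>]])
    also have "(\<lambda>u. (indicator {0..1} u *\<^sub>R \<rho> t u) * (indicator {0..1} u *\<^sub>R \<phi> u)) = (\<lambda>u. indicator {0..1} u *\<^sub>R (\<rho> t u * \<phi> u))"
      by (auto split: split_indicator)
    finally show "(\<lambda>u. indicator {0..1} u *\<^sub>R (\<rho> t u * \<phi> u)) \<in> borel_measurable lborel" .
    show "AE u in lborel. indicator {0..1} u *\<^sub>R (v u * \<phi> u) = indicator {0..1} u *\<^sub>R (\<rho> t u * \<phi> u)"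
      using AE by eventually_elim (auto split: split_indicator)
  qed
  have lim2: "(LBINT u:{0..1}. \<phi> u * (1 / 2 * (v u)\<^sup>2)) = (LBINT u:{0..1}. \<phi> u * (1 / 2 * (\<rho> t u)\<^sup>2))"
    unfolding set_lebesgue_integral_def
  proof (rule integral_cong_AE)
    show "(\<lambda>u. indicator {0..1} u *\<^sub>R (\<phi> u * (1 / 2 * (v u)\<^sup>2))) \<in> borel_measurable lborel"
      by (intro cont_meas continuous_intros v \<phi>) simp
    have "(\<lambda>u. (indicator {0..1} u *\<^sub>R \<phi> u) * (1 / 2 * (indicator {0..1} u *\<^sub>R \<rho> t u)\<^sup>2)) \<in> borel_measurable lborel"
      by (intro borel_measurable_times[OF cont_meas[OF \<phi>]] borel_measurable_times[OF borel_measurable_const] borel_measurable_power \<rho>_meas)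
    also have "(\<lambda>u. (indicator {0..1} u *\<^sub>R \<phi> u) * (1 / 2 * (indicator {0..1} u *\<^sub>R \<rho> t u)\<^sup>2)) = (\<lambda>u. indicator {0..1} u *\<^sub>R (\<phi> u * (1 / 2 * (\<rho> t u)\<^sup>2)))"
      by (auto split: split_indicator)
    finally show "(\<lambda>u. indicator {0..1} u *\<^sub>R (\<phi> u * (1 / 2 * (\<rho> t u)\<^sup>2))) \<in> borel_measurable lborel" .
    show "AE u in lborel. indicator {0..1} u *\<^sub>R (\<phi> u * (1 / 2 * (v u)\<^sup>2)) = indicator {0..1} u *\<^sub>R (\<phi> u * (1 / 2 * (\<rho> t u)\<^sup>2))"
      using AE by eventually_elim (auto split: split_indicator)
  qed
  have seq1: "1 / real n * (\<Sum>x=1..n. \<phi> (real x / real n) * r' n x)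
     = 1 / real n * (\<Sum>x=1..n. \<phi> (real x / real n) * mean (M n) (r n) x ((real n)\<^sup>2 * t))" for n
    by (auto simp: r'_def rm_def intro!: arg_cong2[where f = "(*)"] sum.cong)
  have seq2: "1 / real n * (\<Sum>x=0..n. \<phi> (real x / real n) * (1 / 2 * ((pm n x ((real n)\<^sup>2 * t))\<^sup>2 + (r' n x)\<^sup>2)))
     = 1 / real n * (\<Sum>x=0..n. \<phi> (real x / real n) * mech_energy (M n) (r n) (p n) x ((real n)\<^sup>2 * t))" for n
  \<comment> \<open>For \<open>n = 0\<close> both sides are zero because
    \<open>1 / 0 = 0\<close>.\<close>
  proof (cases "n = 0")
    case False
    then have "r n 0 s \<omega> = 0" for s \<omega> using cp[of n] by (simp add: chain_process_def)
    then have "mean (M n) (r n) 0 s = 0" for s by (simp add: mean_def)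
    then show ?thesis
      by (auto simp: r'_def rm_def pm_def mech_energy_def intro!: arg_cong2[where f = "(*)"] sum.cong)
  qed simp
  show ?thesis
    using average_limits[where v = v and \<phi> = \<phi> and r = r' and p = "\<lambda>n x. pm n x ((real n)\<^sup>2 * t)", OF v \<phi> r'0 D]
    unfolding seq1 seq2 lim1 lim2 by (rule conjI)
qed

end
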